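(* Let $r\ge2$ and let $n\ge0$ be an integer. The action of $\mathfrak{sl}_r\otimes\mathbb{C}[x,y]$ on the limit $\varinjlim_NW_{\mathbb{C}^2}(\{0\}_{(Nr+n)\omega_1})$ can be extended to an action of the universal central extension of $\mathfrak{sl}_r\otimes\mathbb{C}[x,x^{-1},y]$.
   Context: For an integer $m\ge0$, $W_{\mathbb{C}^2}(\{0\}_{m\omega_1})$ is the maximal finite-dimensional $\mathfrak{sl}_r\otimes\mathbb{C}[x,y]$-module generated by a vector $w_m$ such that for all $P\in\mathbb{C}[x,y]$: $(h\otimes P)w_m=m\,\omega_1(h)P(0,0)w_m$ for $h$ in the diagonal Cartan subalgebra, and $(E_{ij}\otimes P)w_m=0$ for $1\le i<j\le r$; here $\omega_1$ is the first fundamental weight. The limit is taken over the maps $W_{\mathbb{C}^2}(\{0\}_{m\omega_1})\to W_{\mathbb{C}^2}(\{0\}_{(m+r)\omega_1})$, $m=Nr+n$, which are the (existing, unique) $\mathfrak{sl}_r\otimes\mathbb{C}[x,y]$-homomorphisms sending $w_m$ to $(E_{r1}\otimes x^{m+1})\cdots(E_{31}\otimes x^{m+r-2})(E_{21}\otimes x^{m+r-1})w_{m+r}$. With $A=\mathbb{C}[x,x^{-1},y]$, the universal central extension of $\mathfrak{sl}_r\otimes A$ is $\mathfrak{sl}_r\otimes A\oplus\Omega^1_A/dA$ with cocycle $\omega(g_1\otimes P_1,g_2\otimes P_2)=(g_1,g_2)\,\pi(dP_1\cdot P_2)$, where $(\cdot,\cdot)$ is the invariant (Cartan–Killing) form,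 $\Omega^1_A$ is the space of algebraic 1-forms, and $\pi:\Omega^1_A\to\Omega^1_A/dA$ is the projection. "Extended" means that the elements $g\otimes P$ with $P\in\mathbb{C}[x,y]$ act by the given action. *)

theory Defs
  imports
    "HOL-Library.Poly_Mapping"
    "HOL-Library.Product_Plus"
    "HOL-Computational_Algebra.Polynomial"
    "Jordan_Normal_Form.Matrix"
begin

section \<open>Lie algebras and their modules, on explicit carriers\<close>

record 'g lie_alg =
  lcarrier :: "'g set"
  ladd :: "'g \<Rightarrow> 'g \<Rightarrow> 'g"
  lscale :: "complex \<Rightarrow> 'g \<Rightarrow> 'g"
  lbracket :: "'g \<Rightarrow> 'g \<Rightarrow> 'g"

text \<open>
  A module is a subspace \<open>V\<close> of an ambient complex vector space with scalar multiplication \<open>sc\<close>;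
  \<open>act\<close> is constrained on \<open>lcarrier g\<close> and \<open>V\<close> only.
\<close>

definition is_lie_module ::
  "'g lie_alg \<Rightarrow> (complex \<Rightarrow> 'v::ab_group_add \<Rightarrow> 'v) \<Rightarrow> 'v set \<Rightarrow> ('g \<Rightarrow> 'v \<Rightarrow> 'v) \<Rightarrow> bool" where
  "is_lie_module g sc V act \<longleftrightarrow>
     vector_space sc \<and> module.subspace sc V \<and>
     (\<forall>X\<in>lcarrier g. \<forall>v\<in>V. act X v \<in> V) \<and>
     (\<forall>X\<in>lcarrier g. \<forall>u\<in>V. \<forall>v\<in>V. act X (u + v) = act X u + act X v) \<and>
     (\<forall>X\<in>lcarrier g. \<forall>c. \<forall>v\<in>V. act X (sc c v) = sc c (act X v)) \<and>
     (\<forall>X\<in>lcarrier g. \<forall>Y\<in>lcarrier g. \<forall>v\<in>V. act (ladd g X Y) v = act X v + act Y v) \<and>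
     (\<forall>X\<in>lcarrier g. \<forall>c. \<forall>v\<in>V. act (lscale g c X) v = sc c (act X v)) \<and>
     (\<forall>X\<in>lcarrier g. \<forall>Y\<in>lcarrier g. \<forall>v\<in>V.
        act (lbracket g X Y) v = act X (act Y v) - act Y (act X v))"

definition is_module_hom ::
  "'g lie_alg \<Rightarrow>
   (complex \<Rightarrow> 'v::ab_group_add \<Rightarrow> 'v) \<Rightarrow> 'v set \<Rightarrow> ('g \<Rightarrow> 'v \<Rightarrow> 'v) \<Rightarrow>
   (complex \<Rightarrow> 'w::ab_group_add \<Rightarrow> 'w) \<Rightarrow> 'w set \<Rightarrow> ('g \<Rightarrow> 'w \<Rightarrow> 'w) \<Rightarrow> ('v \<Rightarrow> 'w) \<Rightarrow> bool" where
  "is_module_hom g sc V act sc' V' act' f \<longleftrightarrow>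
     (\<forall>v\<in>V. f v \<in> V') \<and>
     (\<forall>u\<in>V. \<forall>v\<in>V. f (u + v) = f u + f v) \<and>
     (\<forall>c. \<forall>v\<in>V. f (sc c v) = sc' c (f v)) \<and>
     (\<forall>X\<in>lcarrier g. \<forall>v\<in>V. f (act X v) = act' X (f v))"

definition finite_dim :: "(complex \<Rightarrow> 'v::ab_group_add \<Rightarrow> 'v) \<Rightarrow> 'v set \<Rightarrow> bool" where
  "finite_dim sc V \<longleftrightarrow> (\<exists>B. finite B \<and> V = module.span sc B)"

definition is_generated_by ::
  "'g lie_alg \<Rightarrow> (complex \<Rightarrow> 'v::ab_group_add \<Rightarrow> 'v) \<Rightarrow> 'v set \<Rightarrow> ('g \<Rightarrow> 'v \<Rightarrow> 'v) \<Rightarrow> 'v \<Rightarrow> bool" where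
  "is_generated_by g sc V act w \<longleftrightarrow>
     w \<in> V \<and>
     (\<forall>U. module.subspace sc U \<and> U \<subseteq> V \<and> w \<in> U \<and> (\<forall>X\<in>lcarrier g. \<forall>u\<in>U. act X u \<in> U) \<longrightarrow> U = V)"

text \<open>
  Direct limit of a sequence of modules \<open>W 0 \<rightarrow> W 1 \<rightarrow> \<dots>\<close> with transition maps
  \<open>\<phi> N : W N \<rightarrow> W (N + 1)\<close>: the disjoint union of the \<open>W N\<close> modulo becoming equal at a later stage.
  The universal property is proved as \<open>direct_limit_universal\<close> below.
\<close>

definition is_direct_limit ::
  "'g lie_alg \<Rightarrow>
   (complex \<Rightarrow> 'w::ab_group_add \<Rightarrow> 'w) \<Rightarrow> (nat \<Rightarrow> 'w set) \<Rightarrow> (nat \<Rightarrow> 'g \<Rightarrow> 'w \<Rightarrow> 'w) \<Rightarrow>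
   (nat \<Rightarrow> 'w \<Rightarrow> 'w) \<Rightarrow>
   (complex \<Rightarrow> 'l::ab_group_add \<Rightarrow> 'l) \<Rightarrow> 'l set \<Rightarrow> ('g \<Rightarrow> 'l \<Rightarrow> 'l) \<Rightarrow> (nat \<Rightarrow> 'w \<Rightarrow> 'l) \<Rightarrow> bool" where
  "is_direct_limit g scW W act \<phi> scL L actL \<iota> \<longleftrightarrow>
     is_lie_module g scL L actL \<and>
     (\<forall>N. is_module_hom g scW (W N) (act N) scL L actL (\<iota> N)) \<and>
     L = (\<Union>N. \<iota> N ` W N) \<and>
     (\<forall>N M. \<forall>v\<in>W N. \<forall>u\<in>W M.
        \<iota> N v = \<iota> M u \<longleftrightarrow> (\<exists>K\<ge>max N M. fold \<phi> [N..<K] v = fold \<phi> [M..<K] u))"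

lemma direct_limit_universal:
  assumes lim: "is_direct_limit g scW W act \<phi> scL L actL \<iota>"
    and modW: "\<And>N. is_lie_module g scW (W N) (act N)"
    and hom: "\<And>N. is_module_hom g scW (W N) (act N) scW (W (Suc N)) (act (Suc N)) (\<phi> N)"
    and psi: "\<And>N. is_module_hom g scW (W N) (act N) scM M actM (\<psi> N)"
    and compat: "\<And>N v. v \<in> W N \<Longrightarrow> \<psi> (Suc N) (\<phi> N v) = \<psi> N v"
  shows "\<exists>f. is_module_hom g scL L actL scM M actM f \<and>
      (\<forall>N. \<forall>v\<in>W N. f (\<iota> N v) = \<psi> N v) \<and>
      (\<forall>f'. (\<forall>N. \<forall>v\<in>W N. f' (\<iota> N v) = \<psi> N v) \<longrightarrow> (\<forall>x\<in>L. f' x = f x))"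
proof -
  have L: "L = (\<Union>N. \<iota> N ` W N)"
    and io: "\<And>N. is_module_hom g scW (W N) (act N) scL L actL (\<iota> N)"
    and eq: "\<And>N M v u. v \<in> W N \<Longrightarrow> u \<in> W M \<Longrightarrow>
        \<iota> N v = \<iota> M u \<longleftrightarrow> (\<exists>K\<ge>max N M. fold \<phi> [N..<K] v = fold \<phi> [M..<K] u)"
    using lim unfolding is_direct_limit_def by blast+
  have sub: "module.subspace scW (W N)" and vs: "vector_space scW" for N
    using modW unfolding is_lie_module_def by blast+
  interpret vector_space scW by (rule vs)
  have push: "fold \<phi> [N..<K] v \<in> W K \<and> \<psi> K (fold \<phi> [N..<K] v) = \<psi> N v"
    if "v \<in> W N" "N \<le> K" for N K v
    using that(2)
  proof (induction K rule: dec_induct)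
    case base
    then show ?case using that by simp
  next
    case (step K)
    then show ?case using hom[of K] compat[of "fold \<phi> [N..<K] v" K]
      by (simp add: is_module_hom_def)
  qed
  have io_push: "\<iota> K (fold \<phi> [N..<K] v) = \<iota> N v" if "v \<in> W N" "N \<le> K" for N K v
    using eq[of "fold \<phi> [N..<K] v" K v N] push[OF that] that by auto
  have wd: "\<psi> N v = \<psi> M u" if asm: "v \<in> W N" "u \<in> W M" "\<iota> N v = \<iota> M u" for N M v u
  proof -
    obtain K where "K \<ge> max N M" "fold \<phi> [N..<K] v = fold \<phi> [M..<K] u"
      using eq[OF asm(1,2)] asm(3) by auto
    then show ?thesis using push[OF asm(1), of K] push[OF asm(2), of K] by auto
  qed
  define f where "f x = (SOME z. \<exists>N. \<exists>v\<in>W N. x = \<iota> N v \<and> z = \<psi> N v)" for x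
  have f: "f (\<iota> N v) = \<psi> N v" if "v \<in> W N" for N v
  proof -
    have "\<exists>M. \<exists>u\<in>W M. \<iota> N v = \<iota> M u \<and> f (\<iota> N v) = \<psi> M u"
      unfolding f_def by (rule someI[of _ "\<psi> N v"]) (use that in blast)
    then show ?thesis using wd that by metis
  qed
  have repr2: "\<exists>K v u. v \<in> W K \<and> u \<in> W K \<and> x = \<iota> K v \<and> y = \<iota> K u" if asm: "x \<in> L" "y \<in> L" for x y
  proof -
    obtain N M v u where "v \<in> W N" "u \<in> W M" "x = \<iota> N v" "y = \<iota> M u"
      using asm L by blast
    then show ?thesis
      using push[of v N "max N M"] push[of u M "max N M"] io_push[of v N "max N M"]
        io_push[of u M "max N M"] by (metis max.cobounded1 max.cobounded2)
  qed
  have "is_module_hom g scL L actL scM M actM f"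
    unfolding is_module_hom_def
  proof (intro conjI ballI allI)
    fix x assume "x \<in> L"
    then obtain K v where v: "v \<in> W K" "x = \<iota> K v" using repr2 by metis
    show "f x \<in> M" using v f psi[of K] by (auto simp: is_module_hom_def)
  next
    fix x y assume "x \<in> L" "y \<in> L"
    then obtain K v u where vu: "v \<in> W K" "u \<in> W K" "x = \<iota> K v" "y = \<iota> K u" using repr2 by metis
    have "v + u \<in> W K" using subspace_add[OF sub] vu by blast
    then have "f (\<iota> K (v + u)) = f x + f y"
      using vu f[of _ K] psi[of K] by (simp add: is_module_hom_def)
    then show "f (x + y) = f x + f y" using vu io[of K] by (simp add: is_module_hom_def)
  next
    fix c x assume "x \<in> L"
    then obtain K v where v: "v \<in> W K" "x = \<iota> K v" using repr2 by metis
    have "scW c v \<in> W K" using subspace_scale[OF sub] v by blast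
    then have "f (\<iota> K (scW c v)) = scM c (f x)"
      using v f[of _ K] psi[of K] by (simp add: is_module_hom_def)
    then show "f (scL c x) = scM c (f x)" using v io[of K] by (simp add: is_module_hom_def)
  next
    fix X x assume X: "X \<in> lcarrier g" and "x \<in> L"
    then obtain K v where v: "v \<in> W K" "x = \<iota> K v" using repr2 by metis
    have "act K X v \<in> W K" using modW[of K] X v unfolding is_lie_module_def by blast
    then have "f (\<iota> K (act K X v)) = actM X (f x)"
      using v X f[of _ K] psi[of K] by (simp add: is_module_hom_def)
    then show "f (actL X x) = actM X (f x)" using v X io[of K] by (simp add: is_module_hom_def)
  qed
  moreover have "\<forall>x\<in>L. f' x = f x" if "\<forall>N. \<forall>v\<in>W N. f' (\<iota> N v) = \<psi> N v" for f'
    using that f L by auto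
  ultimately show ?thesis using f by blast
qed

section \<open>The algebras $A = C[x, x^{-1}, y]$ and $C[x, y]$\<close>

text \<open>The coefficient of \<open>x\<^sup>i y\<^sup>j\<close> in \<open>P\<close> is \<open>lookup P (i, j)\<close>.\<close>

type_synonym laurent = "(int \<times> nat) \<Rightarrow>\<^sub>0 complex"

definition const :: "complex \<Rightarrow> laurent" where
  "const c = Poly_Mapping.single 0 c"

definition xpow :: "int \<Rightarrow> laurent" where
  "xpow k = Poly_Mapping.single (k, 0) 1"

definition polys :: "laurent set" where
  "polys = {P. \<forall>k\<in>Poly_Mapping.keys P. 0 \<le> fst k}"

lift_definition ddx :: "laurent \<Rightarrow> laurent" is
  "\<lambda>p k. of_int (fst k + 1) * p (fst k + 1, snd k)"
proof -
  fix p :: "int \<times> nat \<Rightarrow> complex"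
  assume "finite {k. p k \<noteq> 0}"
  then have "finite ((\<lambda>k. (fst k - 1, snd k)) ` {k. p k \<noteq> 0})" by simp
  moreover have "{k. of_int (fst k + 1) * p (fst k + 1, snd k) \<noteq> 0}
      \<subseteq> (\<lambda>k. (fst k - 1, snd k)) ` {k. p k \<noteq> 0}"
    by (force simp: image_iff)
  ultimately show "finite {k. of_int (fst k + 1) * p (fst k + 1, snd k) \<noteq> 0}"
    by (rule finite_subset[rotated])
qed

lift_definition ddy :: "laurent \<Rightarrow> laurent" is
  "\<lambda>p k. of_nat (snd k + 1) * p (fst k, snd k + 1)"
proof -
  fix p :: "int \<times> nat \<Rightarrow> complex"
  assume "finite {k. p k \<noteq> 0}"
  then have "finite ((\<lambda>k. (fst k, snd k - 1)) ` {k. p k \<noteq> 0})" by simp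
  moreover have "{k. of_nat (snd k + 1) * p (fst k, snd k + 1) \<noteq> 0}
      \<subseteq> (\<lambda>k. (fst k, snd k - 1)) ` {k. p k \<noteq> 0}"
    by (force simp: image_iff)
  ultimately show "finite {k. of_nat (snd k + 1) * p (fst k, snd k + 1) \<noteq> 0}"
    by (rule finite_subset[rotated])
qed

section \<open>Algebraic one-forms on $A$ modulo exact forms\<close>

text \<open>
  The module of Kaehler differentials of \<open>A\<close> is free on \<open>dx\<close>, \<open>dy\<close>;
  the pair \<open>(f, g)\<close> stands for \<open>f dx + g dy\<close>.
\<close>

type_synonym form = "laurent \<times> laurent"

definition form_d :: "laurent \<Rightarrow> form" where
  "form_d P = (ddx P, ddy P)"

definition form_mult :: "laurent \<Rightarrow> form \<Rightarrow> form" where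
  "form_mult Q \<alpha> = (Q * fst \<alpha>, Q * snd \<alpha>)"

lemma ddx_add: "ddx (P + Q) = ddx P + ddx Q"
  by transfer (simp add: fun_eq_iff distrib_left)

lemma ddy_add: "ddy (P + Q) = ddy P + ddy Q"
  by transfer (simp add: fun_eq_iff distrib_left)

lemma ddx_uminus: "ddx (- P) = - ddx P"
  by transfer (simp add: fun_eq_iff)

lemma ddy_uminus: "ddy (- P) = - ddy P"
  by transfer (simp add: fun_eq_iff)

lemma lookup_const_mult: "Poly_Mapping.lookup (const c * P) k = c * Poly_Mapping.lookup P k"
proof -
  have "const c * P = Poly_Mapping.map ((*) c) P"
    by (simp add: const_def mult_map_scale_conv_mult)
  then show ?thesis by (simp add: map.rep_eq when_def)
qed

lemma ddx_const_mult: "ddx (const c * P) = const c * ddx P"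
  by (rule poly_mapping_eqI) (simp add: lookup_const_mult ddx.rep_eq)

lemma ddy_const_mult: "ddy (const c * P) = const c * ddy P"
  by (rule poly_mapping_eqI) (simp add: lookup_const_mult ddy.rep_eq)

lemma form_d_add: "form_d (P + Q) = form_d P + form_d Q"
  by (simp add: form_d_def ddx_add ddy_add)

lemma form_d_uminus: "form_d (- P) = - form_d P"
  by (simp add: form_d_def ddx_uminus ddy_uminus)

lemma form_d_const_mult: "form_d (const c * P) = form_mult (const c) (form_d P)"
  by (simp add: form_d_def form_mult_def ddx_const_mult ddy_const_mult)

quotient_type forms_mod_exact = form / "\<lambda>\<alpha> \<beta>. \<exists>P. \<alpha> - \<beta> = form_d P"
  morphisms rep_form form_proj
proof (rule equivpI)
  show "reflp (\<lambda>\<alpha> \<beta>. \<exists>P. \<alpha> - \<beta> = form_d P)"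
    using form_d_add[of 0 0] by (auto intro!: reflpI exI[of _ 0])
  show "symp (\<lambda>\<alpha> \<beta>. \<exists>P. \<alpha> - \<beta> = form_d P)"
    by (rule sympI) (metis form_d_uminus minus_diff_eq)
  show "transp (\<lambda>\<alpha> \<beta>. \<exists>P. \<alpha> - \<beta> = form_d P)"
    by (rule transpI) (metis form_d_add diff_add_cancel add_diff_eq)
qed

lift_definition fme_add :: "forms_mod_exact \<Rightarrow> forms_mod_exact \<Rightarrow> forms_mod_exact" is
  "\<lambda>\<alpha> \<beta>. \<alpha> + \<beta>"
  by (metis form_d_add add_diff_add)

lift_definition fme_scale :: "complex \<Rightarrow> forms_mod_exact \<Rightarrow> forms_mod_exact" is
  "\<lambda>c. form_mult (const c)"
proof -
  fix c and \<alpha> \<beta> :: form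
  assume "\<exists>P. \<alpha> - \<beta> = form_d P"
  then obtain P where "\<alpha> - \<beta> = form_d P" by blast
  then have "form_mult (const c) \<alpha> - form_mult (const c) \<beta> = form_d (const c * P)"
    by (simp add: form_d_const_mult form_mult_def prod_eq_iff flip: right_diff_distrib)
  then show "\<exists>P. form_mult (const c) \<alpha> - form_mult (const c) \<beta> = form_d P" by blast
qed

section \<open>Special linear Lie algebras with coefficients\<close>

text \<open>
  Rows and columns are numbered from 0, so \<open>elem_mat r i j\<close> is $E_{i+1,j+1}$.
  For a subspace \<open>S\<close> of \<open>A\<close> the tensor product of $sl_r$ with \<open>S\<close> is identified with the
  traceless matrices with entries in \<open>S\<close>, and \<open>tensor g P\<close> is $g \otimes P$.
\<close>

definition mat_trace :: "'a::comm_ring_1 mat \<Rightarrow> 'a" where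
  "mat_trace X = (\<Sum>i<dim_row X. X $$ (i, i))"

definition mat_bracket :: "'a::comm_ring_1 mat \<Rightarrow> 'a mat \<Rightarrow> 'a mat" where
  "mat_bracket X Y = X * Y - Y * X"

definition elem_mat :: "nat \<Rightarrow> nat \<Rightarrow> nat \<Rightarrow> complex mat" where
  "elem_mat r i j = mat r r (\<lambda>p. if p = (i, j) then 1 else 0)"

definition tensor :: "complex mat \<Rightarrow> laurent \<Rightarrow> laurent mat" where
  "tensor g P = map_mat (\<lambda>c. const c * P) g"

definition cartan :: "nat \<Rightarrow> complex mat set" where
  "cartan r = {h \<in> carrier_mat r r. mat_trace h = 0 \<and> (\<forall>i<r. \<forall>j<r. i \<noteq> j \<longrightarrow> h $$ (i, j) = 0)}"

definition sl_over :: "nat \<Rightarrow> laurent set \<Rightarrow> laurent mat set" where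
  "sl_over r S = {X \<in> carrier_mat r r. mat_trace X = 0 \<and> (\<forall>i<r. \<forall>j<r. X $$ (i, j) \<in> S)}"

definition sl_poly :: "nat \<Rightarrow> laurent mat lie_alg" where
  "sl_poly r =
    \<lparr> lcarrier = sl_over r polys,
      ladd = (\<lambda>X Y. X + Y),
      lscale = (\<lambda>c X. const c \<cdot>\<^sub>m X),
      lbracket = mat_bracket \<rparr>"

text \<open>
  Trace of \<open>ad X \<circ> ad Y\<close> taken over $gl_r$; as $gl_r$ is the direct sum of $sl_r$ and its centre,
  this is the Killing form of $sl_r$ when \<open>X\<close> and \<open>Y\<close> are traceless.
\<close>

definition killing :: "nat \<Rightarrow> complex mat \<Rightarrow> complex mat \<Rightarrow> complex" where
  "killing r X Y = (\<Sum>i<r. \<Sum>j<r. mat_bracket X (mat_bracket Y (elem_mat r i j)) $$ (i, j))"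

text \<open>
  The bilinear extension of $\omega(g_1 \otimes P_1, g_2 \otimes P_2) = (g_1, g_2)\, \pi(dP_1 \cdot P_2)$,
  obtained by writing \<open>X\<close> and \<open>Y\<close> in terms of the matrix units.
\<close>

definition cocycle :: "nat \<Rightarrow> laurent mat \<Rightarrow> laurent mat \<Rightarrow> forms_mod_exact" where
  "cocycle r X Y = form_proj (\<Sum>i<r. \<Sum>j<r. \<Sum>k<r. \<Sum>l<r.
     form_mult (const (killing r (elem_mat r i j) (elem_mat r k l)) * Y $$ (k, l))
       (form_d (X $$ (i, j))))"

definition univ_central_ext :: "nat \<Rightarrow> (laurent mat \<times> forms_mod_exact) lie_alg" where
  "univ_central_ext r =
    \<lparr> lcarrier = sl_over r UNIV \<times> UNIV,
      ladd = (\<lambda>(X, \<alpha>) (Y, \<beta>). (X + Y, fme_add \<alpha> \<beta>)),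
      lscale = (\<lambda>c (X, \<alpha>). (const c \<cdot>\<^sub>m X, fme_scale c \<alpha>)),
      lbracket = (\<lambda>(X, \<alpha>) (Y, \<beta>). (mat_bracket X Y, cocycle r X Y)) \<rparr>"

section \<open>Weyl modules\<close>

text \<open>The first fundamental weight sends a diagonal matrix \<open>h\<close> to its first entry.\<close>

definition is_weyl_quotient ::
  "nat \<Rightarrow> nat \<Rightarrow> (complex \<Rightarrow> 'v::ab_group_add \<Rightarrow> 'v) \<Rightarrow> 'v set \<Rightarrow> (laurent mat \<Rightarrow> 'v \<Rightarrow> 'v) \<Rightarrow> 'v \<Rightarrow> bool"
  where
  "is_weyl_quotient r m sc V act w \<longleftrightarrow>
     is_lie_module (sl_poly r) sc V act \<and>
     finite_dim sc V \<and>
     is_generated_by (sl_poly r) sc V act w \<and>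
     (\<forall>P\<in>polys. \<forall>h\<in>cartan r.
        act (tensor h P) w = sc (of_nat m * h $$ (0, 0) * Poly_Mapping.lookup P (0, 0)) w) \<and>
     (\<forall>P\<in>polys. \<forall>i j. i < j \<and> j < r \<longrightarrow> act (tensor (elem_mat r i j) P) w = 0)"

text \<open>
  Maximality: every finite-dimensional cyclic module with the same relations is a quotient.
  The competing modules are taken inside the countable-dimensional space \<open>complex poly\<close>, which
  contains a copy of every finite-dimensional complex vector space; \<open>weyl_module_universal\<close>
  below removes this restriction.
\<close>

definition is_weyl_module ::
  "nat \<Rightarrow> nat \<Rightarrow> (complex \<Rightarrow> 'v::ab_group_add \<Rightarrow> 'v) \<Rightarrow> 'v set \<Rightarrow> (laurent mat \<Rightarrow> 'v \<Rightarrow> 'v) \<Rightarrow> 'v \<Rightarrow> bool"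
  where
  "is_weyl_module r m sc V act w \<longleftrightarrow>
     is_weyl_quotient r m sc V act w \<and>
     (\<forall>(V' :: complex poly set) act' w'.
        is_weyl_quotient r m Polynomial.smult V' act' w' \<longrightarrow>
        (\<exists>f. is_module_hom (sl_poly r) sc V act Polynomial.smult V' act' f \<and> f w = w'))"

lemma weyl_module_universal:
  fixes sc' :: "complex \<Rightarrow> 'u::ab_group_add \<Rightarrow> 'u"
  assumes weyl: "is_weyl_module r m sc V act w"
    and quot: "is_weyl_quotient r m sc' V' act' w'"
  shows "\<exists>f. is_module_hom (sl_poly r) sc V act sc' V' act' f \<and> f w = w'"
proof -
  let ?g = "sl_poly r"
  have lm: "is_lie_module ?g sc' V' act'" and fd: "finite_dim sc' V'"
    and gen: "is_generated_by ?g sc' V' act' w'"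
    and h1: "\<And>P h. P \<in> polys \<Longrightarrow> h \<in> cartan r \<Longrightarrow>
        act' (tensor h P) w' = sc' (of_nat m * h $$ (0, 0) * Poly_Mapping.lookup P (0, 0)) w'"
    and h2: "\<And>P i j. P \<in> polys \<Longrightarrow> i < j \<Longrightarrow> j < r \<Longrightarrow> act' (tensor (elem_mat r i j) P) w' = 0"
    using quot unfolding is_weyl_quotient_def by blast+
  have vs': "vector_space sc'" and sub: "module.subspace sc' V'"
    using lm unfolding is_lie_module_def by blast+
  have vsp: "vector_space (Polynomial.smult :: complex \<Rightarrow> complex poly \<Rightarrow> complex poly)"
    by unfold_locales (simp_all add: smult_add_left smult_add_right)
  interpret A: vector_space sc' by (rule vs')
  interpret B: vector_space "Polynomial.smult :: complex \<Rightarrow> complex poly \<Rightarrow> complex poly"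
    by (rule vsp)
  interpret AB: vector_space_pair sc' "Polynomial.smult :: complex \<Rightarrow> complex poly \<Rightarrow> complex poly" ..
  obtain S where S: "finite S" "V' = A.span S" using fd unfolding finite_dim_def by blast
  obtain E where E: "E \<subseteq> S" "A.independent E" "S \<subseteq> A.span E"
    using A.maximal_independent_subset[of S] by blast
  have V': "V' = A.span E"
    using S E by (metis A.span_mono A.span_subspace A.subspace_span A.span_minimal subset_antisym)
  have finE: "finite E" using S E finite_subset by blast
  obtain e :: "'u \<Rightarrow> nat" where e: "inj_on e E" using finE finite_imp_inj_to_nat_seg by blast
  obtain T where T: "Vector_Spaces.linear sc' Polynomial.smult T"
    and TE: "\<And>b. b \<in> E \<Longrightarrow> T b = Polynomial.monom (1::complex) (e b)"
    using AB.linear_independent_extend[OF E(2), of "\<lambda>b. Polynomial.monom 1 (e b)"] by blast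
  interpret T: Vector_Spaces.linear sc' "Polynomial.smult :: complex \<Rightarrow> complex poly \<Rightarrow> complex poly" T
    by (rule T)
  have injT: "inj_on T V'"
  proof (rule inj_onI)
    fix x y assume xy: "x \<in> V'" "y \<in> V'" "T x = T y"
    then have "x - y \<in> A.span E" using V' A.span_diff by blast
    then obtain u where u: "x - y = (\<Sum>b\<in>E. sc' (u b) b)" using A.span_finite[OF finE] by auto
    have "(\<Sum>b\<in>E. Polynomial.monom (u b) (e b)) = T (x - y)"
      unfolding u T.sum T.scale using TE by (intro sum.cong) (simp_all add: smult_monom)
    also have "\<dots> = 0" using xy by (simp add: T.diff)
    finally have z: "(\<Sum>b\<in>E. Polynomial.monom (u b) (e b)) = 0" .
    have "u b = 0" if b: "b \<in> E" for b
    proof -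
      have "0 = Polynomial.coeff (\<Sum>b\<in>E. Polynomial.monom (u b) (e b)) (e b)" using z by simp
      also have "\<dots> = (\<Sum>c\<in>E. if c = b then u c else 0)"
        unfolding coeff_sum using e b by (intro sum.cong) (auto simp: inj_on_eq_iff)
      also have "\<dots> = u b" using finE b by simp
      finally show ?thesis by simp
    qed
    then have "x - y = 0" unfolding u by (simp add: sum.neutral)
    then show "x = y" by simp
  qed
  define R where "R = inv_into V' T"
  have RT: "R (T v) = v" if "v \<in> V'" for v unfolding R_def using injT that by simp
  define act2 where "act2 X p = T (act' X (R p))" for X p
  have act2: "act2 X (T v) = T (act' X v)" if "v \<in> V'" for X v using RT that by (simp add: act2_def)
  have cl: "act' X v \<in> V'" if "X \<in> lcarrier ?g" "v \<in> V'" for X v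
    using lm that unfolding is_lie_module_def by blast
  have add: "act' X (u + v) = act' X u + act' X v" if "X \<in> lcarrier ?g" "u \<in> V'" "v \<in> V'" for X u v
    using lm that unfolding is_lie_module_def by blast
  have scl: "act' X (sc' c v) = sc' c (act' X v)" if "X \<in> lcarrier ?g" "v \<in> V'" for X c v
    using lm that unfolding is_lie_module_def by blast
  have gadd: "act' (ladd ?g X Y) v = act' X v + act' Y v"
    if "X \<in> lcarrier ?g" "Y \<in> lcarrier ?g" "v \<in> V'" for X Y v
    using lm that unfolding is_lie_module_def by blast
  have gscl: "act' (lscale ?g c X) v = sc' c (act' X v)" if "X \<in> lcarrier ?g" "v \<in> V'" for X c v
    using lm that unfolding is_lie_module_def by blast
  have gbr: "act' (lbracket ?g X Y) v = act' X (act' Y v) - act' Y (act' X v)"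
    if "X \<in> lcarrier ?g" "Y \<in> lcarrier ?g" "v \<in> V'" for X Y v
    using lm that unfolding is_lie_module_def by blast
  have subT: "B.subspace (T ` V')" by (rule T.subspace_image[OF sub])
  have lm2: "is_lie_module ?g Polynomial.smult (T ` V') act2"
    unfolding is_lie_module_def
    by (intro conjI ballI allI vsp subT;
        (elim imageE)?;
        simp add: act2 cl add scl gadd gscl gbr A.subspace_add[OF sub] A.subspace_scale[OF sub]
          flip: T.add T.scale T.diff)
  have fd2: "finite_dim Polynomial.smult (T ` V')"
    unfolding finite_dim_def using S T.span_image by blast
  have w'V: "w' \<in> V'" using gen unfolding is_generated_by_def by blast
  have gen2: "is_generated_by ?g Polynomial.smult (T ` V') act2 (T w')"
    unfolding is_generated_by_def
  proof (intro conjI allI impI)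
    show "T w' \<in> T ` V'" using w'V by blast
  next
    fix U assume U: "B.subspace U \<and> U \<subseteq> T ` V' \<and> T w' \<in> U \<and> (\<forall>X\<in>lcarrier ?g. \<forall>u\<in>U. act2 X u \<in> U)"
    let ?U = "{v \<in> V'. T v \<in> U}"
    have "A.subspace ?U"
      using U sub by (auto simp: A.subspace_def B.subspace_def T.add T.scale T.zero)
    moreover have "\<forall>X\<in>lcarrier ?g. \<forall>u\<in>?U. act' X u \<in> ?U"
      using U cl act2 by (metis (no_types, lifting) mem_Collect_eq)
    ultimately have "?U = V'"
      using gen U w'V unfolding is_generated_by_def by (metis (no_types, lifting) mem_Collect_eq subsetI)
    then show "U = T ` V'" using U by blast
  qed
  have "is_weyl_quotient r m Polynomial.smult (T ` V') act2 (T w')"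
    unfolding is_weyl_quotient_def using lm2 fd2 gen2
    by (auto simp: act2[OF w'V] h1 h2 T.scale T.zero)
  then obtain f where f: "is_module_hom ?g sc V act Polynomial.smult (T ` V') act2 f" "f w = T w'"
    using weyl unfolding is_weyl_module_def by blast
  have fV: "f v \<in> T ` V'" if "v \<in> V" for v using f(1) that unfolding is_module_hom_def by blast
  have RV: "R p \<in> V'" and TR: "T (R p) = p" if "p \<in> T ` V'" for p using that RT by auto
  have Radd: "R (p + q) = R p + R q" if "p \<in> T ` V'" "q \<in> T ` V'" for p q
    using that RT A.subspace_add[OF sub] by (auto simp flip: T.add)
  have Rscl: "R (Polynomial.smult c p) = sc' c (R p)" if "p \<in> T ` V'" for c p
    using that RT A.subspace_scale[OF sub] by (auto simp flip: T.scale)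
  have Ract: "R (act2 X p) = act' X (R p)" if "X \<in> lcarrier ?g" "p \<in> T ` V'" for X p
    using that RT cl by (auto simp: act2_def)
  have "is_module_hom ?g sc V act sc' V' act' (R \<circ> f)"
    using f(1) unfolding is_module_hom_def by (simp add: fV RV Radd Rscl Ract)
  moreover have "(R \<circ> f) w = w'" using f(2) RT w'V by simp
  ultimately show ?thesis by blast
qed

text \<open>
  For \<open>u\<close> the generator of weight $m + r$:
  $(E_{r1} \otimes x^{m+1}) \cdots (E_{31} \otimes x^{m+r-2}) (E_{21} \otimes x^{m+r-1})\, u$;
  the factor $E_{21}$ acts first.
\<close>

definition lowered_vector :: "nat \<Rightarrow> nat \<Rightarrow> (laurent mat \<Rightarrow> 'v \<Rightarrow> 'v) \<Rightarrow> 'v \<Rightarrow> 'v" where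
  "lowered_vector r m act u =
     fold (\<lambda>j. act (tensor (elem_mat r j 0) (xpow (int (m + r - j))))) [1..<r] u"

end

theory Submission
  imports Defs "HOL-Combinatorics.Transposition"
begin

text \<open>
  Number rows and columns from 0 and write \<open>f_j(P)\<close>, \<open>e_j(P)\<close> for the elements $E_{j0} \otimes P$,
  $E_{0j} \otimes P$ with \<open>0 < j < r\<close>. They generate the Lie algebra, both over $C[x,y]$ and over \<open>A\<close>, so
  the task is to find operators \<open>f_j(P)\<close>, \<open>e_j(P)\<close> on the limit \<open>L\<close> for Laurent \<open>P\<close> and to compute
  the Lie algebra that they generate.
  
  The operators come from a bijection \<open>T\<close> of \<open>L\<close> with \<open>T e_j(x\<^sup>r P) = e_j(P) T\<close> and
  \<open>T f_j(P) = f_j(x\<^sup>r P) T\<close> for polynomial \<open>P\<close>: it intertwines the action with its twist under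
  conjugation by the diagonal matrix with entries $1, x^r, \dots, x^r$. For a Laurent polynomial \<open>P\<close> one puts
  $e_j(P) = T^k e_j(x^{rk} P) T^{-k}$ and $f_j(P) = T^{-k} f_j(x^{rk} P) T^k$ with any \<open>k\<close> that makes
  $x^{rk} P$ a polynomial.
  
  Construction of \<open>T\<close>. There is an action of $gl_r[x,y]$ on the symmetric algebra in symbols \<open>b_j(P)\<close> in which
  \<open>f_j(P)\<close> is the multiplication by \<open>b_j(P)\<close> and \<open>e_j(P)\<close> is a differential operator of order two
  (\<open>act_sym_bracket\<close>). The Weyl module of weight $m\omega_1$ is its quotient by \<open>G_m\<close>, the submodule generated by all
  products of more than \<open>m\<close> symbols (\<open>ev_Gsub\<close>, \<open>W_weyl_quotient\<close>). In this model the transition maps are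
  multiplications by monomials $\prod_j b_j(x^{m+r-j})$. The algebra homomorphism \<open>tau\<close> with \<open>tau(b_j(P)) = b_j(xP)\<close> maps \<open>G_m\<close>
  into $G_{m+1}$ (\<open>tau_Gsub\<close>), and its \<open>r\<close>-th power permutes the monomials of the transition maps, so that it
  induces a map \<open>T\<close> on the limit.
  
  \<open>T\<close> is bijective because it has an inverse up to scalars: conjugating \<open>tau\<close> by the transposition of the colours 0 and \<open>i\<close>
  gives a map \<open>tau_i\<close> for every \<open>i > 0\<close>, and the product of all \<open>tau_i\<close> shifts in the direction opposite to \<open>tau\<close>.
  Its \<open>r\<close>-th power, composed with $\tau^r$ on either side, is a nonzero multiple of a composition of \<open>r\<close> transition maps
  (\<open>tv_pow_tau_pow\<close>, \<open>Theta_formula\<close>). For one of the two orders this can be read off from the generators \<open>b_j(P)\<close>. For the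
  other order it is only clear that the composition commutes with all \<open>e_j(P)\<close> and with the diagonal matrices; here rigidity
  helps: an operator between locally finite $sl_2$-modules that commutes with \<open>e\<close> and \<open>h\<close> commutes with \<open>f\<close>, and it vanishes
  if it commutes with \<open>e\<close> and has negative weight (\<open>sl2_rigidity\<close>).
  
  Relations. The \<open>e_j\<close> commute with each other, and so do the \<open>f_j\<close>, since one may conjugate by a power of \<open>T\<close>. The crucial
  relation is $[[e_i(P), f_j(Q)], e_k(R)] = \delta_{ij} e_k(PQR) + \delta_{jk} e_i(PQR)$. The difference of its two sides
  commutes with $f_i(x^{rK})$ for large \<open>K\<close>, because relations with a factor of high \<open>x\<close>-degree reduce to relations of
  polynomials, and it has positive weight for the \<open>i\<close>-th coroot. So it vanishes by rigidity (\<open>efe_laurent\<close>). It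
  follows that \<open>[f_i(P), e_j(Q)]\<close> and \<open>[f_i(PQ), e_j(1)]\<close> differ by a central operator, which is zero for \<open>i \<noteq> j\<close> and is an
  operator \<open>c(P, Q)\<close> independent of \<open>i\<close> for \<open>i = j\<close>. The Jacobi identity shows that \<open>c\<close> is antisymmetric with
  \<open>c(P, QR) = c(PQ, R) + c(PR, Q)\<close>; so \<open>c(P, Q)\<close> depends linearly on the class of the form \<open>P dQ\<close> modulo exact forms. The resulting
  cocycle of $sl_r \otimes A$ is $\sum c(X_{ab}, Y_{ba})$, which is the cocycle of the universal central extension up to
  the factor \<open>2r\<close> between the trace form and the Killing form (\<open>ZZ_cocycle\<close>, \<open>rho_ZZ_br\<close>).
\<close>

section \<open>Complex-linear maps between spaces of formal linear combinations\<close>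

abbreviation mono1 :: "'k \<Rightarrow> 'k \<Rightarrow>\<^sub>0 complex" where
  "mono1 k \<equiv> Poly_Mapping.single k 1"

text \<open>
  The formal linear combinations of elements of a commutative monoid form an algebra; since the monoid is written additively,
  scalars sit at the exponent 0.
\<close>

definition scal :: "complex \<Rightarrow> ('k::comm_monoid_add \<Rightarrow>\<^sub>0 complex) \<Rightarrow> 'k \<Rightarrow>\<^sub>0 complex" where
  "scal c u = Poly_Mapping.single 0 c * u"

lemma lookup_scal: "Poly_Mapping.lookup (scal c u) k = c * Poly_Mapping.lookup u k"
proof -
  have "scal c u = Poly_Mapping.map ((*) c) u"
    by (simp add: scal_def mult_map_scale_conv_mult)
  then show ?thesis by (simp add: map.rep_eq when_def)
qed

lemma const_mult_eq_scal: "const c * P = scal c P"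
  by (simp add: scal_def const_def)

lemma scal_add_right: "scal c (u + v) = scal c u + scal c v"
  and scal_add_left: "scal (a + b) u = scal a u + scal b u"
  and scal_scal: "scal a (scal b u) = scal (a * b) u"
  and scal_one [simp]: "scal 1 u = u"
  and scal_zero [simp]: "scal 0 u = 0"
  and scal_zero_right [simp]: "scal c 0 = 0"
  and scal_minus_right: "scal c (- u) = - scal c u"
  and scal_minus_left: "scal (- c) u = - scal c u"
  and scal_diff_right: "scal c (u - v) = scal c u - scal c v"
  and scal_mult_left: "scal c u * v = scal c (u * v)"
  and scal_mult_right: "u * scal c v = scal c (u * v)"
  and scal_single: "scal c (Poly_Mapping.single k a) = Poly_Mapping.single k (c * a)"
  by (simp_all add: scal_def algebra_simps mult_single single_add single_uminus flip: mult.assoc)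

lemma vector_space_scal: "vector_space (scal :: complex \<Rightarrow> ('k::comm_monoid_add \<Rightarrow>\<^sub>0 complex) \<Rightarrow> _)"
  by unfold_locales (simp_all add: scal_add_right scal_add_left scal_scal)

interpretation scal: vector_space scal
  by (rule vector_space_scal)

lemma sum_single_lookup:
  "(\<Sum>k\<in>Poly_Mapping.keys u. Poly_Mapping.single k (Poly_Mapping.lookup u k)) = u"
  by (rule poly_mapping_eqI) (simp add: lookup_sum lookup_single when_def in_keys_iff)

lemma poly_mapping_linear_induct [case_names single add]:
  fixes u :: "'k \<Rightarrow>\<^sub>0 'a::comm_monoid_add"
  assumes "\<And>k c. P (Poly_Mapping.single k c)" and "\<And>u v. P u \<Longrightarrow> P v \<Longrightarrow> P (u + v)"
  shows "P u"
proof -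
  have "finite K \<Longrightarrow> P (\<Sum>k\<in>K. Poly_Mapping.single k (Poly_Mapping.lookup u k))" for K
  proof (induction K rule: finite_induct)
    case empty
    show ?case using assms(1)[of undefined 0] by simp
  next
    case (insert x F)
    then show ?case using assms by simp
  qed
  then show ?thesis by (metis sum_single_lookup finite_keys)
qed

text \<open>
  The linear extension of a map that is given on the basis.
\<close>

definition lext :: "(complex \<Rightarrow> 'v::ab_group_add \<Rightarrow> 'v) \<Rightarrow> ('k \<Rightarrow> 'v) \<Rightarrow> ('k \<Rightarrow>\<^sub>0 complex) \<Rightarrow> 'v" where
  "lext sc \<phi> u = (\<Sum>k\<in>Poly_Mapping.keys u. sc (Poly_Mapping.lookup u k) (\<phi> k))"

lemma lext_superset:
  assumes "vector_space sc" and "finite K" and "Poly_Mapping.keys u \<subseteq> K"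
  shows "lext sc \<phi> u = (\<Sum>k\<in>K. sc (Poly_Mapping.lookup u k) (\<phi> k))"
proof -
  interpret vector_space sc by (rule assms)
  show ?thesis unfolding lext_def using assms
    by (intro sum.mono_neutral_left) (auto simp: in_keys_iff)
qed

lemma lext_add:
  assumes "vector_space sc"
  shows "lext sc \<phi> (u + v) = lext sc \<phi> u + lext sc \<phi> v"
proof -
  interpret vector_space sc by (rule assms)
  let ?K = "Poly_Mapping.keys u \<union> Poly_Mapping.keys v"
  have "Poly_Mapping.keys (u + v) \<subseteq> ?K" by (rule Poly_Mapping.keys_add)
  then show ?thesis
    by (simp add: lext_superset[OF assms, of ?K] lookup_add scale_left_distrib sum.distrib)
qed

lemma lext_single:
  assumes "vector_space sc"
  shows "lext sc \<phi> (Poly_Mapping.single k c) = sc c (\<phi> k)"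
proof -
  interpret vector_space sc by (rule assms)
  show ?thesis by (subst lext_superset[OF assms, of "{k}"]) (auto split: if_splits)
qed

lemma lext_scal:
  fixes u :: "'k::comm_monoid_add \<Rightarrow>\<^sub>0 complex"
  assumes "vector_space sc"
  shows "lext sc \<phi> (scal c u) = sc c (lext sc \<phi> u)"
proof -
  interpret vector_space sc by (rule assms)
  have "Poly_Mapping.keys (scal c u) \<subseteq> Poly_Mapping.keys u"
    by (auto simp: in_keys_iff lookup_scal)
  then show ?thesis
    by (simp add: lext_superset[OF assms, of "Poly_Mapping.keys u"] lookup_scal scale_sum_right)
qed

lemma lext_zero: "lext sc \<phi> 0 = 0"
  by (simp add: lext_def)

definition clin :: "(('a::comm_monoid_add \<Rightarrow>\<^sub>0 complex) \<Rightarrow> ('b::comm_monoid_add \<Rightarrow>\<^sub>0 complex)) \<Rightarrow> bool" where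
  "clin f \<longleftrightarrow> (\<forall>u v. f (u + v) = f u + f v) \<and> (\<forall>c u. f (scal c u) = scal c (f u))"

lemma clin_add: "clin f \<Longrightarrow> f (u + v) = f u + f v"
  and clin_scal: "clin f \<Longrightarrow> f (scal c u) = scal c (f u)"
  by (auto simp: clin_def)

lemma clin_zero: "clin f \<Longrightarrow> f 0 = 0"
  using clin_scal[of f 0 0] by simp

lemma clin_minus: "clin f \<Longrightarrow> f (- u) = - f u"
  using clin_scal[of f "-1" u] by (simp add: scal_minus_left)

lemma clin_diff: "clin f \<Longrightarrow> f (u - v) = f u - f v"
  using clin_add[of f u "- v"] by (simp add: clin_minus)

lemma clin_sum: "clin f \<Longrightarrow> f (sum g A) = (\<Sum>a\<in>A. f (g a))"
  by (induction A rule: infinite_finite_induct) (simp_all add: clin_zero clin_add)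

lemma clin_eqI:
  assumes "clin f" "clin g" "\<And>k. f (mono1 k) = g (mono1 k)"
  shows "f u = g u"
proof (induction u rule: poly_mapping_linear_induct)
  case (single k c)
  have "Poly_Mapping.single k c = scal c (mono1 k)" by (simp add: scal_single)
  then show ?case using assms by (simp add: clin_scal)
next
  case (add u v)
  then show ?case using assms by (simp add: clin_add)
qed

lemma clin_lext: "clin (lext scal \<phi>)"
  by (simp add: clin_def lext_add lext_scal vector_space_scal)

lemma lext_mono1 [simp]: "lext scal \<phi> (mono1 k) = \<phi> k"
  by (simp add: lext_single vector_space_scal)

section \<open>A module of gl_r[x, y] on a symmetric algebra\<close>

text \<open>
  The generator \<open>(c, (a, b))\<close> stands for the symbol $b_c(x^a y^b)$ of colour \<open>c\<close>. Negative \<open>a\<close> and all colours are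
  admitted in the type; the symmetric algebra proper is the subalgebra \<open>S0 r\<close> below.
\<close>

type_synonym gen = "nat \<times> (int \<times> nat)"
type_synonym sym = "gen multiset \<Rightarrow>\<^sub>0 complex"

definition bb :: "nat \<Rightarrow> laurent \<Rightarrow> sym" where
  "bb c = lext scal (\<lambda>k. mono1 {#(c, k)#})"

lemma clin_bb: "clin (bb c)"
  by (simp add: bb_def clin_lext)

lemma bb_mono1 [simp]: "bb c (mono1 k) = mono1 {#(c, k)#}"
  by (simp add: bb_def)

lemmas bb_add = clin_add[OF clin_bb] and bb_scal = clin_scal[OF clin_bb]
  and bb_zero [simp] = clin_zero[OF clin_bb] and bb_diff = clin_diff[OF clin_bb]
  and bb_minus = clin_minus[OF clin_bb] and bb_sum = clin_sum[OF clin_bb]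

text \<open>
  \<open>lop \<Phi>\<close> deletes one factor \<open>t\<close> of a monomial and applies \<open>\<Phi> t\<close> to the rest, summed over all factors. Derivations have this form
  with \<open>\<Phi> t\<close> a multiplication; a second nesting gives operators of order two.
\<close>

definition lop :: "(gen \<Rightarrow> sym \<Rightarrow> sym) \<Rightarrow> sym \<Rightarrow> sym" where
  "lop \<Phi> = lext scal (\<lambda>M. \<Sum>t\<in>#M. \<Phi> t (mono1 (M - {#t#})))"

lemma clin_lop: "clin (lop \<Phi>)"
  by (simp add: lop_def clin_lext)

lemma lop_mono1: "lop \<Phi> (mono1 M) = (\<Sum>t\<in>#M. \<Phi> t (mono1 (M - {#t#})))"
  by (simp add: lop_def)

lemma mono1_add_mset: "(mono1 (add_mset t M) :: sym) = mono1 {#t#} * mono1 M"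
  by (simp add: mult_single)

lemma lop_one [simp]: "lop \<Phi> 1 = 0"
  using lop_mono1[of \<Phi> "{#}"] by simp

lemma clin_mult: "clin ((*) a)"
  by (simp add: clin_def algebra_simps scal_mult_right)

lemma clin_compose: "clin f \<Longrightarrow> clin g \<Longrightarrow> clin (\<lambda>u. f (g u))"
  by (simp add: clin_def)

lemma clin_plus: "clin f \<Longrightarrow> clin g \<Longrightarrow> clin (\<lambda>u. f u + g u)"
  by (simp add: clin_def algebra_simps scal_add_right)

lemma clin_minus_fun: "clin f \<Longrightarrow> clin g \<Longrightarrow> clin (\<lambda>u. f u - g u)"
  by (simp add: clin_def algebra_simps scal_diff_right)

lemma clin_const_zero: "clin (\<lambda>u. 0)"
  by (simp add: clin_def)

lemma clin_id: "clin (\<lambda>u. u)"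
  by (simp add: clin_def)

lemma clin_fun_sum: "(\<And>a. a \<in> A \<Longrightarrow> clin (f a)) \<Longrightarrow> clin (\<lambda>u. \<Sum>a\<in>A. f a u)"
  by (simp add: clin_def sum.distrib scal.scale_sum_right)

lemma clin_scal_fun: "clin f \<Longrightarrow> clin (\<lambda>u. scal c (f u))"
  by (simp add: clin_def scal_add_right scal_scal mult.commute)

lemma clin_mult_const: "clin f \<Longrightarrow> clin (\<lambda>u. f u * b)"
  by (simp add: clin_def distrib_right scal_mult_left)

lemma sum_mset_cong_diff:
  assumes "\<And>t. t \<in># M \<Longrightarrow> f t = g t"
  shows "(\<Sum>t\<in>#M. f t) = (\<Sum>t\<in>#M. g t)"
  using assms by (simp cong: image_mset_cong)

text \<open>
  The new factor is either kept, and then it has to be moved past \<open>\<Phi> t\<close>, or it is the one that is deleted.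
\<close>

lemma lop_gen:
  assumes lin: "\<And>t. clin (\<Phi> t)"
    and com: "\<And>t v. \<Phi> t (mono1 {#s#} * v) = mono1 {#s#} * \<Phi> t v + \<Psi> t v"
  shows "lop \<Phi> (mono1 {#s#} * u) = mono1 {#s#} * lop \<Phi> u + \<Phi> s u + lop \<Psi> u"
proof (rule clin_eqI[where u = u])
  show "clin (\<lambda>u. lop \<Phi> (mono1 {#s#} * u))"
    by (intro clin_compose[OF clin_lop] clin_mult)
  show "clin (\<lambda>u. mono1 {#s#} * lop \<Phi> u + \<Phi> s u + lop \<Psi> u)"
    by (intro clin_plus clin_compose[OF clin_mult] clin_lop lin)
next
  fix M :: "gen multiset"
  have "lop \<Phi> (mono1 {#s#} * mono1 M)
      = \<Phi> s (mono1 M) + (\<Sum>t\<in>#M. \<Phi> t (mono1 (add_mset s M - {#t#})))"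
    by (simp add: lop_mono1 mono1_add_mset[of s M, symmetric])
  also have "(\<Sum>t\<in>#M. \<Phi> t (mono1 (add_mset s M - {#t#})))
      = (\<Sum>t\<in>#M. mono1 {#s#} * \<Phi> t (mono1 (M - {#t#})) + \<Psi> t (mono1 (M - {#t#})))"
  proof (rule sum_mset_cong_diff)
    fix t assume "t \<in># M"
    then have "add_mset s M - {#t#} = add_mset s (M - {#t#})" by simp
    then show "\<Phi> t (mono1 (add_mset s M - {#t#}))
        = mono1 {#s#} * \<Phi> t (mono1 (M - {#t#})) + \<Psi> t (mono1 (M - {#t#}))"
      by (simp add: mono1_add_mset[of s "M - {#t#}"] com)
  qed
  also have "\<dots> = mono1 {#s#} * lop \<Phi> (mono1 M) + lop \<Psi> (mono1 M)"
    by (simp add: lop_mono1 sum_mset.distrib sum_mset_distrib_left image_mset.compositionality comp_def)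
  finally show "lop \<Phi> (mono1 {#s#} * mono1 M)
      = mono1 {#s#} * lop \<Phi> (mono1 M) + \<Phi> s (mono1 M) + lop \<Psi> (mono1 M)"
    by (simp add: algebra_simps)
qed

text \<open>
  These are the actions of $E_{ij} \otimes P$, of $E_{00} \otimes P$ and of $E_{0j} \otimes P$, where \<open>i, j > 0\<close>, on the symmetric algebra.
  The first is the derivation \<open>b_j(Q) \<mapsto> b_i(PQ)\<close>. The second is the weight \<open>m P(0)\<close> minus the derivation
  \<open>b_c(Q) \<mapsto> b_c(PQ)\<close>, the third has order two.
\<close>

definition DD :: "nat \<Rightarrow> nat \<Rightarrow> laurent \<Rightarrow> sym \<Rightarrow> sym" where
  "DD i j P = lop (\<lambda>(c, k) v. if c = j then bb i (P * mono1 k) * v else 0)"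

definition qq :: "nat \<Rightarrow> laurent \<Rightarrow> sym \<Rightarrow> sym" where
  "qq m P u = scal (of_nat m * Poly_Mapping.lookup P 0) u
     - lop (\<lambda>(c, k) v. bb c (P * mono1 k) * v) u"

definition ee :: "nat \<Rightarrow> nat \<Rightarrow> laurent \<Rightarrow> sym \<Rightarrow> sym" where
  "ee m j P = lop (\<lambda>(c, k) v. if c = j then qq m (P * mono1 k) v else 0)"

lemma clin_DD: "clin (DD i j P)"
  by (simp add: DD_def clin_lop)

lemma clin_qq: "clin (qq m P)"
  unfolding qq_def by (intro clin_minus_fun clin_scal_fun clin_id clin_lop)

lemma clin_ee: "clin (ee m j P)"
  by (simp add: ee_def clin_lop)

lemma clin_lop_param:
  assumes "\<And>t v. clin (\<lambda>P. \<Phi> P t v)"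
  shows "clin (\<lambda>P. lop (\<Phi> P) u)"
proof -
  have *: "lop (\<Phi> P) u = (\<Sum>M\<in>Poly_Mapping.keys u. scal (Poly_Mapping.lookup u M)
      (\<Sum>t\<in>#M. \<Phi> P t (mono1 (M - {#t#}))))" for P
    by (simp add: lop_def lext_def)
  have "clin (\<lambda>P. \<Sum>t\<in>#M. \<Phi> P t (mono1 (N - {#t#})))" for M N
    by (induction M) (simp_all add: clin_const_zero clin_plus assms)
  then show ?thesis
    unfolding * by (intro clin_fun_sum clin_scal_fun)
qed

lemma clin_DD_param: "clin (\<lambda>P. DD i j P u)"
  unfolding DD_def
proof (rule clin_lop_param, clarify)
  fix c k v
  show "clin (\<lambda>P. if c = j then bb i (P * mono1 k) * v else 0)" for c j i and k :: "int \<times> nat" and v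
    by (cases "c = j") (simp_all add: clin_const_zero clin_mult_const clin_compose[OF clin_bb] clin_id)
qed

lemma clin_qq_param: "clin (\<lambda>P. qq m P u)"
proof -
  have "clin (\<lambda>P. lop (\<lambda>(c, k) v. bb c (P * mono1 k) * v) u)"
    by (rule clin_lop_param, clarify)
      (simp add: clin_mult_const clin_compose[OF clin_bb] clin_id)
  then show ?thesis
    unfolding qq_def
    by (intro clin_minus_fun)
      (simp_all add: clin_def lookup_add lookup_scal scal_add_left scal_scal distrib_left mult.left_commute)
qed

lemma clin_ee_param: "clin (\<lambda>P. ee m j P u)"
  unfolding ee_def
proof (rule clin_lop_param, clarify)
  fix c k v
  have "clin (\<lambda>P. qq m (P * mono1 k) v)" for k v
    using clin_compose[OF clin_qq_param clin_mult_const[OF clin_id]] .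
  then show "clin (\<lambda>P. if c = j then qq m (P * mono1 k) v else 0)"
     for c j and k :: "int \<times> nat" and v
    by (cases "c = j") (simp_all add: clin_const_zero)
qed

lemma DD_one [simp]: "DD i j P 1 = 0"
  and ee_one [simp]: "ee m j P 1 = 0"
  and qq_one [simp]: "qq m P 1 = scal (of_nat m * Poly_Mapping.lookup P 0) 1"
  by (simp_all add: DD_def ee_def qq_def)

lemma lop_derivation:
  "lop (\<lambda>t v. g t * v) (mono1 {#s#} * u) = mono1 {#s#} * lop (\<lambda>t v. g t * v) u + g s * u"
proof -
  have "lop (\<lambda>t v. 0) u = 0"
    by (rule clin_eqI[where u = u]) (simp_all add: clin_lop clin_const_zero lop_mono1)
  then show ?thesis
    by (subst lop_gen[where \<Psi> = "\<lambda>t v. 0"]) (simp_all add: clin_mult algebra_simps)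
qed

lemma DD_gen:
  "DD i j P (mono1 {#(c, k)#} * u)
    = mono1 {#(c, k)#} * DD i j P u + (if c = j then bb i (P * mono1 k) * u else 0)"
proof -
  have "DD i j P = lop (\<lambda>t v. (if fst t = j then bb i (P * mono1 (snd t)) else 0) * v)"
    unfolding DD_def by (rule arg_cong[where f = lop]) (auto simp: fun_eq_iff)
  then show ?thesis by (simp add: lop_derivation)
qed

lemma qq_gen:
  "qq m P (mono1 {#(c, k)#} * u)
    = mono1 {#(c, k)#} * qq m P u - bb c (P * mono1 k) * u"
proof -
  have "lop (\<lambda>(c, k) v. bb c (P * mono1 k) * v) = lop (\<lambda>t v. bb (fst t) (P * mono1 (snd t)) * v)"
    by (rule arg_cong[where f = lop]) (auto simp: fun_eq_iff)
  then show ?thesis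
    by (simp add: qq_def lop_derivation right_diff_distrib scal_mult_right)
qed

lemma sum_mset_minus: "(\<Sum>t\<in>#M. - f t) = - (\<Sum>t\<in>#M. f t :: 'a::ab_group_add)"
  by (induction M) simp_all

lemma lop_minus: "lop (\<lambda>t v. - \<Phi> t v) u = - lop \<Phi> u"
proof (rule clin_eqI[where u = u])
  show "clin (\<lambda>u. - lop \<Phi> u)"
    using clin_minus_fun[OF clin_const_zero clin_lop] by simp
qed (simp_all add: clin_lop lop_mono1 sum_mset_minus)

lemma ee_gen:
  "ee m j P (mono1 {#(c, k)#} * u)
    = mono1 {#(c, k)#} * ee m j P u + (if c = j then qq m (P * mono1 k) u else 0)
      - DD c j (P * mono1 k) u"
proof -
  let ?\<Phi> = "\<lambda>t v. if fst t = j then qq m (P * mono1 (snd t)) v else 0"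
  let ?\<Psi> = "\<lambda>t v. - (case t of (c', k') \<Rightarrow> \<lambda>v. if c' = j then bb c ((P * mono1 k) * mono1 k') * v else 0) v"
  have e: "ee m j P = lop ?\<Phi>"
    unfolding ee_def by (rule arg_cong[where f = lop]) (auto simp: fun_eq_iff)
  have "clin (?\<Phi> t)" for t
    by (cases "fst t = j") (simp_all add: clin_const_zero clin_qq)
  moreover have "?\<Phi> t (mono1 {#(c, k)#} * v) = mono1 {#(c, k)#} * ?\<Phi> t v + ?\<Psi> t v" for t v
    by (cases t) (simp add: qq_gen mult.assoc mult.commute[of "mono1 k"])
  ultimately have "lop ?\<Phi> (mono1 {#(c, k)#} * u)
      = mono1 {#(c, k)#} * lop ?\<Phi> u + ?\<Phi> (c, k) u + lop ?\<Psi> u"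
    by (rule lop_gen)
  also have "lop ?\<Psi> u = - DD c j (P * mono1 k) u"
    by (simp only: lop_minus DD_def)
  finally show ?thesis unfolding e by simp
qed

lemma clin_if: "clin f \<Longrightarrow> clin g \<Longrightarrow> clin (\<lambda>u. if c then f u else g u)"
  by (cases c) simp_all

lemma clin_uminus: "clin f \<Longrightarrow> clin (\<lambda>u. - f u)"
  by (simp add: clin_def scal_minus_right)

text \<open>
  With these rules an identity that is linear in a Laurent polynomial is reduced to monomials, where the operators are defined.
\<close>

lemmas clin_intros = clin_id clin_const_zero clin_plus clin_minus_fun clin_uminus clin_if clin_scal_fun
  clin_compose[OF clin_mult] clin_mult_const clin_compose[OF clin_bb] clin_fun_sum
  clin_compose[OF clin_DD] clin_compose[OF clin_ee] clin_compose[OF clin_qq]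
  clin_compose[OF clin_DD_param] clin_compose[OF clin_ee_param] clin_compose[OF clin_qq_param]

lemma DD_bb:
  "DD i j P (bb c Q * u) = bb c Q * DD i j P u + (if c = j then bb i (P * Q) * u else 0)"
  by (rule clin_eqI[where u = Q]) (intro clin_intros | simp add: DD_gen)+

lemma qq_bb: "qq m P (bb c Q * u) = bb c Q * qq m P u - bb c (P * Q) * u"
  by (rule clin_eqI[where u = Q]) (intro clin_intros | simp add: qq_gen)+

text \<open>
  The commutator $[E_{0j} \otimes P, E_{c0} \otimes Q] = \delta_{jc} E_{00} \otimes PQ - E_{cj} \otimes PQ$ in operator form.
\<close>

lemma ee_bb:
  "ee m j P (bb c Q * u)
    = bb c Q * ee m j P u + (if c = j then qq m (P * Q) u else 0) - DD c j (P * Q) u"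
  by (rule clin_eqI[where u = Q]) (intro clin_intros | simp add: ee_gen)+

definition act_sym :: "nat \<Rightarrow> nat \<Rightarrow> laurent mat \<Rightarrow> sym \<Rightarrow> sym" where
  "act_sym r m X u = (\<Sum>j\<in>{1..<r}. bb j (X $$ (j, 0)) * u) + qq m (X $$ (0, 0)) u
     + (\<Sum>i\<in>{1..<r}. \<Sum>j\<in>{1..<r}. DD i j (X $$ (i, j)) u) + (\<Sum>j\<in>{1..<r}. ee m j (X $$ (0, j)) u)"

lemma clin_act_sym: "clin (act_sym r m X)"
  unfolding act_sym_def by (intro clin_intros)

lemma act_sym_add:
  "X \<in> carrier_mat r r \<Longrightarrow> Y \<in> carrier_mat r r \<Longrightarrow> 0 < r \<Longrightarrow> act_sym r m (X + Y) u = act_sym r m X u + act_sym r m Y u"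
  by (simp add: act_sym_def bb_add clin_add[OF clin_qq_param] clin_add[OF clin_DD_param]
      clin_add[OF clin_ee_param] distrib_right sum.distrib)

lemma act_sym_smult:
  "X \<in> carrier_mat r r \<Longrightarrow> 0 < r \<Longrightarrow> act_sym r m (const c \<cdot>\<^sub>m X) u = scal c (act_sym r m X u)"
  by (simp add: act_sym_def const_mult_eq_scal bb_scal clin_scal[OF clin_qq_param]
      clin_scal[OF clin_DD_param] clin_scal[OF clin_ee_param] scal_mult_left scal_add_right
      scal.scale_sum_right)

abbreviation Emat :: "nat \<Rightarrow> nat \<Rightarrow> nat \<Rightarrow> laurent \<Rightarrow> laurent mat" where
  "Emat r i j P \<equiv> tensor (elem_mat r i j) P"

lemma Emat_carrier [simp]: "Emat r i j P \<in> carrier_mat r r"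
  by (simp add: tensor_def elem_mat_def)

lemma Emat_dim [simp]: "dim_row (Emat r i j P) = r" "dim_col (Emat r i j P) = r"
  by (simp_all add: tensor_def elem_mat_def)

lemma const_one: "const 1 = 1" and const_zero: "const 0 = 0"
  by (simp_all add: const_def)

lemma Emat_index [simp]:
  "a < r \<Longrightarrow> b < r \<Longrightarrow> Emat r i j P $$ (a, b) = (if a = i \<and> b = j then P else 0)"
  by (simp add: tensor_def elem_mat_def const_one const_zero)

lemma mat_bracket_carrier [simp]:
  "X \<in> carrier_mat r r \<Longrightarrow> Y \<in> carrier_mat r r \<Longrightarrow> mat_bracket X Y \<in> carrier_mat r r"
  by (auto simp: mat_bracket_def)

lemma mat_bracket_index:
  assumes "X \<in> carrier_mat r r" "Y \<in> carrier_mat r r" "a < r" "b < r"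
  shows "mat_bracket X Y $$ (a, b) = (\<Sum>k<r. X $$ (a, k) * Y $$ (k, b)) - (\<Sum>k<r. Y $$ (a, k) * X $$ (k, b))"
  using assms by (simp add: mat_bracket_def scalar_prod_def lessThan_atLeast0)

lemma mat_bracket_Emat_index:
  assumes "X \<in> carrier_mat r r" "a < r" "b < r" "i < r" "j < r"
  shows "mat_bracket X (Emat r i j Q) $$ (a, b)
    = (if b = j then X $$ (a, i) * Q else 0) - (if a = i then Q * X $$ (j, b) else 0)"
proof -
  have "(\<Sum>k<r. X $$ (a, k) * Emat r i j Q $$ (k, b)) = (\<Sum>k<r. if k = i then (if b = j then X $$ (a, i) * Q else 0) else 0)"
    using assms by (intro sum.cong) auto
  moreover have "(\<Sum>k<r. Emat r i j Q $$ (a, k) * X $$ (k, b)) = (\<Sum>k<r. if k = j then (if a = i then Q * X $$ (j, b) else 0) else 0)"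
    using assms by (intro sum.cong) auto
  ultimately show ?thesis
    using assms by (simp add: mat_bracket_index)
qed

lemma mat_bracket_jacobi:
  fixes X Y Z :: "'a::comm_ring_1 mat"
  assumes X: "X \<in> carrier_mat r r" and Y: "Y \<in> carrier_mat r r" and Z: "Z \<in> carrier_mat r r"
  shows "mat_bracket (mat_bracket X Y) Z = mat_bracket (mat_bracket X Z) Y + mat_bracket X (mat_bracket Y Z)"
proof -
  have [simp]: "X * Y \<in> carrier_mat r r" "Y * X \<in> carrier_mat r r" "X * Z \<in> carrier_mat r r"
    "Z * X \<in> carrier_mat r r" "Y * Z \<in> carrier_mat r r" "Z * Y \<in> carrier_mat r r"
    using assms by auto
  have a: "A \<in> carrier_mat r r \<Longrightarrow> B \<in> carrier_mat r r \<Longrightarrow> C \<in> carrier_mat r r \<Longrightarrow>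
      (A - B) * C = A * C - B * C" for A B C :: "'a mat"
    by (rule minus_mult_distrib_mat)
  have b: "A \<in> carrier_mat r r \<Longrightarrow> B \<in> carrier_mat r r \<Longrightarrow> C \<in> carrier_mat r r \<Longrightarrow>
      C * (A - B) = C * A - C * B" for A B C :: "'a mat"
    by (rule mult_minus_distrib_mat)
  have c: "A \<in> carrier_mat r r \<Longrightarrow> B \<in> carrier_mat r r \<Longrightarrow> C \<in> carrier_mat r r \<Longrightarrow>
      A * B * C = A * (B * C)" for A B C :: "'a mat"
    by (rule assoc_mult_mat)
  show ?thesis
    unfolding mat_bracket_def
    by (rule eq_matI) (use assms in \<open>simp_all add: a b c\<close>)
qed

text \<open>
  Together with the value at 1 this formula determines the operators \<open>act_sym r m X\<close>: it moves \<open>X\<close> past the multiplications by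
  the generators, which are the operators of the first column.
\<close>

lemma act_sym_bb:
  assumes X: "X \<in> carrier_mat r r" and c: "1 \<le> c" "c < r"
  shows "act_sym r m X (bb c Q * u)
    = bb c Q * act_sym r m X u + act_sym r m (mat_bracket X (Emat r c 0 Q)) u"
proof -
  let ?B = "mat_bracket X (Emat r c 0 Q)"
  have [simp]: "0 < r" using c by simp
  have cin: "c \<in> {1..<r}" using c by simp
  have B0: "?B $$ (0, 0) = X $$ (0, c) * Q"
    using X c by (simp add: mat_bracket_Emat_index)
  have Bj: "?B $$ (j, 0) = X $$ (j, c) * Q - (if j = c then Q * X $$ (0, 0) else 0)" if "j \<in> {1..<r}" for j
    using X c that by (simp add: mat_bracket_Emat_index)
  have Bij: "?B $$ (i, j) = - (if i = c then Q * X $$ (0, j) else 0)" if "i \<in> {1..<r}" "j \<in> {1..<r}" for i j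
    using X c that by (simp add: mat_bracket_Emat_index)
  have B0j: "?B $$ (0, j) = 0" if "j \<in> {1..<r}" for j
    using X c that by (simp add: mat_bracket_Emat_index)
  have 1: "(\<Sum>j\<in>{1..<r}. bb j (?B $$ (j, 0)) * u)
      = (\<Sum>j\<in>{1..<r}. bb j (X $$ (j, c) * Q) * u) - bb c (Q * X $$ (0, 0)) * u"
  proof -
    have "(\<Sum>j\<in>{1..<r}. bb j (?B $$ (j, 0)) * u) = (\<Sum>j\<in>{1..<r}. bb j (X $$ (j, c) * Q) * u
       - (if j = c then bb c (Q * X $$ (0, 0)) * u else 0))"
      by (rule sum.cong) (simp_all add: Bj bb_diff left_diff_distrib)
    then show ?thesis using cin by (simp add: sum_subtractf)
  qed
  have 2: "(\<Sum>i\<in>{1..<r}. \<Sum>j\<in>{1..<r}. DD i j (?B $$ (i, j)) u) = - (\<Sum>j\<in>{1..<r}. DD c j (Q * X $$ (0, j)) u)"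
  proof -
    have "(\<Sum>i\<in>{1..<r}. \<Sum>j\<in>{1..<r}. DD i j (?B $$ (i, j)) u)
      = (\<Sum>i\<in>{1..<r}. if i = c then - (\<Sum>j\<in>{1..<r}. DD c j (Q * X $$ (0, j)) u) else 0)"
      by (rule sum.cong) (simp_all add: Bij clin_minus[OF clin_DD_param] clin_zero[OF clin_DD_param] sum_negf)
    then show ?thesis using cin by simp
  qed
  have 3: "(\<Sum>j\<in>{1..<r}. ee m j (?B $$ (0, j)) u) = 0"
    by (simp add: B0j clin_zero[OF clin_ee_param])
  have D: "(\<Sum>i\<in>{1..<r}. \<Sum>j\<in>{1..<r}. DD i j (X $$ (i, j)) (bb c Q * u))
     = bb c Q * (\<Sum>i\<in>{1..<r}. \<Sum>j\<in>{1..<r}. DD i j (X $$ (i, j)) u) + (\<Sum>i\<in>{1..<r}. bb i (X $$ (i, c) * Q) * u)"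
    using cin by (simp add: DD_bb sum.distrib sum_distrib_left)
  have E: "(\<Sum>j\<in>{1..<r}. ee m j (X $$ (0, j)) (bb c Q * u))
     = bb c Q * (\<Sum>j\<in>{1..<r}. ee m j (X $$ (0, j)) u) + qq m (X $$ (0, c) * Q) u
       - (\<Sum>j\<in>{1..<r}. DD c j (Q * X $$ (0, j)) u)"
    using cin by (simp add: ee_bb sum.distrib sum_subtractf sum_distrib_left mult.commute[of _ Q])
  have F: "(\<Sum>j\<in>{1..<r}. bb j (X $$ (j, 0)) * (bb c Q * u)) = bb c Q * (\<Sum>j\<in>{1..<r}. bb j (X $$ (j, 0)) * u)"
    by (simp add: sum_distrib_left mult.left_commute)
  show ?thesis
    unfolding act_sym_def B0 1 2 3 D E F
    by (simp add: qq_bb distrib_left mult.commute[of _ Q])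
qed

lemma polys_add: "P \<in> polys \<Longrightarrow> Q \<in> polys \<Longrightarrow> P + Q \<in> polys"
  using Poly_Mapping.keys_add[of P Q] by (auto simp: polys_def)

lemma polys_mult: "P \<in> polys \<Longrightarrow> Q \<in> polys \<Longrightarrow> P * Q \<in> polys"
  using keys_mult[of P Q] by (fastforce simp: polys_def)

lemma polys_zero [simp]: "0 \<in> polys"
  by (simp add: polys_def)

lemma polys_one [simp]: "1 \<in> polys"
  by (simp add: polys_def)

lemma polys_single: "0 \<le> fst k \<Longrightarrow> Poly_Mapping.single k c \<in> polys"
  by (simp add: polys_def)

lemma polys_const [simp]: "const c \<in> polys"
  by (simp add: const_def polys_single)

lemma polys_scal: "P \<in> polys \<Longrightarrow> scal c P \<in> polys"
  by (simp add: polys_mult flip: const_mult_eq_scal)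

lemma polys_uminus: "P \<in> polys \<Longrightarrow> - P \<in> polys"
  by (simp add: polys_def)

lemma polys_diff: "P \<in> polys \<Longrightarrow> Q \<in> polys \<Longrightarrow> P - Q \<in> polys"
  using polys_add[of P "- Q"] by (simp add: polys_uminus)

lemma polys_sum: "(\<And>a. a \<in> A \<Longrightarrow> f a \<in> polys) \<Longrightarrow> sum f A \<in> polys"
  by (induction A rule: infinite_finite_induct) (simp_all add: polys_add)

lemma polys_xpow: "0 \<le> k \<Longrightarrow> xpow k \<in> polys"
  by (simp add: xpow_def polys_single)

definition gl_poly :: "nat \<Rightarrow> laurent mat set" where
  "gl_poly r = {X \<in> carrier_mat r r. \<forall>i<r. \<forall>j<r. X $$ (i, j) \<in> polys}"

lemma gl_polyD: "X \<in> gl_poly r \<Longrightarrow> X \<in> carrier_mat r r"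
  "X \<in> gl_poly r \<Longrightarrow> i < r \<Longrightarrow> j < r \<Longrightarrow> X $$ (i, j) \<in> polys"
  by (auto simp: gl_poly_def)

lemma Emat_gl_poly: "P \<in> polys \<Longrightarrow> Emat r i j P \<in> gl_poly r"
  by (simp add: gl_poly_def)

lemma gl_poly_bracket: "X \<in> gl_poly r \<Longrightarrow> Y \<in> gl_poly r \<Longrightarrow> mat_bracket X Y \<in> gl_poly r"
  by (auto simp: gl_poly_def mat_bracket_index intro!: polys_diff polys_sum polys_mult)

inductive_set S0 :: "nat \<Rightarrow> sym set" for r :: nat where
  one: "1 \<in> S0 r"
| add: "u \<in> S0 r \<Longrightarrow> v \<in> S0 r \<Longrightarrow> u + v \<in> S0 r"
| scal: "u \<in> S0 r \<Longrightarrow> scal c u \<in> S0 r"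
| bb: "1 \<le> c \<Longrightarrow> c < r \<Longrightarrow> Q \<in> polys \<Longrightarrow> u \<in> S0 r \<Longrightarrow> bb c Q * u \<in> S0 r"

lemma S0_zero: "0 \<in> S0 r"
  using S0.scal[OF S0.one, of 0] by simp

lemma S0_uminus: "u \<in> S0 r \<Longrightarrow> - u \<in> S0 r"
  using S0.scal[of u r "-1"] by (simp add: scal_minus_left)

lemma S0_diff: "u \<in> S0 r \<Longrightarrow> v \<in> S0 r \<Longrightarrow> u - v \<in> S0 r"
  using S0.add[of u r "- v"] by (simp add: S0_uminus)

lemma S0_sum: "(\<And>a. a \<in> A \<Longrightarrow> f a \<in> S0 r) \<Longrightarrow> sum f A \<in> S0 r"
  by (induction A rule: infinite_finite_induct) (simp_all add: S0_zero S0.add)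

lemma act_sym_one:
  "act_sym r m X 1 = (\<Sum>j\<in>{1..<r}. bb j (X $$ (j, 0))) + scal (of_nat m * Poly_Mapping.lookup (X $$ (0, 0)) 0) 1"
  by (simp add: act_sym_def)

lemma act_sym_S0:
  assumes "u \<in> S0 r" "X \<in> gl_poly r" "0 < r"
  shows "act_sym r m X u \<in> S0 r"
  using assms(1,2)
proof (induction arbitrary: X rule: S0.induct)
  case one
  have "bb j (X $$ (j, 0)) \<in> S0 r" if "j \<in> {1..<r}" for j
    using S0.bb[of j r "X $$ (j, 0)" 1] one that assms(3) by (simp add: S0.one gl_polyD)
  then show ?case
    unfolding act_sym_one by (intro S0.add S0.scal S0.one S0_sum)
next
  case (bb c Q u)
  then show ?case
    by (simp add: act_sym_bb gl_polyD S0.bb S0.add gl_poly_bracket Emat_gl_poly)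
qed (simp_all add: clin_add[OF clin_act_sym] clin_scal[OF clin_act_sym] S0.intros)

lemma act_sym_one_minus:
  assumes "0 < r" "X \<in> carrier_mat r r"
  shows "act_sym r m X (act_sym r m Y 1) =
    (\<Sum>j\<in>{1..<r}. bb j (Y $$ (j, 0)) * act_sym r m X 1 + act_sym r m (mat_bracket X (Emat r j 0 (Y $$ (j, 0)))) 1)
    + scal (of_nat m * Poly_Mapping.lookup (Y $$ (0, 0)) 0) (act_sym r m X 1)"
proof -
  have "act_sym r m X (bb j (Y $$ (j, 0))) = bb j (Y $$ (j, 0)) * act_sym r m X 1 + act_sym r m (mat_bracket X (Emat r j 0 (Y $$ (j, 0)))) 1"
    if "j \<in> {1..<r}" for j
    using act_sym_bb[of X r j m "Y $$ (j, 0)" 1] assms that by simp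
  then show ?thesis
    unfolding act_sym_one[of r m Y]
    by (simp add: clin_add[OF clin_act_sym] clin_scal[OF clin_act_sym] clin_sum[OF clin_act_sym])
qed

lemma sum_first:
  fixes r :: nat
  assumes "0 < r"
  shows "(\<Sum>k<r. f k) = f 0 + (\<Sum>k\<in>{1..<r}. f k :: 'a::comm_monoid_add)"
proof -
  have "{..<r} = insert 0 {1..<r}" using assms by auto
  then show ?thesis by simp
qed

lemma act_sym_bracket_one:
  assumes X: "X \<in> carrier_mat r r" and Y: "Y \<in> carrier_mat r r" and r: "0 < r"
  shows "act_sym r m (mat_bracket X Y) 1 = act_sym r m X (act_sym r m Y 1) - act_sym r m Y (act_sym r m X 1)"
proof -
  let ?l = "\<lambda>X. Poly_Mapping.lookup X 0"
  let ?b = "\<lambda>X. \<Sum>j\<in>{1..<r}. bb j (X $$ (j, 0))"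
  let ?s = "\<lambda>X. scal (of_nat m * ?l (X $$ (0, 0))) (1 :: sym)"
  have E: "act_sym r m (mat_bracket X (Emat r j 0 Q)) 1
      = (\<Sum>a\<in>{1..<r}. bb a (X $$ (a, j) * Q)) - bb j (Q * X $$ (0, 0)) + scal (of_nat m * ?l (X $$ (0, j) * Q)) 1"
    if "X \<in> carrier_mat r r" "j \<in> {1..<r}" for X j Q
    using act_sym_bb[OF that(1), of j m Q 1] that r
    by (simp add: act_sym_one mat_bracket_Emat_index bb_diff sum_subtractf if_distrib[of "bb _"] cong: if_cong)
  have l0: "?l (\<Sum>k\<in>A. f k) = (\<Sum>k\<in>A. ?l (f k))" for f :: "nat \<Rightarrow> laurent" and A
    by (simp add: lookup_sum)
  have lhs: "act_sym r m (mat_bracket X Y) 1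
    = (\<Sum>a\<in>{1..<r}. bb a (X $$ (a, 0) * Y $$ (0, 0) - Y $$ (a, 0) * X $$ (0, 0)))
      + (\<Sum>a\<in>{1..<r}. \<Sum>j\<in>{1..<r}. bb a (X $$ (a, j) * Y $$ (j, 0)) - bb a (Y $$ (a, j) * X $$ (j, 0)))
      + (\<Sum>j\<in>{1..<r}. scal (of_nat m * ?l (X $$ (0, j) * Y $$ (j, 0))) 1 - scal (of_nat m * ?l (Y $$ (0, j) * X $$ (j, 0))) 1)"
    using X Y r
    by (simp add: act_sym_one mat_bracket_index sum_first bb_add bb_diff bb_sum sum.distrib sum_subtractf
       lookup_minus lookup_add l0 distrib_left right_diff_distrib scal_add_left scal.scale_left_diff_distrib
       sum_distrib_left scal.scale_sum_left algebra_simps)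
  have half: "act_sym r m X (act_sym r m Y 1) = ?b Y * ?b X + ?b Y * ?s X
      + (\<Sum>a\<in>{1..<r}. \<Sum>j\<in>{1..<r}. bb a (X $$ (a, j) * Y $$ (j, 0)))
      - (\<Sum>j\<in>{1..<r}. bb j (Y $$ (j, 0) * X $$ (0, 0)))
      + (\<Sum>j\<in>{1..<r}. scal (of_nat m * ?l (X $$ (0, j) * Y $$ (j, 0))) 1)
      + ?b X * ?s Y + ?s X * ?s Y" if "X \<in> carrier_mat r r" for X Y
  proof -
    have 1: "(\<Sum>j\<in>{1..<r}. bb j (Y $$ (j, 0)) * (?b X + ?s X)) = ?b Y * ?b X + ?b Y * ?s X"
      by (simp add: distrib_left distrib_right sum.distrib sum_distrib_right)
    have 2: "scal (of_nat m * ?l (Y $$ (0, 0))) (?b X + ?s X) = ?b X * ?s Y + ?s X * ?s Y"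
      by (simp add: scal_add_right scal_mult_left scal_mult_right scal_scal mult.commute)
    have "act_sym r m X (act_sym r m Y 1) = (\<Sum>j\<in>{1..<r}. bb j (Y $$ (j, 0)) * (?b X + ?s X))
      + (\<Sum>j\<in>{1..<r}. (\<Sum>a\<in>{1..<r}. bb a (X $$ (a, j) * Y $$ (j, 0)))
          - bb j (Y $$ (j, 0) * X $$ (0, 0)) + scal (of_nat m * ?l (X $$ (0, j) * Y $$ (j, 0))) 1)
      + scal (of_nat m * ?l (Y $$ (0, 0))) (?b X + ?s X)"
    proof -
      have "(\<Sum>j\<in>{1..<r}. act_sym r m (mat_bracket X (Emat r j 0 (Y $$ (j, 0)))) 1)
        = (\<Sum>j\<in>{1..<r}. (\<Sum>a\<in>{1..<r}. bb a (X $$ (a, j) * Y $$ (j, 0)))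
          - bb j (Y $$ (j, 0) * X $$ (0, 0)) + scal (of_nat m * ?l (X $$ (0, j) * Y $$ (j, 0))) 1)"
        by (rule sum.cong[OF refl], rule E[OF that])
      then show ?thesis
        unfolding act_sym_one_minus[OF r that] sum.distrib act_sym_one[of r m X] by simp
    qed
    also have "\<dots> = ?b Y * ?b X + ?b Y * ?s X
      + (\<Sum>j\<in>{1..<r}. \<Sum>a\<in>{1..<r}. bb a (X $$ (a, j) * Y $$ (j, 0)))
      - (\<Sum>j\<in>{1..<r}. bb j (Y $$ (j, 0) * X $$ (0, 0)))
      + (\<Sum>j\<in>{1..<r}. scal (of_nat m * ?l (X $$ (0, j) * Y $$ (j, 0))) 1)
      + ?b X * ?s Y + ?s X * ?s Y"
      unfolding 1 2 by (simp add: sum.distrib sum_subtractf algebra_simps)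
    finally show ?thesis
      by (subst (asm) sum.swap)
  qed
  show ?thesis
    unfolding lhs half[OF X] half[OF Y]
    by (simp add: sum.distrib sum_subtractf bb_diff algebra_simps)
qed

text \<open>
  Both sides satisfy the recursion \<open>act_sym_bb\<close> by the Jacobi identity for matrices, so it is enough to compare them at 1.
\<close>

lemma act_sym_bracket:
  assumes "u \<in> S0 r" "X \<in> gl_poly r" "Y \<in> gl_poly r" and r: "0 < r"
  shows "act_sym r m (mat_bracket X Y) u = act_sym r m X (act_sym r m Y u) - act_sym r m Y (act_sym r m X u)"
  using assms(1-3)
proof (induction arbitrary: X Y rule: S0.induct)
  case one
  then show ?case by (intro act_sym_bracket_one gl_polyD r)
next
  case (bb c Q u)
  let ?F = "Emat r c 0 Q"
  have F: "?F \<in> gl_poly r" using bb by (simp add: Emat_gl_poly)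
  note c [simp] = gl_polyD(1)[OF bb.prems(1)] gl_polyD(1)[OF bb.prems(2)] gl_polyD(1)[OF F]
  have "mat_bracket (mat_bracket X Y) ?F = mat_bracket (mat_bracket X ?F) Y + mat_bracket X (mat_bracket Y ?F)"
    by (rule mat_bracket_jacobi[where r = r]) simp_all
  then have "act_sym r m (mat_bracket (mat_bracket X Y) ?F) u
    = act_sym r m (mat_bracket (mat_bracket X ?F) Y) u + act_sym r m (mat_bracket X (mat_bracket Y ?F)) u"
    using r by (simp add: act_sym_add)
  moreover have "act_sym r m (mat_bracket (mat_bracket X ?F) Y) u
      = act_sym r m (mat_bracket X ?F) (act_sym r m Y u) - act_sym r m Y (act_sym r m (mat_bracket X ?F) u)"
    by (intro bb.IH gl_poly_bracket bb.prems F)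
  moreover have "act_sym r m (mat_bracket X (mat_bracket Y ?F)) u
      = act_sym r m X (act_sym r m (mat_bracket Y ?F) u) - act_sym r m (mat_bracket Y ?F) (act_sym r m X u)"
    by (intro bb.IH gl_poly_bracket bb.prems F)
  moreover have "act_sym r m (mat_bracket X Y) u = act_sym r m X (act_sym r m Y u) - act_sym r m Y (act_sym r m X u)"
    by (intro bb.IH bb.prems)
  ultimately show ?case
    using bb.hyps
    by (simp add: act_sym_bb clin_add[OF clin_act_sym] right_diff_distrib distrib_left)
qed (simp_all add: clin_add[OF clin_act_sym] clin_scal[OF clin_act_sym] scal_diff_right)

lemma act_sym_Emat_col:
  assumes "1 \<le> i" "i < r"
  shows "act_sym r m (Emat r i 0 P) u = bb i P * u"
proof -
  have "(\<Sum>k\<in>{1..<r}. bb k (Emat r i 0 P $$ (k, 0)) * u) = (\<Sum>k\<in>{1..<r}. if k = i then bb i P * u else 0)"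
    using assms by (intro sum.cong) auto
  then show ?thesis
    using assms by (simp add: act_sym_def clin_zero[OF clin_qq_param] clin_zero[OF clin_DD_param] clin_zero[OF clin_ee_param])
qed

lemma act_sym_Emat_00:
  assumes "0 < r"
  shows "act_sym r m (Emat r 0 0 P) u = qq m P u"
  using assms by (simp add: act_sym_def clin_zero[OF clin_DD_param] clin_zero[OF clin_ee_param])

lemma act_sym_Emat_block:
  assumes "1 \<le> i" "i < r" "1 \<le> j" "j < r"
  shows "act_sym r m (Emat r i j P) u = DD i j P u"
proof -
  have "(\<Sum>b\<in>{1..<r}. DD a b (Emat r i j P $$ (a, b)) u) = (if a = i then DD i j P u else 0)"
    if "a \<in> {1..<r}" for a
  proof -
    have "(\<Sum>b\<in>{1..<r}. DD a b (Emat r i j P $$ (a, b)) u)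
      = (\<Sum>b\<in>{1..<r}. if b = j then (if a = i then DD i j P u else 0) else 0)"
      using that by (intro sum.cong) (auto simp: clin_zero[OF clin_DD_param])
    then show ?thesis using assms by simp
  qed
  then show ?thesis
    using assms by (simp add: act_sym_def clin_zero[OF clin_qq_param] clin_zero[OF clin_ee_param])
qed

lemma act_sym_Emat_row:
  assumes "1 \<le> j" "j < r"
  shows "act_sym r m (Emat r 0 j P) u = ee m j P u"
proof -
  have "(\<Sum>k\<in>{1..<r}. ee m k (Emat r 0 j P $$ (0, k)) u) = (\<Sum>k\<in>{1..<r}. if k = j then ee m j P u else 0)"
    using assms by (intro sum.cong) (auto simp: clin_zero[OF clin_ee_param])
  then show ?thesis
    using assms by (simp add: act_sym_def clin_zero[OF clin_qq_param] clin_zero[OF clin_DD_param])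
qed

section \<open>The submodule generated by products of more than m generators\<close>

definition valid :: "nat \<Rightarrow> (nat \<times> laurent) list \<Rightarrow> bool" where
  "valid r qs \<longleftrightarrow> (\<forall>(c, Q)\<in>set qs. 1 \<le> c \<and> c < r \<and> Q \<in> polys)"

definition bprod :: "(nat \<times> laurent) list \<Rightarrow> sym" where
  "bprod qs = prod_list (map (\<lambda>(c, Q). bb c Q) qs)"

lemma valid_simps [simp]: "valid r []" 
  "valid r ((c, Q) # qs) \<longleftrightarrow> 1 \<le> c \<and> c < r \<and> Q \<in> polys \<and> valid r qs"
  "valid r (qs @ qs') \<longleftrightarrow> valid r qs \<and> valid r qs'"
  by (auto simp: valid_def)

lemma bprod_simps [simp]: "bprod [] = 1" "bprod ((c, Q) # qs) = bb c Q * bprod qs"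
  "bprod (qs @ qs') = bprod qs * bprod qs'"
  by (auto simp: bprod_def)

lemma bprod_S0: "valid r qs \<Longrightarrow> bprod qs \<in> S0 r"
  by (induction qs) (auto simp: S0.one S0.bb)

text \<open>
  Closure under the raising operators and under linear combinations is all that is required; that the result is closed under
  the whole Lie algebra is \<open>Gsub_act\<close>.
\<close>

inductive_set Gsub :: "nat \<Rightarrow> nat \<Rightarrow> sym set" for r m :: nat where
  gen: "valid r qs \<Longrightarrow> m < length qs \<Longrightarrow> bprod qs \<in> Gsub r m"
| add: "u \<in> Gsub r m \<Longrightarrow> v \<in> Gsub r m \<Longrightarrow> u + v \<in> Gsub r m"
| scal: "u \<in> Gsub r m \<Longrightarrow> scal c u \<in> Gsub r m"
| ee: "u \<in> Gsub r m \<Longrightarrow> 1 \<le> j \<Longrightarrow> j < r \<Longrightarrow> R \<in> polys \<Longrightarrow> ee m j R u \<in> Gsub r m"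

lemma Gsub_S0: "u \<in> Gsub r m \<Longrightarrow> u \<in> S0 r"
proof (induction rule: Gsub.induct)
  case (ee u j R)
  then show ?case
    using act_sym_S0[of u r "Emat r 0 j R" m] by (simp add: act_sym_Emat_row Emat_gl_poly)
qed (simp_all add: bprod_S0 S0.intros)

lemma Gsub_zero:
  assumes "2 \<le> r" shows "0 \<in> Gsub r m"
proof -
  have "bprod (replicate (Suc m) (1, 1)) \<in> Gsub r m"
    using assms by (intro Gsub.gen) (auto simp: valid_def)
  from Gsub.scal[OF this, of 0] show ?thesis by simp
qed

lemma Gsub_uminus: "u \<in> Gsub r m \<Longrightarrow> - u \<in> Gsub r m"
  using Gsub.scal[of u r m "-1"] by (simp add: scal_minus_left)

lemma Gsub_diff: "u \<in> Gsub r m \<Longrightarrow> v \<in> Gsub r m \<Longrightarrow> u - v \<in> Gsub r m"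
  using Gsub.add[of u r m "- v"] by (simp add: Gsub_uminus)

lemma Gsub_sum: "2 \<le> r \<Longrightarrow> (\<And>a. a \<in> A \<Longrightarrow> f a \<in> Gsub r m) \<Longrightarrow> sum f A \<in> Gsub r m"
  by (induction A rule: infinite_finite_induct) (simp_all add: Gsub_zero Gsub.add)

lemma act_sym_parts:
  assumes "0 < r"
  shows "act_sym r m X u = (\<Sum>j\<in>{1..<r}. bb j (X $$ (j, 0)) * u) + act_sym r m (Emat r 0 0 (X $$ (0, 0))) u
     + (\<Sum>i\<in>{1..<r}. \<Sum>j\<in>{1..<r}. act_sym r m (Emat r i j (X $$ (i, j))) u)
     + (\<Sum>j\<in>{1..<r}. ee m j (X $$ (0, j)) u)"
  unfolding act_sym_def[of r m X] using assms by (simp add: act_sym_Emat_00 act_sym_Emat_block)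

text \<open>
  Matrices that are block-diagonal for the decomposition \<open>1 + (r - 1)\<close> of \<open>r\<close>. They act without changing the number of factors of a
  product of generators, and commutators with raising operators are again raising operators.
\<close>

definition blockd :: "nat \<Rightarrow> laurent mat \<Rightarrow> bool" where
  "blockd r X \<longleftrightarrow> X \<in> gl_poly r \<and> (\<forall>a\<in>{1..<r}. X $$ (a, 0) = 0 \<and> X $$ (0, a) = 0)"

lemma act_sym_block_bprod:
  assumes "blockd r X" "valid r qs" "0 < r"
  shows "act_sym r m X (bprod qs) \<in> scal.span {bprod qs' |qs'. valid r qs' \<and> length qs' = length qs}"
  using assms(2)
proof (induction qs)
  case Nil
  have "(1 :: sym) \<in> {bprod qs' |qs'. valid r qs' \<and> length qs' = length []}"
    by (auto intro!: exI[of _ "[]"])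
  then show ?case
    using assms(1) by (simp add: act_sym_one blockd_def scal.span_base scal.span_scale)
next
  case (Cons cQ qs)
  obtain c Q where cQ: "cQ = (c, Q)" by fastforce
  with Cons.prems have c: "1 \<le> c" "c < r" "Q \<in> polys" "valid r qs" by auto
  have X: "X \<in> carrier_mat r r" "\<And>i j. i < r \<Longrightarrow> j < r \<Longrightarrow> X $$ (i, j) \<in> polys"
    using assms(1) by (auto simp: blockd_def gl_poly_def)
  let ?S = "\<lambda>k. {bprod qs' |qs'. valid r qs' \<and> length qs' = k}"
  have mul: "bb d P * u \<in> scal.span (?S (Suc k))" if "u \<in> scal.span (?S k)" "1 \<le> d" "d < r" "P \<in> polys" for d P u k
    using that(1)
  proof (induction rule: scal.span_induct_alt)
    case base
    then show ?case by (simp add: scal.span_zero)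
  next
    case (step a x y)
    then obtain qs' where "x = bprod qs'" "valid r qs'" "length qs' = k" by auto
    then have "bb d P * x \<in> ?S (Suc k)"
      using that by (auto intro!: exI[of _ "(d, P) # qs'"])
    then show ?case
      using step by (simp add: distrib_left scal_mult_right scal.span_add scal.span_scale scal.span_base)
  qed
  have "act_sym r m (mat_bracket X (Emat r c 0 Q)) (bprod qs)
      = (\<Sum>a\<in>{1..<r}. bb a (X $$ (a, c) * Q - (if a = c then Q * X $$ (0, 0) else 0)) * bprod qs)"
    using X c assms(1)
    by (simp add: act_sym_def mat_bracket_Emat_index blockd_def clin_zero[OF clin_DD_param]
       clin_zero[OF clin_qq_param] clin_zero[OF clin_ee_param] if_distrib cong: if_cong)
  moreover have "\<dots> \<in> scal.span (?S (Suc (length qs)))"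
    using X c
    by (intro scal.span_sum mul scal.span_base) (auto intro!: polys_diff polys_mult)
  ultimately show ?case
    using Cons.IH[OF c(4)] c X mul[of "act_sym r m X (bprod qs)"] unfolding cQ
    by (simp add: act_sym_bb scal.span_add)
qed

lemma Gsub_span:
  assumes "2 \<le> r" "u \<in> scal.span {bprod qs' |qs'. valid r qs' \<and> length qs' = k}" "m < k"
  shows "u \<in> Gsub r m"
  using assms(2)
proof (induction rule: scal.span_induct_alt)
  case base
  then show ?case by (rule Gsub_zero[OF assms(1)])
next
  case (step c x y)
  then have "x \<in> Gsub r m" using assms(3) by (auto intro: Gsub.gen)
  then show ?case using step by (intro Gsub.add Gsub.scal)
qed

lemma Gsub_block:
  assumes "u \<in> Gsub r m" "blockd r X" and r: "2 \<le> r"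
  shows "act_sym r m X u \<in> Gsub r m"
  using assms(1)
proof (induction rule: Gsub.induct)
  case (gen qs)
  then show ?case
    using act_sym_block_bprod[OF assms(2) gen(1)] r by (intro Gsub_span[of r _ "length qs"]) auto
next
  case (ee u j R)
  let ?E = "Emat r 0 j R"
  have X: "X \<in> gl_poly r" "X \<in> carrier_mat r r" using assms(2) by (auto simp: blockd_def gl_poly_def)
  have E: "?E \<in> gl_poly r" using ee by (simp add: Emat_gl_poly)
  have "act_sym r m (mat_bracket X ?E) u = (\<Sum>b\<in>{1..<r}. ee m b ((if b = j then X $$ (0, 0) * R else 0) - R * X $$ (j, b)) u)"
    using X ee assms(2) by (simp add: act_sym_def mat_bracket_Emat_index blockd_def clin_zero[OF clin_DD_param]
       clin_zero[OF clin_qq_param] cong: if_cong)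
  also have "\<dots> \<in> Gsub r m"
    using X ee r by (intro Gsub_sum Gsub.ee) (auto intro!: polys_diff polys_uminus polys_mult gl_polyD(2)[OF X(1)])
  finally have 1: "act_sym r m (mat_bracket X ?E) u \<in> Gsub r m" .
  have "act_sym r m X (ee m j R u) = act_sym r m (mat_bracket X ?E) u + ee m j R (act_sym r m X u)"
    using act_sym_bracket[OF Gsub_S0[OF ee.hyps(1)] X(1) E, of m] r ee.hyps by (simp add: act_sym_Emat_row)
  then show ?case using 1 ee by (simp add: Gsub.add Gsub.ee)
qed (simp_all add: clin_add[OF clin_act_sym] clin_scal[OF clin_act_sym] Gsub.add Gsub.scal)

text \<open>
  The commutator of a raising operator and a multiplication by a generator is block-diagonal, hence harmless by \<open>Gsub_block\<close>.
\<close>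

lemma Gsub_bb:
  assumes "u \<in> Gsub r m" "1 \<le> c" "c < r" "Q \<in> polys" and r: "2 \<le> r"
  shows "bb c Q * u \<in> Gsub r m"
  using assms(1-4)
proof (induction rule: Gsub.induct)
  case (gen qs)
  then show ?case using Gsub.gen[of r "(c, Q) # qs" m] by simp
next
  case (add u v)
  then show ?case by (simp add: distrib_left Gsub.add)
next
  case (scal u a)
  then show ?case by (simp add: scal_mult_right Gsub.scal)
next
  case (ee u j R)
  let ?E = "Emat r 0 j R" and ?F = "Emat r c 0 Q"
  have E: "?E \<in> gl_poly r" and F: "?F \<in> gl_poly r" using ee by (simp_all add: Emat_gl_poly)
  have "blockd r (mat_bracket ?E ?F)"
    using ee gl_poly_bracket[OF E F] by (simp add: blockd_def mat_bracket_Emat_index)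
  then have "act_sym r m (mat_bracket ?E ?F) u \<in> Gsub r m"
    using Gsub_block ee r by blast
  moreover have "bb c Q * ee m j R u = ee m j R (bb c Q * u) - act_sym r m (mat_bracket ?E ?F) u"
    using act_sym_bb[of ?E r c m Q u] ee by (simp add: act_sym_Emat_row)
  ultimately show ?case using ee by (simp add: Gsub_diff Gsub.ee)
qed

lemma Gsub_act:
  assumes u: "u \<in> Gsub r m" and X: "X \<in> gl_poly r" and r: "2 \<le> r"
  shows "act_sym r m X u \<in> Gsub r m"
proof -
  have b: "blockd r (Emat r i j P)" if "P \<in> polys" "(i = 0 \<and> j = 0) \<or> (1 \<le> i \<and> 1 \<le> j)" for i j P
    using that by (auto simp: blockd_def Emat_gl_poly)
  show ?thesis
    using r gl_polyD[OF X] u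
    by (subst act_sym_parts) (auto intro!: Gsub.add Gsub_sum Gsub_bb Gsub.ee Gsub_block b)
qed

lemma Gsub_ideal:
  assumes "u \<in> S0 r" "v \<in> Gsub r m" "2 \<le> r"
  shows "u * v \<in> Gsub r m"
  using assms(1)
  by (induction rule: S0.induct)
    (simp_all add: assms distrib_right scal_mult_left Gsub.add Gsub.scal Gsub_bb mult.assoc)

section \<open>Iterated contractions\<close>

text \<open>
  \<open>eps q [R\<^sub>1, \<dots>, R\<^sub>d]\<close> is the operator obtained from the product of the \<open>q(R\<^sub>i)\<close> by subtracting the terms in which
  several \<open>R\<^sub>i\<close> are merged: a product in which no generator is hit twice. It arises because raising operators applied
  to products of generators produce exactly these combinations (\<open>ee_eps\<close>).
\<close>

function eps :: "(laurent \<Rightarrow> 'a \<Rightarrow> 'a::ab_group_add) \<Rightarrow> laurent list \<Rightarrow> 'a \<Rightarrow> 'a" where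
  "eps q [] u = u"
| "eps q (S # Rs) u = q S (eps q Rs u) - (\<Sum>i<length Rs. eps q (Rs[i := Rs ! i * S]) u)"
  by pat_completeness auto
termination
  by (relation "measure (\<lambda>(q, Rs, u). length Rs)") auto

declare eps.simps [simp del]
lemmas eps_Nil [simp] = eps.simps(1) and eps_Cons = eps.simps(2)

lemma eps_induct [case_names Nil Cons]:
  assumes "P []" "\<And>S Rs. P Rs \<Longrightarrow> (\<And>i. i < length Rs \<Longrightarrow> P (Rs[i := Rs ! i * S])) \<Longrightarrow> P (S # Rs)"
  shows "P Rs"
proof (induction "length Rs" arbitrary: Rs)
  case 0
  then show ?case using assms(1) by simp
next
  case (Suc n)
  then obtain S Rs' where "Rs = S # Rs'" by (cases Rs) auto
  then show ?case using Suc assms(2) by simp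
qed

definition remv :: "nat \<Rightarrow> 'a list \<Rightarrow> 'a list" where
  "remv l qs = take l qs @ drop (Suc l) qs"

lemma remv_simps [simp]: "remv 0 (q # qs) = qs" "remv (Suc l) (q # qs) = q # remv l qs"
  by (simp_all add: remv_def)

lemma length_remv: "l < length qs \<Longrightarrow> length (remv l qs) = length qs - 1"
  by (simp add: remv_def)

lemma valid_remv: "valid r qs \<Longrightarrow> valid r (remv l qs)"
  by (auto simp: remv_def valid_def dest: in_set_takeD in_set_dropD)

lemma valid_nth: "valid r qs \<Longrightarrow> l < length qs \<Longrightarrow> 1 \<le> fst (qs ! l) \<and> fst (qs ! l) < r \<and> snd (qs ! l) \<in> polys"
  by (auto simp: valid_def dest!: nth_mem)

lemma DD_bprod:
  "DD i j P (bprod qs) = (\<Sum>l<length qs. if fst (qs ! l) = j then bb i (P * snd (qs ! l)) * bprod (remv l qs) else 0)"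
proof (induction qs)
  case (Cons cQ qs)
  obtain c Q where cQ: "cQ = (c, Q)" by fastforce
  have "bb c Q * DD i j P (bprod qs) = (\<Sum>l<length qs. if fst (qs ! l) = j then bb i (P * snd (qs ! l)) * (bb c Q * bprod (remv l qs)) else 0)"
    unfolding Cons sum_distrib_left by (intro sum.cong) (auto simp: mult.left_commute)
  then show ?case unfolding cQ by (simp add: DD_bb sum.lessThan_Suc_shift del: sum.lessThan_Suc cong: if_cong)
qed simp

lemma ee_bprod:
  "ee m j R (bprod qs) = (\<Sum>l<length qs. if fst (qs ! l) = j then qq m (R * snd (qs ! l)) (bprod (remv l qs)) else 0)"
proof (induction qs)
  case (Cons cQ qs)
  obtain c Q where cQ: "cQ = (c, Q)" by fastforce
  have *: "bb c Q * ee m j R (bprod qs) - DD c j (R * Q) (bprod qs)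
      = (\<Sum>l<length qs. if fst (qs ! l) = j then qq m (R * snd (qs ! l)) (bb c Q * bprod (remv l qs)) else 0)"
    unfolding Cons DD_bprod sum_distrib_left sum_subtractf[symmetric]
    by (intro sum.cong) (auto simp: qq_bb ac_simps)
  have "ee m j R (bb c Q * bprod qs) = (if c = j then qq m (R * Q) (bprod qs) else 0)
      + (bb c Q * ee m j R (bprod qs) - DD c j (R * Q) (bprod qs))"
    by (simp add: ee_bb)
  then show ?case unfolding cQ * by (simp add: sum.lessThan_Suc_shift del: sum.lessThan_Suc cong: if_cong)
qed simp

lemma qq_S0: "u \<in> S0 r \<Longrightarrow> S \<in> polys \<Longrightarrow> 0 < r \<Longrightarrow> qq m S u \<in> S0 r"
  using act_sym_S0[of u r "Emat r 0 0 S" m] by (simp add: act_sym_Emat_00 Emat_gl_poly)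

lemma update_mult_subset:
  assumes "set Rs \<subseteq> A" "i < length Rs" "\<And>P. P \<in> A \<Longrightarrow> P * S \<in> A"
  shows "set (Rs[i := Rs ! i * S]) \<subseteq> A"
proof -
  have "Rs ! i * S \<in> A" using assms nth_mem[of i Rs] by blast
  then show ?thesis using set_update_subset_insert[of Rs i "Rs ! i * S"] assms(1) by blast
qed

lemma polys_update: "set Rs \<subseteq> polys \<Longrightarrow> S \<in> polys \<Longrightarrow> i < length Rs \<Longrightarrow> set (Rs[i := Rs ! i * S]) \<subseteq> polys"
  by (rule update_mult_subset) (auto intro: polys_mult)

lemma eps_S0: "set Rs \<subseteq> polys \<Longrightarrow> u \<in> S0 r \<Longrightarrow> 0 < r \<Longrightarrow> eps (qq m) Rs u \<in> S0 r"
  by (induction Rs rule: eps_induct) (auto simp: eps_Cons polys_update intro!: S0_diff qq_S0 S0_sum)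

lemma ee_qq:
  assumes "u \<in> S0 r" "1 \<le> j" "j < r" "R \<in> polys" "S \<in> polys"
  shows "ee m j R (qq m S u) = qq m S (ee m j R u) - ee m j (R * S) u"
proof -
  have "mat_bracket (Emat r 0 j R) (Emat r 0 0 S) = Emat r 0 j (- (R * S))"
  proof (rule eq_matI)
    have B: "mat_bracket (Emat r 0 j R) (Emat r 0 0 S) \<in> carrier_mat r r" by simp
    show "dim_row (mat_bracket (Emat r 0 j R) (Emat r 0 0 S)) = dim_row (Emat r 0 j (- (R * S)))"
      "dim_col (mat_bracket (Emat r 0 j R) (Emat r 0 0 S)) = dim_col (Emat r 0 j (- (R * S)))"
      using carrier_matD[OF B] by simp_all
  qed (use assms in \<open>auto simp: mat_bracket_Emat_index mult.commute\<close>)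
  then show ?thesis
    using act_sym_bracket[OF assms(1) Emat_gl_poly[OF assms(4), of r 0 j] Emat_gl_poly[OF assms(5), of r 0 0], of m] assms
    by (simp add: act_sym_Emat_00 act_sym_Emat_row clin_minus[OF clin_ee_param] algebra_simps)
qed

text \<open>
  A raising operator removes one generator and appends its argument to the list of contractions. This is the rule by which
  \<open>Gsub\<close> is computed.
\<close>

lemma ee_eps:
  assumes "set Rs \<subseteq> polys" "valid r qs" "1 \<le> j" "j < r" "R \<in> polys"
  shows "ee m j R (eps (qq m) Rs (bprod qs))
    = (\<Sum>l<length qs. if fst (qs ! l) = j then eps (qq m) (Rs @ [R * snd (qs ! l)]) (bprod (remv l qs)) else 0)"
  using assms(1,5)
proof (induction Rs arbitrary: R rule: eps_induct)
  case Nil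
  then show ?case by (simp add: ee_bprod eps_Cons cong: if_cong)
next
  case (Cons S Rs)
  have "ee m j R (eps (qq m) (S # Rs) (bprod qs)) = qq m S (ee m j R (eps (qq m) Rs (bprod qs)))
     - ee m j (R * S) (eps (qq m) Rs (bprod qs)) - (\<Sum>i<length Rs. ee m j R (eps (qq m) (Rs[i := Rs ! i * S]) (bprod qs)))"
    using Cons.prems assms
    by (simp add: eps_Cons clin_diff[OF clin_ee] clin_sum[OF clin_ee] ee_qq[of _ r] eps_S0 bprod_S0)
  also have "\<dots> = (\<Sum>l<length qs. if fst (qs ! l) = j then
       qq m S (eps (qq m) (Rs @ [R * snd (qs ! l)]) (bprod (remv l qs)))
       - eps (qq m) (Rs @ [R * S * snd (qs ! l)]) (bprod (remv l qs))
       - (\<Sum>i<length Rs. eps (qq m) (Rs[i := Rs ! i * S] @ [R * snd (qs ! l)]) (bprod (remv l qs))) else 0)"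
    using Cons.prems
    apply (simp add: Cons.IH(1) Cons.IH(2) polys_mult polys_update clin_sum[OF clin_qq] if_distrib[of "qq m S"] clin_zero[OF clin_qq]
       cong: if_cong)
    apply (subst sum.swap)
    apply (simp add: sum_subtractf[symmetric])
    apply (intro sum.cong refl)
    apply auto
    done
  also have "\<dots> = (\<Sum>l<length qs. if fst (qs ! l) = j then eps (qq m) ((S # Rs) @ [R * snd (qs ! l)]) (bprod (remv l qs)) else 0)"
    by (intro sum.cong) (auto simp: eps_Cons nth_append list_update_append ac_simps)
  finally show ?case .
qed

text \<open>
  The maximal ideal of the origin, where the weight term of \<open>qq\<close> vanishes.
\<close>

definition maxid :: "laurent set" where
  "maxid = {P \<in> polys. Poly_Mapping.lookup P 0 = 0}"

lemma maxid_polys: "P \<in> maxid \<Longrightarrow> P \<in> polys"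
  by (simp add: maxid_def)

lemma maxid_mult: "P \<in> maxid \<Longrightarrow> Q \<in> polys \<Longrightarrow> P * Q \<in> maxid"
proof -
  assume P: "P \<in> maxid" and Q: "Q \<in> polys"
  have "(0, 0) \<notin> Poly_Mapping.keys (P * Q)"
  proof
    assume "(0, 0) \<in> Poly_Mapping.keys (P * Q)"
    then obtain a b where ab: "a \<in> Poly_Mapping.keys P" "b \<in> Poly_Mapping.keys Q" "(0, 0) = a + b"
      using keys_mult[of P Q] by blast
    then have "0 \<le> fst a" "0 \<le> fst b" "fst a + fst b = 0" "snd a + snd b = 0"
      using P Q by (auto simp: maxid_def polys_def prod_eq_iff)
    then have "a = 0" by (simp add: prod_eq_iff)
    then show False using ab(1) P by (auto simp: maxid_def in_keys_iff)
  qed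
  then show ?thesis
    using P Q by (simp add: maxid_def polys_mult in_keys_iff zero_prod_def)
qed

lemma maxid_single: "0 \<le> fst k \<Longrightarrow> k \<noteq> 0 \<Longrightarrow> mono1 k \<in> maxid"
  by (simp add: maxid_def polys_single lookup_single when_def)

lemma lookup_mult_zero:
  assumes "P \<in> polys" "Q \<in> polys"
  shows "Poly_Mapping.lookup (P * Q) 0 = Poly_Mapping.lookup P 0 * Poly_Mapping.lookup Q 0"
proof -
  let ?c = "Poly_Mapping.lookup P 0"
  have "P - const ?c \<in> maxid"
    using assms polys_diff[OF assms(1) polys_const] by (simp add: maxid_def lookup_minus const_def)
  then have "(P - const ?c) * Q \<in> maxid" using assms by (intro maxid_mult)
  then have "Poly_Mapping.lookup (P * Q) 0 = Poly_Mapping.lookup (const ?c * Q) 0"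
    by (simp add: maxid_def left_diff_distrib lookup_minus)
  then show ?thesis by (simp add: lookup_const_mult)
qed

lemma remv_replicate_append:
  "l < n \<Longrightarrow> remv l (replicate n x @ ts) = replicate (n - 1) x @ ts"
  "n \<le> l \<Longrightarrow> remv l (replicate n x @ ts) = replicate n x @ remv (l - n) ts"
proof -
  show "l < n \<Longrightarrow> remv l (replicate n x @ ts) = replicate (n - 1) x @ ts"
    by (simp add: remv_def min_def flip: replicate_add append_assoc)
  show "n \<le> l \<Longrightarrow> remv l (replicate n x @ ts) = replicate n x @ remv (l - n) ts"
    by (simp add: remv_def Suc_diff_le)
qed

lemma sum_split_at:
  fixes n k :: nat
  shows "(\<Sum>l<n + k. f l) = (\<Sum>l<n. f l) + (\<Sum>l<k. f (n + l) :: 'a::comm_monoid_add)"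
  by (induction k) (simp_all add: add.assoc)

text \<open>
  A contraction counts as much as a generator. By \<open>ee_eps\<close> for the colour 1, removing one of \<open>s + 1\<close> factors \<open>b_1(1)\<close>
  from a product with one contraction less gives \<open>s + 1\<close> times the wanted element, plus terms in which one of
  the other factors is removed. The inner induction is on the number of these other factors.
\<close>

lemma eps_in_Gsub:
  assumes r: "2 \<le> r" and "set Rs \<subseteq> maxid" "valid r qs" "m < length Rs + length qs"
  shows "eps (qq m) Rs (bprod qs) \<in> Gsub r m"
  using assms(2-)
proof (induction Rs arbitrary: qs rule: rev_induct)
  case Nil
  then show ?case by (simp add: Gsub.gen)
next
  case (snoc R Rs)
  have inner: "eps (qq m) (Rs @ [R]) (bprod (replicate s (1, 1) @ ts)) \<in> Gsub r m"
    if "valid r ts" "R \<in> maxid" "m < Suc (length Rs) + s + length ts" for s ts R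
    using that
  proof (induction "length ts" arbitrary: s ts R rule: less_induct)
    case less
    let ?qs = "replicate (Suc s) (1, 1) @ ts"
    let ?g = "\<lambda>R s ts. eps (qq m) (Rs @ [R]) (bprod (replicate s (1, 1) @ ts))"
    have v: "valid r ?qs" using less.prems r by (auto simp: valid_def)
    have Rs: "set Rs \<subseteq> polys" using snoc.prems by (auto simp: maxid_polys)
    have R: "R \<in> polys" using less.prems by (simp add: maxid_polys)
    have "eps (qq m) Rs (bprod ?qs) \<in> Gsub r m"
      using snoc.prems less.prems v by (intro snoc.IH) auto
    then have "ee m 1 R (eps (qq m) Rs (bprod ?qs)) \<in> Gsub r m"
      using r R by (intro Gsub.ee) auto
    also have "ee m 1 R (eps (qq m) Rs (bprod ?qs))
      = (\<Sum>l<Suc s + length ts. if fst (?qs ! l) = 1 then eps (qq m) (Rs @ [R * snd (?qs ! l)]) (bprod (remv l ?qs)) else 0)"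
      using ee_eps[OF Rs v _ _ R, of 1] r by simp
    also have "\<dots> = (\<Sum>l<Suc s. ?g R s ts)
       + (\<Sum>l<length ts. if fst (ts ! l) = 1 then ?g (R * snd (ts ! l)) (Suc s) (remv l ts) else 0)"
      unfolding sum_split_at
      by (intro arg_cong2[where f = "(+)"] sum.cong)
        (auto simp: remv_replicate_append nth_append simp del: replicate.simps)
    finally have *: "(\<Sum>l<Suc s. ?g R s ts)
       + (\<Sum>l<length ts. if fst (ts ! l) = 1 then ?g (R * snd (ts ! l)) (Suc s) (remv l ts) else 0) \<in> Gsub r m" .
    have "?g (R * snd (ts ! l)) (Suc s) (remv l ts) \<in> Gsub r m" if l: "l < length ts" for l
      using less.prems l valid_nth[OF less.prems(1) l]
      by (intro less.hyps) (auto simp: length_remv valid_remv intro!: maxid_mult)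
    then have "(\<Sum>l<length ts. if fst (ts ! l) = 1 then ?g (R * snd (ts ! l)) (Suc s) (remv l ts) else 0) \<in> Gsub r m"
      using r by (intro Gsub_sum) (auto simp: Gsub_zero)
    from Gsub_diff[OF * this] have "(\<Sum>l<Suc s. ?g R s ts) \<in> Gsub r m" by simp
    moreover have "(\<Sum>l<Suc s. ?g R s ts) = scal (of_nat (Suc s)) (?g R s ts)"
      by (simp only: sum_constant card_lessThan scal_def single_of_nat)
    ultimately have "scal (inverse (of_nat (Suc s))) (scal (of_nat (Suc s)) (?g R s ts)) \<in> Gsub r m"
      by (simp only: Gsub.scal)
    then show ?case by (simp add: scal_scal del: of_nat_Suc)
  qed
  show ?case
    using inner[of qs R 0] snoc.prems by simp
qed

lemma qq_maxid_bb: "S \<in> maxid \<Longrightarrow> qq m S (bb j Q) = - bb j (S * Q)"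
  using qq_bb[of m S j Q 1] by (simp add: maxid_def)

text \<open>
  On a single generator every merging has the same effect, so the contractions add up to a multiple of \<open>b_j(R\<^sub>1 \<cdots> R\<^sub>d Q)\<close>;
  the recursion for the factor is \<open>-1 - d\<close>.
\<close>

lemma eps_bb:
  assumes "set Rs \<subseteq> maxid"
  shows "eps (qq m) Rs (bb j Q) = scal ((-1) ^ length Rs * fact (length Rs)) (bb j (prod_list Rs * Q))"
  using assms
proof (induction Rs arbitrary: Q rule: eps_induct)
  case Nil
  then show ?case by simp
next
  case (Cons S Rs)
  let ?d = "length Rs"
  let ?b = "bb j (S * (prod_list Rs * Q))"
  have S: "S \<in> polys" using Cons.prems by (simp add: maxid_polys)
  have "prod_list (Rs[i := Rs ! i * S]) = S * prod_list Rs" if "i < ?d" for i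
  proof -
    have "Rs = take i Rs @ Rs ! i # drop (Suc i) Rs" using that by (simp add: id_take_nth_drop)
    then have "prod_list Rs = prod_list (take i Rs @ Rs ! i # drop (Suc i) Rs)" by simp
    moreover have "prod_list (Rs[i := Rs ! i * S]) = prod_list (take i Rs @ Rs ! i * S # drop (Suc i) Rs)"
      using that by (simp add: upd_conv_take_nth_drop)
    ultimately show ?thesis by (simp add: ac_simps)
  qed
  moreover have "set (Rs[i := Rs ! i * S]) \<subseteq> maxid" if "i < ?d" for i
    using Cons.prems that S by (intro update_mult_subset) (auto intro: maxid_mult)
  ultimately have "eps (qq m) (Rs[i := Rs ! i * S]) (bb j Q) = scal ((-1) ^ ?d * fact ?d) ?b" if "i < ?d" for i
    using Cons.IH(2)[of i Q] that by (simp add: mult.assoc)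
  then have "(\<Sum>i<?d. eps (qq m) (Rs[i := Rs ! i * S]) (bb j Q)) = scal (of_nat ?d) (scal ((-1) ^ ?d * fact ?d) ?b)"
    by (simp add: scal_def)
  then have "(\<Sum>i<?d. eps (qq m) (Rs[i := Rs ! i * S]) (bb j Q)) = scal (of_nat ?d * ((-1) ^ ?d * fact ?d)) ?b"
    by (simp only: scal_scal)
  moreover have "qq m S (eps (qq m) Rs (bb j Q)) = scal (- ((-1) ^ ?d * fact ?d)) ?b"
    using Cons.prems by (simp add: Cons.IH(1) clin_scal[OF clin_qq] qq_maxid_bb scal_minus_left scal_minus_right)
  ultimately show ?case
    by (simp add: eps_Cons scal.scale_left_diff_distrib[symmetric] algebra_simps)
qed

text \<open>
  Generators of degree at least \<open>m\<close> vanish in the quotient: write the argument as a product of \<open>m\<close> coordinate functions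
  and a rest, and use \<open>m\<close> contractions. This is what makes the quotient finite-dimensional.
\<close>

lemma bb_in_Gsub:
  assumes r: "2 \<le> r" and j: "1 \<le> j" "j < r" and k: "0 \<le> a" "m \<le> nat a + b"
  shows "bb j (mono1 (a, b)) \<in> Gsub r m"
proof -
  define a' where "a' = min (nat a) m"
  define b' where "b' = m - a'"
  let ?Rs = "replicate a' (mono1 (1, 0)) @ replicate b' (mono1 (0, 1)) :: laurent list"
  let ?Q = "mono1 (a - int a', b - b') :: laurent"
  have le: "b' \<le> b" "int a' \<le> a" "a' + b' = m" using k by (auto simp: a'_def b'_def)
  have Q: "?Q \<in> polys" using le by (simp add: polys_single)
  have p: "mono1 (1, 0) ^ n = (mono1 (int n, 0) :: laurent)" "mono1 (0, 1) ^ n = (mono1 (0, n) :: laurent)" for n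
    by (induction n) (simp_all add: mult_single flip: single_one zero_prod_def)
  have "mono1 (1, 0) \<in> maxid" "mono1 (0, 1) \<in> maxid"
    by (auto simp: zero_prod_def intro!: maxid_single)
  then have "eps (qq m) ?Rs (bprod [(j, ?Q)]) \<in> Gsub r m"
    using j Q le by (intro eps_in_Gsub[OF r]) auto
  moreover have "prod_list ?Rs * ?Q = mono1 (a, b)"
    using le by (simp add: p p[simplified] mult_single)
  moreover have "set ?Rs \<subseteq> maxid"
    by (auto simp: zero_prod_def intro!: maxid_single)
  moreover from this have "eps (qq m) ?Rs (bb j ?Q) = scal ((-1) ^ length ?Rs * fact (length ?Rs)) (bb j (prod_list ?Rs * ?Q))"
    by (rule eps_bb)
  moreover have "length ?Rs = m" "bprod [(j, ?Q)] = bb j ?Q" using le by simp_all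
  ultimately have "scal ((-1) ^ m * fact m) (bb j (mono1 (a, b))) \<in> Gsub r m"
    by (simp only:)
  moreover have nz: "(-1) ^ m * fact m \<noteq> (0 :: complex)" by simp
  ultimately show ?thesis
    using Gsub.scal[of "scal ((-1) ^ m * fact m) (bb j (mono1 (a, b)))" r m "inverse ((-1) ^ m * fact m)"]
    by (simp only: scal_scal left_inverse[OF nz] scal_one simp_thms)
qed

section \<open>Multiplication by x respects the submodules\<close>

text \<open>
  The same recursion as \<open>eps\<close>, but in a commutative ring in place of operators. Then the result is symmetric in the list.
\<close>

definition eh :: "(laurent \<Rightarrow> 'a::comm_ring_1) \<Rightarrow> laurent list \<Rightarrow> 'a" where
  "eh q Rs = eps (\<lambda>S u. q S * u) Rs 1"

lemma eh_Nil [simp]: "eh q [] = 1"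
  by (simp add: eh_def)

lemma eh_Cons: "eh q (S # Rs) = q S * eh q Rs - (\<Sum>i<length Rs. eh q (Rs[i := Rs ! i * S]))"
  by (simp add: eh_def eps_Cons)

lemma eh_update_add:
  assumes q: "\<And>P Q. q (P + Q) = q P + q Q" and "i < length Rs"
  shows "eh q (Rs[i := A + B]) = eh q (Rs[i := A]) + eh q (Rs[i := B])"
  using assms(2)
proof (induction "length Rs" arbitrary: Rs i A B)
  case (Suc n)
  then obtain S Rs' where Rs: "Rs = S # Rs'" "length Rs' = n" by (cases Rs) auto
  have IH: "eh q (Rs''[i := A + B]) = eh q (Rs''[i := A]) + eh q (Rs''[i := B])"
    if "length Rs'' = n" "i < n" for Rs'' i A B
    using Suc.hyps(1)[of Rs'' i] that by simp
  show ?case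
  proof (cases i)
    case 0
    then show ?thesis using Rs(2)
      by (simp add: Rs(1) eh_Cons q distrib_left distrib_right IH sum.distrib)
  next
    case (Suc i')
    then have i': "i' < n" using Suc.prems Rs by simp
    have "eh q (Rs'[i' := A + B, k := Rs'[i' := A + B] ! k * S])
      = eh q (Rs'[i' := A, k := Rs'[i' := A] ! k * S]) + eh q (Rs'[i' := B, k := Rs'[i' := B] ! k * S])"
      if "k < n" for k
    proof (cases "k = i'")
      case True
      then show ?thesis using i' Rs(2) by (simp add: distrib_right IH)
    next
      case False
      then show ?thesis using i' Rs(2) that by (simp add: list_update_swap[of i' k] IH)
    qed
    then show ?thesis
      using i' Rs(2) by (simp add: Rs(1) Suc eh_Cons IH distrib_left sum.distrib)
  qed
qed simp

lemma eh_Cons_add: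
  assumes q: "\<And>P Q. q (P + Q) = q P + q Q"
  shows "eh q ((A + B) # Rs) = eh q (A # Rs) + eh q (B # Rs)"
  using eh_update_add[of q 0 "A # Rs" A B] q by simp

lemma eh_update_scal:
  fixes q :: "laurent \<Rightarrow> ('k::comm_monoid_add \<Rightarrow>\<^sub>0 complex)"
  assumes q: "\<And>P. q (scal c P) = scal c (q P)" and "i < length Rs"
  shows "eh q (Rs[i := scal c A]) = scal c (eh q (Rs[i := A]))"
  using assms(2)
proof (induction "length Rs" arbitrary: Rs i A)
  case (Suc n)
  then obtain S Rs' where Rs: "Rs = S # Rs'" "length Rs' = n" by (cases Rs) auto
  have IH: "eh q (Rs''[i := scal c A]) = scal c (eh q (Rs''[i := A]))"
    if "length Rs'' = n" "i < n" for Rs'' i A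
    using Suc.hyps(1)[of Rs'' i] that by simp
  show ?case
  proof (cases i)
    case 0
    then show ?thesis using Rs(2)
      by (simp add: Rs(1) eh_Cons q IH scal_mult_left scal_mult_right scal_diff_right scal.scale_sum_right)
  next
    case (Suc i')
    then have i': "i' < n" using Suc.prems Rs by simp
    have "eh q (Rs'[i' := scal c A, k := Rs'[i' := scal c A] ! k * S])
      = scal c (eh q (Rs'[i' := A, k := Rs'[i' := A] ! k * S]))"
      if "k < n" for k
    proof (cases "k = i'")
      case True
      then show ?thesis using i' Rs(2) by (simp add: scal_mult_left IH)
    next
      case False
      then show ?thesis using i' Rs(2) that by (simp add: list_update_swap[of i' k] IH)
    qed
    then show ?thesis
      using i' Rs(2) by (simp add: Rs(1) Suc eh_Cons IH scal_mult_right scal_diff_right scal.scale_sum_right)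
  qed
qed simp

text \<open>
  Exchanging the first two entries changes the recursion only by terms in which \<open>S\<close> and \<open>S'\<close> are merged, and these agree.
\<close>

lemma eh_swap: "eh q (S # S' # Rs) = eh q (S' # S # Rs)"
proof -
  let ?n = "length Rs"
  have F: "(\<Sum>i<?n. \<Sum>k<?n. eh q (Rs[i := Rs ! i * S, k := Rs[i := Rs ! i * S] ! k * S']))
      = (\<Sum>i<?n. \<Sum>k<?n. eh q (Rs[i := Rs ! i * S', k := Rs[i := Rs ! i * S'] ! k * S]))"
    (is "(\<Sum>i<?n. \<Sum>k<?n. ?f S S' i k) = _")
  proof (subst sum.swap, intro sum.cong refl)
    fix i k assume "i \<in> {..<?n}" "k \<in> {..<?n}"
    then show "?f S S' k i = ?f S' S i k"
      by (cases "i = k") (simp_all add: ac_simps list_update_swap[of i k])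
  qed
  have E: "eh q (S # S' # Rs) = q S * q S' * eh q Rs - q S * (\<Sum>i<?n. eh q (Rs[i := Rs ! i * S']))
     - eh q ((S' * S) # Rs) - q S' * (\<Sum>i<?n. eh q (Rs[i := Rs ! i * S]))
     + (\<Sum>i<?n. \<Sum>k<?n. ?f S S' i k)" for S S'
    by (subst eh_Cons)
      (simp add: sum.lessThan_Suc_shift eh_Cons[of q S'] sum_subtractf sum_distrib_left right_diff_distrib
        mult.assoc del: sum.lessThan_Suc)
  show ?thesis
    unfolding E F by (simp add: ac_simps)
qed

lemma eh_snoc: "eh q (Rs @ [S]) = eh q (S # Rs)"
proof (induction Rs arbitrary: S rule: eps_induct)
  case (Cons T Rs)
  have "eh q ((T # Rs) @ [S]) = q T * eh q (S # Rs) - ((\<Sum>i<length Rs. eh q (S # Rs[i := Rs ! i * T])) + eh q ((S * T) # Rs))"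
    using Cons by (simp add: eh_Cons[of q T] nth_append list_update_append)
  also have "\<dots> = eh q (T # S # Rs)"
    by (subst (3) eh_Cons) (simp add: sum.lessThan_Suc_shift del: sum.lessThan_Suc)
  also have "\<dots> = eh q (S # T # Rs)" by (rule eh_swap)
  finally show ?case .
qed simp

text \<open>
  Merging with 1 changes nothing, so an entry 1 contributes a scalar.
\<close>

lemma eh_Cons_one: "eh q (1 # Rs) = (q 1 - of_nat (length Rs)) * eh q Rs"
  by (simp add: eh_Cons left_diff_distrib)

lemma clin_hom_mult:
  assumes "clin f" and "\<And>k l. f (mono1 (k + l)) = f (mono1 k) * f (mono1 l)"
  shows "f (u * v) = f u * f v"
proof (rule clin_eqI[where u = u])
  show "clin (\<lambda>u. f (u * v))" "clin (\<lambda>u. f u * f v)"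
    by (simp_all add: clin_def distrib_right scal_mult_left clin_add[OF assms(1)] clin_scal[OF assms(1)])
next
  fix k
  show "f (mono1 k * v) = f (mono1 k) * f v"
  proof (rule clin_eqI[where u = v])
    show "clin (\<lambda>v. f (mono1 k * v))" "clin (\<lambda>v. f (mono1 k) * f v)"
      by (simp_all add: clin_def distrib_left scal_mult_right clin_add[OF assms(1)] clin_scal[OF assms(1)])
  qed (simp add: mult_single assms(2))
qed

text \<open>
  The algebra homomorphism \<open>b_c(Q) \<mapsto> b_c(x Q)\<close>, given on monomials.
\<close>

definition tau :: "sym \<Rightarrow> sym" where
  "tau = lext scal (\<lambda>M. mono1 (image_mset (\<lambda>(c, k). (c, (1, 0) + k)) M))"

lemma clin_tau: "clin tau"
  by (simp add: tau_def clin_lext)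

lemma tau_mult: "tau (u * v) = tau u * tau v"
  by (rule clin_hom_mult[OF clin_tau]) (simp add: tau_def mult_single)

lemma tau_one [simp]: "tau 1 = 1"
  by (simp add: tau_def flip: single_one)

lemma tau_bb: "tau (bb c Q) = bb c (xpow 1 * Q)"
proof (rule clin_eqI[where u = Q])
  show "clin (\<lambda>u. tau (bb c u))" by (intro clin_compose[OF clin_tau] clin_bb)
  show "clin (\<lambda>u. bb c (xpow 1 * u))" by (intro clin_compose[OF clin_bb] clin_mult)
qed (simp add: tau_def xpow_def mult_single)

text \<open>
  Laurent polynomials in several pairs of variables \<open>(x_l, y_l)\<close>. A product of \<open>n\<close> generators with prescribed colours \<open>ks\<close>
  depends linearly on the tensor product of its arguments; \<open>UU ks\<close> is this linear map, and \<open>zz l P\<close> is \<open>P\<close> in the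
  \<open>l\<close>-th pair of variables. The point is that \<open>qq\<close> and \<open>tau\<close> become multiplications by the elements
  \<open>qh\<close> and $\prod_l x_l$ of a commutative ring.
\<close>

type_synonym tp = "(nat \<Rightarrow>\<^sub>0 (int \<times> nat)) \<Rightarrow>\<^sub>0 complex"

definition zz :: "nat \<Rightarrow> laurent \<Rightarrow> tp" where
  "zz l = lext scal (\<lambda>k. mono1 (Poly_Mapping.single l k))"

lemma clin_zz: "clin (zz l)"
  by (simp add: zz_def clin_lext)

lemma zz_mono1 [simp]: "zz l (mono1 k) = mono1 (Poly_Mapping.single l k)"
  by (simp add: zz_def)

lemma zz_mult: "zz l (P * Q) = zz l P * zz l Q"
  by (rule clin_hom_mult[OF clin_zz]) (simp add: mult_single single_add)

lemma zz_one [simp]: "zz l 1 = 1"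
  using zz_mono1[of l 0] by simp

lemma zz_power: "zz l (P ^ c) = zz l P ^ c"
  by (induction c) (simp_all add: zz_mult)

definition UU :: "nat list \<Rightarrow> tp \<Rightarrow> sym" where
  "UU ks = lext scal (\<lambda>g. mono1 (mset (map (\<lambda>l. (ks ! l, Poly_Mapping.lookup g l)) [0..<length ks])))"

lemma clin_UU: "clin (UU ks)"
  by (simp add: UU_def clin_lext)

lemma UU_mono1: "UU ks (mono1 g) = mono1 (mset (map (\<lambda>l. (ks ! l, Poly_Mapping.lookup g l)) [0..<length ks]))"
  by (simp add: UU_def)

definition qh :: "nat \<Rightarrow> nat \<Rightarrow> laurent \<Rightarrow> tp" where
  "qh m n S = scal (of_nat m * Poly_Mapping.lookup S 0) 1 - (\<Sum>l<n. zz l S)"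

lemma sum_mset_map_upt: "(\<Sum>t\<in>#mset (map f [0..<n]). h t) = (\<Sum>l<n. h (f l))"
  by (simp add: mset_map image_mset.compositionality comp_def sum_mset_sum_list sum_list_sum_nth lessThan_atLeast0
      flip: mset_map)

lemma mset_map_update:
  assumes "l < n"
  shows "mset (map (\<lambda>i. if i = l then v else f i) [0..<n]) = add_mset v (mset (map f [0..<n]) - {#f l#})"
proof -
  have "map (\<lambda>i. if i = l then v else f i) [0..<n] = (map f [0..<n])[l := v]"
    using assms by (auto intro!: nth_equalityI simp: nth_list_update)
  then show ?thesis using assms by (simp add: mset_update)
qed

lemma qq_UU: "qq m S (UU ks G) = UU ks (qh m (length ks) S * G)"
proof (rule clin_eqI[where u = G])
  show "clin (\<lambda>G. qq m S (UU ks G))" by (intro clin_compose[OF clin_qq] clin_UU)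
  show "clin (\<lambda>G. UU ks (qh m (length ks) S * G))" by (intro clin_compose[OF clin_UU] clin_mult)
next
  fix g :: "nat \<Rightarrow>\<^sub>0 int \<times> nat"
  let ?n = "length ks"
  let ?f = "\<lambda>l. (ks ! l, Poly_Mapping.lookup g l)"
  have "lop (\<lambda>(c, k) v. bb c (S * mono1 k) * v) (UU ks (mono1 g)) = (\<Sum>l<?n. UU ks (zz l S * mono1 g))"
  proof (rule clin_eqI[where u = S])
    show "clin (\<lambda>S. lop (\<lambda>(c, k) v. bb c (S * mono1 k) * v) (UU ks (mono1 g)))"
      by (rule clin_lop_param, clarify) (intro clin_intros)
    show "clin (\<lambda>S. \<Sum>l<?n. UU ks (zz l S * mono1 g))"
      by (intro clin_fun_sum clin_compose[OF clin_UU] clin_mult_const clin_zz)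
  next
    fix k :: "int \<times> nat"
    have "(if i = l then (ks ! l, k + Poly_Mapping.lookup g l) else ?f i)
        = (ks ! i, Poly_Mapping.lookup (Poly_Mapping.single l k + g) i)" for i l
      by (simp add: lookup_add lookup_single)
    then have "mono1 (add_mset (ks ! l, k + Poly_Mapping.lookup g l) (mset (map ?f [0..<?n]) - {#?f l#}))
      = UU ks (zz l (mono1 k) * mono1 g)" if "l < ?n" for l
      using that by (subst mset_map_update[symmetric]) (simp_all add: UU_mono1 mult_single)
    then show "lop (\<lambda>(c, k') v. bb c (mono1 k * mono1 k') * v) (UU ks (mono1 g)) = (\<Sum>l<?n. UU ks (zz l (mono1 k) * mono1 g))"
      unfolding UU_mono1[of ks g] lop_mono1 sum_mset_map_upt
      by (intro sum.cong) (simp_all add: mult_single)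
  qed
  then show "qq m S (UU ks (mono1 g)) = UU ks (qh m ?n S * mono1 g)"
    by (simp add: qq_def qh_def left_diff_distrib clin_diff[OF clin_UU] sum_distrib_right clin_sum[OF clin_UU]
      scal_mult_left clin_scal[OF clin_UU])
qed

lemma eps_UU: "eps (qq m) Rs (UU ks G) = UU ks (eh (qh m (length ks)) Rs * G)"
  by (induction Rs rule: eps_induct)
    (simp_all add: eps_Cons eh_Cons qq_UU left_diff_distrib clin_diff[OF clin_UU] clin_sum[OF clin_UU]
      sum_distrib_right mult.assoc)

lemma tau_UU: "tau (UU ks G) = UU ks ((\<Prod>l<length ks. zz l (xpow 1)) * G)"
proof (rule clin_eqI[where u = G])
  show "clin (\<lambda>G. tau (UU ks G))" by (intro clin_compose[OF clin_tau] clin_UU)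
  show "clin (\<lambda>G. UU ks ((\<Prod>l<length ks. zz l (xpow 1)) * G))" by (intro clin_compose[OF clin_UU] clin_mult)
next
  fix g
  have p: "(\<Prod>l<n. zz l (xpow 1)) = mono1 (\<Sum>l<n. Poly_Mapping.single l (1, 0))" for n
    by (induction n) (simp_all add: xpow_def mult_single)
  have "Poly_Mapping.lookup (\<Sum>l<n. Poly_Mapping.single l (1 :: int, 0 :: nat)) i = (1, 0)" if "i < n" for n i :: nat
    using that by (simp add: lookup_sum lookup_single when_def)
  then show "tau (UU ks (mono1 g)) = UU ks ((\<Prod>l<length ks. zz l (xpow 1)) * mono1 g)"
    by (auto simp: p mult_single UU_mono1 tau_def lookup_add mset_map[symmetric] image_mset.compositionality comp_def
      simp del: mset_map intro!: arg_cong[where f = "\<lambda>xs. mono1 (mset xs)"])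
qed

lemma bprod_UU: "bprod qs = UU (map fst qs) (\<Prod>l<length qs. zz l (snd (qs ! l)))"
proof (induction qs rule: rev_induct)
  case Nil
  show ?case using UU_mono1[of "[]" 0] by simp
next
  case (snoc cQ qs)
  obtain c Q where cQ: "cQ = (c, Q)" by fastforce
  let ?n = "length qs" and ?ks = "map fst qs"
  let ?G = "\<Prod>l<?n. zz l (snd (qs ! l))"
  have k1: "Poly_Mapping.lookup g i = 0" if g: "g \<in> Poly_Mapping.keys (\<Prod>l<k. zz l (f l))" and i: "k \<le> i" for k g f i
    using g i
  proof (induction k arbitrary: g)
    case (Suc k)
    obtain a b where ab: "a \<in> Poly_Mapping.keys (\<Prod>l<k. zz l (f l))" "b \<in> Poly_Mapping.keys (zz k (f k))" "g = a + b"
      using Suc.prems keys_mult by fastforce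
    have "Poly_Mapping.keys (zz k P) \<subseteq> range (Poly_Mapping.single k)" for P
    proof (induction P rule: poly_mapping_linear_induct)
      case (single j d)
      have "zz k (Poly_Mapping.single j d) = scal d (mono1 (Poly_Mapping.single k j))"
        using clin_scal[OF clin_zz, of k d "mono1 j"] by (simp add: scal_single)
      then show ?case by (simp add: scal_single)
    next
      case (add u v)
      then show ?case
        using Poly_Mapping.keys_add[of "zz k u" "zz k v"] by (auto simp: clin_add[OF clin_zz])
    qed
    then obtain j where "b = Poly_Mapping.single k j" using ab by blast
    then show ?case using ab Suc by (simp add: lookup_add lookup_single)
  qed simp
  have k2: "UU (?ks @ [c]) (zz ?n Q * mono1 g) = UU ?ks (mono1 g) * bb c Q" if "Poly_Mapping.lookup g ?n = 0" for g
  proof (rule clin_eqI[where u = Q])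
    show "clin (\<lambda>Q. UU (?ks @ [c]) (zz ?n Q * mono1 g))"
      by (intro clin_compose[OF clin_UU] clin_mult_const clin_zz)
    show "clin (\<lambda>Q. UU ?ks (mono1 g) * bb c Q)"
      by (intro clin_compose[OF clin_mult] clin_bb)
  next
    fix k
    have "map (\<lambda>l. ((?ks @ [c]) ! l, Poly_Mapping.lookup (Poly_Mapping.single ?n k + g) l)) [0..<?n]
      = map (\<lambda>l. (?ks ! l, Poly_Mapping.lookup g l)) [0..<?n]"
      by (auto simp: nth_append lookup_add lookup_single)
    then show "UU (?ks @ [c]) (zz ?n (mono1 k) * mono1 g) = UU ?ks (mono1 g) * bb c (mono1 k)"
      using that by (simp add: UU_mono1 mult_single lookup_add lookup_single nth_append del: map_eq_conv)
  qed
  have "UU (?ks @ [c]) (zz ?n Q * (\<Sum>g\<in>A. Poly_Mapping.single g (Poly_Mapping.lookup ?G g)))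
    = UU ?ks (\<Sum>g\<in>A. Poly_Mapping.single g (Poly_Mapping.lookup ?G g)) * bb c Q" if "A \<subseteq> Poly_Mapping.keys ?G" for A
  proof -
    have "UU (?ks @ [c]) (zz ?n Q * Poly_Mapping.single g d) = UU ?ks (Poly_Mapping.single g d) * bb c Q"
      if "g \<in> A" for g d
    proof -
      have "Poly_Mapping.single g d = scal d (mono1 g)" by (simp add: scal_single)
      then show ?thesis
        using k2[of g] k1[where g = g and k = ?n and i = ?n and f = "\<lambda>l. snd (qs ! l)"] that \<open>A \<subseteq> _\<close>
        by (auto simp: scal_mult_right scal_mult_left clin_scal[OF clin_UU])
    qed
    then show ?thesis
      by (simp add: sum_distrib_left clin_sum[OF clin_UU] sum_distrib_right)
  qed
  from this[OF subset_refl] have "UU (?ks @ [c]) (zz ?n Q * ?G) = UU ?ks ?G * bb c Q"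
    unfolding sum_single_lookup .
  moreover have "(\<Prod>l<?n. zz l (snd ((qs @ [cQ]) ! l))) = ?G"
    by (intro prod.cong) (auto simp: nth_append)
  ultimately show ?case using snoc by (simp add: cQ mult.commute)
qed

text \<open>
  The subring of polynomials.
\<close>

definition TP :: "tp set" where
  "TP = {G. \<forall>g\<in>Poly_Mapping.keys G. \<forall>l. 0 \<le> fst (Poly_Mapping.lookup g l)}"

lemma TP_add: "F \<in> TP \<Longrightarrow> G \<in> TP \<Longrightarrow> F + G \<in> TP"
  using Poly_Mapping.keys_add[of F G] by (auto simp: TP_def)

lemma TP_mult: "F \<in> TP \<Longrightarrow> G \<in> TP \<Longrightarrow> F * G \<in> TP"
  using keys_mult[of F G] by (fastforce simp: TP_def lookup_add)

lemma TP_zero [simp]: "0 \<in> TP"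
  by (simp add: TP_def)

lemma TP_one [simp]: "1 \<in> TP"
  by (simp add: TP_def)

lemma TP_uminus: "F \<in> TP \<Longrightarrow> - F \<in> TP"
  by (simp add: TP_def)

lemma TP_diff: "F \<in> TP \<Longrightarrow> G \<in> TP \<Longrightarrow> F - G \<in> TP"
  using TP_add[of F "- G"] by (simp add: TP_uminus)

lemma TP_sum: "(\<And>a. a \<in> A \<Longrightarrow> f a \<in> TP) \<Longrightarrow> sum f A \<in> TP"
  by (induction A rule: infinite_finite_induct) (simp_all add: TP_add)

lemma TP_prod: "(\<And>a. a \<in> A \<Longrightarrow> f a \<in> TP) \<Longrightarrow> prod f A \<in> TP"
  by (induction A rule: infinite_finite_induct) (simp_all add: TP_mult)

lemma TP_scal: "F \<in> TP \<Longrightarrow> scal c F \<in> TP"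
  unfolding scal_def by (rule TP_mult) (simp_all add: TP_def)

lemma TP_zz: "P \<in> polys \<Longrightarrow> zz l P \<in> TP"
proof -
  assume P: "P \<in> polys"
  have "zz l P = (\<Sum>k\<in>Poly_Mapping.keys P. scal (Poly_Mapping.lookup P k) (mono1 (Poly_Mapping.single l k)))"
    by (simp add: zz_def lext_def)
  moreover have "mono1 (Poly_Mapping.single l k) \<in> TP" if "k \<in> Poly_Mapping.keys P" for k
    using P that by (simp add: TP_def polys_def lookup_single when_def)
  ultimately show ?thesis by (simp add: TP_sum TP_scal)
qed

lemma bprod_monomials:
  "bprod (map (\<lambda>l. (f l, mono1 (h l))) ls) = mono1 (mset (map (\<lambda>l. (f l, h l)) ls))"
  by (induction ls) (simp_all add: mult_single flip: single_one)

lemma UU_eh_in_Gsub: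
  assumes r: "2 \<le> r" and ks: "\<forall>k\<in>set ks. 1 \<le> k \<and> k < r" and Rs: "set Rs \<subseteq> maxid"
    and G: "G \<in> TP" and m: "m < length Rs + length ks"
  shows "UU ks (eh (qh m (length ks)) Rs * G) \<in> Gsub r m"
proof -
  have "UU ks (eh (qh m (length ks)) Rs * mono1 g) \<in> Gsub r m" if g: "g \<in> Poly_Mapping.keys G" for g
  proof -
    let ?qs = "map (\<lambda>l. (ks ! l, mono1 (Poly_Mapping.lookup g l) :: laurent)) [0..<length ks]"
    have "valid r ?qs" using ks g G by (auto simp: valid_def TP_def intro!: polys_single)
    then have "eps (qq m) Rs (bprod ?qs) \<in> Gsub r m"
      using m by (intro eps_in_Gsub r Rs) auto
    also have "bprod ?qs = UU ks (mono1 g)" by (simp add: bprod_monomials UU_mono1)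
    finally show ?thesis by (simp add: eps_UU)
  qed
  moreover have "UU ks (eh (qh m (length ks)) Rs * G)
      = (\<Sum>g\<in>Poly_Mapping.keys G. scal (Poly_Mapping.lookup G g) (UU ks (eh (qh m (length ks)) Rs * mono1 g)))"
  proof -
    have "UU ks (eh (qh m (length ks)) Rs * G)
      = UU ks (eh (qh m (length ks)) Rs * (\<Sum>g\<in>Poly_Mapping.keys G. scal (Poly_Mapping.lookup G g) (mono1 g)))"
      by (simp add: scal_single sum_single_lookup)
    then show ?thesis
      by (simp only: sum_distrib_left clin_sum[OF clin_UU] scal_mult_right clin_scal[OF clin_UU])
  qed
  ultimately show ?thesis by (simp add: Gsub_sum[OF r] Gsub.scal)
qed

lemma qh_maxid: "S \<in> maxid \<Longrightarrow> qh m n S = - (\<Sum>l<n. zz l S)"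
  by (simp add: qh_def maxid_def)

lemma maxid_update: "set Rs \<subseteq> maxid \<Longrightarrow> S \<in> polys \<Longrightarrow> i < length Rs \<Longrightarrow> set (Rs[i := Rs ! i * S]) \<subseteq> maxid"
  by (rule update_mult_subset) (auto intro: maxid_mult)

text \<open>
  It makes contractions for the weights \<open>m\<close> and \<open>m + 1\<close> comparable.
\<close>

lemma eh_maxid_indep:
  assumes "set Rs \<subseteq> maxid"
  shows "eh (qh m n) Rs = eh (qh m' n) Rs"
  using assms
  by (induction Rs rule: eps_induct) (simp_all add: eh_Cons qh_maxid maxid_update maxid_polys)

lemma eh_TP: "set Rs \<subseteq> maxid \<Longrightarrow> eh (qh m n) Rs \<in> TP"
  by (induction Rs rule: eps_induct)
    (auto simp: eh_Cons qh_maxid maxid_update maxid_polys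
      intro!: TP_diff TP_sum TP_mult TP_uminus TP_zz)

text \<open>
  The dependence on one entry is through \<open>l \<mapsto> zz l S\<close> only, with coefficients that do not depend on \<open>S\<close>: in each term of the
  expansion, \<open>S\<close> ends up in exactly one of the pairs of variables.
\<close>

lemma eh_update_decomp:
  assumes "set Rs \<subseteq> maxid" "i < length Rs"
  shows "\<exists>\<eta>. (\<forall>l. \<eta> l \<in> TP) \<and> (\<forall>S\<in>polys. eh (qh m n) (Rs[i := Rs ! i * S]) = (\<Sum>l<n. zz l S * \<eta> l))"
  using assms
proof (induction "length Rs" arbitrary: Rs i)
  case (Suc d)
  then obtain R Rs' where Rs: "Rs = R # Rs'" "length Rs' = d" by (cases Rs) auto
  have R: "R \<in> maxid" "R \<in> polys" and Rs': "set Rs' \<subseteq> maxid" using Suc.prems Rs by (auto simp: maxid_polys)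
  have IH: "\<exists>\<eta>. (\<forall>l. \<eta> l \<in> TP) \<and> (\<forall>S\<in>polys. eh (qh m n) (Rs''[i := Rs'' ! i * S]) = (\<Sum>l<n. zz l S * \<eta> l))"
    if "length Rs'' = d" "set Rs'' \<subseteq> maxid" "i < d" for Rs'' i
    using Suc.hyps(1)[of Rs'' i] that by simp
  show ?case
  proof (cases i)
    case 0
    have "\<forall>k\<in>{..<d}. \<exists>\<eta>. (\<forall>l. \<eta> l \<in> TP) \<and> (\<forall>S\<in>polys. eh (qh m n) (Rs'[k := Rs' ! k * S]) = (\<Sum>l<n. zz l S * \<eta> l))"
      using IH[OF Rs(2) Rs'] by simp
    then obtain \<eta> where \<eta>: "\<And>k l. k < d \<Longrightarrow> \<eta> k l \<in> TP"
      "\<And>k S. k < d \<Longrightarrow> S \<in> polys \<Longrightarrow> eh (qh m n) (Rs'[k := Rs' ! k * S]) = (\<Sum>l<n. zz l S * \<eta> k l)"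
      unfolding bchoice_iff by auto
    let ?e = "\<lambda>l. - (zz l R * eh (qh m n) Rs') - (\<Sum>k<d. zz l R * \<eta> k l)"
    have "eh (qh m n) (Rs[i := Rs ! i * S]) = (\<Sum>l<n. zz l S * ?e l)" if S: "S \<in> polys" for S
    proof -
      have "eh (qh m n) (Rs[i := Rs ! i * S])
        = - (\<Sum>l<n. zz l (R * S)) * eh (qh m n) Rs' - (\<Sum>k<d. \<Sum>l<n. zz l (R * S) * \<eta> k l)"
        using R S Rs by (simp add: Rs(1) 0 eh_Cons qh_maxid maxid_mult \<eta>(2) polys_mult)
      also have "(\<Sum>k<d. \<Sum>l<n. zz l (R * S) * \<eta> k l) = (\<Sum>l<n. \<Sum>k<d. zz l (R * S) * \<eta> k l)"
        by (rule sum.swap)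
      also have "- (\<Sum>l<n. zz l (R * S)) * eh (qh m n) Rs' - \<dots> = (\<Sum>l<n. zz l S * ?e l)"
        by (simp add: zz_mult right_diff_distrib sum_subtractf sum_distrib_left sum_distrib_right sum_negf ac_simps)
      finally show ?thesis .
    qed
    moreover have "?e l \<in> TP" for l
      using \<eta>(1) R Rs' by (intro TP_diff TP_uminus TP_sum TP_mult TP_zz eh_TP) auto
    ultimately show ?thesis by (intro exI[of _ ?e]) blast
  next
    case (Suc i')
    then have i': "i' < d" using Suc.prems Rs by simp
    obtain \<theta> where \<theta>: "\<And>l. \<theta> l \<in> TP"
      "\<And>S. S \<in> polys \<Longrightarrow> eh (qh m n) (Rs'[i' := Rs' ! i' * S]) = (\<Sum>l<n. zz l S * \<theta> l)"
      using IH[OF Rs(2) Rs' i'] by blast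
    have "\<forall>k\<in>{..<d}. \<exists>\<eta>. (\<forall>l. \<eta> l \<in> TP) \<and>
      (\<forall>S\<in>polys. eh (qh m n) (Rs'[i' := Rs' ! i' * S, k := Rs'[i' := Rs' ! i' * S] ! k * R]) = (\<Sum>l<n. zz l S * \<eta> l))"
    proof
      fix k assume k: "k \<in> {..<d}"
      show "\<exists>\<eta>. (\<forall>l. \<eta> l \<in> TP) \<and>
        (\<forall>S\<in>polys. eh (qh m n) (Rs'[i' := Rs' ! i' * S, k := Rs'[i' := Rs' ! i' * S] ! k * R]) = (\<Sum>l<n. zz l S * \<eta> l))"
      proof -
        have "Rs'[i' := Rs' ! i' * S, k := Rs'[i' := Rs' ! i' * S] ! k * R]
          = (Rs'[k := Rs' ! k * R])[i' := Rs'[k := Rs' ! k * R] ! i' * S]" for S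
          using i' Rs(2) k by (cases "k = i'") (simp_all add: list_update_swap[of i' k] ac_simps)
        then show ?thesis
          using IH[of "Rs'[k := Rs' ! k * R]" i'] Rs(2) i' maxid_update[OF Rs' R(2)] k by simp
      qed
    qed
    then obtain \<eta> where \<eta>: "\<And>k l. k < d \<Longrightarrow> \<eta> k l \<in> TP"
      "\<And>k S. k < d \<Longrightarrow> S \<in> polys \<Longrightarrow>
        eh (qh m n) (Rs'[i' := Rs' ! i' * S, k := Rs'[i' := Rs' ! i' * S] ! k * R]) = (\<Sum>l<n. zz l S * \<eta> k l)"
      unfolding bchoice_iff by auto
    let ?e = "\<lambda>l. qh m n R * \<theta> l - (\<Sum>k<d. \<eta> k l)"
    have "eh (qh m n) (Rs[i := Rs ! i * S]) = (\<Sum>l<n. zz l S * ?e l)" if S: "S \<in> polys" for S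
    proof -
      have "eh (qh m n) (Rs[i := Rs ! i * S])
        = qh m n R * (\<Sum>l<n. zz l S * \<theta> l) - (\<Sum>k<d. \<Sum>l<n. zz l S * \<eta> k l)"
        using S Rs by (simp add: Rs(1) Suc eh_Cons \<eta>(2) \<theta>(2))
      also have "(\<Sum>k<d. \<Sum>l<n. zz l S * \<eta> k l) = (\<Sum>l<n. \<Sum>k<d. zz l S * \<eta> k l)"
        by (rule sum.swap)
      also have "qh m n R * (\<Sum>l<n. zz l S * \<theta> l) - \<dots> = (\<Sum>l<n. zz l S * ?e l)"
        by (simp add: right_diff_distrib sum_subtractf sum_distrib_left ac_simps)
      finally show ?thesis .
    qed
    moreover have "?e l \<in> TP" for l
      using \<eta>(1) \<theta>(1) R by (auto simp: qh_maxid intro!: TP_diff TP_uminus TP_sum TP_mult TP_zz)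
    ultimately show ?thesis by (intro exI[of _ ?e]) blast
  qed
qed simp

lemma coeff_TP_mult:
  "\<forall>c. coeff p c \<in> TP \<Longrightarrow> \<forall>c. coeff q c \<in> TP \<Longrightarrow> coeff (p * q) c \<in> TP"
  by (simp add: coeff_mult TP_sum TP_mult)

lemma coeff_TP_prod:
  "(\<And>a c. a \<in> A \<Longrightarrow> coeff (f a) c \<in> TP) \<Longrightarrow> coeff (prod f A) c \<in> TP"
proof (induction A arbitrary: c rule: infinite_finite_induct)
  case (insert x F)
  then show ?case by (simp add: coeff_TP_mult)
qed (auto simp: coeff_1)

lemma power_maxid: "P \<in> maxid \<Longrightarrow> 0 < c \<Longrightarrow> P ^ c \<in> maxid"
proof (induction c)
  case (Suc c)
  have "P ^ c \<in> polys" using Suc.prems by (induction c) (simp_all add: polys_mult maxid_polys)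
  then show ?case using Suc.prems by (simp add: maxid_mult)
qed simp

text \<open>
  The only critical case is that of \<open>m + 1\<close> contractions and factors in total, one less than \<open>G_{m+1}\<close> requires. Adding a
  further contraction with \<open>S\<close> in the maximal ideal yields, by \<open>eh_update_decomp\<close>, a relation
  $\sum_l S(x_l, y_l) \zeta_l \in G_{m+1}$ with \<open>\<zeta>_l\<close> independent of \<open>S\<close>. The powers of \<open>x\<close> are such \<open>S\<close>; the
  polynomial $p(X) = \prod_k x_k - \prod_k (x_k - X)$ has no constant term and takes the value $\prod_k x_k$ at every \<open>x_l\<close>, so
  $\prod_k x_k \sum_l \zeta_l$ lies in $G_{m+1}$. Finally \<open>\<Sum>\<^sub>l \<zeta>_l\<close> is \<open>m + 1\<close> times the contraction.
\<close>

lemma tau_eps_in_Gsub: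
  assumes r: "2 \<le> r" and Rs: "set Rs \<subseteq> maxid" and qs: "valid r qs" and m: "m < length Rs + length qs"
  shows "tau (eps (qq m) Rs (bprod qs)) \<in> Gsub r (Suc m)"
proof -
  define ks where "ks = map fst qs"
  define n where "n = length ks"
  define d where "d = length Rs"
  define G where "G = (\<Prod>l<n. zz l (snd (qs ! l)))"
  define x :: laurent where "x = xpow 1"
  let ?X = "\<Prod>l<n. zz l x"
  let ?eh = "eh (qh (Suc m) n)"
  have n: "n = length qs" by (simp add: n_def ks_def)
  have ks: "\<forall>k\<in>set ks. 1 \<le> k \<and> k < r" using qs by (auto simp: ks_def valid_def)
  have x: "x \<in> maxid" by (auto simp: x_def xpow_def zero_prod_def intro!: maxid_single)
  have zx: "zz l x \<in> TP" for l using x by (simp add: TP_zz maxid_polys)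
  have G: "G \<in> TP" using valid_nth[OF qs] by (auto simp: G_def n intro!: TP_prod TP_zz)
  have "tau (eps (qq m) Rs (bprod qs)) = UU ks (?X * (eh (qh m n) Rs * G))"
    by (simp add: bprod_UU eps_UU tau_UU ks_def G_def n x_def)
  also have "eh (qh m n) Rs = ?eh Rs" by (rule eh_maxid_indep[OF Rs])
  finally have eq: "tau (eps (qq m) Rs (bprod qs)) = UU ks (?X * (?eh Rs * G))" .
  have mem: "UU ks (?eh Rs' * F) \<in> Gsub r (Suc m)" if "set Rs' \<subseteq> maxid" "F \<in> TP" "Suc m < length Rs' + n" for Rs' F
    using UU_eh_in_Gsub[OF r ks that(1,2)] that(3) by (simp add: n_def)
  show ?thesis
  proof (cases "Suc m < d + n")
    case True
    then have "UU ks (?eh Rs * (?X * G)) \<in> Gsub r (Suc m)"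
      using zx G by (intro mem Rs TP_mult TP_prod) (simp_all add: d_def)
    then show ?thesis by (simp add: eq ac_simps)
  next
    case False
    then have dn: "d + n = Suc m" using m by (simp add: n d_def)
    have "\<forall>i\<in>{..<d}. \<exists>\<eta>. (\<forall>l. \<eta> l \<in> TP) \<and> (\<forall>S\<in>polys. ?eh (Rs[i := Rs ! i * S]) = (\<Sum>l<n. zz l S * \<eta> l))"
      using eh_update_decomp[OF Rs] by (simp add: d_def)
    then obtain \<eta> where \<eta>: "\<And>i l. i < d \<Longrightarrow> \<eta> i l \<in> TP"
      "\<And>i S. i < d \<Longrightarrow> S \<in> polys \<Longrightarrow> ?eh (Rs[i := Rs ! i * S]) = (\<Sum>l<n. zz l S * \<eta> i l)"
      unfolding bchoice_iff by auto
    define \<zeta> where "\<zeta> l = ?eh Rs + (\<Sum>i<d. \<eta> i l)" for l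
    have \<zeta>: "\<zeta> l \<in> TP" for l
      using \<eta>(1) by (auto simp: \<zeta>_def intro!: TP_add TP_sum eh_TP Rs)
    have rel: "UU ks ((\<Sum>l<n. zz l S * \<zeta> l) * F) \<in> Gsub r (Suc m)" if S: "S \<in> maxid" and F: "F \<in> TP" for S F
    proof -
      have "?eh (S # Rs) = - (\<Sum>l<n. zz l S) * ?eh Rs - (\<Sum>i<d. \<Sum>l<n. zz l S * \<eta> i l)"
        using S by (simp add: eh_Cons qh_maxid \<eta>(2) maxid_polys d_def)
      also have "(\<Sum>i<d. \<Sum>l<n. zz l S * \<eta> i l) = (\<Sum>l<n. \<Sum>i<d. zz l S * \<eta> i l)"
        by (rule sum.swap)
      also have "- (\<Sum>l<n. zz l S) * ?eh Rs - \<dots> = - (\<Sum>l<n. zz l S * \<zeta> l)"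
        by (simp add: \<zeta>_def distrib_left sum.distrib sum_distrib_left sum_distrib_right)
      finally have "UU ks (?eh (S # Rs) * - F) = UU ks ((\<Sum>l<n. zz l S * \<zeta> l) * F)" by simp
      moreover have "UU ks (?eh (S # Rs) * - F) \<in> Gsub r (Suc m)"
        using S F Rs dn by (intro mem TP_uminus) (auto simp: d_def)
      ultimately show ?thesis by simp
    qed
    \<comment> \<open>The coefficient 0 vanishes, and every \<open>zz l x\<close> is a root of the subtracted product.\<close>
    let ?p = "[:?X:] - (\<Prod>k<n. [:zz k x, -1:])"
    have p0: "coeff ?p 0 = 0"
      by (simp add: poly_prod flip: poly_0_coeff_0)
    have pc: "coeff ?p c \<in> TP" for c
    proof -
      have "coeff [:zz k x, -1:] c \<in> TP" for k c
        using zx by (auto simp: coeff_pCons TP_uminus split: nat.split)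
      then have "coeff (\<Prod>k<n. [:zz k x, -1:]) c \<in> TP" by (intro coeff_TP_prod)
      moreover have "coeff [:?X:] c \<in> TP"
        using zx by (auto simp: coeff_pCons intro!: TP_prod split: nat.split)
      ultimately show ?thesis by (simp add: TP_diff)
    qed
    have "poly ?p (zz l x) = ?X" if "l < n" for l
    proof -
      have "(\<Prod>k<n. zz k x - zz l x) = 0" using that by (intro prod_zero) auto
      then show ?thesis by (simp add: poly_prod)
    qed
    then have "UU ks ((\<Sum>l<n. ?X * \<zeta> l) * G) = UU ks ((\<Sum>l<n. poly ?p (zz l x) * \<zeta> l) * G)"
      by simp
    also have "(\<Sum>l<n. poly ?p (zz l x) * \<zeta> l) = (\<Sum>l<n. \<Sum>c\<le>degree ?p. coeff ?p c * zz l x ^ c * \<zeta> l)"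
      unfolding poly_altdef[of ?p] by (simp only: sum_distrib_right)
    also have "\<dots> = (\<Sum>c\<le>degree ?p. \<Sum>l<n. coeff ?p c * zz l x ^ c * \<zeta> l)"
      by (rule sum.swap)
    also have "UU ks (\<dots> * G) = (\<Sum>c\<le>degree ?p. UU ks ((\<Sum>l<n. zz l (x ^ c) * \<zeta> l) * (coeff ?p c * G)))"
      by (simp add: clin_sum[OF clin_UU, symmetric] sum_distrib_left sum_distrib_right zz_power ac_simps)
    also have "\<dots> \<in> Gsub r (Suc m)"
    proof (rule Gsub_sum[OF r])
      fix c
      show "UU ks ((\<Sum>l<n. zz l (x ^ c) * \<zeta> l) * (coeff ?p c * G)) \<in> Gsub r (Suc m)"
      proof (cases "c = 0")
        case True
        then show ?thesis
          using p0 Gsub_zero[OF r] by (simp add: clin_zero[OF clin_UU])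
      next
        case False
        then show ?thesis
          using x by (intro rel power_maxid TP_mult pc G) auto
      qed
    qed
    finally have "UU ks ((\<Sum>l<n. ?X * \<zeta> l) * G) \<in> Gsub r (Suc m)" .
    moreover have "(\<Sum>l<n. ?X * \<zeta> l) * G = scal (of_nat (Suc m)) (?X * (?eh Rs * G))"
    proof -
      have "(\<Sum>l<n. \<Sum>i<d. \<eta> i l) = (\<Sum>i<d. \<Sum>l<n. \<eta> i l)" by (rule sum.swap)
      also have "\<dots> = (\<Sum>i<d. ?eh Rs)"
        using \<eta>(2)[of _ 1] by (intro sum.cong) (auto simp: d_def)
      finally have "(\<Sum>l<n. \<zeta> l) = of_nat (d + n) * ?eh Rs"
        by (simp add: \<zeta>_def sum.distrib distrib_right)
      then show ?thesis
        unfolding dn sum_distrib_left[symmetric] by (simp only: scal_def single_of_nat ac_simps)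
    qed
    ultimately have "scal (inverse (of_nat (Suc m))) (scal (of_nat (Suc m)) (UU ks (?X * (?eh Rs * G)))) \<in> Gsub r (Suc m)"
      by (simp only: Gsub.scal clin_scal[OF clin_UU])
    then show ?thesis by (simp add: eq scal_scal del: of_nat_Suc)
  qed
qed

text \<open>
  \<open>Gsub r m\<close> equals this span. The inclusion needed here holds since the span is closed under raising operators: after
  \<open>ee_eps\<close> the appended entry is split into its value at the origin and an element of the maximal ideal.
\<close>

definition eps_span :: "nat \<Rightarrow> nat \<Rightarrow> sym set" where
  "eps_span r m = scal.span {eps (qq m) Rs (bprod qs) |Rs qs.
     set Rs \<subseteq> maxid \<and> valid r qs \<and> m < length Rs + length qs}"

lemma eps_span_base:
  "set Rs \<subseteq> maxid \<Longrightarrow> valid r qs \<Longrightarrow> m < length Rs + length qs \<Longrightarrow> eps (qq m) Rs (bprod qs) \<in> eps_span r m"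
  unfolding eps_span_def by (rule scal.span_base) blast

text \<open>
  The scalar vanishes when entries and factors together number \<open>m\<close>. This is the borderline case, in which the shorter contraction
  is too short for the span.
\<close>

lemma eps_snoc_const:
  "eps (qq m) (Rs @ [P]) (bprod qs) = eps (qq m) (Rs @ [P - const c]) (bprod qs)
     + scal (c * (of_nat m - of_nat (length qs) - of_nat (length Rs))) (eps (qq m) Rs (bprod qs))"
proof -
  let ?q = "qh m (length qs)" and ?ks = "map fst qs"
  let ?G = "\<Prod>l<length qs. zz l (snd (qs ! l))"
  have qadd: "?q (A + B) = ?q A + ?q B" for A B
    by (simp add: qh_def lookup_add clin_add[OF clin_zz] sum.distrib distrib_left scal_add_left)
  have qscal: "?q (scal c A) = scal c (?q A)" for A
    by (simp add: qh_def lookup_scal clin_scal[OF clin_zz] scal.scale_sum_right scal_diff_right scal_scal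
       mult.left_commute)
  have q1: "?q 1 = scal (of_nat m - of_nat (length qs)) 1"
    by (simp add: qh_def scal.scale_left_diff_distrib) (simp add: scal_def)
  have "eh ?q (Rs @ [P]) = eh ?q ((P - const c + scal c 1) # Rs)"
    by (simp add: eh_snoc scal_def const_def)
  also have "\<dots> = eh ?q (Rs @ [P - const c]) + eh ?q ((1 # Rs)[0 := scal c 1])"
    by (simp add: eh_Cons_add[of ?q, OF qadd] eh_snoc)
  also have "eh ?q ((1 # Rs)[0 := scal c 1]) = scal c (eh ?q (1 # Rs))"
    by (subst eh_update_scal[where q = ?q and c = c, OF qscal]) simp_all
  also have "eh ?q (1 # Rs) = scal (of_nat m - of_nat (length qs) - of_nat (length Rs)) (eh ?q Rs)"
    unfolding eh_Cons_one q1
    by (simp add: scal.scale_left_diff_distrib left_diff_distrib scal_mult_left) (simp add: scal_def left_diff_distrib)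
  finally show ?thesis
    by (simp add: bprod_UU[of qs] eps_UU[where ks = ?ks, simplified] distrib_right clin_add[OF clin_UU] scal_mult_left
      clin_scal[OF clin_UU] scal_scal)
qed

lemma Gsub_subset_eps_span:
  assumes r: "2 \<le> r" and u: "u \<in> Gsub r m"
  shows "u \<in> eps_span r m"
  using u
proof (induction rule: Gsub.induct)
  case (gen qs)
  then show ?case using eps_span_base[of "[]" r qs m] by simp
next
  case (ee u j R)
  have "ee m j R (eps (qq m) Rs (bprod qs)) \<in> eps_span r m"
    if Rs: "set Rs \<subseteq> maxid" and qs: "valid r qs" and m: "m < length Rs + length qs" for Rs qs
  proof -
    have "eps (qq m) (Rs @ [R * snd (qs ! l)]) (bprod (remv l qs)) \<in> eps_span r m" if l: "l < length qs" for l
    proof -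
      let ?P = "R * snd (qs ! l)" and ?qs = "remv l qs"
      let ?c = "Poly_Mapping.lookup ?P 0"
      have P: "?P \<in> polys" using valid_nth[OF qs l] ee by (simp add: polys_mult)
      then have P': "?P - const ?c \<in> maxid"
        using polys_diff[OF P polys_const] by (simp add: maxid_def lookup_minus const_def)
      have "eps (qq m) (Rs @ [?P - const ?c]) (bprod ?qs) \<in> eps_span r m"
        using Rs P' qs m l by (intro eps_span_base) (auto simp: length_remv valid_remv)
      moreover have "scal (?c * (of_nat m - of_nat (length ?qs) - of_nat (length Rs))) (eps (qq m) Rs (bprod ?qs)) \<in> eps_span r m"
      proof (cases "m < length Rs + length ?qs")
        case True
        then have "eps (qq m) Rs (bprod ?qs) \<in> eps_span r m"
          by (intro eps_span_base Rs valid_remv qs)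
        then show ?thesis by (simp add: eps_span_def scal.span_scale)
      next
        case False
        then have "m = length Rs + length ?qs" using m l by (simp add: length_remv)
        then show ?thesis by (simp add: eps_span_def scal.span_zero)
      qed
      ultimately show ?thesis
        unfolding eps_snoc_const[of m Rs ?P ?qs ?c] eps_span_def by (rule scal.span_add)
    qed
    moreover have "set Rs \<subseteq> polys" using Rs by (auto simp: maxid_polys)
    ultimately show ?thesis
      using qs ee by (subst ee_eps[of _ r]) (auto simp: eps_span_def intro!: scal.span_sum scal.span_zero)
  qed
  note * = this
  from ee.IH show ?case
    unfolding eps_span_def
  proof (induction rule: scal.span_induct_alt)
    case base
    then show ?case by (simp add: clin_zero[OF clin_ee] scal.span_zero)
  next
    case (step c x y)
    then show ?case using *
      by (auto simp: eps_span_def clin_add[OF clin_ee] clin_scal[OF clin_ee] intro!: scal.span_add scal.span_scale)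
  qed
qed (simp_all add: eps_span_def scal.span_add scal.span_scale)

theorem tau_Gsub:
  assumes r: "2 \<le> r" and u: "u \<in> Gsub r m"
  shows "tau u \<in> Gsub r (Suc m)"
  using Gsub_subset_eps_span[OF r u] unfolding eps_span_def
proof (induction rule: scal.span_induct_alt)
  case base
  then show ?case by (simp add: clin_zero[OF clin_tau] Gsub_zero[OF r])
next
  case (step c x y)
  then show ?case
    using tau_eps_in_Gsub[OF r] by (auto simp: clin_add[OF clin_tau] clin_scal[OF clin_tau] Gsub.add Gsub.scal)
qed

lemma tau_S0: "u \<in> S0 r \<Longrightarrow> tau u \<in> S0 r"
  by (induction rule: S0.induct)
    (simp_all add: clin_add[OF clin_tau] clin_scal[OF clin_tau] tau_mult tau_bb S0.intros polys_mult polys_xpow)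

section \<open>Modules over sl_r[x, y]\<close>

abbreviation slp :: "nat \<Rightarrow> laurent mat set" where
  "slp r \<equiv> sl_over r polys"

lemma slp_gl: "X \<in> slp r \<Longrightarrow> X \<in> gl_poly r"
  by (auto simp: sl_over_def gl_poly_def)

lemma slp_carrier: "X \<in> slp r \<Longrightarrow> X \<in> carrier_mat r r"
  by (auto simp: sl_over_def)

lemma Emat_slp: "P \<in> polys \<Longrightarrow> i \<noteq> j \<Longrightarrow> Emat r i j P \<in> slp r"
  by (auto simp: sl_over_def mat_trace_def intro!: sum.neutral)

lemma slp_add: "X \<in> slp r \<Longrightarrow> Y \<in> slp r \<Longrightarrow> X + Y \<in> slp r"
  by (auto simp: sl_over_def mat_trace_def sum.distrib polys_add)

lemma mat_trace_bracket:
  assumes "X \<in> carrier_mat r r" "Y \<in> carrier_mat r r"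
  shows "mat_trace (mat_bracket X Y) = 0"
proof -
  have "dim_row (mat_bracket X Y) = r" using carrier_matD[OF mat_bracket_carrier[OF assms]] by simp
  then have "mat_trace (mat_bracket X Y) = (\<Sum>i<r. \<Sum>k<r. X $$ (i, k) * Y $$ (k, i)) - (\<Sum>i<r. \<Sum>k<r. Y $$ (i, k) * X $$ (k, i))"
    using assms by (simp add: mat_trace_def mat_bracket_index sum_subtractf)
  also have "(\<Sum>i<r. \<Sum>k<r. Y $$ (i, k) * X $$ (k, i)) = (\<Sum>k<r. \<Sum>i<r. Y $$ (i, k) * X $$ (k, i))"
    by (rule sum.swap)
  finally show ?thesis by (simp add: mult.commute)
qed

lemma slp_bracket: "X \<in> slp r \<Longrightarrow> Y \<in> slp r \<Longrightarrow> mat_bracket X Y \<in> slp r"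
  using gl_poly_bracket[OF slp_gl slp_gl, of X r Y] mat_trace_bracket[of X r Y]
  by (auto simp: sl_over_def gl_poly_def)

lemma slp_smult: "X \<in> slp r \<Longrightarrow> const c \<cdot>\<^sub>m X \<in> slp r"
  by (auto simp: sl_over_def mat_trace_def polys_mult sum_distrib_left[symmetric])

text \<open>
  The matrices $(E_{ii} - E_{00}) \otimes P$ span the diagonal part. Note the sign: \<open>hmat r i (-1)\<close> is the coroot of the triple
  formed by \<open>e_i(1)\<close> and \<open>f_i(1)\<close>.
\<close>

definition hmat :: "nat \<Rightarrow> nat \<Rightarrow> laurent \<Rightarrow> laurent mat" where
  "hmat r i P = Emat r i i P + Emat r 0 0 (- P)"

lemma hmat_carrier [simp]: "hmat r i P \<in> carrier_mat r r"
  by (simp add: hmat_def)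

lemma hmat_dim [simp]: "dim_row (hmat r i P) = r" "dim_col (hmat r i P) = r"
  by (simp_all add: hmat_def)

lemma hmat_index [simp]: "a < r \<Longrightarrow> b < r \<Longrightarrow>
  hmat r i P $$ (a, b) = (if a = i \<and> b = i then P else 0) + (if a = 0 \<and> b = 0 then - P else 0)"
  by (simp add: hmat_def)

lemma hmat_slp: "P \<in> polys \<Longrightarrow> 0 < r \<Longrightarrow> i < r \<Longrightarrow> hmat r i P \<in> slp r"
  by (auto simp: sl_over_def mat_trace_def sum.distrib polys_uminus)

lemma hmat_tensor: 
  assumes "0 < i" "i < r"
  shows "hmat r i P = tensor (elem_mat r i i - elem_mat r 0 0) P" "elem_mat r i i - elem_mat r 0 0 \<in> cartan r"
proof -
  have "const (-1) = -1" by (simp add: const_def single_uminus)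
  then show "hmat r i P = tensor (elem_mat r i i - elem_mat r 0 0) P"
    by (intro eq_matI) (use assms in \<open>auto simp: tensor_def elem_mat_def const_one const_zero hmat_index\<close>)
  show "elem_mat r i i - elem_mat r 0 0 \<in> cartan r"
    using assms by (auto simp: cartan_def elem_mat_def mat_trace_def sum_subtractf)
qed

lemma slp_additive_decomp:
  fixes \<Phi> :: "laurent mat \<Rightarrow> 'v::ab_group_add"
  assumes r: "0 < r" and add: "\<And>X Y. X \<in> slp r \<Longrightarrow> Y \<in> slp r \<Longrightarrow> \<Phi> (X + Y) = \<Phi> X + \<Phi> Y"
    and X: "X \<in> slp r"
  shows "\<Phi> X = (\<Sum>(i, j)\<in>{(i, j). i < r \<and> j < r \<and> i \<noteq> j}. \<Phi> (Emat r i j (X $$ (i, j))))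
    + (\<Sum>i\<in>{1..<r}. \<Phi> (hmat r i (X $$ (i, i))))"
proof -
  have Xe: "X $$ (i, j) \<in> polys" if "i < r" "j < r" for i j using X that by (simp add: sl_over_def)
  have z: "0\<^sub>m r r \<in> slp r" by (simp add: sl_over_def mat_trace_def)
  then have z0: "\<Phi> (0\<^sub>m r r) = 0" using add[OF z z] by simp
  let ?I = "{(i, j). i < r \<and> j < r \<and> i \<noteq> j}"
  let ?off = "\<lambda>A. mat r r (\<lambda>p. if p \<in> A then X $$ p else 0)"
  have finI: "finite ?I" by (rule finite_subset[of _ "{..<r} \<times> {..<r}"]) auto
  have off: "A \<subseteq> ?I \<Longrightarrow> ?off A \<in> slp r \<and> \<Phi> (?off A) = (\<Sum>(i, j)\<in>A. \<Phi> (Emat r i j (X $$ (i, j))))" if "finite A" for A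
    using that
  proof (induction A rule: finite_induct)
    case empty
    have "?off {} = 0\<^sub>m r r" by (rule eq_matI) auto
    then show ?case using z z0 by simp
  next
    case (insert p A)
    obtain i j where p: "p = (i, j)" "i < r" "j < r" "i \<noteq> j" using insert by auto
    have E: "Emat r i j (X $$ (i, j)) \<in> slp r" using p Xe by (intro Emat_slp) auto
    have "?off (insert p A) = Emat r i j (X $$ (i, j)) + ?off A"
      using insert p by (intro eq_matI) auto
    then show ?case using insert E p by (auto simp: add slp_add)
  qed
  let ?dg = "\<lambda>B. mat r r (\<lambda>(i, j). if i = j then (if i = 0 then - (\<Sum>k\<in>B. X $$ (k, k)) else if i \<in> B then X $$ (i, i) else 0) else 0)"
  have dg: "B \<subseteq> {1..<r} \<Longrightarrow> ?dg B \<in> slp r \<and> \<Phi> (?dg B) = (\<Sum>i\<in>B. \<Phi> (hmat r i (X $$ (i, i))))" if "finite B" for B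
    using that
  proof (induction B rule: finite_induct)
    case empty
    have "?dg {} = 0\<^sub>m r r" by (rule eq_matI) auto
    then show ?case using z z0 by simp
  next
    case (insert i B)
    have i: "0 < i" "i < r" using insert by auto
    have E: "hmat r i (X $$ (i, i)) \<in> slp r" using i Xe r by (intro hmat_slp) auto
    have "?dg (insert i B) = hmat r i (X $$ (i, i)) + ?dg B"
      using insert i by (intro eq_matI) (auto simp: hmat_index)
    then show ?case using insert E i by (auto simp: add slp_add)
  qed
  have tr: "X $$ (0, 0) = - (\<Sum>k\<in>{1..<r}. X $$ (k, k))"
  proof -
    have "(\<Sum>k<r. X $$ (k, k)) = 0" using X by (auto simp: sl_over_def mat_trace_def)
    then show ?thesis using sum_first[OF r, of "\<lambda>k. X $$ (k, k)"] by (simp add: eq_neg_iff_add_eq_0)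
  qed
  have "X = ?off ?I + ?dg {1..<r}"
    using slp_carrier[OF X] tr by (intro eq_matI) auto
  then show ?thesis
    using off[OF finI] dg[of "{1..<r}"] add by (metis (no_types, lifting) finite_atLeastLessThan subset_refl)
qed

locale slmod =
  fixes r :: nat and sc :: "complex \<Rightarrow> 'v::ab_group_add \<Rightarrow> 'v" and V :: "'v set"
    and act :: "laurent mat \<Rightarrow> 'v \<Rightarrow> 'v"
  assumes r2: "2 \<le> r" and lm: "is_lie_module (sl_poly r) sc V act"
begin

lemma vs: "vector_space sc" using lm by (simp add: is_lie_module_def)

sublocale vector_space sc by (rule vs)

lemma sub: "subspace V" using lm by (simp add: is_lie_module_def)

lemma V_zero: "0 \<in> V" using sub by (rule subspace_0)
lemma V_add: "u \<in> V \<Longrightarrow> v \<in> V \<Longrightarrow> u + v \<in> V" using sub by (rule subspace_add)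
lemma V_diff: "u \<in> V \<Longrightarrow> v \<in> V \<Longrightarrow> u - v \<in> V" using sub by (rule subspace_diff)
lemma V_scale: "v \<in> V \<Longrightarrow> sc c v \<in> V" using sub by (rule subspace_scale)
lemma carr [simp]: "lcarrier (sl_poly r) = slp r" by (simp add: sl_poly_def)

lemma act_closed: "X \<in> slp r \<Longrightarrow> v \<in> V \<Longrightarrow> act X v \<in> V"
  using lm by (simp add: is_lie_module_def)

lemma act_add: "X \<in> slp r \<Longrightarrow> u \<in> V \<Longrightarrow> v \<in> V \<Longrightarrow> act X (u + v) = act X u + act X v"
  using lm by (simp add: is_lie_module_def)

lemma act_scale: "X \<in> slp r \<Longrightarrow> v \<in> V \<Longrightarrow> act X (sc c v) = sc c (act X v)"
  using lm by (simp add: is_lie_module_def)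

lemma act_zero: "X \<in> slp r \<Longrightarrow> act X 0 = 0"
  using act_scale[OF _ V_zero, of X 0] by simp

lemma act_ladd: "X \<in> slp r \<Longrightarrow> Y \<in> slp r \<Longrightarrow> v \<in> V \<Longrightarrow> act (X + Y) v = act X v + act Y v"
  using lm by (simp add: is_lie_module_def sl_poly_def)

lemma act_lscale: "X \<in> slp r \<Longrightarrow> v \<in> V \<Longrightarrow> act (const c \<cdot>\<^sub>m X) v = sc c (act X v)"
  using lm by (simp add: is_lie_module_def sl_poly_def)

lemma act_bracket: "X \<in> slp r \<Longrightarrow> Y \<in> slp r \<Longrightarrow> v \<in> V \<Longrightarrow>
    act (mat_bracket X Y) v = act X (act Y v) - act Y (act X v)"
  using lm by (simp add: is_lie_module_def sl_poly_def)

lemma act_decomp: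
  assumes "X \<in> slp r" "v \<in> V"
  shows "act X v = (\<Sum>(i, j)\<in>{(i, j). i < r \<and> j < r \<and> i \<noteq> j}. act (Emat r i j (X $$ (i, j))) v)
    + (\<Sum>i\<in>{1..<r}. act (hmat r i (X $$ (i, i))) v)"
  by (rule slp_additive_decomp[of r "\<lambda>X. act X v" X]) (use assms r2 in \<open>auto simp: act_ladd\<close>)

lemma act_Emat_add: "P \<in> polys \<Longrightarrow> Q \<in> polys \<Longrightarrow> i \<noteq> j \<Longrightarrow> v \<in> V \<Longrightarrow>
    act (Emat r i j (P + Q)) v = act (Emat r i j P) v + act (Emat r i j Q) v"
proof -
  assume *: "P \<in> polys" "Q \<in> polys" "i \<noteq> j" "v \<in> V"
  have "Emat r i j (P + Q) = Emat r i j P + Emat r i j Q" by (rule eq_matI) auto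
  then show ?thesis using * by (simp add: act_ladd Emat_slp)
qed

lemma act_Emat_scal: "P \<in> polys \<Longrightarrow> i \<noteq> j \<Longrightarrow> v \<in> V \<Longrightarrow>
    act (Emat r i j (scal c P)) v = sc c (act (Emat r i j P) v)"
proof -
  assume *: "P \<in> polys" "i \<noteq> j" "v \<in> V"
  have "Emat r i j (scal c P) = const c \<cdot>\<^sub>m Emat r i j P" by (rule eq_matI) (auto simp: const_mult_eq_scal)
  then show ?thesis using * by (simp add: act_lscale Emat_slp)
qed

lemma act_Emat_zero: "i \<noteq> j \<Longrightarrow> v \<in> V \<Longrightarrow> act (Emat r i j 0) v = 0"
  using act_Emat_scal[of 0 i j v 0] by simp

lemma act_Emat_sum: 
  assumes "i \<noteq> j" "v \<in> V" "\<And>a. a \<in> A \<Longrightarrow> f a \<in> polys"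
  shows "act (Emat r i j (sum f A)) v = (\<Sum>a\<in>A. act (Emat r i j (f a)) v)"
  using assms(3) by (induction A rule: infinite_finite_induct) (simp_all add: assms act_Emat_zero act_Emat_add polys_sum)

end

text \<open>
  Otherwise all $f^n w$ with \<open>n > k\<close> would be nonzero and independent, because \<open>e\<close> maps each of them except the first to a nonzero multiple
  of its predecessor, and the first one to 0.
\<close>

lemma sl2_lowering_vanishes:
  fixes sc :: "complex \<Rightarrow> 'v::ab_group_add \<Rightarrow> 'v"
  assumes vs: "vector_space sc" and sub: "module.subspace sc V" and fd: "finite_dim sc V"
    and e: "\<And>v. v \<in> V \<Longrightarrow> e v \<in> V" "\<And>u v. u \<in> V \<Longrightarrow> v \<in> V \<Longrightarrow> e (u + v) = e u + e v"
      "\<And>c v. v \<in> V \<Longrightarrow> e (sc c v) = sc c (e v)"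
    and f: "\<And>v. v \<in> V \<Longrightarrow> f v \<in> V" "\<And>c v. v \<in> V \<Longrightarrow> f (sc c v) = sc c (f v)"
    and ef: "\<And>v. v \<in> V \<Longrightarrow> e (f v) = f (e v) + h v"
    and hf: "\<And>v. v \<in> V \<Longrightarrow> h (f v) = f (h v) - sc 2 (f v)"
    and w: "w \<in> V" "e w = 0" "h w = sc (of_nat k) w"
  shows "(f ^^ Suc k) w = 0"
proof (rule ccontr)
  assume nz: "(f ^^ Suc k) w \<noteq> 0"
  interpret vector_space sc by (rule vs)
  define v where "v n = (f ^^ n) w" for n
  have vV: "v n \<in> V" for n by (induction n) (simp_all add: v_def w f)
  have vS: "v (Suc n) = f (v n)" for n by (simp add: v_def)
  have hv: "h (v n) = sc (of_nat k - 2 * of_nat n) (v n)" for n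
  proof (induction n)
    case (Suc n)
    have "h (v (Suc n)) = f (h (v n)) - sc 2 (f (v n))" by (simp add: vS hf[OF vV])
    also have "\<dots> = sc (of_nat k - 2 * of_nat n) (v (Suc n)) - sc 2 (v (Suc n))"
      by (simp add: Suc vS f(2)[OF vV])
    finally show ?case by (simp add: algebra_simps flip: scale_left_diff_distrib)
  qed (simp add: v_def w)
  have ev: "e (v (Suc n)) = sc (of_nat (Suc n) * (of_nat k - of_nat n)) (v n)" for n
  proof (induction n)
    case 0
    have "f 0 = 0" using f(2)[OF w(1), of 0] by simp
    then show ?case using ef[OF w(1)] w by (simp add: v_def)
  next
    case (Suc n)
    have "e (v (Suc (Suc n))) = f (e (v (Suc n))) + h (v (Suc n))" by (simp only: vS[of "Suc n"] ef[OF vV])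
    also have "\<dots> = sc (of_nat (Suc n) * (of_nat k - of_nat n)) (v (Suc n)) + sc (of_nat k - 2 * of_nat (Suc n)) (v (Suc n))"
      unfolding Suc hv f(2)[OF vV] vS[symmetric] ..
    finally show ?case by (simp add: algebra_simps flip: scale_left_distrib)
  qed
  have nzv: "v (Suc k + n) \<noteq> 0" for n
  proof (induction n)
    case 0
    then show ?case using nz by (simp add: v_def)
  next
    case (Suc n)
    have "e 0 = 0" using e(3)[OF w(1), of 0] by simp
    moreover have "of_nat (Suc (Suc k + n)) * (of_nat k - of_nat (Suc k + n)) \<noteq> (0 :: complex)"
      by (simp del: of_nat_Suc)
    ultimately show ?case using ev[of "Suc k + n"] Suc by auto
  qed
  have indep: "independent {v (Suc k + i) |i. i < n} \<and> card {v (Suc k + i) |i. i < n} = n \<and>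
     (\<forall>u\<in>span {v (Suc k + i) |i. i < n}. u \<in> V \<and> (e ^^ n) u = 0)" for n
  proof (induction n)
    case 0
    have "span {} = {0 :: 'v}" by simp
    then show ?case using sub by (simp add: subspace_0 independent_empty)
  next
    case (Suc n)
    let ?S = "\<lambda>n. {v (Suc k + i) |i. i < n}"
    have S: "?S (Suc n) = insert (v (Suc k + n)) (?S n)" by (auto simp: less_Suc_eq)
    have top: "\<exists>c. c \<noteq> 0 \<and> (e ^^ j) (v (Suc k + n)) = sc c (v (Suc k + (n - j)))" if "j \<le> n" for j
      using that
    proof (induction j)
      case 0
      show ?case by (rule exI[of _ 1]) simp
    next
      case (Suc j)
      then obtain c where c: "c \<noteq> 0" "(e ^^ j) (v (Suc k + n)) = sc c (v (Suc k + (n - j)))" by auto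
      obtain i where i: "n - j = Suc i" "n - Suc j = i" using Suc.prems by (metis Suc_diff_Suc Suc_le_lessD)
      have "(e ^^ Suc j) (v (Suc k + n)) = sc c (e (v (Suc (Suc k + i))))" using c i e(3)[OF vV] by simp
      also have "\<dots> = sc (c * (of_nat (Suc (Suc k + i)) * (of_nat k - of_nat (Suc k + i)))) (v (Suc k + i))"
        by (simp add: ev)
      finally have "(e ^^ Suc j) (v (Suc k + n)) = sc (c * (of_nat (Suc (Suc k + i)) * (of_nat k - of_nat (Suc k + i)))) (v (Suc k + (n - Suc j)))"
        using i by simp
      moreover have "of_nat (Suc (Suc k + i)) * (of_nat k - of_nat (Suc k + i)) \<noteq> (0 :: complex)"
        by (simp del: of_nat_Suc)
      ultimately show ?case using c(1) by (metis mult_eq_0_iff)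
    qed
    obtain c where c: "c \<noteq> 0" "(e ^^ n) (v (Suc k + n)) = sc c (v (Suc k))" using top[of n] by auto
    have nn: "(e ^^ n) (v (Suc k + n)) \<noteq> 0" using c nzv[of 0] by simp
    then have notin: "v (Suc k + n) \<notin> span (?S n)" using Suc by blast
    have fin: "finite (?S n)" by simp
    have e0: "e (v (Suc k)) = 0" using ev[of k] by simp
    have kill: "u \<in> V \<and> (e ^^ Suc n) u = 0" if u: "u \<in> span (?S (Suc n))" for u
    proof -
      obtain d where d: "u - sc d (v (Suc k + n)) \<in> span (?S n)"
        using u unfolding S span_breakdown_eq by blast
      let ?u = "u - sc d (v (Suc k + n))" and ?a = "sc d (v (Suc k + n))"
      have a: "?a \<in> V" using vV sub by (simp add: subspace_scale)
      have u': "?u \<in> V" "(e ^^ n) ?u = 0" using Suc d by blast+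
      have eadd: "x \<in> V \<Longrightarrow> y \<in> V \<Longrightarrow> (e ^^ j) x \<in> V \<and> (e ^^ j) y \<in> V \<and> (e ^^ j) (x + y) = (e ^^ j) x + (e ^^ j) y" for j x y
        by (induction j) (auto simp: e)
      have escl: "x \<in> V \<Longrightarrow> (e ^^ j) x \<in> V \<and> (e ^^ j) (sc b x) = sc b ((e ^^ j) x)" for j x b
        by (induction j) (auto simp: e)
      have uu: "u = ?u + ?a" by simp
      then have "u \<in> V" using subspace_add[OF sub u'(1) a] by simp
      moreover have "(e ^^ n) u = (e ^^ n) ?a"
        using eadd[OF u'(1) a, of n] u'(2) uu by simp
      then have "(e ^^ Suc n) u = e (sc d (sc c (v (Suc k))))"
        using escl[OF vV[of "Suc k + n"], of n d] c by simp
      ultimately show ?thesis using e(3)[OF vV] e0 by simp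
    qed
    have ni: "v (Suc k + n) \<notin> ?S n" using notin by (rule contrapos_nn) (rule span_base)
    have i: "independent (?S n)" "card (?S n) = n" using Suc by blast+
    have "independent (?S (Suc n))" unfolding S by (rule independent_insertI[OF notin i(1)])
    moreover have "card (?S (Suc n)) = Suc n" unfolding S card_insert_disjoint[OF fin ni] i(2) ..
    ultimately show ?case using kill by blast
  qed
  obtain B where B: "finite B" "V = span B" using fd unfolding finite_dim_def by blast
  have "{v (Suc k + i) |i. i < Suc (card B)} \<subseteq> span B" using vV B by auto
  from independent_span_bound[OF B(1) _ this] indep[of "Suc (card B)"] show False by auto
qed

section \<open>Weyl modules are quotients of the symmetric algebra\<close>

lemma mat_bracket_EmatI:
  assumes "X \<in> carrier_mat r r" "Z \<in> carrier_mat r r" "k < r" "l < r"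
    "\<And>a b. a < r \<Longrightarrow> b < r \<Longrightarrow>
      Z $$ (a, b) = (if b = l then X $$ (a, k) * Q else 0) - (if a = k then Q * X $$ (l, b) else 0)"
  shows "mat_bracket X (Emat r k l Q) = Z"
proof (rule eq_matI)
  have B: "mat_bracket X (Emat r k l Q) \<in> carrier_mat r r" using assms by simp
  show "dim_row (mat_bracket X (Emat r k l Q)) = dim_row Z" "dim_col (mat_bracket X (Emat r k l Q)) = dim_col Z"
    using carrier_matD[OF B] assms by simp_all
qed (use assms in \<open>simp_all add: mat_bracket_Emat_index\<close>)

context slmod
begin

lemma act_cols_commute:
  assumes "1 \<le> c" "c < r" "1 \<le> d" "d < r" "P \<in> polys" "Q \<in> polys" "v \<in> V"
  shows "act (Emat r c 0 P) (act (Emat r d 0 Q) v) = act (Emat r d 0 Q) (act (Emat r c 0 P) v)"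
proof -
  have "mat_bracket (Emat r c 0 P) (Emat r d 0 Q) = Emat r 1 0 0"
    by (rule mat_bracket_EmatI) (use assms r2 in auto)
  moreover have "act (Emat r 1 0 0) v = 0" using assms by (intro act_Emat_zero) auto
  moreover have "Emat r c 0 P \<in> slp r" "Emat r d 0 Q \<in> slp r"
    using assms by (auto intro: Emat_slp)
  ultimately show ?thesis using act_bracket[of "Emat r c 0 P" "Emat r d 0 Q" v] assms by simp
qed

text \<open>
  Defined on the whole ambient space, with the identity outside of \<open>V\<close>, and zero for symbols that do not belong to the symmetric
  algebra, so that these operators commute without restriction and can be folded over multisets.
\<close>

definition F :: "gen \<Rightarrow> 'v \<Rightarrow> 'v" where
  "F t v = (if v \<in> V then
      (if 1 \<le> fst t \<and> fst t < r \<and> 0 \<le> fst (snd t) then act (Emat r (fst t) 0 (mono1 (snd t))) v else 0)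
    else v)"

lemma F_V: "v \<in> V \<Longrightarrow> F t v \<in> V"
  by (auto simp: F_def V_zero intro!: act_closed Emat_slp polys_single)

lemma F_commute: "F t (F s v) = F s (F t v)"
proof (cases "v \<in> V")
  case True
  show ?thesis
    using True F_V[OF True, of t] F_V[OF True, of s]
    unfolding F_def
    by (auto simp: act_cols_commute polys_single act_zero Emat_slp)
qed (simp add: F_def)

sublocale F: comp_fun_commute F
  by unfold_locales (simp add: fun_eq_iff F_commute)

end

locale weyl_quotient = slmod +
  fixes m :: nat and w :: 'a
  assumes quot: "is_weyl_quotient r m sc V act w"
begin

lemma fd: "finite_dim sc V" and gen: "is_generated_by (sl_poly r) sc V act w"
  and wV: "w \<in> V"
  using quot by (auto simp: is_weyl_quotient_def is_generated_by_def)

lemma cartan_w: "P \<in> polys \<Longrightarrow> h \<in> cartan r \<Longrightarrow>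
    act (tensor h P) w = sc (of_nat m * h $$ (0, 0) * Poly_Mapping.lookup P 0) w"
  using quot by (simp add: is_weyl_quotient_def zero_prod_def)

lemma upper_w: "P \<in> polys \<Longrightarrow> i < j \<Longrightarrow> j < r \<Longrightarrow> act (Emat r i j P) w = 0"
  using quot by (simp add: is_weyl_quotient_def)

lemma hmat_w:
  assumes "P \<in> polys" "0 < i" "i < r"
  shows "act (hmat r i P) w = sc (- (of_nat m * Poly_Mapping.lookup P 0)) w"
proof -
  have "(elem_mat r i i - elem_mat r 0 0) $$ (0, 0) = -1"
    using assms by (simp add: elem_mat_def)
  then show ?thesis
    using assms cartan_w[OF assms(1) hmat_tensor(2)[OF assms(2,3)]] by (simp add: hmat_tensor(1))
qed

text \<open>
  The map from the symmetric algebra to \<open>V\<close> that sends a product of generators to the product of the corresponding lowering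
  operators, applied to the highest weight vector.
\<close>

definition ev :: "sym \<Rightarrow> 'a" where
  "ev = lext sc (fold_mset F w)"

lemma ev_add: "ev (u + v) = ev u + ev v"
  by (simp add: ev_def lext_add[OF vs])

lemma ev_scal: "ev (scal c u) = sc c (ev u)"
  by (simp add: ev_def lext_scal[OF vs])

lemma ev_mono1: "ev (mono1 M) = fold_mset F w M"
  by (simp add: ev_def lext_single[OF vs])

lemma ev_one: "ev 1 = w"
  using ev_mono1[of "{#}"] by simp

lemma ev_zero: "ev 0 = 0" by (simp add: ev_def lext_zero)

lemma ev_uminus: "ev (- u) = - ev u"
  using ev_scal[of "-1" u] by (simp add: scal_minus_left)

lemma ev_diff: "ev (u - v) = ev u - ev v"
  using ev_add[of u "- v"] by (simp add: ev_uminus)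

lemma ev_sum: "ev (sum f A) = (\<Sum>a\<in>A. ev (f a))"
  by (induction A rule: infinite_finite_induct) (simp_all add: ev_zero ev_add)

lemma fold_V: "fold_mset F w M \<in> V"
  by (induction M) (simp_all add: wV F_V)

lemma ev_V: "ev u \<in> V"
proof (induction u rule: poly_mapping_linear_induct)
  case (single k c)
  then show ?case by (simp add: ev_def lext_single[OF vs] V_scale fold_V)
qed (simp add: ev_add V_add)

lemma F_lin: 
  assumes "v \<in> V" "u \<in> V"
  shows "F t (v + u) = F t v + F t u" "F t (sc c v) = sc c (F t v)"
  using assms by (auto simp: F_def V_add V_scale act_add act_scale Emat_slp polys_single)

lemma ev_gen: "ev (mono1 {#t#} * u) = F t (ev u)"
proof (induction u rule: poly_mapping_linear_induct)
  case (single M c)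
  have "Poly_Mapping.single M c = scal c (mono1 M)" by (simp add: scal_single)
  moreover have "mono1 {#t#} * (mono1 M :: sym) = mono1 (add_mset t M)" by (simp add: mult_single)
  ultimately show ?case
    by (simp only: scal_mult_right ev_scal ev_mono1 F.fold_mset_add_mset F_lin[OF fold_V fold_V])
next
  case (add u v)
  then show ?case by (simp add: distrib_left ev_add F_lin ev_V)
qed

lemma ev_bb:
  assumes "1 \<le> c" "c < r" "Q \<in> polys"
  shows "ev (bb c Q * u) = act (Emat r c 0 Q) (ev u)"
proof -
  have c: "c \<noteq> 0" using assms by simp
  have Q: "Q = (\<Sum>k\<in>Poly_Mapping.keys Q. scal (Poly_Mapping.lookup Q k) (mono1 k))"
    by (simp add: scal_single sum_single_lookup)
  have kp: "mono1 k \<in> polys" "0 \<le> fst k" if "k \<in> Poly_Mapping.keys Q" for k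
    using that assms by (auto simp: polys_def)
  have "ev (bb c Q * u) = (\<Sum>k\<in>Poly_Mapping.keys Q. sc (Poly_Mapping.lookup Q k) (F (c, k) (ev u)))"
    by (subst Q) (simp only: bb_sum bb_scal bb_mono1 sum_distrib_right scal_mult_left ev_sum ev_scal ev_gen)
  also have "\<dots> = (\<Sum>k\<in>Poly_Mapping.keys Q. act (Emat r c 0 (scal (Poly_Mapping.lookup Q k) (mono1 k))) (ev u))"
    using assms c kp by (intro sum.cong refl) (simp add: F_def ev_V act_Emat_scal)
  also have "\<dots> = act (Emat r c 0 Q) (ev u)"
    using kp by (subst (3) Q) (simp add: act_Emat_sum[OF c ev_V] polys_scal)
  finally show ?thesis .
qed

text \<open>
  For \<open>P = 1\<close> this is the $sl_2$-theory of a vector of weight 0 for the coroot of the positions \<open>j, i\<close>; the general case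
  follows by a commutator with a diagonal matrix.
\<close>

lemma lower_block_w:
  assumes P: "P \<in> polys" and ij: "1 \<le> j" "j < i" "i < r"
  shows "act (Emat r i j P) w = 0"
proof -
  let ?f = "act (Emat r i j 1)" and ?e = "act (Emat r j i 1)"
  let ?H = "hmat r j 1 + hmat r i (-1)"
  have f: "Emat r i j 1 \<in> slp r" and e: "Emat r j i 1 \<in> slp r" and hj: "hmat r j 1 \<in> slp r" and hi: "hmat r i (-1) \<in> slp r"
    using ij by (auto intro!: Emat_slp hmat_slp polys_uminus)
  have H: "?H \<in> slp r" by (rule slp_add[OF hj hi])
  have 1: "mat_bracket (Emat r j i 1) (Emat r i j 1) = ?H"
    by (rule mat_bracket_EmatI) (use ij in auto)
  have 2: "mat_bracket ?H (Emat r i j 1) = const (-2) \<cdot>\<^sub>m Emat r i j 1"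
  proof (rule mat_bracket_EmatI)
    have c2: "const (-2) = -2" by (simp add: const_def single_uminus flip: single_numeral)
    show "(const (-2) \<cdot>\<^sub>m Emat r i j 1) $$ (a, b) = (if b = j then ?H $$ (a, i) * 1 else 0) - (if a = i then 1 * ?H $$ (j, b) else 0)"
      if "a < r" "b < r" for a b
      using that ij by (auto simp: c2)
  qed (use ij in auto)
  have "(?f ^^ Suc 0) w = 0"
  proof (rule sl2_lowering_vanishes[OF vs sub fd, where e = ?e and h = "act ?H"])
    show "?e (?f v) = ?f (?e v) + act ?H v" if "v \<in> V" for v
      using act_bracket[OF e f that] 1 by simp
    show "act ?H (?f v) = ?f (act ?H v) - sc 2 (?f v)" if "v \<in> V" for v
      using act_bracket[OF H f that] act_lscale[OF f that, of "-2"] 2 by (simp add: algebra_simps)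
    show "?e w = 0" using ij by (intro upper_w) auto
    show "act ?H w = sc (of_nat 0) w"
      using hmat_w[of 1 j] hmat_w[of "-1" i] ij act_ladd[OF hj hi wV]
      by (simp add: polys_uminus lookup_one)
  qed (use e f in \<open>auto simp: act_closed act_add act_scale wV\<close>)
  then have f0: "?f w = 0" by simp
  have "mat_bracket (hmat r i P) (Emat r i j 1) = Emat r i j P"
    by (rule mat_bracket_EmatI) (use ij in auto)
  moreover have "hmat r i P \<in> slp r" using P ij by (intro hmat_slp) auto
  ultimately have "act (Emat r i j P) w = act (hmat r i P) (?f w) - ?f (act (hmat r i P) w)"
    using act_bracket[OF _ f wV, of "hmat r i P"] by simp
  also have "\<dots> = 0"
    using f0 hmat_w[OF P, of i] ij \<open>hmat r i P \<in> slp r\<close> f wV by (simp add: act_zero act_scale del: scale_minus_left)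
  finally show ?thesis .
qed

lemma act_w:
  assumes X: "X \<in> slp r"
  shows "act X w = (\<Sum>j\<in>{1..<r}. act (Emat r j 0 (X $$ (j, 0))) w) + sc (of_nat m * Poly_Mapping.lookup (X $$ (0, 0)) 0) w"
proof -
  have Xe: "X $$ (i, j) \<in> polys" if "i < r" "j < r" for i j using X that by (simp add: sl_over_def)
  have "(\<Sum>(i, j)\<in>{(i, j). i < r \<and> j < r \<and> i \<noteq> j}. act (Emat r i j (X $$ (i, j))) w)
    = (\<Sum>(i, j)\<in>(\<lambda>i. (i, 0)) ` {1..<r}. act (Emat r i j (X $$ (i, j))) w)"
  proof (rule sum.mono_neutral_right)
    show "finite {(i, j). i < r \<and> j < r \<and> i \<noteq> j}" by (rule finite_subset[of _ "{..<r} \<times> {..<r}"]) auto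
    show "\<forall>p\<in>{(i, j). i < r \<and> j < r \<and> i \<noteq> j} - (\<lambda>i. (i, 0)) ` {1..<r}.
       (case p of (i, j) \<Rightarrow> act (Emat r i j (X $$ (i, j))) w) = 0"
    proof clarify
      fix i j assume ij: "i < r" "j < r" "i \<noteq> j" "(i, j) \<notin> (\<lambda>i. (i, 0)) ` {1..<r}"
      then have "1 \<le> j" by (cases j) auto
      then show "act (Emat r i j (X $$ (i, j))) w = 0"
        using ij Xe upper_w[of _ i j] lower_block_w[of _ j i] by (cases "i < j") auto
    qed
  qed auto
  also have "\<dots> = (\<Sum>j\<in>{1..<r}. act (Emat r j 0 (X $$ (j, 0))) w)"
    by (subst sum.reindex) (auto simp: inj_on_def)
  moreover have "(\<Sum>i\<in>{1..<r}. act (hmat r i (X $$ (i, i))) w) = sc (of_nat m * Poly_Mapping.lookup (X $$ (0, 0)) 0) w"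
  proof -
    have "(\<Sum>k<r. X $$ (k, k)) = 0" using X by (auto simp: sl_over_def mat_trace_def)
    then have "X $$ (0, 0) = - (\<Sum>k\<in>{1..<r}. X $$ (k, k))"
      using sum_first[of r "\<lambda>k. X $$ (k, k)"] r2 by (simp add: eq_neg_iff_add_eq_0)
    then have "of_nat m * Poly_Mapping.lookup (X $$ (0, 0)) 0 = (\<Sum>k\<in>{1..<r}. - (of_nat m * Poly_Mapping.lookup (X $$ (k, k)) 0))"
      by (simp add: lookup_sum sum_distrib_left sum_negf)
    moreover have "(\<Sum>i\<in>{1..<r}. act (hmat r i (X $$ (i, i))) w) = (\<Sum>k\<in>{1..<r}. sc (- (of_nat m * Poly_Mapping.lookup (X $$ (k, k)) 0)) w)"
      using Xe by (intro sum.cong refl hmat_w) auto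
    ultimately show ?thesis by (simp add: scale_sum_left)
  qed
  ultimately show ?thesis using act_decomp[OF X wV] by simp
qed

lemma ev_act:
  assumes "u \<in> S0 r" "X \<in> slp r"
  shows "ev (act_sym r m X u) = act X (ev u)"
  using assms
proof (induction arbitrary: X rule: S0.induct)
  case one
  have "ev (bb j (X $$ (j, 0))) = act (Emat r j 0 (X $$ (j, 0))) w" if "j \<in> {1..<r}" for j
    using ev_bb[of j "X $$ (j, 0)" 1] gl_polyD(2)[OF slp_gl[OF one]] that by (simp add: ev_one)
  then show ?case
    by (simp add: act_sym_one ev_add ev_sum ev_scal ev_one act_w[OF one])
next
  case (add u v)
  then show ?case by (simp add: clin_add[OF clin_act_sym] ev_add act_add ev_V)
next
  case (scal u c)
  then show ?case by (simp add: clin_scal[OF clin_act_sym] ev_scal act_scale ev_V)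
next
  case (bb c Q u)
  have E: "Emat r c 0 Q \<in> slp r" using bb by (intro Emat_slp) auto
  have "ev (act_sym r m X (bb c Q * u)) = act (Emat r c 0 Q) (act X (ev u)) + act (mat_bracket X (Emat r c 0 Q)) (ev u)"
    using bb by (simp add: act_sym_bb slp_carrier ev_add ev_bb slp_bracket E)
  also have "\<dots> = act X (act (Emat r c 0 Q) (ev u))"
    using act_bracket[OF bb.prems E ev_V] by simp
  finally show ?case using bb by (simp add: ev_bb)
qed

lemma V_eq: "V = ev ` S0 r"
proof -
  have "subspace (ev ` S0 r)"
    unfolding subspace_def
  proof (intro conjI ballI allI)
    show "0 \<in> ev ` S0 r" using ev_zero S0_zero by force
  qed (auto simp flip: ev_add ev_scal intro: S0.add S0.scal)
  moreover have "act X u \<in> ev ` S0 r" if "X \<in> slp r" "u \<in> ev ` S0 r" for X u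
    using that act_sym_S0[OF _ slp_gl] r2 by (auto simp flip: ev_act)
  moreover have "w \<in> ev ` S0 r" using ev_one S0.one by force
  moreover have "ev ` S0 r \<subseteq> V" using ev_V by blast
  ultimately show ?thesis
    using gen unfolding is_generated_by_def carr by blast
qed

end

lemma qq_bprod:
  "qq m S (bprod qs) = scal (of_nat m * Poly_Mapping.lookup S 0) (bprod qs)
    - (\<Sum>l<length qs. bb (fst (qs ! l)) (S * snd (qs ! l)) * bprod (remv l qs))"
proof (induction qs)
  case (Cons cQ qs)
  obtain c Q where cQ: "cQ = (c, Q)" by fastforce
  have "bb c Q * (\<Sum>l<length qs. bb (fst (qs ! l)) (S * snd (qs ! l)) * bprod (remv l qs))
    = (\<Sum>l<length qs. bb (fst (qs ! l)) (S * snd (qs ! l)) * (bb c Q * bprod (remv l qs)))"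
    unfolding sum_distrib_left by (intro sum.cong) (auto simp: mult.left_commute)
  then show ?case unfolding cQ
    by (simp add: qq_bb Cons right_diff_distrib scal_mult_right sum.lessThan_Suc_shift del: sum.lessThan_Suc)
qed simp

context weyl_quotient
begin

text \<open>
  The vector \<open>w\<close> has weight \<open>m\<close> for the first coroot, which is why \<open>m + 1\<close> lowering operators kill it.
\<close>

lemma f_power_w: "ev (bprod (replicate (Suc m) (1, 1))) = 0"
proof -
  let ?f = "act (Emat r 1 0 1)" and ?e = "act (Emat r 0 1 1)"
  let ?H = "hmat r 1 (-1)"
  have f: "Emat r 1 0 1 \<in> slp r" and e: "Emat r 0 1 1 \<in> slp r" and H: "?H \<in> slp r"
    using r2 by (auto intro!: Emat_slp hmat_slp polys_uminus)
  have 1: "mat_bracket (Emat r 0 1 1) (Emat r 1 0 1) = ?H"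
    by (rule mat_bracket_EmatI) (use r2 in auto)
  have 2: "mat_bracket ?H (Emat r 1 0 1) = const (-2) \<cdot>\<^sub>m Emat r 1 0 1"
  proof (rule mat_bracket_EmatI)
    have c2: "const (-2) = -2" by (simp add: const_def single_uminus flip: single_numeral)
    show "(const (-2) \<cdot>\<^sub>m Emat r 1 0 1) $$ (a, b) = (if b = 0 then ?H $$ (a, 1) * 1 else 0) - (if a = 1 then 1 * ?H $$ (0, b) else 0)"
      if "a < r" "b < r" for a b
      using that r2 by (auto simp: c2)
  qed (use r2 in auto)
  have "(?f ^^ Suc m) w = 0"
  proof (rule sl2_lowering_vanishes[OF vs sub fd, where e = ?e and h = "act ?H"])
    show "?e (?f v) = ?f (?e v) + act ?H v" if "v \<in> V" for v
      using act_bracket[OF e f that] 1 by simp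
    show "act ?H (?f v) = ?f (act ?H v) - sc 2 (?f v)" if "v \<in> V" for v
      using act_bracket[OF H f that] act_lscale[OF f that, of "-2"] 2 by (simp add: algebra_simps)
    show "?e w = 0" using r2 by (intro upper_w) auto
    show "act ?H w = sc (of_nat m) w"
      using hmat_w[of "-1" 1] r2 by (simp add: polys_uminus lookup_one)
  qed (use e f in \<open>auto simp: act_closed act_add act_scale wV\<close>)
  moreover have "ev (bprod (replicate n (1, 1))) = (?f ^^ n) w" for n
    by (induction n) (use r2 in \<open>simp_all add: ev_one ev_bb\<close>)
  ultimately show ?thesis by metis
qed

text \<open>
  Polarisation of \<open>f_power_w\<close>: replacing the factors \<open>b_1(1)\<close> one at a time by arbitrary ones is achieved by applying
  $E_{c1} \otimes Q$, or \<open>hmat r 1 Q\<close> when \<open>c = 1\<close>.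
\<close>

lemma ev_polarize:
  assumes "valid r ts" "s + length ts = Suc m"
  shows "ev (bprod (replicate s (1, 1) @ ts)) = 0"
  using assms
proof (induction "length ts" arbitrary: s ts)
  case 0
  then show ?case using f_power_w by simp
next
  case (Suc n)
  obtain c Q ts' where ts: "ts = (c, Q) # ts'" using Suc.hyps(2) by (cases ts) auto
  then have c: "1 \<le> c" "c < r" "Q \<in> polys" "valid r ts'" "length ts' = n" using Suc by auto
  have n: "Suc s + n = Suc m" using Suc.prems ts c by simp
  let ?R = "replicate (Suc s) (1, 1) :: (nat \<times> laurent) list"
  have IH: "ev (bprod (?R @ ts'')) = 0" if "valid r ts''" "length ts'' = n" for ts''
    using Suc.hyps(1)[of ts'' "Suc s"] that n by simp
  have z0: "ev (bprod (?R @ ts')) = 0" by (rule IH) (use c in auto)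
  have mv: "bb d P * bprod (?R @ ts'') = bprod (?R @ ((d, P) # ts''))" for d P ts''
    by (simp add: ac_simps)
  have rest: "ev (bb d P * bprod (?R @ remv l ts')) = 0" if "l < n" "1 \<le> d" "d < r" "P \<in> polys" for d P l
    unfolding mv using that c by (intro IH) (auto simp: valid_remv length_remv)
  have D: "ev (DD c 1 Q (bprod (?R @ ts'))) = sc (of_nat (Suc s)) (ev (bprod (replicate s (1, 1) @ ts)))"
  proof -
    have "DD c 1 Q (bprod (?R @ ts')) = (\<Sum>l<Suc s. bprod (replicate s (1, 1) @ ts))
       + (\<Sum>l<n. if fst (ts' ! l) = 1 then bb c (Q * snd (ts' ! l)) * bprod (?R @ remv l ts') else 0)"
      unfolding DD_bprod length_append length_replicate c(5) sum_split_at ts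
      by (intro arg_cong2[where f = "(+)"] sum.cong)
        (auto simp: remv_replicate_append nth_append mult.left_commute simp del: replicate.simps)
    moreover have z: "ev (if fst (ts' ! l) = 1 then bb c (Q * snd (ts' ! l)) * bprod (?R @ remv l ts') else 0) = 0" if "l < n" for l
      using rest[OF that c(1,2), of "Q * snd (ts' ! l)"] valid_nth[OF c(4), of l] that c by (auto simp: ev_zero polys_mult)
    ultimately have "ev (DD c 1 Q (bprod (?R @ ts'))) = (\<Sum>l<Suc s. ev (bprod (replicate s (1, 1) @ ts)))"
      by (simp only: ev_add ev_sum sum.neutral[OF ballI, OF z[OF lessThan_iff[THEN iffD1]]] add_0_right)
    then show ?thesis by (simp only: sum_constant_scale card_lessThan)
  qed
  have v: "bprod (?R @ ts') \<in> S0 r" using c r2 by (intro bprod_S0) (auto simp: valid_def)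
  have "ev (bprod (replicate s (1, 1) @ ts)) = 0"
  proof (cases "c = 1")
    case False
    then have "Emat r c 1 Q \<in> slp r" using c by (intro Emat_slp) auto
    from ev_act[OF v this] have "ev (DD c 1 Q (bprod (?R @ ts'))) = 0"
      using c r2 z0 \<open>Emat r c 1 Q \<in> slp r\<close> by (simp add: act_sym_Emat_block act_zero)
    then show ?thesis unfolding D by (simp del: of_nat_Suc)
  next
    case True
    have H: "hmat r 1 Q \<in> slp r" using c r2 by (intro hmat_slp) auto
    have "act_sym r m (hmat r 1 Q) u = DD 1 1 Q u - qq m Q u" for u
      using r2 unfolding hmat_def
      by (simp add: act_sym_add act_sym_Emat_block act_sym_Emat_00 clin_minus[OF clin_qq_param])
    then have e: "ev (DD 1 1 Q (bprod (?R @ ts'))) - ev (qq m Q (bprod (?R @ ts'))) = 0"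
      using ev_act[OF v H] H z0 by (simp add: ev_diff act_zero)
    have "ev (qq m Q (bprod (?R @ ts'))) = - sc (of_nat (Suc s)) (ev (bprod (replicate s (1, 1) @ ts)))"
    proof -
      have "(\<Sum>l<length (?R @ ts'). bb (fst ((?R @ ts') ! l)) (Q * snd ((?R @ ts') ! l)) * bprod (remv l (?R @ ts')))
         = (\<Sum>l<Suc s. bprod (replicate s (1, 1) @ ts))
       + (\<Sum>l<n. bb (fst (ts' ! l)) (Q * snd (ts' ! l)) * bprod (?R @ remv l ts'))"
        unfolding length_append length_replicate c(5) sum_split_at ts True
        by (intro arg_cong2[where f = "(+)"] sum.cong)
          (auto simp: remv_replicate_append nth_append mult.left_commute simp del: replicate.simps)
      moreover have "ev (bb (fst (ts' ! l)) (Q * snd (ts' ! l)) * bprod (?R @ remv l ts')) = 0" if "l < n" for l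
        using rest[OF that, of "fst (ts' ! l)" "Q * snd (ts' ! l)"] valid_nth[OF c(4), of l] that c by (auto simp: polys_mult)
      ultimately have "ev (qq m Q (bprod (?R @ ts'))) = - (\<Sum>l<Suc s. ev (bprod (replicate s (1, 1) @ ts)))"
        unfolding qq_bprod using z0 by (simp only: ev_diff ev_scal ev_sum ev_add) simp
      then show ?thesis by (simp only: sum_constant_scale card_lessThan)
    qed
    then have "sc (2 * of_nat (Suc s)) (ev (bprod (replicate s (1, 1) @ ts))) = 0"
      using e D True by (simp only: diff_minus_eq_add scale_left_distrib[symmetric] mult_2)
    then show ?thesis by (simp del: of_nat_Suc)
  qed
  then show ?case .
qed

lemma ev_bprod_zero:
  assumes "valid r qs" "m < length qs"
  shows "ev (bprod qs) = 0"
  using assms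
proof (induction qs)
  case (Cons cQ qs)
  obtain c Q where cQ: "cQ = (c, Q)" by fastforce
  show ?case
  proof (cases "m < length qs")
    case True
    then have "ev (bprod qs) = 0" using Cons cQ by simp
    then show ?thesis using Cons cQ by (simp add: ev_bb act_zero Emat_slp)
  next
    case False
    then show ?thesis using ev_polarize[of "cQ # qs" 0] Cons by simp
  qed
qed simp

text \<open>
  So every finite-dimensional cyclic module with the Weyl relations is a quotient of the symmetric algebra modulo \<open>Gsub r m\<close>.
\<close>

lemma ev_Gsub:
  assumes "u \<in> Gsub r m"
  shows "ev u = 0"
  using assms
proof (induction rule: Gsub.induct)
  case (gen qs)
  then show ?case by (rule ev_bprod_zero)
next
  case (ee u j R)
  have E: "Emat r 0 j R \<in> slp r" using ee by (intro Emat_slp) auto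
  then show ?case
    using ev_act[OF Gsub_S0[OF ee.hyps(1)] E] ee by (simp add: act_sym_Emat_row act_zero)
qed (simp_all add: ev_add ev_scal)

end

lemma (in vector_space) exists_projection_with_kernel:
  assumes U: "subspace U"
  shows "\<exists>p. (\<forall>u v. p (u + v) = p u + p v) \<and> (\<forall>c u. p (scale c u) = scale c (p u))
    \<and> (\<forall>u. u - p u \<in> U) \<and> (\<forall>u. p u = 0 \<longleftrightarrow> u \<in> U)"
proof -
  interpret p: vector_space_pair scale scale ..
  obtain B where B: "B \<subseteq> U" "independent B" "U \<subseteq> span B" using maximal_independent_subset[of U] by blast
  obtain C where C: "B \<subseteq> C" "independent C" "span C = UNIV"
    using maximal_independent_subset_extend[of B UNIV] B(2) by (metis span_superset subset_UNIV top.extremum_uniqueI)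
  have sB: "span B = U" using B U by (metis span_minimal subset_antisym)
  obtain p where p: "Vector_Spaces.linear scale scale p" "\<And>x. x \<in> C \<Longrightarrow> p x = (if x \<in> B then 0 else x)"
    using p.linear_independent_extend[OF C(2), of "\<lambda>x. if x \<in> B then 0 else x"] by blast
  interpret L: Vector_Spaces.linear scale scale p by (rule p(1))
  have pB: "p x = 0" if "x \<in> span B" for x
    using that by (induction rule: span_induct_alt) (use C(1) p(2) in \<open>auto simp: L.add L.scale L.zero\<close>)
  have pD: "p x = x" if "x \<in> span (C - B)" for x
    using that by (induction rule: span_induct_alt) (use p(2) in \<open>auto simp: L.add L.scale L.zero\<close>)
  have dec: "\<exists>b d. u = b + d \<and> b \<in> span B \<and> d \<in> span (C - B)" for u
  proof -
    have "u \<in> span (B \<union> (C - B))" using C by (metis UNIV_I Un_Diff_cancel sup.absorb2)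
    then show ?thesis unfolding span_Un by blast
  qed
  have 1: "u - p u \<in> U" for u
  proof -
    obtain b d where "u = b + d" "b \<in> span B" "d \<in> span (C - B)" using dec by blast
    then show ?thesis using sB by (simp add: L.add pB pD)
  qed
  have "p u = 0 \<longleftrightarrow> u \<in> U" for u
    using 1[of u] pB sB by auto
  then show ?thesis using 1 L.add L.scale by blast
qed

lemma Gsub_subspace: "2 \<le> r \<Longrightarrow> scal.subspace (Gsub r m)"
  by (auto simp: scal.subspace_def Gsub_zero Gsub.add Gsub.scal)

text \<open>
  The quotient by \<open>Gsub r m\<close> is realised on a complement, the image of a linear projection with this kernel.
\<close>

definition Gproj :: "nat \<Rightarrow> nat \<Rightarrow> sym \<Rightarrow> sym" where
  "Gproj r m = (SOME p. clin p \<and> (\<forall>u. u - p u \<in> Gsub r m) \<and> (\<forall>u. p u = 0 \<longleftrightarrow> u \<in> Gsub r m))"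

lemma Gproj:
  assumes "2 \<le> r"
  shows clin_Gproj: "clin (Gproj r m)" and Gproj_diff: "u - Gproj r m u \<in> Gsub r m"
    and Gproj_eq_0: "Gproj r m u = 0 \<longleftrightarrow> u \<in> Gsub r m"
proof -
  have "\<exists>p. clin p \<and> (\<forall>u. u - p u \<in> Gsub r m) \<and> (\<forall>u. p u = 0 \<longleftrightarrow> u \<in> Gsub r m)"
    using scal.exists_projection_with_kernel[OF Gsub_subspace[OF assms, of m]] unfolding clin_def by blast
  from someI_ex[OF this] show "clin (Gproj r m)" "u - Gproj r m u \<in> Gsub r m"
    "Gproj r m u = 0 \<longleftrightarrow> u \<in> Gsub r m"
    unfolding Gproj_def by blast+
qed

lemma Gproj_cong:
  assumes "2 \<le> r" "u - v \<in> Gsub r m"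
  shows "Gproj r m u = Gproj r m v"
  using Gproj_eq_0[OF assms(1), of m "u - v"] assms(2) by (simp add: clin_diff[OF clin_Gproj[OF assms(1)]])

lemma Gproj_S0: "2 \<le> r \<Longrightarrow> u \<in> S0 r \<Longrightarrow> Gproj r m u \<in> S0 r"
  using S0_diff[of u r "u - Gproj r m u"] Gsub_S0[OF Gproj_diff] by simp

lemma Gproj_idem: "2 \<le> r \<Longrightarrow> Gproj r m (Gproj r m u) = Gproj r m u"
  using Gproj_cong[OF _ Gproj_diff] by metis

definition WV :: "nat \<Rightarrow> nat \<Rightarrow> sym set" where "WV r m = Gproj r m ` S0 r"
definition Wact :: "nat \<Rightarrow> nat \<Rightarrow> laurent mat \<Rightarrow> sym \<Rightarrow> sym" where
  "Wact r m X v = Gproj r m (act_sym r m X v)"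
definition Ww :: "nat \<Rightarrow> nat \<Rightarrow> sym" where "Ww r m = Gproj r m 1"

lemma WV_S0: "2 \<le> r \<Longrightarrow> v \<in> WV r m \<Longrightarrow> v \<in> S0 r"
  by (auto simp: WV_def Gproj_S0)

lemma Gproj_WV: "2 \<le> r \<Longrightarrow> v \<in> WV r m \<Longrightarrow> Gproj r m v = v"
  by (auto simp: WV_def Gproj_idem)

lemma Gproj_act_Gproj:
  assumes "2 \<le> r" "X \<in> gl_poly r"
  shows "Gproj r m (act_sym r m X (Gproj r m u)) = Gproj r m (act_sym r m X u)"
proof (rule Gproj_cong[OF assms(1)])
  have "Gproj r m u - u \<in> Gsub r m"
    using Gsub_uminus[OF Gproj_diff[OF assms(1), of u m]] by simp
  from Gsub_act[OF this assms(2,1)]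
  show "act_sym r m X (Gproj r m u) - act_sym r m X u \<in> Gsub r m"
    by (simp add: clin_diff[OF clin_act_sym])
qed

lemma Wact_Gproj: "2 \<le> r \<Longrightarrow> X \<in> gl_poly r \<Longrightarrow> Wact r m X (Gproj r m u) = Gproj r m (act_sym r m X u)"
  by (simp add: Wact_def Gproj_act_Gproj)

lemma Wmodule:
  assumes r: "2 \<le> r"
  shows "is_lie_module (sl_poly r) scal (WV r m) (Wact r m)"
proof -
  note c = clin_Gproj[OF r, of m]
  have sub: "scal.subspace (WV r m)"
    unfolding scal.subspace_def WV_def
  proof (intro conjI ballI allI)
    show "0 \<in> Gproj r m ` S0 r" using clin_zero[OF c] S0_zero by force
  qed (auto simp flip: clin_add[OF c] clin_scal[OF c] intro: S0.add S0.scal)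
  show ?thesis
    unfolding is_lie_module_def sl_poly_def
    using r WV_S0[OF r]
    by (auto simp: sub vector_space_scal Wact_def clin_add[OF clin_act_sym] clin_scal[OF clin_act_sym] clin_add[OF c] clin_scal[OF c]
       act_sym_add act_sym_smult slp_carrier act_sym_bracket slp_gl clin_diff[OF c] Gproj_act_Gproj)
      (auto simp: WV_def intro!: act_sym_S0 Gproj_S0 slp_gl)
qed

lemma finite_multisets_le: "finite K \<Longrightarrow> finite {M. set_mset M \<subseteq> K \<and> size M \<le> n}"
proof -
  assume K: "finite K"
  have "{M. set_mset M \<subseteq> K \<and> size M \<le> n} \<subseteq> mset ` {xs. set xs \<subseteq> K \<and> length xs \<le> n}"
  proof
    fix M assume M: "M \<in> {M. set_mset M \<subseteq> K \<and> size M \<le> n}"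
    obtain xs where "mset xs = M" using ex_mset by blast
    then show "M \<in> mset ` {xs. set xs \<subseteq> K \<and> length xs \<le> n}" using M by (auto intro!: image_eqI[of _ _ xs])
  qed
  then show ?thesis using finite_lists_length_le[OF K] by (rule finite_subset[OF _ finite_imageI])
qed

definition vgen :: "nat \<Rightarrow> gen set" where
  "vgen r = {(c, k). 1 \<le> c \<and> c < r \<and> 0 \<le> fst k}"

lemma S0_span: "u \<in> S0 r \<Longrightarrow> u \<in> scal.span {mono1 M |M. set_mset M \<subseteq> vgen r}"
proof (induction rule: S0.induct)
  case one
  have "(1 :: sym) \<in> {mono1 M |M. set_mset M \<subseteq> vgen r}" by (auto intro!: exI[of _ "{#}"])
  then show ?case by (rule scal.span_base)
next
  case (bb c Q u)
  have Q: "bb c Q = (\<Sum>k\<in>Poly_Mapping.keys Q. scal (Poly_Mapping.lookup Q k) (mono1 {#(c, k)#}))"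
    by (simp add: bb_def lext_def)
  have "mono1 {#(c, k)#} * u \<in> scal.span {mono1 M |M. set_mset M \<subseteq> vgen r}" if k: "k \<in> Poly_Mapping.keys Q" for k
    using bb.IH
  proof (induction rule: scal.span_induct_alt)
    case base
    then show ?case by (simp add: scal.span_zero)
  next
    case (step a x y)
    then obtain M where M: "x = mono1 M" "set_mset M \<subseteq> vgen r" by auto
    have "(c, k) \<in> vgen r" using bb k by (auto simp: vgen_def polys_def)
    then have "mono1 {#(c, k)#} * x \<in> {mono1 M |M. set_mset M \<subseteq> vgen r}"
      using M by (auto simp: mult_single intro!: exI[of _ "add_mset (c, k) M"])
    then show ?case using step
      by (simp add: distrib_left scal_mult_right scal.span_add scal.span_scale scal.span_base)
  qed
  then show ?case
    unfolding Q sum_distrib_right scal_mult_left by (intro scal.span_sum scal.span_scale)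
qed (simp_all add: scal.span_add scal.span_scale)

lemma mono1_mset: "mono1 (mset ls) = bprod (map (\<lambda>(c, k). (c, mono1 k)) ls)"
  using bprod_monomials[of fst snd ls] by (simp add: case_prod_unfold)

lemma mono1_Gsub:
  assumes r: "2 \<le> r" and M: "set_mset M \<subseteq> vgen r"
    and big: "m < size M \<or> (\<exists>(c, k)\<in>#M. m \<le> nat (fst k) + snd k)"
  shows "mono1 M \<in> Gsub r m"
proof -
  note ml = mono1_mset
  have vl: "valid r (map (\<lambda>(c, k). (c, mono1 k)) ls)" if "set ls \<subseteq> vgen r" for ls
    using that by (auto simp: valid_def vgen_def intro!: polys_single)
  show ?thesis
  proof (cases "m < size M")
    case True
    obtain ls where ls: "mset ls = M" using ex_mset by blast
    then have "set ls \<subseteq> vgen r" "m < length ls" using M True by auto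
    then show ?thesis using Gsub.gen[OF vl, of ls m] ml[of ls] ls by simp
  next
    case False
    then obtain c k where ck: "(c, k) \<in># M" "m \<le> nat (fst k) + snd k" using big by auto
    obtain ls where ls: "mset ls = M - {#(c, k)#}" using ex_mset by blast
    have "set ls \<subseteq> vgen r" using M ls by (metis in_diffD set_mset_mset subset_iff)
    then have S: "mono1 (mset ls) \<in> S0 r" unfolding ml by (intro bprod_S0 vl)
    have c: "1 \<le> c" "c < r" "0 \<le> fst k" using M ck by (auto simp: vgen_def)
    have "bb c (mono1 (fst k, snd k)) \<in> Gsub r m" using c ck by (intro bb_in_Gsub r) auto
    from Gsub_ideal[OF S this r] have "mono1 (mset ls) * mono1 {#(c, k)#} \<in> Gsub r m" by simp
    moreover have "mono1 (mset ls) * mono1 {#(c, k)#} = (mono1 M :: sym)"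
      using ck by (simp add: mult_single ls)
    ultimately show ?thesis by simp
  qed
qed

lemma W_finite_dim:
  assumes r: "2 \<le> r"
  shows "finite_dim scal (WV r m)"
proof -
  define K where "K = {1..<r} \<times> ({0..int m} \<times> {0..m})"
  define F where "F = {M. set_mset M \<subseteq> K \<and> size M \<le> m}"
  have fin: "finite F" unfolding F_def K_def by (intro finite_multisets_le) auto
  have KF: "mono1 M \<in> Gsub r m" if "set_mset M \<subseteq> vgen r" "M \<notin> F" for M
  proof (rule mono1_Gsub[OF r that(1)])
    show "m < size M \<or> (\<exists>(c, k)\<in>#M. m \<le> nat (fst k) + snd k)"
    proof (rule ccontr)
      assume n: "\<not> ?thesis"
      have "(c, k) \<in> K" if "(c, k) \<in># M" for c k
        using that n \<open>set_mset M \<subseteq> vgen r\<close> by (cases k) (fastforce simp: K_def vgen_def)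
      then have "M \<in> F" using n by (auto simp: F_def)
      then show False using that by simp
    qed
  qed
  note c = clin_Gproj[OF r, of m]
  have FS: "mono1 M \<in> S0 r" if "M \<in> F" for M
  proof -
    obtain ls where ls: "mset ls = M" using ex_mset by blast
    have "valid r (map (\<lambda>(c, k). (c, mono1 k)) ls)" 
      using that ls by (auto simp: valid_def F_def K_def intro!: polys_single)
    then show ?thesis using bprod_S0 ls mono1_mset by metis
  qed
  have "Gproj r m u \<in> scal.span ((\<lambda>M. Gproj r m (mono1 M)) ` F)" if "u \<in> scal.span {mono1 M |M. set_mset M \<subseteq> vgen r}" for u
    using that
  proof (induction rule: scal.span_induct_alt)
    case base
    then show ?case by (simp add: clin_zero[OF c] scal.span_zero)
  next
    case (step a x y)
    then obtain M where M: "x = mono1 M" "set_mset M \<subseteq> vgen r" by auto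
    have "Gproj r m x \<in> scal.span ((\<lambda>M. Gproj r m (mono1 M)) ` F)"
    proof (cases "M \<in> F")
      case True
      then show ?thesis using M by (auto intro: scal.span_base)
    next
      case False
      then have "Gproj r m x = 0" using KF[OF M(2)] Gproj_eq_0[OF r, of m x] M(1) by simp
      then show ?thesis by (simp add: scal.span_zero)
    qed
    then show ?case using step by (simp add: clin_add[OF c] clin_scal[OF c] scal.span_add scal.span_scale)
  qed
  then have "WV r m \<subseteq> scal.span ((\<lambda>M. Gproj r m (mono1 M)) ` F)"
    unfolding WV_def using S0_span by blast
  moreover have "scal.span ((\<lambda>M. Gproj r m (mono1 M)) ` F) \<subseteq> WV r m"
    using Wmodule[OF r, of m] FS unfolding is_lie_module_def
    by (intro scal.span_minimal) (auto simp: WV_def)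
  ultimately show ?thesis
    unfolding finite_dim_def using fin by (intro exI[of _ "(\<lambda>M. Gproj r m (mono1 M)) ` F"]) auto
qed

text \<open>
  Conversely the quotient is such a module, hence it is the largest one.
\<close>

lemma W_weyl_quotient:
  assumes r: "2 \<le> r"
  shows "is_weyl_quotient r m scal (WV r m) (Wact r m) (Ww r m)"
  unfolding is_weyl_quotient_def
proof (intro conjI Wmodule W_finite_dim r ballI allI impI)
  note c = clin_Gproj[OF r, of m]
  show "is_generated_by (sl_poly r) scal (WV r m) (Wact r m) (Ww r m)"
    unfolding is_generated_by_def
  proof (intro conjI allI impI)
    show "Ww r m \<in> WV r m" by (simp add: WV_def Ww_def S0.one)
  next
    fix U assume U: "scal.subspace U \<and> U \<subseteq> WV r m \<and> Ww r m \<in> U \<and> (\<forall>X\<in>lcarrier (sl_poly r). \<forall>u\<in>U. Wact r m X u \<in> U)"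
    have "Gproj r m u \<in> U" if "u \<in> S0 r" for u
      using that
    proof (induction rule: S0.induct)
      case (bb d Q u)
      have E: "Emat r d 0 Q \<in> slp r" using bb by (intro Emat_slp) auto
      then have "Wact r m (Emat r d 0 Q) (Gproj r m u) \<in> U" using U bb by (auto simp: sl_poly_def)
      then show ?case using bb E by (simp add: Wact_Gproj[OF r] slp_gl act_sym_Emat_col)
    qed (use U in \<open>auto simp: Ww_def clin_add[OF c] clin_scal[OF c] scal.subspace_add scal.subspace_scale\<close>)
    then show "U = WV r m" using U by (auto simp: WV_def)
  qed
next
  fix P h assume P: "P \<in> polys" and h: "h \<in> cartan r"
  have hc: "h \<in> carrier_mat r r" "\<And>i j. i < r \<Longrightarrow> j < r \<Longrightarrow> i \<noteq> j \<Longrightarrow> h $$ (i, j) = 0"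
    using h by (auto simp: cartan_def)
  then have t: "tensor h P \<in> gl_poly r"
    using P by (auto simp: tensor_def gl_poly_def polys_mult)
  have "bb j (tensor h P $$ (j, 0)) = 0" if "j \<in> {1..<r}" for j
    using that hc r by (simp add: tensor_def const_zero)
  then have "act_sym r m (tensor h P) 1 = scal (of_nat m * h $$ (0, 0) * Poly_Mapping.lookup P 0) 1"
    using hc r by (simp add: act_sym_one tensor_def lookup_const_mult mult.assoc)
  then show "Wact r m (tensor h P) (Ww r m) = scal (of_nat m * h $$ (0, 0) * Poly_Mapping.lookup P (0, 0)) (Ww r m)"
    unfolding Ww_def Wact_Gproj[OF r t] by (simp add: clin_scal[OF clin_Gproj[OF r]] zero_prod_def)
next
  fix P i j assume P: "P \<in> polys" and ij: "i < j \<and> j < r"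
  have "Emat r i j P \<in> gl_poly r" using P by (rule Emat_gl_poly)
  moreover have "bb k (Emat r i j P $$ (k, 0)) = 0" if "k \<in> {1..<r}" for k
    using that ij by simp
  then have "act_sym r m (Emat r i j P) 1 = 0"
    using ij by (simp add: act_sym_one)
  ultimately show "Wact r m (Emat r i j P) (Ww r m) = 0"
    unfolding Ww_def by (simp add: Wact_Gproj[OF r] clin_zero[OF clin_Gproj[OF r]])
qed

locale weyl_module = slmod +
  fixes m :: nat and w :: 'a
  assumes wm: "is_weyl_module r m sc V act w"
begin

sublocale weyl_quotient
  by unfold_locales (use wm in \<open>auto simp: is_weyl_module_def\<close>)

text \<open>
  The universal property, applied to the model \<open>WV r m\<close>, gives a map that inverts \<open>ev\<close> modulo \<open>Gsub r m\<close>.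
\<close>

lemma ev_eq_0_iff:
  assumes u: "u \<in> S0 r"
  shows "ev u = 0 \<longleftrightarrow> u \<in> Gsub r m"
proof
  assume 0: "ev u = 0"
  obtain f where f: "is_module_hom (sl_poly r) sc V act scal (WV r m) (Wact r m) f" "f w = Ww r m"
    using weyl_module_universal[OF wm W_weyl_quotient[OF r2]] by blast
  note c = clin_Gproj[OF r2, of m]
  have "f (ev u) = Gproj r m u"
    using u
  proof (induction rule: S0.induct)
    case (bb d Q u)
    have E: "Emat r d 0 Q \<in> slp r" using bb by (intro Emat_slp) auto
    then have "f (ev (bb d Q * u)) = Wact r m (Emat r d 0 Q) (f (ev u))"
      using f(1) bb by (simp add: ev_bb is_module_hom_def ev_V)
    then show ?case using bb E by (simp add: Wact_Gproj[OF r2] slp_gl act_sym_Emat_col)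
  qed (use f in \<open>simp_all add: is_module_hom_def ev_one Ww_def ev_add ev_scal ev_V clin_add[OF c] clin_scal[OF c]\<close>)
  moreover have "f 0 = 0"
    using f(1) V_zero scale_zero_left[of 0] scal_zero[of "f 0"] unfolding is_module_hom_def by metis
  ultimately show "u \<in> Gsub r m" using 0 Gproj_eq_0[OF r2] by simp
qed (rule ev_Gsub)

end

section \<open>Rigidity of intertwiners between integrable sl_2-modules\<close>

definition lin_on :: "(complex \<Rightarrow> 'v::ab_group_add \<Rightarrow> 'v) \<Rightarrow> 'v set \<Rightarrow> (complex \<Rightarrow> 'w::ab_group_add \<Rightarrow> 'w) \<Rightarrow> 'w set \<Rightarrow> ('v \<Rightarrow> 'w) \<Rightarrow> bool" where
  "lin_on sc V sc' V' f \<longleftrightarrow> (\<forall>v\<in>V. f v \<in> V') \<and> (\<forall>u\<in>V. \<forall>v\<in>V. f (u + v) = f u + f v) \<and>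
     (\<forall>c. \<forall>v\<in>V. f (sc c v) = sc' c (f v))"

lemma lin_onD:
  assumes "lin_on sc V sc' V' f"
  shows "v \<in> V \<Longrightarrow> f v \<in> V'" "u \<in> V \<Longrightarrow> v \<in> V \<Longrightarrow> f (u + v) = f u + f v"
    "v \<in> V \<Longrightarrow> f (sc c v) = sc' c (f v)"
  using assms by (auto simp: lin_on_def)

lemma lin_on_zero:
  assumes "lin_on sc V sc' V' f" "vector_space sc" "module.subspace sc V" "vector_space sc'"
  shows "f 0 = 0"
proof -
  interpret A: vector_space sc by (rule assms)
  interpret B: vector_space sc' by (rule assms)
  show ?thesis using lin_onD(3)[OF assms(1) A.subspace_0[OF assms(3)], of 0] by simp
qed

lemma lin_on_diff:
  assumes "lin_on sc V sc' V' f" "vector_space sc" "module.subspace sc V" "vector_space sc'" "u \<in> V" "v \<in> V"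
  shows "f (u - v) = f u - f v"
proof -
  interpret A: vector_space sc by (rule assms)
  interpret B: vector_space sc' by (rule assms)
  have "f (u + sc (-1) v) = f u + sc' (-1) (f v)"
    using assms(5,6) lin_onD[OF assms(1)] A.subspace_scale[OF assms(3)] by metis
  then show ?thesis by simp
qed

definition sl2_integrable ::
  "(complex \<Rightarrow> 'v::ab_group_add \<Rightarrow> 'v) \<Rightarrow> 'v set \<Rightarrow> ('v \<Rightarrow> 'v) \<Rightarrow> ('v \<Rightarrow> 'v) \<Rightarrow> ('v \<Rightarrow> 'v) \<Rightarrow> bool" where
  "sl2_integrable sc V e f h \<longleftrightarrow>
     vector_space sc \<and> module.subspace sc V \<and> lin_on sc V sc V e \<and> lin_on sc V sc V f \<and> lin_on sc V sc V h \<and>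
     (\<forall>v\<in>V. e (f v) = f (e v) + h v) \<and> (\<forall>v\<in>V. h (f v) = f (h v) - sc 2 (f v)) \<and>
     (\<forall>v\<in>V. \<exists>k. (e ^^ k) v = 0) \<and> (\<forall>v\<in>V. \<exists>k. (f ^^ k) v = 0)"

text \<open>
  Let $y_n$ be the \<open>n\<close>-fold commutator of \<open>f\<close> with \<open>\<Theta>\<close>. As \<open>\<Theta>\<close> commutes with \<open>e\<close>, it is a highest weight vector of weight
  \<open>-a\<close> for the adjoint action, so $[e, y_{n+1}]$ is a multiple of $y_n$ by the factor \<open>-(n + 1)(a + n)\<close>, which vanishes only for
  \<open>a = n = 0\<close>. On a given vector, local nilpotency of \<open>f\<close> on both sides makes $y_n$ vanish for large \<open>n\<close>, and that of \<open>e\<close>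
  allows this to be applied to the finitely many vectors \<open>e\<^sup>i v\<close> at once. Descending from large \<open>n\<close>, all $y_n$ vanish
  down to \<open>n = 0\<close>, or to \<open>n = 1\<close> when \<open>a = 0\<close>.
\<close>

lemma sl2_rigidity:
  assumes S1: "sl2_integrable sc1 V1 e1 f1 h1" and S2: "sl2_integrable sc2 V2 e2 f2 h2"
    and \<Theta>: "lin_on sc1 V1 sc2 V2 \<Theta>"
    and e\<Theta>: "\<And>v. v \<in> V1 \<Longrightarrow> e2 (\<Theta> v) = \<Theta> (e1 v)"
    and h\<Theta>: "\<And>v. v \<in> V1 \<Longrightarrow> h2 (\<Theta> v) = \<Theta> (h1 v) - sc2 (of_nat a) (\<Theta> v)"
    and v: "v \<in> V1"
  shows "if a = 0 then f2 (\<Theta> v) = \<Theta> (f1 v) else \<Theta> v = 0"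
proof -
  have vs1: "vector_space sc1" and sub1: "module.subspace sc1 V1" and e1: "lin_on sc1 V1 sc1 V1 e1"
    and f1: "lin_on sc1 V1 sc1 V1 f1" and h1: "lin_on sc1 V1 sc1 V1 h1"
    and ef1: "\<And>v. v \<in> V1 \<Longrightarrow> e1 (f1 v) = f1 (e1 v) + h1 v"
    and hf1: "\<And>v. v \<in> V1 \<Longrightarrow> h1 (f1 v) = f1 (h1 v) - sc1 2 (f1 v)"
    and nil1: "\<And>v. v \<in> V1 \<Longrightarrow> \<exists>k. (e1 ^^ k) v = 0" "\<And>v. v \<in> V1 \<Longrightarrow> \<exists>k. (f1 ^^ k) v = 0"
    using S1 unfolding sl2_integrable_def by blast+
  have vs2: "vector_space sc2" and sub2: "module.subspace sc2 V2" and e2: "lin_on sc2 V2 sc2 V2 e2"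
    and f2: "lin_on sc2 V2 sc2 V2 f2" and h2: "lin_on sc2 V2 sc2 V2 h2"
    and ef2: "\<And>v. v \<in> V2 \<Longrightarrow> e2 (f2 v) = f2 (e2 v) + h2 v"
    and hf2: "\<And>v. v \<in> V2 \<Longrightarrow> h2 (f2 v) = f2 (h2 v) - sc2 2 (f2 v)"
    and nil2: "\<And>v. v \<in> V2 \<Longrightarrow> \<exists>k. (f2 ^^ k) v = 0"
    using S2 unfolding sl2_integrable_def by blast+
  interpret A: vector_space sc1 by (rule vs1)
  interpret B: vector_space sc2 by (rule vs2)
  note A1 = lin_onD[OF e1] lin_onD[OF f1] lin_onD[OF h1]
  note B1 = lin_onD[OF e2] lin_onD[OF f2] lin_onD[OF h2]
  note dif2 = lin_on_diff[OF e2 vs2 sub2 vs2] lin_on_diff[OF f2 vs2 sub2 vs2] lin_on_diff[OF h2 vs2 sub2 vs2]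
  note zer2 = lin_on_zero[OF e2 vs2 sub2 vs2] lin_on_zero[OF f2 vs2 sub2 vs2] lin_on_zero[OF h2 vs2 sub2 vs2]
  define y where "y = rec_nat \<Theta> (\<lambda>_ g v. f2 (g v) - g (f1 v))"
  have y0: "y 0 v = \<Theta> v" and yS: "y (Suc n) v = f2 (y n v) - y n (f1 v)" for n v
    by (simp_all add: y_def)
  have yl: "lin_on sc1 V1 sc2 V2 (y n)" for n
  proof (induction n)
    case 0
    then show ?case using \<Theta> by (simp add: lin_on_def y0)
  next
    case (Suc n)
    note Y = lin_onD[OF Suc]
    show ?case
      unfolding lin_on_def yS
      by (auto simp: A1 Y B1 B.subspace_diff[OF sub2] B.scale_right_diff_distrib)
  qed
  note Y = lin_onD[OF yl]
  note Yd = lin_on_diff[OF yl vs1 sub1 vs2] and Y0 = lin_on_zero[OF yl vs1 sub1 vs2]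
  have hy: "h2 (y n v) = y n (h1 v) - sc2 (of_nat a + 2 * of_nat n) (y n v)" if "v \<in> V1" for n v
    using that
  proof (induction n arbitrary: v)
    case 0
    then show ?case by (simp add: y0 h\<Theta>)
  next
    case (Suc n)
    have *: "y n (f1 (h1 v)) = y n (h1 (f1 v)) + sc2 2 (y n (f1 v))"
      using Suc.prems hf1[OF Suc.prems] Y(3)[of "f1 v" n 2] Yd[of "f1 (h1 v)" "sc1 2 (f1 v)" n]
      by (simp add: A1 A.subspace_scale[OF sub1])
    have "h2 (y (Suc n) v) = f2 (h2 (y n v)) - sc2 2 (f2 (y n v)) - h2 (y n (f1 v))"
      using Suc.prems by (simp add: yS dif2 hf2 Y A1 B1)
    also have "\<dots> = f2 (y n (h1 v)) - y n (f1 (h1 v)) - sc2 (of_nat a + 2 * of_nat (Suc n)) (y (Suc n) v)"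
      using Suc.prems unfolding *
      by (simp add: Suc.IH A1 B1 dif2 Y B.subspace_scale[OF sub2] yS algebra_simps B.scale_right_diff_distrib
        flip: B.scale_left_distrib)
    finally show ?case by (simp add: yS)
  qed
  let ?c = "\<lambda>n. - (of_nat n * (of_nat a + of_nat n - 1)) :: complex"
  have ey: "e2 (y (Suc n) v) = y (Suc n) (e1 v) + sc2 (?c (Suc n)) (y n v)" if "v \<in> V1" for n v
    using that
  proof (induction n arbitrary: v)
    case 0
    have "e2 (y 1 v) = f2 (\<Theta> (e1 v)) + h2 (\<Theta> v) - \<Theta> (e1 (f1 v))"
      using 0 Y(1)[of v 0] by (simp add: yS y0 dif2 ef2 e\<Theta> A1 B1 lin_onD[OF \<Theta>])
    also have "\<Theta> (e1 (f1 v)) = \<Theta> (f1 (e1 v)) + \<Theta> (h1 v)"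
      using 0 by (simp add: ef1 lin_onD[OF \<Theta>] A1)
    finally show ?case using 0 by (simp add: yS y0 h\<Theta>)
  next
    case (Suc n)
    have 1: "y (Suc n) (e1 (f1 v)) = y (Suc n) (f1 (e1 v)) + y (Suc n) (h1 v)"
      using Suc.prems by (simp add: ef1 Y A1)
    have "e2 (y (Suc (Suc n)) v) = f2 (e2 (y (Suc n) v)) + h2 (y (Suc n) v) - e2 (y (Suc n) (f1 v))"
      using Suc.prems by (simp add: yS[of "Suc n"] dif2 ef2 A1 B1 Y)
    also have "\<dots> = f2 (y (Suc n) (e1 v)) - y (Suc n) (f1 (e1 v))
        + sc2 (?c (Suc n)) (f2 (y n v) - y n (f1 v)) - sc2 (of_nat a + 2 * of_nat (Suc n)) (y (Suc n) v)"
      using Suc.prems unfolding Suc.IH[OF Suc.prems] Suc.IH[OF A1(4)[OF Suc.prems]] hy[OF Suc.prems] 1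
      by (simp add: A1 B1 Y dif2 B.subspace_scale[OF sub2] B.scale_right_diff_distrib)
    also have "\<dots> = y (Suc (Suc n)) (e1 v) + sc2 (?c (Suc (Suc n))) (y (Suc n) v)"
    proof -
      have C: "?c (Suc n) - (of_nat a + 2 * of_nat (Suc n)) = ?c (Suc (Suc n))" by (simp add: algebra_simps)
      show ?thesis
        unfolding yS[of "Suc n" "e1 v"] yS[of n v, symmetric] C[symmetric] B.scale_left_diff_distrib by simp
    qed
    finally show ?case .
  qed
  have van: "\<exists>n0. \<forall>n\<ge>n0. y n v = 0" if v: "v \<in> V1" for v
  proof -
    obtain k where "(f1 ^^ k) v = 0" using nil1(2)[OF v] by blast
    then show ?thesis using v
    proof (induction k arbitrary: v)
      case 0
      then show ?case using Y0 by simp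
    next
      case (Suc k)
      have "(f1 ^^ k) (f1 v) = 0" using Suc.prems by (simp add: funpow_swap1)
      then obtain n1 where n1: "\<And>n. n \<ge> n1 \<Longrightarrow> y n (f1 v) = 0"
        using Suc.IH[OF _ A1(4)[OF Suc.prems(2)]] by blast
      have pw: "y (n1 + j) v = (f2 ^^ j) (y n1 v)" for j
        by (induction j) (simp_all add: yS n1)
      obtain j where j: "(f2 ^^ j) (y n1 v) = 0" using nil2[OF Y(1)[OF Suc.prems(2)]] by blast
      have "(f2 ^^ (i + j)) (y n1 v) = 0" for i
        by (induction i) (simp_all add: j zer2)
      then have "y n v = 0" if "n \<ge> n1 + j" for n
      proof -
        have "y n v = (f2 ^^ (n - n1)) (y n1 v)" using pw[of "n - n1"] that by simp
        moreover have "n - n1 = (n - n1 - j) + j" using that by simp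
        ultimately show ?thesis using \<open>\<And>i. (f2 ^^ (i + j)) (y n1 v) = 0\<close> by metis
      qed
      then show ?case by blast
    qed
  qed
  define b where "b = (if a = 0 then 1 else 0 :: nat)"
  have down: "y n v = 0" if bn: "b \<le> n" and vV: "v \<in> V1" for n v
  proof -
    obtain k where k: "(e1 ^^ k) v = 0" using nil1(1)[OF vV] by blast
    have eV: "(e1 ^^ i) v \<in> V1" for i by (induction i) (simp_all add: vV A1)
    have "\<forall>i. \<exists>n0. \<forall>n\<ge>n0. y n ((e1 ^^ i) v) = 0" using van eV by blast
    then obtain g where g: "\<And>i n. g i \<le> n \<Longrightarrow> y n ((e1 ^^ i) v) = 0" by metis
    define n0 where "n0 = Max (g ` {..<k})"
    have n0: "y n ((e1 ^^ i) v) = 0" if "n0 \<le> n" for n i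
    proof (cases "i < k")
      case True
      then have "g i \<le> n0" unfolding n0_def by (intro Max_ge) auto
      then show ?thesis using g that by simp
    next
      case False
      have "(e1 ^^ (j + k)) v = 0" for j
        by (induction j) (simp_all add: k lin_on_zero[OF e1 vs1 sub1 vs1])
      from this[of "i - k"] show ?thesis using False Y0 by simp
    qed
    have "n \<le> n0 \<longrightarrow> (\<forall>i. y (n0 - d) ((e1 ^^ i) v) = 0)" if "b \<le> n0 - d" "d \<le> n0" for d
      using that
    proof (induction d)
      case 0
      then show ?case using n0 by simp
    next
      case (Suc d)
      have s: "n0 - d = Suc (n0 - Suc d)" using Suc.prems by simp
      have IH: "n \<le> n0 \<longrightarrow> (\<forall>i. y (n0 - d) ((e1 ^^ i) v) = 0)" using Suc by simp
      have c: "?c (Suc (n0 - Suc d)) \<noteq> 0"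
      proof -
        have "of_nat a + of_nat (Suc (n0 - Suc d)) - 1 = (of_nat (a + (n0 - Suc d)) :: complex)" by simp
        moreover have "a + (n0 - Suc d) \<noteq> 0" using Suc.prems by (auto simp: b_def split: if_splits)
        ultimately show ?thesis by (simp del: of_nat_add of_nat_Suc add: of_nat_eq_0_iff)
      qed
      show ?case
      proof (intro impI allI)
        fix i assume "n \<le> n0"
        then have "y (n0 - d) ((e1 ^^ i) v) = 0" "y (n0 - d) ((e1 ^^ Suc i) v) = 0"
          using IH by blast+
        then have "sc2 (?c (Suc (n0 - Suc d))) (y (n0 - Suc d) ((e1 ^^ i) v)) = 0"
          using ey[OF eV, of "n0 - Suc d" i] zer2 by (simp add: s[symmetric])
        then show "y (n0 - Suc d) ((e1 ^^ i) v) = 0" using c by (simp del: of_nat_Suc)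
      qed
    qed
    from this[of "n0 - n"] bn n0[of n 0] show ?thesis
      by (cases "n \<le> n0") (auto dest: spec[of _ 0])
  qed
  show ?thesis
    using down[of 0 v] down[of 1 v] v by (auto simp: b_def y0 yS)
qed

section \<open>The transposition of two colours\<close>

lemma bracket_E0i_Ei0:
  assumes "1 \<le> i" "i < r"
  shows "mat_bracket (Emat r 0 i P) (Emat r i 0 Q) = hmat r i (- (P * Q))"
  by (rule mat_bracket_EmatI) (use assms in \<open>auto simp: mult.commute\<close>)

lemma bracket_hmat_Ei0:
  assumes "1 \<le> i" "i < r"
  shows "mat_bracket (hmat r i P) (Emat r i 0 Q) = const 2 \<cdot>\<^sub>m Emat r i 0 (P * Q)"
proof (rule mat_bracket_EmatI)
  have c2: "const 2 = 2" by (simp add: const_def)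
  show "(const 2 \<cdot>\<^sub>m Emat r i 0 (P * Q)) $$ (a, b) = (if b = 0 then hmat r i P $$ (a, i) * Q else 0)
    - (if a = i then Q * hmat r i P $$ (0, b) else 0)" if "a < r" "b < r" for a b
    using that assms by (auto simp: c2 mult.commute)
qed (use assms in auto)

text \<open>
  Conjugation by the permutation matrix of the transposition of 0 and \<open>i\<close>, an involutive automorphism of the Lie algebra.
\<close>

definition twist :: "nat \<Rightarrow> nat \<Rightarrow> laurent mat \<Rightarrow> laurent mat" where
  "twist r i X = mat r r (\<lambda>(a, b). X $$ (transpose 0 i a, transpose 0 i b))"

lemma transpose_less: "0 < r \<Longrightarrow> i < r \<Longrightarrow> a < r \<Longrightarrow> transpose 0 i a < (r :: nat)"
  by (simp add: transpose_def)

context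
  fixes r i :: nat
  assumes ri: "0 < r" "i < r"
begin

lemma twist_carrier [simp]: "twist r i X \<in> carrier_mat r r"
  by (simp add: twist_def)

lemma twist_dim [simp]: "dim_row (twist r i X) = r" "dim_col (twist r i X) = r"
  by (simp_all add: twist_def)

lemma twist_index: "a < r \<Longrightarrow> b < r \<Longrightarrow> twist r i X $$ (a, b) = X $$ (transpose 0 i a, transpose 0 i b)"
  by (simp add: twist_def)

lemma sum_transpose: "(\<Sum>k<r. f (transpose 0 i k)) = (\<Sum>k<r. f k)"
  by (rule sum.reindex_bij_witness[of _ "transpose 0 i" "transpose 0 i"]) (use ri in \<open>auto simp: transpose_less\<close>)

lemma twist_slp: "X \<in> slp r \<Longrightarrow> twist r i X \<in> slp r"
  using sum_transpose[of "\<lambda>k. X $$ (k, k)"] ri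
  by (auto simp: sl_over_def mat_trace_def twist_def transpose_less)

lemma twist_add:
  "X \<in> carrier_mat r r \<Longrightarrow> Y \<in> carrier_mat r r \<Longrightarrow> twist r i (X + Y) = twist r i X + twist r i Y"
  by (rule eq_matI) (use ri in \<open>auto simp: twist_def transpose_less\<close>)

lemma twist_smult: "X \<in> carrier_mat r r \<Longrightarrow> twist r i (c \<cdot>\<^sub>m X) = c \<cdot>\<^sub>m twist r i X"
  by (rule eq_matI) (use ri in \<open>auto simp: twist_def transpose_less\<close>)

lemma twist_bracket:
  assumes "X \<in> carrier_mat r r" "Y \<in> carrier_mat r r"
  shows "twist r i (mat_bracket X Y) = mat_bracket (twist r i X) (twist r i Y)"
proof (rule eq_matI)
  have B: "mat_bracket (twist r i X) (twist r i Y) \<in> carrier_mat r r" by simp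
  show "dim_row (twist r i (mat_bracket X Y)) = dim_row (mat_bracket (twist r i X) (twist r i Y))"
    "dim_col (twist r i (mat_bracket X Y)) = dim_col (mat_bracket (twist r i X) (twist r i Y))"
    using carrier_matD[OF B] by (simp_all add: twist_def)
  fix a b assume "a < dim_row (mat_bracket (twist r i X) (twist r i Y))" "b < dim_col (mat_bracket (twist r i X) (twist r i Y))"
  then have ab: "a < r" "b < r" using carrier_matD[OF B] by simp_all
  have "(\<Sum>k<r. twist r i X $$ (a, k) * twist r i Y $$ (k, b)) = (\<Sum>k<r. X $$ (transpose 0 i a, k) * Y $$ (k, transpose 0 i b))"
    if "a < r" "b < r" for X Y
    using that by (subst sum_transpose[symmetric]) (simp add: twist_index)
  then show "twist r i (mat_bracket X Y) $$ (a, b) = mat_bracket (twist r i X) (twist r i Y) $$ (a, b)"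
    using ab assms ri by (simp add: twist_index mat_bracket_index[of _ r] transpose_less)
qed

lemma twist_twist: "X \<in> carrier_mat r r \<Longrightarrow> twist r i (twist r i X) = X"
  by (rule eq_matI) (use ri in \<open>auto simp: twist_index transpose_less\<close>)

lemma twist_Emat:
  assumes "a < r" "b < r"
  shows "twist r i (Emat r a b P) = Emat r (transpose 0 i a) (transpose 0 i b) P"
proof (rule eq_matI)
  fix x y assume "x < dim_row (Emat r (transpose 0 i a) (transpose 0 i b) P)"
    "y < dim_col (Emat r (transpose 0 i a) (transpose 0 i b) P)"
  then have xy: "x < r" "y < r" by simp_all
  have eq: "transpose 0 i x = a \<longleftrightarrow> x = transpose 0 i a" for x a :: nat
    by (metis transpose_involutory)
  show "twist r i (Emat r a b P) $$ (x, y) = Emat r (transpose 0 i a) (transpose 0 i b) P $$ (x, y)"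
    using xy ri by (simp add: twist_index transpose_less eq)
qed simp_all

end

abbreviation brep :: "nat \<Rightarrow> nat \<Rightarrow> sym" where
  "brep k i \<equiv> bprod (replicate k (i, 1))"

lemma brep_S0: "1 \<le> i \<Longrightarrow> i < r \<Longrightarrow> brep k i \<in> S0 r"
  by (intro bprod_S0) (auto simp: valid_def)

lemma DD_brep: "a \<noteq> i \<Longrightarrow> DD c a P (brep k i) = 0"
  by (simp add: DD_bprod)

lemma ee_brep_other: "a \<noteq> i \<Longrightarrow> ee m a P (brep k i) = 0"
  by (simp add: ee_bprod)

lemma remv_replicate: "l < n \<Longrightarrow> remv l (replicate n x) = replicate (n - 1) x"
  using remv_replicate_append(1)[of l n x "[]"] by simp

lemma qq_one_bprod: "qq m 1 (bprod qs) = scal (of_nat m - of_nat (length qs)) (bprod qs)"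
proof -
  have "bb (fst (qs ! l)) (snd (qs ! l)) * bprod (remv l qs) = bprod qs" if "l < length qs" for l
  proof -
    have "qs = take l qs @ qs ! l # drop (Suc l) qs" using that by (simp add: id_take_nth_drop)
    then have "bprod qs = bprod (take l qs @ qs ! l # drop (Suc l) qs)" by simp
    then show ?thesis by (cases "qs ! l") (simp add: remv_def ac_simps)
  qed
  then have "qq m 1 (bprod qs) = scal (of_nat m) (bprod qs) - scal (of_nat (length qs)) (bprod qs)"
    unfolding qq_bprod by (simp add: lookup_one) (simp add: scal_def)
  then show ?thesis by (simp add: scal.scale_left_diff_distrib)
qed

lemma ee_brep:
  assumes "k < m"
  shows "ee m i 1 (brep (Suc k) i) = scal (of_nat (Suc k) * (of_nat m - of_nat k)) (brep k i)"
proof -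
  have "ee m i 1 (brep (Suc k) i) = (\<Sum>l<Suc k. qq m 1 (brep k i))"
    unfolding ee_bprod by (intro sum.cong) (auto simp: remv_replicate simp del: replicate.simps)
  also have "\<dots> = scal (of_nat (Suc k)) (qq m 1 (brep k i))"
    by (simp only: sum_constant card_lessThan scal_def single_of_nat)
  finally show ?thesis by (simp add: qq_one_bprod scal_scal del: of_nat_Suc)
qed

lemma qq_brep_Gsub:
  assumes "2 \<le> r" "1 \<le> i" "i < r" "P \<in> polys"
  shows "qq m P (brep m i) \<in> Gsub r m"
proof -
  let ?c = "Poly_Mapping.lookup P 0"
  have P': "P - const ?c \<in> maxid"
    using assms polys_diff[OF assms(4) polys_const] by (simp add: maxid_def lookup_minus const_def)
  have "eps (qq m) [P - const ?c] (brep m i) \<in> Gsub r m"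
    using assms P' by (intro eps_in_Gsub) (auto simp: valid_def)
  moreover have "qq m P (brep m i) = qq m (P - const ?c) (brep m i) + scal ?c (qq m 1 (brep m i))"
    by (simp add: clin_add[OF clin_qq_param, symmetric] clin_scal[OF clin_qq_param, symmetric]) (simp add: scal_def const_def)
  ultimately show ?thesis by (simp add: eps_Cons qq_one_bprod)
qed

lemma DD_brep_Gsub:
  assumes "2 \<le> r" "1 \<le> i" "i < r" "P \<in> polys"
  shows "DD i i P (brep m i) - scal (of_nat m * Poly_Mapping.lookup P 0) (brep m i) \<in> Gsub r m"
proof -
  have "DD i i P (brep m i) = (\<Sum>l<length (replicate m (i, 1 :: laurent)). bb (fst (replicate m (i, 1 :: laurent) ! l)) (P * snd (replicate m (i, 1 :: laurent) ! l)) * bprod (remv l (replicate m (i, 1))))"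
    unfolding DD_bprod by (intro sum.cong) auto
  then have "DD i i P (brep m i) - scal (of_nat m * Poly_Mapping.lookup P 0) (brep m i) = - qq m P (brep m i)"
    unfolding qq_bprod by simp
  then show ?thesis using qq_brep_Gsub[OF assms] by (simp add: Gsub_uminus)
qed

lemma slmod_W: "2 \<le> r \<Longrightarrow> slmod r scal (WV r m) (Wact r m)"
  by unfold_locales (simp_all add: Wmodule)

lemma Wact_brep_zero:
  assumes r: "2 \<le> r" and i: "1 \<le> i" "i < r" and P: "P \<in> polys" and ab: "a < r" "b < r" "a \<noteq> b"
    and c: "a = i \<or> b \<noteq> i"
  shows "Gproj r m (act_sym r m (Emat r a b P) (brep m i)) = 0"
proof (cases "b = 0")
  case True
  then have "act_sym r m (Emat r a b P) (brep m i) = bprod ((a, P) # replicate m (i, 1))"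
    using ab by (simp add: act_sym_Emat_col)
  also have "\<dots> \<in> Gsub r m"
    using ab True P i by (intro Gsub.gen) (auto simp: valid_def)
  finally show ?thesis by (simp add: Gproj_eq_0[OF r])
next
  case False
  then have "b \<noteq> i" using c ab by auto
  then have "act_sym r m (Emat r a b P) (brep m i) = 0"
    using False ab by (cases "a = 0") (simp_all add: act_sym_Emat_row act_sym_Emat_block DD_brep ee_brep_other)
  then show ?thesis by (simp add: clin_zero[OF clin_Gproj[OF r]])
qed

text \<open>
  The Weyl group preserves the set of weights: the vector $b_i(1)^m$ satisfies the Weyl relations for the twisted action. It generates,
  since raising it \<open>m\<close> times by \<open>e_i(1)\<close> gives a nonzero multiple of the original generator.
\<close>

lemma W_twist_quotient:
  assumes r: "2 \<le> r" and i: "1 \<le> i" "i < r"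
  shows "is_weyl_quotient r m scal (WV r m) (\<lambda>X. Wact r m (twist r i X)) (Gproj r m (brep m i))"
proof -
  interpret W: slmod r scal "WV r m" "Wact r m" by (rule slmod_W[OF r])
  have r0: "0 < r" using r by simp
  note tw = twist_slp[OF r0 i(2)] twist_add[OF r0 i(2)] twist_smult[OF r0 i(2)] twist_bracket[OF r0 i(2)]
  note c = clin_Gproj[OF r, of m]
  show ?thesis
    unfolding is_weyl_quotient_def
  proof (intro conjI ballI allI impI W_finite_dim r)
    show "is_lie_module (sl_poly r) scal (WV r m) (\<lambda>X. Wact r m (twist r i X))"
      using W.sub
      by (auto simp: is_lie_module_def sl_poly_def vector_space_scal tw W.act_closed W.act_add W.act_scale
          W.act_ladd W.act_lscale W.act_bracket slp_carrier)
  next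
    show "is_generated_by (sl_poly r) scal (WV r m) (\<lambda>X. Wact r m (twist r i X)) (Gproj r m (brep m i))"
      unfolding is_generated_by_def
    proof (intro conjI allI impI)
      show "Gproj r m (brep m i) \<in> WV r m" using brep_S0[OF i] by (simp add: WV_def)
    next
      fix U assume U: "scal.subspace U \<and> U \<subseteq> WV r m \<and> Gproj r m (brep m i) \<in> U
        \<and> (\<forall>X\<in>lcarrier (sl_poly r). \<forall>u\<in>U. Wact r m (twist r i X) u \<in> U)"
      have cl: "Wact r m X u \<in> U" if "X \<in> slp r" "u \<in> U" for X u
      proof -
        have "Wact r m (twist r i (twist r i X)) u \<in> U" using U that tw(1) by auto
        then show ?thesis using that by (simp add: twist_twist[OF r0 i(2)] slp_carrier)
      qed
      have "Gproj r m (brep (m - k) i) \<in> U" if "k \<le> m" for k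
        using that
      proof (induction k)
        case 0
        then show ?case using U by simp
      next
        case (Suc k)
        let ?j = "m - Suc k"
        have E: "Emat r 0 i 1 \<in> slp r" using i by (intro Emat_slp) auto
        have s: "m - k = Suc ?j" using Suc.prems by simp
        have "Wact r m (Emat r 0 i 1) (Gproj r m (brep (m - k) i)) \<in> U"
          using Suc cl[OF E] by simp
        moreover have "Wact r m (Emat r 0 i 1) (Gproj r m (brep (m - k) i))
            = scal (of_nat (Suc ?j) * (of_nat m - of_nat ?j)) (Gproj r m (brep ?j i))"
          unfolding Wact_Gproj[OF r slp_gl[OF E]] act_sym_Emat_row[OF i] s
          using Suc.prems by (subst ee_brep) (auto simp: clin_scal[OF c] simp del: replicate.simps of_nat_Suc)
        moreover have nz: "of_nat (Suc ?j) * (of_nat m - of_nat ?j) \<noteq> (0 :: complex)"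
          using Suc.prems by (simp del: of_nat_Suc)
        ultimately have "scal (of_nat (Suc ?j) * (of_nat m - of_nat ?j)) (Gproj r m (brep ?j i)) \<in> U" by simp
        then have "scal (inverse (of_nat (Suc ?j) * (of_nat m - of_nat ?j))) (scal (of_nat (Suc ?j) * (of_nat m - of_nat ?j)) (Gproj r m (brep ?j i))) \<in> U"
          using U by (blast intro: scal.subspace_scale)
        then show ?case by (simp only: scal_scal left_inverse[OF nz] scal_one)
      qed
      from this[of m] have "Ww r m \<in> U" by (simp add: Ww_def)
      moreover have "\<forall>X\<in>lcarrier (sl_poly r). \<forall>u\<in>U. Wact r m X u \<in> U" using cl by simp
      ultimately show "U = WV r m"
        using U W_weyl_quotient[OF r, of m] unfolding is_weyl_quotient_def is_generated_by_def by blast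
    qed
  next
    fix P h assume P: "P \<in> polys" and h: "h \<in> cartan r"
    let ?X = "twist r i (tensor h P)"
    have hc: "h \<in> carrier_mat r r" "\<And>a b. a < r \<Longrightarrow> b < r \<Longrightarrow> a \<noteq> b \<Longrightarrow> h $$ (a, b) = 0"
      using h by (auto simp: cartan_def)
    then have t: "tensor h P \<in> gl_poly r"
      using P by (auto simp: tensor_def gl_poly_def polys_mult)
    have tne: "transpose 0 i a \<noteq> transpose 0 i b" if "a \<noteq> b" for a b
      using that by (metis transpose_involutory)
    have Xe: "?X $$ (a, b) = (if a = b then scal (h $$ (transpose 0 i a, transpose 0 i a)) P else 0)" if "a < r" "b < r" for a b
      using that hc r0 i transpose_less[OF r0 i(2)] tne[of a b]
      by (auto simp: twist_index[OF r0 i(2)] tensor_def const_zero const_mult_eq_scal)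
    have Xgl: "?X \<in> gl_poly r"
      using P r0 i by (auto simp: gl_poly_def Xe polys_scal)
    let ?h = "\<lambda>a. h $$ (transpose 0 i a, transpose 0 i a)"
    have "act_sym r m ?X (brep m i) = qq m (scal (?h 0) P) (brep m i) + DD i i (scal (?h i) P) (brep m i)"
    proof -
      have "(\<Sum>a\<in>{1..<r}. \<Sum>b\<in>{1..<r}. DD a b (?X $$ (a, b)) (brep m i))
        = (\<Sum>a\<in>{1..<r}. if a = i then DD i i (scal (?h i) P) (brep m i) else 0)"
      proof (rule sum.cong[OF refl])
        fix a assume a: "a \<in> {1..<r}"
        have "(\<Sum>b\<in>{1..<r}. DD a b (?X $$ (a, b)) (brep m i))
          = (\<Sum>b\<in>{1..<r}. if b = i then (if a = i then DD i i (scal (?h i) P) (brep m i) else 0) else 0)"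
          using a by (intro sum.cong refl) (auto simp: Xe clin_zero[OF clin_DD_param] DD_brep)
        then show "(\<Sum>b\<in>{1..<r}. DD a b (?X $$ (a, b)) (brep m i)) = (if a = i then DD i i (scal (?h i) P) (brep m i) else 0)"
          using i by simp
      qed
      then have "(\<Sum>a\<in>{1..<r}. \<Sum>b\<in>{1..<r}. DD a b (?X $$ (a, b)) (brep m i)) = DD i i (scal (?h i) P) (brep m i)"
        using i by simp
      then show ?thesis
        unfolding act_sym_def using r0 by (simp add: Xe clin_zero[OF clin_ee_param])
    qed
    then have "act_sym r m ?X (brep m i) - scal (of_nat m * Poly_Mapping.lookup (scal (?h i) P) 0) (brep m i)
        = qq m (scal (?h 0) P) (brep m i) + (DD i i (scal (?h i) P) (brep m i) - scal (of_nat m * Poly_Mapping.lookup (scal (?h i) P) 0) (brep m i))"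
      by simp
    also have "\<dots> \<in> Gsub r m"
      using r i P by (intro Gsub.add qq_brep_Gsub DD_brep_Gsub polys_scal)
    finally have "Gproj r m (act_sym r m ?X (brep m i)) = Gproj r m (scal (of_nat m * Poly_Mapping.lookup (scal (?h i) P) 0) (brep m i))"
      by (rule Gproj_cong[OF r])
    then show "Wact r m ?X (Gproj r m (brep m i)) = scal (of_nat m * h $$ (0, 0) * Poly_Mapping.lookup P (0, 0)) (Gproj r m (brep m i))"
      unfolding Wact_Gproj[OF r Xgl] by (simp add: clin_scal[OF c] lookup_scal zero_prod_def mult.assoc)
  next
    fix P a b assume P: "P \<in> polys" and ab: "a < b \<and> b < r"
    then have lt: "transpose 0 i a < r" "transpose 0 i b < r" using transpose_less[OF r0 i(2)] by auto
    have ne: "transpose 0 i a \<noteq> transpose 0 i b" using ab by (metis less_irrefl transpose_involutory)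
    have "transpose 0 i a = i \<or> transpose 0 i b \<noteq> i" using ab by (auto simp: transpose_def)
    from Wact_brep_zero[OF r i P lt ne this, of m]
    show "Wact r m (twist r i (Emat r a b P)) (Gproj r m (brep m i)) = 0"
      using ab twist_Emat[OF r0 i(2), of a b P] Wact_Gproj[OF r Emat_gl_poly[OF P]] by simp
  qed
qed

text \<open>
  By the universal property of the Weyl module there is a map from it onto its twist; \<open>sigma r i m\<close> is such a map, lifted to the symmetric
  algebra.
\<close>

definition is_sigma :: "nat \<Rightarrow> nat \<Rightarrow> nat \<Rightarrow> (sym \<Rightarrow> sym) \<Rightarrow> bool" where
  "is_sigma r i m s \<longleftrightarrow> clin s \<and> (\<forall>u. s u \<in> WV r m) \<and> s 1 = Gproj r m (brep m i) \<and>
     (\<forall>u\<in>S0 r. \<forall>X\<in>slp r. s (act_sym r m X u) = Wact r m (twist r i X) (s u)) \<and>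
     (\<forall>u\<in>Gsub r m. s u = 0) \<and> WV r m = s ` S0 r"

definition sigma :: "nat \<Rightarrow> nat \<Rightarrow> nat \<Rightarrow> sym \<Rightarrow> sym" where
  "sigma r i m = (SOME s. is_sigma r i m s)"

lemma is_sigma:
  assumes "2 \<le> r" "1 \<le> i" "i < r"
  shows "is_sigma r i m (sigma r i m)"
proof -
  interpret weyl_quotient r scal "WV r m" "\<lambda>X. Wact r m (twist r i X)" m "Gproj r m (brep m i)"
    by unfold_locales (use assms W_twist_quotient[OF assms, of m] in \<open>auto simp: is_weyl_quotient_def\<close>)
  have "is_sigma r i m ev"
    unfolding is_sigma_def
  proof (intro conjI ballI allI)
    show "clin ev" by (simp add: clin_def ev_add ev_scal)
  qed (auto simp: ev_V ev_one ev_act ev_Gsub V_eq[symmetric])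
  then show ?thesis unfolding sigma_def by (rule someI[of "is_sigma r i m"])
qed

section \<open>The map tau and its conjugates\<close>

lemma xpow_add: "xpow a * xpow b = xpow (a + b)"
  by (simp add: xpow_def mult_single)

lemma xpow_0 [simp]: "xpow 0 = 1"
  by (simp add: xpow_def flip: zero_prod_def)

lemma lookup_xpow_mult: "0 < k \<Longrightarrow> P \<in> polys \<Longrightarrow> Poly_Mapping.lookup (xpow k * P) 0 = 0"
  by (simp add: lookup_mult_zero polys_xpow) (simp add: xpow_def lookup_single zero_prod_def)

lemma clin_tau_pow: "clin (tau ^^ k)"
  by (induction k) (simp_all add: clin_def clin_add[OF clin_tau] clin_scal[OF clin_tau])

lemma tau_pow_mult: "(tau ^^ k) (u * v) = (tau ^^ k) u * (tau ^^ k) v"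
  by (induction k) (simp_all add: tau_mult)

lemma tau_pow_one [simp]: "(tau ^^ k) 1 = 1"
  by (induction k) simp_all

lemma tau_pow_bb: "(tau ^^ k) (bb c Q) = bb c (xpow (int k) * Q)"
  by (induction k) (simp_all add: tau_bb xpow_add flip: mult.assoc)

lemma tau_pow_S0: "u \<in> S0 r \<Longrightarrow> (tau ^^ k) u \<in> S0 r"
  by (induction k) (simp_all add: tau_S0)

lemma tau_pow_Gsub: "2 \<le> r \<Longrightarrow> u \<in> Gsub r m \<Longrightarrow> (tau ^^ k) u \<in> Gsub r (m + k)"
  by (induction k) (simp_all add: tau_Gsub)

text \<open>
  \<open>Y\<close> is the conjugate of \<open>X\<close> by the diagonal matrix with entries $1, x^k, \dots, x^k$; without division by powers of \<open>x\<close>.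
\<close>

definition xconj :: "nat \<Rightarrow> nat \<Rightarrow> laurent mat \<Rightarrow> laurent mat \<Rightarrow> bool" where
  "xconj r k X Y \<longleftrightarrow> X \<in> gl_poly r \<and> Y \<in> gl_poly r \<and> Y $$ (0, 0) = X $$ (0, 0) \<and>
     (\<forall>a\<in>{1..<r}. Y $$ (a, 0) = xpow (int k) * X $$ (a, 0) \<and> X $$ (0, a) = xpow (int k) * Y $$ (0, a) \<and>
       (\<forall>b\<in>{1..<r}. Y $$ (a, b) = X $$ (a, b)))"

text \<open>
  Apart from a scalar, \<open>tau\<close> intertwines the action with its conjugate. The scalar stems from the change of the weight \<open>m\<close> and appears at 1 only; it
  persists because the correction \<open>[X, E_{c0} Q]\<close> has an upper left entry divisible by \<open>x\<close>.
\<close>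

lemma tau_pow_act:
  assumes "u \<in> S0 r" "xconj r k X Y" "0 < r" "0 < k"
  shows "(tau ^^ k) (act_sym r m X u) = act_sym r (m + k) Y ((tau ^^ k) u)
    - scal (of_nat k * Poly_Mapping.lookup (X $$ (0, 0)) 0) ((tau ^^ k) u)"
  using assms(1,2)
proof (induction arbitrary: X Y rule: S0.induct)
  case one
  then have "bb j (Y $$ (j, 0)) = (tau ^^ k) (bb j (X $$ (j, 0)))" if "j \<in> {1..<r}" for j
    using that by (simp add: xconj_def tau_pow_bb)
  then show ?case
    using one by (simp add: act_sym_one clin_add[OF clin_tau_pow] clin_sum[OF clin_tau_pow] clin_scal[OF clin_tau_pow]
      xconj_def distrib_right scal_add_left)
next
  case (bb c Q u)
  let ?E = "Emat r c 0 Q" and ?F = "Emat r c 0 (xpow (int k) * Q)"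
  have X: "X \<in> gl_poly r" "Y \<in> gl_poly r" using bb by (auto simp: xconj_def)
  have E: "?E \<in> gl_poly r" "?F \<in> gl_poly r" using bb by (auto simp: Emat_gl_poly polys_mult polys_xpow)
  have "xconj r k (mat_bracket X ?E) (mat_bracket Y ?F)"
    unfolding xconj_def
  proof (intro conjI ballI gl_poly_bracket X E)
    show "mat_bracket Y ?F $$ (0, 0) = mat_bracket X ?E $$ (0, 0)"
      using bb gl_polyD(1)[OF X(1)] gl_polyD(1)[OF X(2)] by (simp add: mat_bracket_Emat_index xconj_def ac_simps)
  next
    fix a assume "a \<in> {1..<r}"
    then show "mat_bracket Y ?F $$ (a, 0) = xpow (int k) * mat_bracket X ?E $$ (a, 0)"
      using bb gl_polyD(1)[OF X(1)] gl_polyD(1)[OF X(2)] by (simp add: mat_bracket_Emat_index xconj_def algebra_simps)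
  next
    fix a assume "a \<in> {1..<r}"
    then show "mat_bracket X ?E $$ (0, a) = xpow (int k) * mat_bracket Y ?F $$ (0, a)"
      using bb gl_polyD(1)[OF X(1)] gl_polyD(1)[OF X(2)] by (simp add: mat_bracket_Emat_index)
  next
    fix a b assume "a \<in> {1..<r}" "b \<in> {1..<r}"
    then show "mat_bracket Y ?F $$ (a, b) = mat_bracket X ?E $$ (a, b)"
      using bb gl_polyD(1)[OF X(1)] gl_polyD(1)[OF X(2)] by (simp add: mat_bracket_Emat_index xconj_def ac_simps)
  qed
  moreover have "Poly_Mapping.lookup (mat_bracket X ?E $$ (0, 0)) 0 = 0"
  proof -
    have "mat_bracket X ?E $$ (0, 0) = xpow (int k) * (Y $$ (0, c) * Q)"
      using bb gl_polyD(1)[OF X(1)] by (simp add: mat_bracket_Emat_index xconj_def ac_simps)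
    then show ?thesis
      using bb assms gl_polyD(2)[OF X(2), of 0 c] by (simp add: lookup_xpow_mult polys_mult)
  qed
  ultimately have "(tau ^^ k) (act_sym r m (mat_bracket X ?E) u) = act_sym r (m + k) (mat_bracket Y ?F) ((tau ^^ k) u)"
    using bb.IH by simp
  moreover have "(tau ^^ k) (act_sym r m X u) = act_sym r (m + k) Y ((tau ^^ k) u)
    - scal (of_nat k * Poly_Mapping.lookup (X $$ (0, 0)) 0) ((tau ^^ k) u)"
    by (rule bb.IH[OF bb.prems])
  ultimately show ?case
    using bb.hyps gl_polyD(1)[OF X(1)] gl_polyD(1)[OF X(2)]
    by (simp add: act_sym_bb clin_add[OF clin_tau_pow] tau_pow_mult tau_pow_bb right_diff_distrib scal_mult_right)
next
  case (add u v)
  then show ?case by (simp add: clin_add[OF clin_act_sym] clin_add[OF clin_tau_pow] scal_add_right)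
next
  case (scal u c)
  then show ?case
    by (simp add: clin_scal[OF clin_act_sym] clin_scal[OF clin_tau_pow] scal_diff_right scal_scal mult.commute)
qed

text \<open>
  The conjugate of \<open>tau\<close> by the transposition of the colours 0 and \<open>i\<close>. In the row and the column of colour \<open>i\<close> it shifts by \<open>x\<close> in the
  direction opposite to \<open>tau\<close>, and it commutes with the operators that do not involve \<open>i\<close>.
\<close>

definition tauc :: "nat \<Rightarrow> nat \<Rightarrow> nat \<Rightarrow> sym \<Rightarrow> sym" where
  "tauc r i m u = sigma r i (Suc m) (tau (sigma r i m u))"

context
  fixes r i :: nat
  assumes r: "2 \<le> r" and i: "1 \<le> i" "i < r"
begin

lemma sigmaD: "clin (sigma r i m)" "sigma r i m u \<in> WV r m" "sigma r i m 1 = Gproj r m (brep m i)"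
  "u \<in> S0 r \<Longrightarrow> X \<in> slp r \<Longrightarrow> sigma r i m (act_sym r m X u) = Wact r m (twist r i X) (sigma r i m u)"
  "u \<in> Gsub r m \<Longrightarrow> sigma r i m u = 0" "WV r m = sigma r i m ` S0 r"
  using is_sigma[OF r i, of m] unfolding is_sigma_def by blast+

lemma sigma_cong: "u - v \<in> Gsub r m \<Longrightarrow> sigma r i m u = sigma r i m v"
  using sigmaD(5)[of "u - v" m] by (simp add: clin_diff[OF sigmaD(1)])

lemma sigma_tau_Gproj: "sigma r i (Suc m) (tau (Gproj r m u)) = sigma r i (Suc m) (tau u)"
  using tau_Gsub[OF r Gsub_uminus[OF Gproj_diff[OF r, of u m]]]
  by (intro sigma_cong) (simp add: clin_diff[OF clin_tau])

lemma clin_tauc: "clin (tauc r i m)"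
  using sigmaD(1) clin_tau by (simp add: clin_def tauc_def)

lemma tauc_WV: "tauc r i m u \<in> WV r (Suc m)"
  by (simp add: tauc_def sigmaD(2))

lemma tauc_Gsub: "u \<in> Gsub r m \<Longrightarrow> tauc r i m u = 0"
  by (simp add: tauc_def sigmaD(5) clin_zero[OF clin_tau] clin_zero[OF sigmaD(1)])

lemma tauc_act:
  assumes u: "u \<in> S0 r" and X: "X \<in> slp r" and Y: "Y \<in> slp r" and p: "xconj r 1 (twist r i X) (twist r i Y)"
  shows "tauc r i m (act_sym r m X u) = Wact r (Suc m) Y (tauc r i m u)
    - scal (Poly_Mapping.lookup (X $$ (i, i)) 0) (tauc r i m u)"
proof -
  have r0: "0 < r" using r by simp
  let ?u = "sigma r i m u"
  have S: "?u \<in> S0 r" using WV_S0[OF r] sigmaD(2) by blast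
  have "tauc r i m (act_sym r m X u) = sigma r i (Suc m) (tau (act_sym r m (twist r i X) ?u))"
    by (simp add: tauc_def sigmaD(4)[OF u X] Wact_def sigma_tau_Gproj)
  also have "tau (act_sym r m (twist r i X) ?u) = act_sym r (Suc m) (twist r i Y) (tau ?u)
      - scal (Poly_Mapping.lookup (X $$ (i, i)) 0) (tau ?u)"
    using tau_pow_act[OF S p, of m] r0 by (simp add: twist_index[OF r0 i(2)])
  also have "sigma r i (Suc m) \<dots> = Wact r (Suc m) (twist r i (twist r i Y)) (tauc r i m u)
    - scal (Poly_Mapping.lookup (X $$ (i, i)) 0) (tauc r i m u)"
    using tau_S0[OF S] twist_slp[OF r0 i(2) Y]
    by (simp add: clin_diff[OF sigmaD(1)] clin_scal[OF sigmaD(1)] sigmaD(4) tauc_def)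
  finally show ?thesis by (simp add: twist_twist[OF r0 i(2)] slp_carrier[OF Y])
qed

lemma twist_gl: "X \<in> slp r \<Longrightarrow> twist r i X \<in> gl_poly r"
  using twist_slp[of r i X] r i slp_gl by auto

lemma tauc_act_other:
  assumes "u \<in> S0 r" "P \<in> polys" "a < r" "b < r" "a \<noteq> b" "a \<noteq> i" "b \<noteq> i"
  shows "tauc r i m (act_sym r m (Emat r a b P) u) = Wact r (Suc m) (Emat r a b P) (tauc r i m u)"
proof -
  have E: "Emat r a b P \<in> slp r" using assms by (intro Emat_slp) auto
  have "xconj r 1 (twist r i (Emat r a b P)) (twist r i (Emat r a b P))"
    using assms i r twist_gl[OF E] by (auto simp: xconj_def twist_index transpose_def)
  from tauc_act[OF assms(1) E E this, of m] show ?thesis using assms i by simp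
qed

lemma tauc_act_row:
  assumes "u \<in> S0 r" "P \<in> polys"
  shows "tauc r i m (act_sym r m (Emat r 0 i P) u) = Wact r (Suc m) (Emat r 0 i (xpow 1 * P)) (tauc r i m u)"
proof -
  have E: "Emat r 0 i P \<in> slp r" "Emat r 0 i (xpow 1 * P) \<in> slp r" using assms i by (auto intro!: Emat_slp polys_mult polys_xpow)
  have "xconj r 1 (twist r i (Emat r 0 i P)) (twist r i (Emat r 0 i (xpow 1 * P)))"
    using assms i r twist_gl[OF E(1)] twist_gl[OF E(2)] by (auto simp: xconj_def twist_index transpose_def)
  from tauc_act[OF assms(1) E this, of m] show ?thesis using assms i by simp
qed

lemma tauc_act_col:
  assumes "u \<in> S0 r" "P \<in> polys"
  shows "tauc r i m (act_sym r m (Emat r i 0 (xpow 1 * P)) u) = Wact r (Suc m) (Emat r i 0 P) (tauc r i m u)"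
proof -
  have E: "Emat r i 0 P \<in> slp r" "Emat r i 0 (xpow 1 * P) \<in> slp r" using assms i by (auto intro!: Emat_slp polys_mult polys_xpow)
  have "xconj r 1 (twist r i (Emat r i 0 (xpow 1 * P))) (twist r i (Emat r i 0 P))"
    using assms i r twist_gl[OF E(1)] twist_gl[OF E(2)] by (auto simp: xconj_def twist_index transpose_def)
  from tauc_act[OF assms(1) E(2,1) this, of m] show ?thesis using assms i by simp
qed

lemma tauc_act_hmat:
  assumes "u \<in> S0 r" "P \<in> polys" "1 \<le> j" "j < r"
  shows "tauc r i m (act_sym r m (hmat r j P) u) = Wact r (Suc m) (hmat r j P) (tauc r i m u)
    - scal (if i = j then Poly_Mapping.lookup P 0 else 0) (tauc r i m u)"
proof -
  have H: "hmat r j P \<in> slp r" using assms by (intro hmat_slp) auto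
  have "xconj r 1 (twist r i (hmat r j P)) (twist r i (hmat r j P))"
    using assms i r twist_gl[OF H] by (auto simp: xconj_def twist_index transpose_def)
  from tauc_act[OF assms(1) H H this, of m] show ?thesis using assms i by auto
qed

lemma ee_eps_brep:
  "ee m i (xpow 1) (eps (qq m) (replicate k (xpow 1)) (brep (Suc n) i))
    = scal (of_nat (Suc n)) (eps (qq m) (replicate (Suc k) (xpow 1)) (brep n i))"
proof -
  have "ee m i (xpow 1) (eps (qq m) (replicate k (xpow 1)) (brep (Suc n) i))
    = (\<Sum>l<Suc n. eps (qq m) (replicate k (xpow 1) @ [xpow 1]) (brep n i))"
    using i by (subst ee_eps[of _ r]) (auto simp: remv_replicate polys_xpow valid_def simp del: replicate.simps intro!: sum.cong)
  also have "\<dots> = scal (of_nat (Suc n)) (eps (qq m) (replicate (Suc k) (xpow 1)) (brep n i))"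
    by (simp only: sum_constant card_lessThan scal_def single_of_nat replicate_append_same replicate.simps)
  finally show ?thesis .
qed

text \<open>
  The image of 1 is $b_i(x)^m$ reflected back, that is, $e_i(x)^m$ applied to $b_i(1)^{m+1}$. By \<open>ee_eps_brep\<close> this is a contraction of
  a single generator, which \<open>eps_bb\<close> evaluates.
\<close>

lemma tauc_one: "\<exists>c. c \<noteq> 0 \<and> tauc r i m 1 = scal c (Gproj r (Suc m) (bb i (xpow (int m))))"
proof -
  let ?M = "Suc m" and ?x = "xpow 1"
  have x: "?x \<in> maxid" unfolding xpow_def by (rule maxid_single) (simp_all add: zero_prod_def)
  note x = maxid_polys[OF x] x
  have E: "Emat r i 0 ?x \<in> slp r" "Emat r 0 i ?x \<in> slp r" using i x by (auto intro!: Emat_slp)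
  have "(tau ^^ 1) (brep k i) = bprod (replicate k (i, ?x))" for k
    by (induction k) (simp_all add: tau_mult tau_bb)
  then have "tauc r i m 1 = sigma r i ?M (bprod (replicate m (i, ?x)))"
    by (simp add: tauc_def sigmaD(3) sigma_tau_Gproj)
  moreover have "\<exists>c. c \<noteq> 0 \<and> sigma r i ?M (bprod (replicate k (i, ?x))) = scal c (Gproj r ?M (eps (qq ?M) (replicate k ?x) (brep (?M - k) i)))"
    if "k \<le> m" for k
    using that
  proof (induction k)
    case 0
    show ?case by (rule exI[of _ 1]) (simp add: sigmaD(3))
  next
    case (Suc k)
    then obtain c where c: "c \<noteq> 0" "sigma r i ?M (bprod (replicate k (i, ?x))) = scal c (Gproj r ?M (eps (qq ?M) (replicate k ?x) (brep (?M - k) i)))"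
      by auto
    have s: "?M - k = Suc (m - k)" using Suc.prems by simp
    have "bprod (replicate k (i, ?x)) \<in> S0 r" using i x by (intro bprod_S0) (auto simp: valid_def)
    from sigmaD(4)[OF this E(1), of ?M]
    have "sigma r i ?M (bprod (replicate (Suc k) (i, ?x))) = Wact r ?M (Emat r 0 i ?x) (sigma r i ?M (bprod (replicate k (i, ?x))))"
      using i r by (simp add: act_sym_Emat_col twist_Emat)
    also have "\<dots> = scal c (Gproj r ?M (ee ?M i ?x (eps (qq ?M) (replicate k ?x) (brep (Suc (m - k)) i))))"
      unfolding c(2) s clin_scal[OF clin_Gproj[OF r], symmetric] Wact_Gproj[OF r slp_gl[OF E(2)]] clin_scal[OF clin_act_sym]
      using i by (simp only: act_sym_Emat_row)
    also have "\<dots> = scal (c * of_nat (Suc (m - k))) (Gproj r ?M (eps (qq ?M) (replicate (Suc k) ?x) (brep (m - k) i)))"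
      unfolding ee_eps_brep clin_scal[OF clin_Gproj[OF r]] scal_scal ..
    finally show ?case
      using c(1) by (intro exI[of _ "c * of_nat (Suc (m - k))"]) (simp del: of_nat_Suc)
  qed
  from this[of m] obtain c where c: "c \<noteq> 0"
    "sigma r i ?M (bprod (replicate m (i, ?x))) = scal c (Gproj r ?M (eps (qq ?M) (replicate m ?x) (bb i 1)))"
    by auto
  moreover have "eps (qq ?M) (replicate m ?x) (bb i 1) = scal ((-1) ^ m * fact m) (bb i (xpow (int m)))"
  proof -
    have "?x ^ m = xpow (int m)" by (induction m) (simp_all add: xpow_add)
    then show ?thesis using x by (subst eps_bb) auto
  qed
  ultimately show ?thesis
    by (intro exI[of _ "c * ((-1) ^ m * fact m)"]) (simp add: clin_scal[OF clin_Gproj[OF r]] scal_scal)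
qed

end

lemma Gproj_mult_Gproj:
  assumes "2 \<le> r" "u \<in> S0 r"
  shows "Gproj r m (u * Gproj r m v) = Gproj r m (u * v)"
proof (rule Gproj_cong[OF assms(1)])
  have "u * (Gproj r m v - v) \<in> Gsub r m"
    using Gsub_uminus[OF Gproj_diff[OF assms(1), of v m]] by (intro Gsub_ideal assms) simp
  then show "u * Gproj r m v - u * v \<in> Gsub r m" by (simp add: right_diff_distrib)
qed

lemma bb_S0: "1 \<le> c \<Longrightarrow> c < r \<Longrightarrow> Q \<in> polys \<Longrightarrow> bb c Q \<in> S0 r"
  using S0.bb[OF _ _ _ S0.one, of c r Q] by simp

lemma S0_mult: "u \<in> S0 r \<Longrightarrow> v \<in> S0 r \<Longrightarrow> u * v \<in> S0 r"
  by (induction rule: S0.induct)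
    (simp_all add: distrib_right scal_mult_left mult.assoc S0.intros)

lemma tauc_cong:
  assumes "2 \<le> r" "1 \<le> i" "i < r" "Gproj r m u = Gproj r m v"
  shows "tauc r i m u = tauc r i m v"
proof -
  have "u - v \<in> Gsub r m"
    using Gproj_eq_0[OF assms(1), of m "u - v"] assms(4) by (simp add: clin_diff[OF clin_Gproj[OF assms(1)]])
  then show ?thesis using tauc_Gsub[OF assms(1-3), of "u - v" m] by (simp add: clin_diff[OF clin_tauc[OF assms(1-3)]])
qed

lemma tauc_bprod_other:
  assumes r: "2 \<le> r" and i: "1 \<le> i" "i < r" and qs: "valid r qs" "\<forall>(c, Q)\<in>set qs. c \<noteq> i"
  shows "tauc r i m (bprod qs) = Gproj r (Suc m) (bprod qs * tauc r i m 1)"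
  using qs
proof (induction qs)
  case Nil
  then show ?case using Gproj_WV[OF r tauc_WV[OF r i]] by simp
next
  case (Cons cQ qs)
  obtain c Q where cQ: "cQ = (c, Q)" by fastforce
  then have c: "1 \<le> c" "c < r" "Q \<in> polys" "valid r qs" "c \<noteq> i" using Cons by auto
  have "tauc r i m (act_sym r m (Emat r c 0 Q) (bprod qs)) = Wact r (Suc m) (Emat r c 0 Q) (tauc r i m (bprod qs))"
    using c i by (intro tauc_act_other[OF r i] bprod_S0) auto
  then have "tauc r i m (bb c Q * bprod qs) = Gproj r (Suc m) (bb c Q * Gproj r (Suc m) (bprod qs * tauc r i m 1))"
    using c Cons cQ by (simp add: act_sym_Emat_col Wact_def)
  then show ?case using c bb_S0 by (simp add: cQ Gproj_mult_Gproj[OF r] mult.assoc)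
qed

text \<open>
  The product of the maps \<open>tauc r i\<close> over the colours \<open>r - 1, \<dots>, 1\<close>, in this order, each of which raises the weight by 1. The product
  shifts all rows and columns in the direction opposite to \<open>tau\<close>.
\<close>

primrec tdown :: "nat \<Rightarrow> nat \<Rightarrow> nat \<Rightarrow> sym \<Rightarrow> sym" where
  "tdown r 0 m u = u"
| "tdown r (Suc k) m u = tauc r (r - 1 - k) (m + k) (tdown r k m u)"

definition tv :: "nat \<Rightarrow> nat \<Rightarrow> sym \<Rightarrow> sym" where
  "tv r m = tdown r (r - 1) m"

primrec tv_pow :: "nat \<Rightarrow> nat \<Rightarrow> nat \<Rightarrow> sym \<Rightarrow> sym" where
  "tv_pow r 0 m u = u"
| "tv_pow r (Suc k) m u = tv r (m + k * (r - 1)) (tv_pow r k m u)"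

text \<open>
  \<open>delta r (m + r)\<close> is the monomial of the transition map from weight \<open>m\<close> to weight \<open>m + r\<close>.
\<close>

definition delta :: "nat \<Rightarrow> int \<Rightarrow> sym" where
  "delta r e = (\<Prod>j\<in>{1..<r}. bb j (xpow (e - int j)))"

lemma tau_prod: "tau (prod f A) = (\<Prod>a\<in>A. tau (f a))"
  by (induction A rule: infinite_finite_induct) (simp_all add: tau_mult)

lemma tau_delta: "tau (delta r e) = delta r (e + 1)"
  by (simp add: delta_def tau_prod tau_bb xpow_add) (simp add: algebra_simps)

lemma S0_prod: "(\<And>a. a \<in> A \<Longrightarrow> f a \<in> S0 r) \<Longrightarrow> prod f A \<in> S0 r"
  by (induction A rule: infinite_finite_induct) (simp_all add: S0.one S0_mult)

lemma delta_S0: "int r - 1 \<le> e \<Longrightarrow> delta r e \<in> S0 r"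
  unfolding delta_def by (intro S0_prod bb_S0 polys_xpow) auto

context
  fixes r :: nat
  assumes r: "2 \<le> r"
begin

lemma not_le_pred: "\<not> r \<le> r - Suc 0"
  using r by simp

lemma clin_tdown: "k \<le> r - 1 \<Longrightarrow> clin (tdown r k m)"
proof (induction k)
  case 0
  have "tdown r 0 m = (\<lambda>u. u)" by (simp add: fun_eq_iff)
  then show ?case by (simp add: clin_id)
next
  case (Suc k)
  have "tdown r (Suc k) m = (\<lambda>u. tauc r (r - 1 - k) (m + k) (tdown r k m u))" by (simp add: fun_eq_iff)
  moreover have "clin (tauc r (r - 1 - k) (m + k))" using Suc.prems by (intro clin_tauc[OF r]) auto
  moreover have "clin (tdown r k m)" using Suc by simp
  ultimately show ?case by (simp add: clin_def)
qed

lemma tdown_S0: "k \<le> r - 1 \<Longrightarrow> u \<in> S0 r \<Longrightarrow> tdown r k m u \<in> S0 r"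
proof (induction k)
  case (Suc k)
  then show ?case using WV_S0[OF r tauc_WV[OF r, of "r - 1 - k" "m + k"]] by simp
qed simp

lemma tdown_Gsub: "k \<le> r - 1 \<Longrightarrow> u \<in> Gsub r m \<Longrightarrow> tdown r k m u \<in> Gsub r (m + k)"
proof (induction k)
  case (Suc k)
  then have "tdown r (Suc k) m u = 0" using tauc_Gsub[OF r, of "r - 1 - k"] by simp
  then show ?case using Gsub_zero[OF r] by simp
qed simp

lemma tv_WV: "tv r m u \<in> WV r (m + (r - 1))"
proof -
  obtain k where k: "r - 1 = Suc k" using r by (cases "r - 1") auto
  then show ?thesis using tauc_WV[OF r, of "r - 1 - k" "m + k"] by (simp add: tv_def)
qed

lemma tdown_act_row:
  assumes "k \<le> r - 1" "u \<in> S0 r" "P \<in> polys" "1 \<le> j" "j < r"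
  shows "Gproj r (m + k) (tdown r k m (act_sym r m (Emat r 0 j P) u))
    = Wact r (m + k) (Emat r 0 j (if r \<le> j + k then xpow 1 * P else P)) (tdown r k m u)"
  using assms(1)
proof (induction k)
  case 0
  then show ?case using assms by (simp add: Wact_def)
next
  case (Suc k)
  let ?i = "r - 1 - k" and ?P = "if r \<le> j + k then xpow 1 * P else P"
  have i: "1 \<le> ?i" "?i < r" using Suc.prems by auto
  have P: "?P \<in> polys" using assms by (simp add: polys_mult polys_xpow)
  have S: "tdown r k m u \<in> S0 r" using Suc.prems assms by (intro tdown_S0) auto
  have "tdown r (Suc k) m (act_sym r m (Emat r 0 j P) u)
     = tauc r ?i (m + k) (act_sym r (m + k) (Emat r 0 j ?P) (tdown r k m u))"
    using Suc by (simp only: tdown.simps, intro tauc_cong[OF r i]) (simp add: Wact_def)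
  also have "\<dots> = Wact r (Suc (m + k)) (Emat r 0 j (if r \<le> j + Suc k then xpow 1 * P else P)) (tdown r (Suc k) m u)"
  proof (cases "j = ?i")
    case True
    then have "\<not> r \<le> j + k" "r \<le> j + Suc k" using i by auto
    then show ?thesis using tauc_act_row[OF r i S P, of "m + k"] True not_le_pred by simp
  next
    case False
    then have "(r \<le> j + k) = (r \<le> j + Suc k)" using i by auto
    then show ?thesis using tauc_act_other[OF r i S P, of 0 j "m + k"] False assms i by simp
  qed
  finally show ?case by (simp only: add_Suc_right Wact_def Gproj_idem[OF r])
qed

lemma tdown_act_col:
  assumes "k \<le> r - 1" "u \<in> S0 r" "P \<in> polys" "1 \<le> j" "j < r"
  shows "Gproj r (m + k) (tdown r k m (act_sym r m (Emat r j 0 (xpow 1 * P)) u))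
    = Wact r (m + k) (Emat r j 0 (if r \<le> j + k then P else xpow 1 * P)) (tdown r k m u)"
  using assms(1)
proof (induction k)
  case 0
  then show ?case using assms by (simp add: Wact_def)
next
  case (Suc k)
  let ?i = "r - 1 - k" and ?P = "if r \<le> j + k then P else xpow 1 * P"
  have i: "1 \<le> ?i" "?i < r" using Suc.prems by auto
  have P: "?P \<in> polys" using assms by (simp add: polys_mult polys_xpow)
  have S: "tdown r k m u \<in> S0 r" using Suc.prems assms by (intro tdown_S0) auto
  have "tdown r (Suc k) m (act_sym r m (Emat r j 0 (xpow 1 * P)) u)
     = tauc r ?i (m + k) (act_sym r (m + k) (Emat r j 0 ?P) (tdown r k m u))"
    using Suc by (simp only: tdown.simps, intro tauc_cong[OF r i]) (simp add: Wact_def)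
  also have "\<dots> = Wact r (Suc (m + k)) (Emat r j 0 (if r \<le> j + Suc k then P else xpow 1 * P)) (tdown r (Suc k) m u)"
  proof (cases "j = ?i")
    case True
    then have "\<not> r \<le> j + k" "r \<le> j + Suc k" using i by auto
    then show ?thesis using tauc_act_col[OF r i S assms(3), of "m + k"] True not_le_pred by simp
  next
    case False
    then have "(r \<le> j + k) = (r \<le> j + Suc k)" using i by auto
    then show ?thesis using tauc_act_other[OF r i S P, of j 0 "m + k"] False assms i by simp
  qed
  finally show ?case by (simp only: add_Suc_right Wact_def Gproj_idem[OF r])
qed

lemma tdown_act_hmat:
  assumes "k \<le> r - 1" "u \<in> S0 r" "P \<in> polys" "1 \<le> j" "j < r"
  shows "Gproj r (m + k) (tdown r k m (act_sym r m (hmat r j P) u))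
    = Wact r (m + k) (hmat r j P) (tdown r k m u)
      - scal (if r \<le> j + k then Poly_Mapping.lookup P 0 else 0) (Gproj r (m + k) (tdown r k m u))"
  using assms(1)
proof (induction k)
  case 0
  then show ?case using assms by (simp add: Wact_def)
next
  case (Suc k)
  let ?i = "r - 1 - k" and ?c = "\<lambda>k. if r \<le> j + k then Poly_Mapping.lookup P 0 else 0"
  have i: "1 \<le> ?i" "?i < r" using Suc.prems by auto
  have S: "tdown r k m u \<in> S0 r" using Suc.prems assms by (intro tdown_S0) auto
  note c = clin_Gproj[OF r]
  have "tdown r (Suc k) m (act_sym r m (hmat r j P) u)
     = tauc r ?i (m + k) (act_sym r (m + k) (hmat r j P) (tdown r k m u) - scal (?c k) (tdown r k m u))"
    using Suc by (simp only: tdown.simps, intro tauc_cong[OF r i]) (simp add: Wact_def clin_diff[OF c] clin_scal[OF c])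
  also have "\<dots> = Wact r (Suc (m + k)) (hmat r j P) (tdown r (Suc k) m u) - scal (?c (Suc k)) (tdown r (Suc k) m u)"
  proof (cases "j = ?i")
    case True
    then have "\<not> r \<le> j + k" "r \<le> j + Suc k" using i by auto
    then show ?thesis using tauc_act_hmat[OF r i S assms(3-5), of "m + k"] True not_le_pred by simp
  next
    case False
    then have "(r \<le> j + k) = (r \<le> j + Suc k)" using i by auto
    moreover have "tauc r ?i (m + k) (act_sym r (m + k) (hmat r j P) (tdown r k m u) - scal (?c k) (tdown r k m u))
      = tauc r ?i (m + k) (act_sym r (m + k) (hmat r j P) (tdown r k m u)) - scal (?c k) (tauc r ?i (m + k) (tdown r k m u))"
      by (simp only: clin_diff[OF clin_tauc[OF r i]] clin_scal[OF clin_tauc[OF r i]])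
    ultimately show ?thesis using tauc_act_hmat[OF r i S assms(3-5), of "m + k"] False by simp
  qed
  finally show ?case by (simp only: add_Suc_right Wact_def Gproj_idem[OF r] clin_diff[OF c] clin_scal[OF c])
qed

lemma tdown_one:
  assumes "k \<le> r - 1"
  shows "\<exists>c. c \<noteq> 0 \<and> Gproj r (m + k) (tdown r k m 1)
    = scal c (Gproj r (m + k) (bprod (map (\<lambda>i. (r - 1 - i, xpow (int (m + i)))) [0..<k])))"
  using assms
proof (induction k)
  case 0
  show ?case by (rule exI[of _ 1]) simp
next
  case (Suc k)
  let ?i = "r - 1 - k"
  let ?b = "\<lambda>k. map (\<lambda>i. (r - 1 - i, xpow (int (m + i)))) [0..<k]"
  have i: "1 \<le> ?i" "?i < r" using Suc.prems by auto
  note c = clin_Gproj[OF r]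
  obtain c where c0: "c \<noteq> 0" "Gproj r (m + k) (tdown r k m 1) = scal c (Gproj r (m + k) (bprod (?b k)))"
    using Suc by auto
  obtain d where d: "d \<noteq> 0" "tauc r ?i (m + k) 1 = scal d (Gproj r (Suc (m + k)) (bb ?i (xpow (int (m + k)))))"
    using tauc_one[OF r i] by blast
  have v: "valid r (?b k)" "\<forall>(c, Q)\<in>set (?b k). c \<noteq> ?i"
    using Suc.prems by (auto simp: valid_def polys_xpow)
  have "tdown r (Suc k) m 1 = tauc r ?i (m + k) (scal c (bprod (?b k)))"
    by (simp only: tdown.simps, intro tauc_cong[OF r i]) (simp add: c0 clin_scal[OF c])
  also have "\<dots> = scal (c * d) (Gproj r (Suc (m + k)) (bprod (?b k) * bb ?i (xpow (int (m + k)))))"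
    by (simp only: clin_scal[OF clin_tauc[OF r i]] tauc_bprod_other[OF r i v] d(2) scal_mult_right clin_scal[OF c]
      scal_scal Gproj_mult_Gproj[OF r bprod_S0[OF v(1)]])
  finally show ?case
    using c0 d by (intro exI[of _ "c * d"]) (simp add: clin_scal[OF c] Gproj_idem[OF r])
qed

lemma bprod_delta:
  "bprod (map (\<lambda>i. (r - 1 - i, xpow (int (m + i)))) [0..<r - 1]) = delta r (int m + int r - 1)"
proof -
  have "bprod (map (\<lambda>i. (f i, g i)) [0..<n]) = (\<Prod>i<n. bb (f i) (g i))" for f g n
    by (induction n) simp_all
  then have "bprod (map (\<lambda>i. (r - 1 - i, xpow (int (m + i)))) [0..<r - 1]) = (\<Prod>i<r - 1. bb (r - 1 - i) (xpow (int (m + i))))"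
    by simp
  also have "\<dots> = (\<Prod>j\<in>{1..<r}. bb j (xpow (int m + int r - 1 - int j)))"
    by (rule prod.reindex_bij_witness[of _ "\<lambda>j. r - 1 - j" "\<lambda>i. r - 1 - i"]) (auto simp: of_nat_diff algebra_simps)
  finally show ?thesis by (simp add: delta_def)
qed

lemma tv_one: "\<exists>c. c \<noteq> 0 \<and> tv r m 1 = scal c (Gproj r (m + (r - 1)) (delta r (int m + int r - 1)))"
  using tdown_one[of "r - 1" m, OF order_refl] Gproj_WV[OF r tv_WV[of m 1]] unfolding bprod_delta tv_def by simp

text \<open>
  The shifts cancel on the first column, so the composition with \<open>tau\<close> commutes with multiplications and is determined by its value at 1.
\<close>

lemma tv_tau: 
  assumes "u \<in> S0 r"
  shows "tv r m (tau u) = Gproj r (m + (r - 1)) (u * tv r m 1)"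
  using assms
proof (induction rule: S0.induct)
  case one
  then show ?case using Gproj_WV[OF r tv_WV] by simp
next
  case (bb c Q u)
  have "tv r m (tau (bb c Q * u)) = Gproj r (m + (r - 1)) (tdown r (r - 1) m (act_sym r m (Emat r c 0 (xpow 1 * Q)) (tau u)))"
    using bb Gproj_WV[OF r tv_WV[of m "tau (bb c Q * u)"]] by (simp add: tau_mult tau_bb act_sym_Emat_col tv_def)
  also have "\<dots> = Gproj r (m + (r - 1)) (bb c Q * tv r m (tau u))"
    using bb tau_S0[OF bb.hyps(4)] by (subst tdown_act_col) (auto simp: Wact_def act_sym_Emat_col tv_def)
  also have "\<dots> = Gproj r (m + (r - 1)) (bb c Q * u * tv r m 1)"
    using bb bb_S0 by (simp add: Gproj_mult_Gproj[OF r] mult.assoc)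
  finally show ?case .
next
  case (add u v)
  then show ?case using clin_tdown[of "r - 1" m] clin_Gproj[OF r]
    by (simp add: tv_def distrib_right clin_add clin_tau)
next
  case (scal u a)
  then show ?case using clin_tdown[of "r - 1" m] clin_Gproj[OF r]
    by (simp add: tv_def scal_mult_left clin_scal clin_tau)
qed

end

lemma delta_prod_S0:
  assumes "int r - 1 \<le> e"
  shows "(\<Prod>i<k. delta r (e + int (i * r))) \<in> S0 r"
proof (rule S0_prod)
  fix i
  have "0 \<le> int (i * r)" by (rule of_nat_0_le_iff)
  then show "delta r (e + int (i * r)) \<in> S0 r" using assms by (intro delta_S0) linarith
qed

lemma tau_pow_delta: "(tau ^^ k) (delta r e) = delta r (e + int k)"
  by (induction k) (simp_all add: tau_delta algebra_simps)

lemma tau_pow_prod: "(tau ^^ k) (prod f A) = (\<Prod>a\<in>A. (tau ^^ k) (f a))"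
  by (induction A rule: infinite_finite_induct) (simp_all add: tau_pow_mult)

context
  fixes r :: nat
  assumes r: "2 \<le> r"
begin

lemma clin_tv: "clin (tv r m)"
  unfolding tv_def by (rule clin_tdown[OF r order_refl])

lemma tv_S0: "u \<in> S0 r \<Longrightarrow> tv r m u \<in> S0 r"
  using WV_S0[OF r tv_WV[OF r]] .

lemma tv_Gsub: "u \<in> Gsub r m \<Longrightarrow> tv r m u \<in> Gsub r (m + (r - 1))"
  unfolding tv_def by (rule tdown_Gsub[OF r order_refl])

lemma tv_Gproj: "Gproj r (m + (r - 1)) (tv r m u) = tv r m u"
  by (rule Gproj_WV[OF r tv_WV[OF r]])

lemma tv_cong: "Gproj r m u = Gproj r m v \<Longrightarrow> tv r m u = tv r m v"
proof -
  assume "Gproj r m u = Gproj r m v"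
  then have "u - v \<in> Gsub r m"
    using Gproj_eq_0[OF r, of m "u - v"] by (simp add: clin_diff[OF clin_Gproj[OF r]])
  from tv_Gsub[OF this] have "Gproj r (m + (r - 1)) (tv r m (u - v)) = 0"
    by (simp only: Gproj_eq_0[OF r])
  then have "tv r m (u - v) = 0" by (simp only: tv_Gproj)
  then show ?thesis by (simp only: clin_diff[OF clin_tv] right_minus_eq)
qed

lemma tv_act_row:
  assumes "u \<in> S0 r" "P \<in> polys" "1 \<le> j" "j < r"
  shows "tv r m (act_sym r m (Emat r 0 j P) u) = Wact r (m + (r - 1)) (Emat r 0 j (xpow 1 * P)) (tv r m u)"
proof -
  have j: "r \<le> j + (r - 1)" using assms by simp
  show ?thesis
    using tdown_act_row[OF r order_refl assms, of m] j unfolding tv_def[symmetric] tv_Gproj by simp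
qed

lemma tv_act_hmat:
  assumes "u \<in> S0 r" "P \<in> polys" "1 \<le> j" "j < r"
  shows "tv r m (act_sym r m (hmat r j P) u) = Wact r (m + (r - 1)) (hmat r j P) (tv r m u)
    - scal (Poly_Mapping.lookup P 0) (tv r m u)"
proof -
  have j: "r \<le> j + (r - 1)" using assms by simp
  show ?thesis
    using tdown_act_hmat[OF r order_refl assms, of m] j unfolding tv_def[symmetric] tv_Gproj by simp
qed

lemma clin_tv_pow: "clin (tv_pow r k m)"
  by (induction k) (simp_all add: clin_def clin_add[OF clin_tv] clin_scal[OF clin_tv])

lemma tv_pow_S0: "u \<in> S0 r \<Longrightarrow> tv_pow r k m u \<in> S0 r"
  by (induction k) (simp_all add: tv_S0)

lemma tv_pow_Gsub: "u \<in> Gsub r m \<Longrightarrow> tv_pow r k m u \<in> Gsub r (m + k * (r - 1))"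
proof (induction k)
  case (Suc k)
  then have "tv r (m + k * (r - 1)) (tv_pow r k m u) \<in> Gsub r (m + k * (r - 1) + (r - 1))" by (intro tv_Gsub) simp
  moreover have "m + k * (r - 1) + (r - 1) = m + Suc k * (r - 1)" by simp
  ultimately show ?case by (simp only: tv_pow.simps)
qed simp

lemma tv_pow_act_row:
  assumes "u \<in> S0 r" "P \<in> polys" "1 \<le> j" "j < r"
  shows "Gproj r (m + k * (r - 1)) (tv_pow r k m (act_sym r m (Emat r 0 j P) u))
    = Wact r (m + k * (r - 1)) (Emat r 0 j (xpow (int k) * P)) (tv_pow r k m u)"
proof (induction k)
  case 0
  then show ?case by (simp add: Wact_def)
next
  case (Suc k)
  let ?m = "m + k * (r - 1)" and ?P = "xpow (int k) * P"
  have s: "m + Suc k * (r - 1) = ?m + (r - 1)" by simp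
  have P: "?P \<in> polys" using assms by (simp add: polys_mult polys_xpow)
  have "tv_pow r (Suc k) m (act_sym r m (Emat r 0 j P) u) = tv r ?m (act_sym r ?m (Emat r 0 j ?P) (tv_pow r k m u))"
    using Suc by (simp only: tv_pow.simps, intro tv_cong) (simp only: Wact_def)
  also have "\<dots> = Wact r (?m + (r - 1)) (Emat r 0 j (xpow (int (Suc k)) * P)) (tv_pow r (Suc k) m u)"
    using tv_act_row[OF tv_pow_S0[OF assms(1)] P assms(3,4), of ?m k m]
    by (simp add: xpow_add flip: mult.assoc)
  finally show ?case unfolding s by (simp only: Wact_def Gproj_idem[OF r])
qed

lemma tv_pow_act_hmat:
  assumes "u \<in> S0 r" "P \<in> polys" "1 \<le> j" "j < r"
  shows "Gproj r (m + k * (r - 1)) (tv_pow r k m (act_sym r m (hmat r j P) u))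
    = Wact r (m + k * (r - 1)) (hmat r j P) (tv_pow r k m u)
      - scal (of_nat k * Poly_Mapping.lookup P 0) (Gproj r (m + k * (r - 1)) (tv_pow r k m u))"
proof (induction k)
  case 0
  then show ?case by (simp add: Wact_def)
next
  case (Suc k)
  let ?m = "m + k * (r - 1)" and ?c = "Poly_Mapping.lookup P 0"
  have s: "m + Suc k * (r - 1) = ?m + (r - 1)" by simp
  note c = clin_Gproj[OF r]
  have "tv_pow r (Suc k) m (act_sym r m (hmat r j P) u)
      = tv r ?m (act_sym r ?m (hmat r j P) (tv_pow r k m u) - scal (of_nat k * ?c) (tv_pow r k m u))"
    using Suc by (simp only: tv_pow.simps, intro tv_cong) (simp only: Wact_def clin_diff[OF c] clin_scal[OF c])
  also have "\<dots> = Wact r (?m + (r - 1)) (hmat r j P) (tv_pow r (Suc k) m u) - scal (of_nat (Suc k) * ?c) (tv_pow r (Suc k) m u)"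
    using tv_act_hmat[OF tv_pow_S0[OF assms(1)] assms(2-4), of ?m k m]
    by (simp add: clin_diff[OF clin_tv] clin_scal[OF clin_tv] distrib_right scal_add_left)
  finally show ?case unfolding s by (simp only: Wact_def Gproj_idem[OF r] clin_diff[OF c] clin_scal[OF c])
qed

text \<open>
  Peeling off one \<open>tau\<close> and one \<open>tv\<close> at a time. The value of \<open>tv\<close> at 1 is a product of generators by \<open>tv_one\<close>; the condition \<open>k \<le> M\<close> keeps
  its exponents nonnegative.
\<close>

lemma tv_pow_tau_pow:
  assumes "k \<le> M"
  shows "\<exists>c. c \<noteq> 0 \<and> (\<forall>u\<in>S0 r. Gproj r (M + k * (r - 1)) (tv_pow r k M ((tau ^^ k) u))
     = scal c (Gproj r (M + k * (r - 1)) (u * (\<Prod>i<k. delta r (int M + int r - int k + int (i * r))))))"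
  using assms
proof (induction k)
  case 0
  show ?case by (rule exI[of _ 1]) simp
next
  case (Suc k)
  let ?m = "M + k * (r - 1)"
  let ?D = "\<lambda>k n. \<Prod>i<n. delta r (int M + int r - int k + int (i * r))"
  have s: "M + Suc k * (r - 1) = ?m + (r - 1)" by simp
  note g = clin_Gproj[OF r]
  obtain c where c: "c \<noteq> 0" "\<And>u. u \<in> S0 r \<Longrightarrow> Gproj r ?m (tv_pow r k M ((tau ^^ k) u)) = scal c (Gproj r ?m (u * ?D k k))"
    using Suc by auto
  obtain d where d: "d \<noteq> 0" "tv r ?m 1 = scal d (Gproj r (?m + (r - 1)) (delta r (int ?m + int r - 1)))"
    using tv_one[OF r] by blast
  have D: "?D (Suc k) n \<in> S0 r" for n
  proof -
    have "int r - 1 \<le> int M + int r - int (Suc k)" using Suc.prems by simp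
    from delta_prod_S0[OF this] show ?thesis .
  qed
  have tD: "tau (?D (Suc k) n) = ?D k n" for n
    by (simp add: tau_prod tau_delta algebra_simps)
  have e: "int ?m + int r - 1 = int M + int r - int (Suc k) + int (k * r)"
  proof -
    have "k * (r - 1) + k = k * r" using r by (cases r) simp_all
    then have "int (k * (r - 1)) + int k = int (k * r)" by (simp only: of_nat_add[symmetric])
    then show ?thesis by simp
  qed
  have "Gproj r (?m + (r - 1)) (tv_pow r (Suc k) M ((tau ^^ Suc k) u))
     = scal (c * d) (Gproj r (?m + (r - 1)) (u * ?D (Suc k) (Suc k)))" if u: "u \<in> S0 r" for u
  proof -
    have ud: "u * ?D (Suc k) k \<in> S0 r" by (rule S0_mult[OF u D])
    have "tv_pow r (Suc k) M ((tau ^^ Suc k) u) = tv r ?m (tv_pow r k M ((tau ^^ k) (tau u)))"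
      by (simp add: funpow_swap1)
    also have "\<dots> = tv r ?m (scal c (tau u * ?D k k))"
      using c(2)[OF tau_S0[OF u]] by (intro tv_cong) (simp add: clin_scal[OF g])
    also have "\<dots> = tv r ?m (scal c (tau (u * ?D (Suc k) k)))"
      by (simp only: tau_mult tD)
    also have "\<dots> = scal c (Gproj r (?m + (r - 1)) (u * ?D (Suc k) k * tv r ?m 1))"
      by (simp only: clin_scal[OF clin_tv] tv_tau[OF r ud])
    also have "\<dots> = scal (c * d) (Gproj r (?m + (r - 1)) (u * ?D (Suc k) k * delta r (int ?m + int r - 1)))"
      by (simp only: d(2) scal_mult_right clin_scal[OF g] Gproj_mult_Gproj[OF r ud] scal_scal)
    also have "u * ?D (Suc k) k * delta r (int ?m + int r - 1) = u * ?D (Suc k) (Suc k)"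
      unfolding e by (simp add: mult.assoc)
    finally show ?thesis by (simp only: clin_scal[OF g] Gproj_idem[OF r])
  qed
  then show ?case unfolding s using c(1) d(1) by (intro exI[of _ "c * d"]) simp
qed

end

section \<open>The composition in the other order\<close>

text \<open>
  A raising operator lowers the number of factors by one, and \<open>qq\<close> preserves it.
\<close>

lemma ee_bprod_nilpotent:
  assumes "length qs = n"
  shows "(ee m j R ^^ Suc n) (bprod qs) = 0"
  using assms
proof (induction n arbitrary: qs)
  case 0
  then show ?case by (simp add: ee_bprod)
next
  case (Suc n)
  have c: "clin (ee m j R ^^ k)" for k
    by (induction k) (simp_all add: clin_def clin_add[OF clin_ee] clin_scal[OF clin_ee])
  note cl = clin_sum[OF c] clin_diff[OF c] clin_scal[OF c] clin_zero[OF c]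
  have z: "(ee m j R ^^ Suc n) (qq m S (bprod qs')) = 0" if l: "length qs' = n" for S qs'
  proof -
    have "(ee m j R ^^ Suc n) (bb (fst (qs' ! i)) (S * snd (qs' ! i)) * bprod (remv i qs')) = 0" if "i < length qs'" for i
      using Suc.IH[of "(fst (qs' ! i), S * snd (qs' ! i)) # remv i qs'"] that l by (simp add: length_remv)
    then show ?thesis unfolding qq_bprod cl(1-3) using Suc.IH[OF l] by (simp only: scal_zero) simp
  qed
  have "(ee m j R ^^ Suc n) (ee m j R (bprod qs)) = 0"
    unfolding ee_bprod cl(1)
  proof (rule sum.neutral, rule ballI)
    fix l assume "l \<in> {..<length qs}"
    then show "(ee m j R ^^ Suc n) (if fst (qs ! l) = j then qq m (R * snd (qs ! l)) (bprod (remv l qs)) else 0) = 0"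
      using z[of "remv l qs"] cl(4) Suc.prems by (simp add: length_remv del: funpow.simps)
  qed
  then show ?case by (simp only: funpow_Suc_right o_apply)
qed

lemma ee_nilpotent:
  assumes "u \<in> S0 r"
  shows "\<exists>k. (ee m j R ^^ k) u = 0"
proof -
  have c: "clin (ee m j R ^^ k)" for k
    by (induction k) (simp_all add: clin_def clin_add[OF clin_ee] clin_scal[OF clin_ee])
  have up: "(ee m j R ^^ (i + k)) u = 0" if "(ee m j R ^^ k) u = 0" for i k u
    using that clin_zero[OF c, of i] by (simp add: funpow_add)
  have "\<exists>k. (ee m j R ^^ k) (bprod qs * u) = 0" for qs
    using assms
  proof (induction arbitrary: qs rule: S0.induct)
    case one
    then show ?case using ee_bprod_nilpotent[OF refl, of qs m j R] by (simp only: mult_1_right) blast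
  next
    case (add u v)
    obtain k l where "(ee m j R ^^ k) (bprod qs * u) = 0" "(ee m j R ^^ l) (bprod qs * v) = 0" using add by blast
    then have "(ee m j R ^^ (l + k)) (bprod qs * (u + v)) = 0"
      using up[of k "bprod qs * u" l] up[of l "bprod qs * v" k]
      by (simp only: distrib_left clin_add[OF c]) (simp add: add.commute)
    then show ?case by (rule exI)
  next
    case (scal u a)
    obtain k where "(ee m j R ^^ k) (bprod qs * u) = 0" using scal by blast
    then have "(ee m j R ^^ k) (bprod qs * scal a u) = 0" by (simp only: scal_mult_right clin_scal[OF c]) simp
    then show ?case by (rule exI)
  next
    case (bb c Q u)
    then show ?case using bb.IH[of "qs @ [(c, Q)]"] by (simp add: mult.assoc)
  qed
  from this[of "[]"] show ?thesis by simp
qed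

lemma bracket_hmat_E0i:
  assumes "1 \<le> i" "i < r"
  shows "mat_bracket (hmat r i P) (Emat r 0 i Q) = const (-2) \<cdot>\<^sub>m Emat r 0 i (P * Q)"
proof (rule mat_bracket_EmatI)
  have c2: "const (-2) = -2" by (simp add: const_def single_uminus flip: single_numeral)
  show "(const (-2) \<cdot>\<^sub>m Emat r 0 i (P * Q)) $$ (a, b) = (if b = i then hmat r i P $$ (a, 0) * Q else 0)
    - (if a = 0 then Q * hmat r i P $$ (i, b) else 0)" if "a < r" "b < r" for a b
    using that assms by (auto simp: c2)
qed (use assms in auto)

context slmod
begin

lemma sl2_integrableI:
  assumes j: "1 \<le> j" "j < r"
    and "\<And>v. v \<in> V \<Longrightarrow> \<exists>k. (act (Emat r 0 j 1) ^^ k) v = 0"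
    and "\<And>v. v \<in> V \<Longrightarrow> \<exists>k. (act (Emat r j 0 1) ^^ k) v = 0"
  shows "sl2_integrable sc V (act (Emat r 0 j 1)) (act (Emat r j 0 1)) (act (hmat r j (-1)))"
proof -
  have E: "Emat r 0 j 1 \<in> slp r" "Emat r j 0 1 \<in> slp r" "hmat r j (-1) \<in> slp r"
    using j by (auto intro!: Emat_slp hmat_slp polys_uminus)
  have l: "lin_on sc V sc V (act X)" if "X \<in> slp r" for X
    using that by (simp add: lin_on_def act_closed act_add act_scale)
  have 1: "mat_bracket (Emat r 0 j 1) (Emat r j 0 1) = hmat r j (-1)"
    using bracket_E0i_Ei0[OF j, of 1 1] by simp
  have "Emat r j 0 (-1 * 1) = const (-1) \<cdot>\<^sub>m Emat r j 0 1"
    by (rule eq_matI) (auto simp: const_def single_uminus)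
  then have 2: "mat_bracket (hmat r j (-1)) (Emat r j 0 1) = const 2 \<cdot>\<^sub>m (const (-1) \<cdot>\<^sub>m Emat r j 0 1)"
    using bracket_hmat_Ei0[OF j, of "-1" 1] by simp
  show ?thesis
    unfolding sl2_integrable_def
  proof (intro conjI ballI vs sub l E assms(3,4))
    fix v assume v: "v \<in> V"
    show "act (Emat r 0 j 1) (act (Emat r j 0 1) v) = act (Emat r j 0 1) (act (Emat r 0 j 1) v) + act (hmat r j (-1)) v"
      using act_bracket[OF E(1,2) v] 1 by simp
    show "act (hmat r j (-1)) (act (Emat r j 0 1) v) = act (Emat r j 0 1) (act (hmat r j (-1)) v) - sc 2 (act (Emat r j 0 1) v)"
      using act_bracket[OF E(3,2) v] 2 act_lscale[OF slp_smult[OF E(2)] v, of 2 "-1"] act_lscale[OF E(2) v, of "-1"]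
      by (simp add: algebra_simps)
  qed
qed

lemma act_hmat_uminus:
  assumes "i < r" "v \<in> V" shows "act (hmat r i 1) v = - act (hmat r i (- 1)) v"
proof -
  have h: "hmat r i 1 \<in> slp r" using assms r2 by (intro hmat_slp) auto
  have "hmat r i (-1) = const (-1) \<cdot>\<^sub>m hmat r i 1"
    by (rule eq_matI) (auto simp: const_def single_uminus)
  then show ?thesis using act_lscale[OF h assms(2), of "-1"] by simp
qed

text \<open>
  The opposite triple, for operators that commute with \<open>f_j(1)\<close> instead of \<open>e_j(1)\<close>.
\<close>

lemma sl2_integrable_swap:
  assumes j: "1 \<le> j" "j < r"
    and "\<And>v. v \<in> V \<Longrightarrow> \<exists>k. (act (Emat r 0 j 1) ^^ k) v = 0"
    and "\<And>v. v \<in> V \<Longrightarrow> \<exists>k. (act (Emat r j 0 1) ^^ k) v = 0"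
  shows "sl2_integrable sc V (act (Emat r j 0 1)) (act (Emat r 0 j 1)) (act (hmat r j 1))"
proof -
  have E: "Emat r 0 j 1 \<in> slp r" "Emat r j 0 1 \<in> slp r" "hmat r j 1 \<in> slp r"
    using j by (auto intro!: Emat_slp hmat_slp)
  have l: "lin_on sc V sc V (act X)" if "X \<in> slp r" for X
    using that by (simp add: lin_on_def act_closed act_add act_scale)
  have 1: "mat_bracket (Emat r 0 j 1) (Emat r j 0 1) = hmat r j (-1)"
    using bracket_E0i_Ei0[OF j, of 1 1] by simp
  show ?thesis
    unfolding sl2_integrable_def
  proof (intro conjI ballI vs sub l E assms(3,4))
    fix v assume v: "v \<in> V"
    show "act (Emat r j 0 1) (act (Emat r 0 j 1) v) = act (Emat r 0 j 1) (act (Emat r j 0 1) v) + act (hmat r j 1) v"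
      using act_bracket[OF E(1,2) v] 1 act_hmat_uminus[OF j(2) v] by simp
    show "act (hmat r j 1) (act (Emat r 0 j 1) v) = act (Emat r 0 j 1) (act (hmat r j 1) v) - sc 2 (act (Emat r 0 j 1) v)"
      using act_bracket[OF E(3,1) v] bracket_hmat_E0i[OF j, of 1 1] act_lscale[OF E(1) v, of "-2"]
      by (simp add: algebra_simps)
  qed
qed

end

context weyl_quotient
begin

lemma act_row_nilpotent:
  assumes "1 \<le> j" "j < r" "P \<in> polys" "v \<in> V"
  shows "\<exists>k. (act (Emat r 0 j P) ^^ k) v = 0"
proof -
  obtain u where u: "u \<in> S0 r" "v = ev u" using assms V_eq by auto
  have E: "Emat r 0 j P \<in> slp r" using assms by (intro Emat_slp) auto
  have "(ee m j P ^^ k) u \<in> S0 r \<and> (act (Emat r 0 j P) ^^ k) v = ev ((ee m j P ^^ k) u)" for k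
  proof (induction k)
    case (Suc k)
    then have S: "(ee m j P ^^ k) u \<in> S0 r" by simp
    from ev_act[OF S E] act_sym_S0[OF S slp_gl[OF E], of m] Suc assms r2 show ?case
      by (simp add: act_sym_Emat_row)
  qed (simp add: u)
  then show ?thesis using ee_nilpotent[OF u(1), of m j P] ev_zero by metis
qed

lemma act_col_pow: "1 \<le> j \<Longrightarrow> j < r \<Longrightarrow> (act (Emat r j 0 1) ^^ k) (ev u) = ev (bprod (replicate k (j, 1)) * u)"
  by (induction k) (simp_all add: ev_bb mult.assoc)

lemma act_col_nilpotent:
  assumes "1 \<le> j" "j < r" "v \<in> V"
  shows "\<exists>k. (act (Emat r j 0 1) ^^ k) v = 0"
proof -
  obtain u where u: "u \<in> S0 r" "v = ev u" using assms V_eq by auto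
  have b: "bprod (replicate (Suc m) (j, 1)) \<in> Gsub r m"
    using assms by (intro Gsub.gen) (auto simp: valid_def)
  have "ev (bprod (replicate (Suc m) (j, 1)) * u) = 0"
    by (subst mult.commute) (rule ev_Gsub[OF Gsub_ideal[OF u(1) b r2]])
  then have "(act (Emat r j 0 1) ^^ Suc m) v = 0" unfolding u(2) act_col_pow[OF assms(1,2)] .
  then show ?thesis by blast
qed

lemma act_sl2: "1 \<le> j \<Longrightarrow> j < r \<Longrightarrow>
    sl2_integrable sc V (act (Emat r 0 j 1)) (act (Emat r j 0 1)) (act (hmat r j (-1)))"
  by (intro sl2_integrableI act_row_nilpotent act_col_nilpotent) auto

end

text \<open>
  First all colours are shifted downwards \<open>r\<close> times, which raises the weight by \<open>r (r - 1)\<close>, then \<open>tau\<close> shifts back \<open>r\<close> times.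
\<close>

definition Theta :: "nat \<Rightarrow> nat \<Rightarrow> sym \<Rightarrow> sym" where
  "Theta r m u = Gproj r (m + r * r) ((tau ^^ r) (tv_pow r r m u))"

context
  fixes r :: nat
  assumes r: "2 \<le> r"
begin

lemma weight_sum: "m + r * (r - 1) + r = m + r * r"
  using r by (cases r) auto

lemma clin_Theta: "clin (Theta r m)"
  unfolding Theta_def
  by (simp add: clin_def clin_add[OF clin_Gproj[OF r]] clin_scal[OF clin_Gproj[OF r]] clin_add[OF clin_tau_pow]
    clin_scal[OF clin_tau_pow] clin_add[OF clin_tv_pow[OF r]] clin_scal[OF clin_tv_pow[OF r]])

lemma tau_pow_Gproj: "Gproj r (m + k) ((tau ^^ k) (Gproj r m u)) = Gproj r (m + k) ((tau ^^ k) u)"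
  using tau_pow_Gsub[OF r Gsub_uminus[OF Gproj_diff[OF r, of u m]]]
  by (intro Gproj_cong[OF r]) (simp add: clin_diff[OF clin_tau_pow])

lemma Theta_WV: "u \<in> S0 r \<Longrightarrow> Theta r m u \<in> WV r (m + r * r)"
  by (simp add: Theta_def WV_def tau_pow_S0 tv_pow_S0[OF r])

lemma Theta_Gsub:
  assumes "u \<in> Gsub r m" shows "Theta r m u = 0"
proof -
  have "(tau ^^ r) (tv_pow r r m u) \<in> Gsub r (m + r * (r - 1) + r)"
    by (rule tau_pow_Gsub[OF r tv_pow_Gsub[OF r assms]])
  then show ?thesis unfolding Theta_def weight_sum by (simp only: Gproj_eq_0[OF r])
qed

lemma Theta_Gproj: "Theta r m (Gproj r m u) = Theta r m u"
  using Theta_Gsub[OF Gproj_diff[OF r, of u m]] by (simp add: clin_diff[OF clin_Theta])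

lemma Theta_row:
  assumes "u \<in> S0 r" "P \<in> polys" "1 \<le> j" "j < r"
  shows "Theta r m (act_sym r m (Emat r 0 j P) u) = Wact r (m + r * r) (Emat r 0 j P) (Theta r m u)"
proof -
  let ?m = "m + r * (r - 1)"
  have E: "Emat r 0 j (xpow (int r) * P) \<in> slp r" "Emat r 0 j P \<in> slp r"
    using assms by (auto intro!: Emat_slp polys_mult polys_xpow)
  have p: "xconj r r (Emat r 0 j (xpow (int r) * P)) (Emat r 0 j P)"
    using E[THEN slp_gl] assms by (auto simp: xconj_def)
  have "Theta r m (act_sym r m (Emat r 0 j P) u)
      = Gproj r (?m + r) ((tau ^^ r) (Gproj r ?m (tv_pow r r m (act_sym r m (Emat r 0 j P) u))))"
    unfolding tau_pow_Gproj by (simp only: Theta_def weight_sum)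
  also have "\<dots> = Gproj r (?m + r) ((tau ^^ r) (act_sym r ?m (Emat r 0 j (xpow (int r) * P)) (tv_pow r r m u)))"
    by (simp only: tv_pow_act_row[OF r assms] Wact_def tau_pow_Gproj)
  also have "(tau ^^ r) (act_sym r ?m (Emat r 0 j (xpow (int r) * P)) (tv_pow r r m u))
      = act_sym r (?m + r) (Emat r 0 j P) ((tau ^^ r) (tv_pow r r m u))"
    using tau_pow_act[OF tv_pow_S0[OF r assms(1)] p, of ?m r m] r assms by simp
  finally show ?thesis
    unfolding weight_sum Theta_def by (simp only: Wact_Gproj[OF r slp_gl[OF E(2)]])
qed

text \<open>
  The scalars of \<open>tv_pow_act_hmat\<close> and of \<open>tau_pow_act\<close> cancel, so that rigidity applies with weight difference 0.
\<close>

lemma Theta_hmat: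
  assumes "u \<in> S0 r" "P \<in> polys" "1 \<le> j" "j < r"
  shows "Theta r m (act_sym r m (hmat r j P) u) = Wact r (m + r * r) (hmat r j P) (Theta r m u)"
proof -
  let ?m = "m + r * (r - 1)" and ?c = "of_nat r * Poly_Mapping.lookup P 0"
  have E: "hmat r j P \<in> slp r" using assms by (auto intro!: hmat_slp)
  have p: "xconj r r (hmat r j P) (hmat r j P)"
    using E[THEN slp_gl] assms by (auto simp: xconj_def)
  note c = clin_Gproj[OF r]
  have "Theta r m (act_sym r m (hmat r j P) u)
      = Gproj r (?m + r) ((tau ^^ r) (Gproj r ?m (tv_pow r r m (act_sym r m (hmat r j P) u))))"
    unfolding tau_pow_Gproj by (simp only: Theta_def weight_sum)
  also have "\<dots> = Gproj r (?m + r) ((tau ^^ r) (act_sym r ?m (hmat r j P) (tv_pow r r m u))) - scal ?c (Theta r m u)"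
    by (simp only: tv_pow_act_hmat[OF r assms] Wact_def tau_pow_Gproj clin_diff[OF clin_tau_pow] clin_scal[OF clin_tau_pow]
        clin_diff[OF c] clin_scal[OF c]) (simp only: Theta_def weight_sum)
  also have "(tau ^^ r) (act_sym r ?m (hmat r j P) (tv_pow r r m u))
      = act_sym r (?m + r) (hmat r j P) ((tau ^^ r) (tv_pow r r m u)) + scal ?c ((tau ^^ r) (tv_pow r r m u))"
    using tau_pow_act[OF tv_pow_S0[OF r assms(1)] p, of ?m r m] r assms by (simp add: lookup_uminus scal_minus_left)
  finally show ?thesis
    unfolding weight_sum clin_add[OF c] clin_scal[OF c] by (simp add: Theta_def Wact_Gproj[OF r slp_gl[OF E]])
qed

text \<open>
  The map \<open>tv\<close> intertwines multiplications by \<open>b_j(x P)\<close> and \<open>b_j(P)\<close>, and in this order there is no earlier \<open>tau\<close> to supply the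
  factor \<open>x\<close>. Rigidity gives the relation for \<open>P = 1\<close>, and a commutator with \<open>hmat r j P\<close> extends it to all \<open>P\<close>.
\<close>

lemma Theta_col:
  assumes u: "u \<in> S0 r" and P: "P \<in> polys" and j: "1 \<le> j" "j < r"
  shows "Theta r m (bb j P * u) = Gproj r (m + r * r) (bb j P * Theta r m u)"
proof -
  let ?M = "m + r * r"
  interpret A: weyl_quotient r scal "WV r m" "Wact r m" m "Ww r m"
    by unfold_locales (use r W_weyl_quotient[OF r, of m] in \<open>auto simp: is_weyl_quotient_def\<close>)
  interpret B: weyl_quotient r scal "WV r ?M" "Wact r ?M" ?M "Ww r ?M"
    by unfold_locales (use r W_weyl_quotient[OF r, of ?M] in \<open>auto simp: is_weyl_quotient_def\<close>)
  have T: "lin_on scal (WV r m) scal (WV r ?M) (Theta r m)"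
    by (simp add: lin_on_def Theta_WV WV_S0[OF r] clin_add[OF clin_Theta] clin_scal[OF clin_Theta])
  have e1: "Theta r m (Wact r m (Emat r j 0 1) v) = Wact r ?M (Emat r j 0 1) (Theta r m v)" if v: "v \<in> WV r m" for v
  proof -
    have "if (0::nat) = 0 then Wact r ?M (Emat r j 0 1) (Theta r m v) = Theta r m (Wact r m (Emat r j 0 1) v) else Theta r m v = 0"
    proof (rule sl2_rigidity[OF A.act_sl2[OF j] B.act_sl2[OF j] T _ _ v])
      fix v assume "v \<in> WV r m"
      then have v: "v \<in> S0 r" by (rule WV_S0[OF r])
      show "Wact r ?M (Emat r 0 j 1) (Theta r m v) = Theta r m (Wact r m (Emat r 0 j 1) v)"
        by (simp only: Wact_def[of r m] Theta_Gproj Theta_row[OF v polys_one j])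
      have "-1 \<in> polys" by (simp add: polys_uminus)
      then show "Wact r ?M (hmat r j (- 1)) (Theta r m v) = Theta r m (Wact r m (hmat r j (- 1)) v) - scal (of_nat 0) (Theta r m v)"
        by (simp only: Wact_def[of r m] Theta_Gproj Theta_hmat[OF v _ j]) simp
    qed
    then show ?thesis by simp
  qed
  have E: "Emat r j 0 1 \<in> slp r" "hmat r j P \<in> slp r" "Emat r j 0 P \<in> slp r"
    using P j by (auto intro!: Emat_slp hmat_slp)
  let ?v = "Gproj r m u"
  have v: "?v \<in> WV r m" using u by (simp add: WV_def)
  have h: "Theta r m (Wact r m (hmat r j P) v) = Wact r ?M (hmat r j P) (Theta r m v)" if "v \<in> WV r m" for v
    by (simp only: Wact_def[of r m] Theta_Gproj Theta_hmat[OF WV_S0[OF r that] P j])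
  have b: "mat_bracket (hmat r j P) (Emat r j 0 1) = const 2 \<cdot>\<^sub>m Emat r j 0 P"
    using bracket_hmat_Ei0[OF j, of P 1] by simp
  have "scal 2 (Theta r m (Wact r m (Emat r j 0 P) ?v)) = Theta r m (Wact r m (const 2 \<cdot>\<^sub>m Emat r j 0 P) ?v)"
    using A.act_lscale[OF E(3) v, of 2] by (simp add: clin_scal[OF clin_Theta])
  also have "\<dots> = Wact r ?M (const 2 \<cdot>\<^sub>m Emat r j 0 P) (Theta r m ?v)"
    unfolding b[symmetric] A.act_bracket[OF E(2,1) v] B.act_bracket[OF E(2,1) Theta_WV[OF WV_S0[OF r v]]] clin_diff[OF clin_Theta]
    by (simp only: h[OF A.act_closed[OF E(1) v]] e1[OF A.act_closed[OF E(2) v]] h[OF v] e1[OF v])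
  also have "\<dots> = scal 2 (Wact r ?M (Emat r j 0 P) (Theta r m ?v))"
    by (rule B.act_lscale[OF E(3) Theta_WV[OF WV_S0[OF r v]]])
  finally have "scal (1/2) (scal 2 (Theta r m (Wact r m (Emat r j 0 P) ?v))) = scal (1/2) (scal 2 (Wact r ?M (Emat r j 0 P) (Theta r m ?v)))"
    by (rule arg_cong)
  then have "Theta r m (Wact r m (Emat r j 0 P) ?v) = Wact r ?M (Emat r j 0 P) (Theta r m ?v)"
    by (simp add: scal_scal)
  then show ?thesis
    using j by (simp add: Wact_Gproj[OF r slp_gl[OF E(3)]] Theta_Gproj act_sym_Emat_col) (simp add: Wact_def act_sym_Emat_col)
qed

lemma Theta_mult:
  assumes "u \<in> S0 r"
  shows "Theta r m u = Gproj r (m + r * r) (u * Theta r m 1)"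
  using assms
proof (induction rule: S0.induct)
  case one
  then show ?case using Gproj_WV[OF r Theta_WV[OF S0.one]] by simp
next
  case (add u v)
  then show ?case by (simp add: clin_add[OF clin_Theta] distrib_right clin_add[OF clin_Gproj[OF r]])
next
  case (scal u a)
  then show ?case by (simp add: clin_scal[OF clin_Theta] scal_mult_left clin_scal[OF clin_Gproj[OF r]])
next
  case (bb c Q u)
  then show ?case by (simp add: Theta_col Gproj_mult_Gproj[OF r bb_S0] mult.assoc)
qed

lemma Theta_formula:
  assumes "r \<le> m"
  shows "\<exists>c. c \<noteq> 0 \<and> (\<forall>u\<in>S0 r. Theta r m u
     = scal c (Gproj r (m + r * r) (u * (\<Prod>i<r. delta r (int m + int r + int (i * r))))))"
proof -
  obtain c where c: "c \<noteq> 0" "\<And>u. u \<in> S0 r \<Longrightarrow> Gproj r (m + r * (r - 1)) (tv_pow r r m ((tau ^^ r) u))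
     = scal c (Gproj r (m + r * (r - 1)) (u * (\<Prod>i<r. delta r (int m + int r - int r + int (i * r)))))"
    using tv_pow_tau_pow[OF r assms] by blast
  let ?m = "m + r * (r - 1)" and ?D = "\<Prod>i<r. delta r (int m + int r + int (i * r))"
  note g = clin_Gproj[OF r]
  have "Theta r m 1 = Gproj r (?m + r) ((tau ^^ r) (Gproj r ?m (tv_pow r r m ((tau ^^ r) 1))))"
    unfolding tau_pow_Gproj by (simp only: Theta_def weight_sum tau_pow_one)
  also have "\<dots> = scal c (Gproj r (?m + r) ((tau ^^ r) (\<Prod>i<r. delta r (int m + int r - int r + int (i * r)))))"
    by (simp only: c(2)[OF S0.one] clin_scal[OF clin_tau_pow] clin_scal[OF g] tau_pow_Gproj mult_1_left)
  also have "(tau ^^ r) (\<Prod>i<r. delta r (int m + int r - int r + int (i * r))) = ?D"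
    by (simp add: tau_pow_prod tau_pow_delta algebra_simps)
  finally have 1: "Theta r m 1 = scal c (Gproj r (m + r * r) ?D)" by (simp only: weight_sum)
  have "Theta r m u = scal c (Gproj r (m + r * r) (u * ?D))" if "u \<in> S0 r" for u
    unfolding Theta_mult[OF that] 1 scal_mult_right clin_scal[OF g] Gproj_mult_Gproj[OF r that] ..
  then show ?thesis using c(1) by blast
qed

end

section \<open>The bijection T of the limit\<close>

locale weyl_limit =
  fixes r n :: nat
    and scW :: "complex \<Rightarrow> 'w::ab_group_add \<Rightarrow> 'w"
    and W :: "nat \<Rightarrow> 'w set"
    and act :: "nat \<Rightarrow> laurent mat \<Rightarrow> 'w \<Rightarrow> 'w"
    and w :: "nat \<Rightarrow> 'w"
    and \<phi> :: "nat \<Rightarrow> 'w \<Rightarrow> 'w"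
    and scL :: "complex \<Rightarrow> 'l::ab_group_add \<Rightarrow> 'l"
    and L :: "'l set"
    and actL :: "laurent mat \<Rightarrow> 'l \<Rightarrow> 'l"
    and \<iota> :: "nat \<Rightarrow> 'w \<Rightarrow> 'l"
  assumes r2: "2 \<le> r"
    and weyl: "\<And>N. is_weyl_module r (N * r + n) scW (W N) (act N) (w N)"
    and hom: "\<And>N. is_module_hom (sl_poly r) scW (W N) (act N) scW (W (Suc N)) (act (Suc N)) (\<phi> N)"
    and gen: "\<And>N. \<phi> N (w N) = lowered_vector r (N * r + n) (act (Suc N)) (w (Suc N))"
    and lim: "is_direct_limit (sl_poly r) scW W act \<phi> scL L actL \<iota>"
begin

sublocale Wm: weyl_module r scW "W N" "act N" "N * r + n" "w N" for N
  by unfold_locales (use weyl[of N] r2 in \<open>auto simp: is_weyl_module_def is_weyl_quotient_def\<close>)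

sublocale Lm: slmod r scL L actL
  by unfold_locales (use lim r2 in \<open>auto simp: is_direct_limit_def\<close>)

lemma iota_hom: "is_module_hom (sl_poly r) scW (W N) (act N) scL L actL (\<iota> N)"
  using lim unfolding is_direct_limit_def by blast

lemma iota_V: "v \<in> W N \<Longrightarrow> \<iota> N v \<in> L"
  and iota_add: "u \<in> W N \<Longrightarrow> v \<in> W N \<Longrightarrow> \<iota> N (u + v) = \<iota> N u + \<iota> N v"
  and iota_scale: "v \<in> W N \<Longrightarrow> \<iota> N (scW c v) = scL c (\<iota> N v)"
  and iota_act: "X \<in> slp r \<Longrightarrow> v \<in> W N \<Longrightarrow> \<iota> N (act N X v) = actL X (\<iota> N v)"
  using iota_hom[of N] by (simp_all add: is_module_hom_def)

lemma iota_eq: "v \<in> W N \<Longrightarrow> u \<in> W M \<Longrightarrow>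
    \<iota> N v = \<iota> M u \<longleftrightarrow> (\<exists>K\<ge>max N M. fold \<phi> [N..<K] v = fold \<phi> [M..<K] u)"
  using lim unfolding is_direct_limit_def by blast

lemma L_eq: "L = (\<Union>N. \<iota> N ` W N)"
  using lim unfolding is_direct_limit_def by blast

lemma iota_zero: "\<iota> N 0 = 0"
  using iota_scale[OF Wm.V_zero, of N 0] by simp

text \<open>
  The elements of the limit are the values of these maps on the symmetric algebra, and by \<open>kappa_push\<close> and
  \<open>kappa_eq_0_iff\<close> the limit is the direct limit of the quotients by \<open>Gsub\<close> along the multiplications by \<open>beta N\<close>.
\<close>

definition kappa :: "nat \<Rightarrow> sym \<Rightarrow> 'l" where
  "kappa N u = \<iota> N (Wm.ev N u)"

definition beta :: "nat \<Rightarrow> sym" where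
  "beta N = delta r (int (N * r + n) + int r)"

lemma beta_S0: "beta N \<in> S0 r"
  unfolding beta_def by (rule delta_S0) (use of_nat_0_le_iff[of "N * r + n", where 'a = int] in linarith)

lemma betas_S0: "(\<Prod>i<k. beta (N + i)) \<in> S0 r"
  by (intro S0_prod beta_S0)

lemma tau_pow_beta: "(tau ^^ r) (beta N) = beta (Suc N)"
  by (simp add: beta_def tau_pow_delta algebra_simps)

lemma tau_pow_betas: "(tau ^^ r) (\<Prod>i<k. beta (N + i)) = (\<Prod>i<k. beta (Suc N + i))"
  by (simp add: tau_pow_prod tau_pow_beta)

lemma lowered: "lowered_vector r m (act N) (w N) = Wm.ev N (delta r (int m + int r))"
proof -
  have "fold (\<lambda>j. act N (Emat r j 0 (xpow (int (m + r - j))))) [1..<k] (w N)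
      = Wm.ev N (\<Prod>j\<in>{1..<k}. bb j (xpow (int m + int r - int j)))" if "1 \<le> k" "k \<le> r" for k
    using that
  proof (induction k rule: dec_induct)
    case base
    then show ?case by (simp add: Wm.ev_one)
  next
    case (step k)
    have "int (m + r - k) = int m + int r - int k" using step by simp
    moreover have "{1..<Suc k} = insert k {1..<k}" using step by auto
    moreover have "xpow (int m + int r - int k) \<in> polys" using step by (intro polys_xpow) simp
    ultimately show ?case using step by (simp add: Wm.ev_bb)
  qed
  from this[of r] show ?thesis using r2 by (simp add: lowered_vector_def delta_def)
qed

lemma phi_ev:
  assumes "u \<in> S0 r"
  shows "\<phi> N (Wm.ev N u) = Wm.ev (Suc N) (u * beta N)"
  using assms
proof (induction rule: S0.induct)
  case one
  then show ?case by (simp add: Wm.ev_one gen lowered beta_def)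
next
  case (add u v)
  then show ?case using hom[of N] by (simp add: is_module_hom_def Wm.ev_V Wm.ev_add distrib_right)
next
  case (scal u c)
  then show ?case using hom[of N] by (simp add: is_module_hom_def Wm.ev_V Wm.ev_scal scal_mult_left)
next
  case (bb c Q u)
  have "Emat r c 0 Q \<in> slp r" using bb by (intro Emat_slp) auto
  then show ?case using bb hom[of N] by (simp add: is_module_hom_def Wm.ev_V Wm.ev_bb mult.assoc)
qed

lemma fold_phi_ev:
  assumes "u \<in> S0 r"
  shows "fold \<phi> [N..<N + k] (Wm.ev N u) = Wm.ev (N + k) (u * (\<Prod>i<k. beta (N + i)))"
proof (induction k)
  case (Suc k)
  have "u * (\<Prod>i<k. beta (N + i)) \<in> S0 r" by (intro S0_mult assms betas_S0)
  then show ?case using Suc phi_ev[of _ "N + k"] by (simp add: mult.assoc)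
qed simp

lemma kappa_V: "kappa N u \<in> L" by (simp add: kappa_def iota_V Wm.ev_V)
lemma kappa_add: "kappa N (u + v) = kappa N u + kappa N v" by (simp add: kappa_def Wm.ev_add iota_add Wm.ev_V)
lemma kappa_scal: "kappa N (scal c u) = scL c (kappa N u)" by (simp add: kappa_def Wm.ev_scal iota_scale Wm.ev_V)
lemma kappa_diff: "kappa N (u - v) = kappa N u - kappa N v"
  using kappa_add[of N "u - v" v] by simp

lemma kappa_act: "u \<in> S0 r \<Longrightarrow> X \<in> slp r \<Longrightarrow> kappa N (act_sym r (N * r + n) X u) = actL X (kappa N u)"
  by (simp add: kappa_def Wm.ev_act iota_act Wm.ev_V)

lemma kappa_Gsub: "u \<in> Gsub r (N * r + n) \<Longrightarrow> kappa N u = 0"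
  by (simp add: kappa_def Wm.ev_Gsub iota_zero)

lemma kappa_cong: "Gproj r (N * r + n) u = Gproj r (N * r + n) v \<Longrightarrow> kappa N u = kappa N v"
  using Gproj_eq_0[OF r2, of "N * r + n" "u - v"] kappa_Gsub[of "u - v" N]
  by (simp add: clin_diff[OF clin_Gproj[OF r2]] kappa_diff)

lemma kappa_push:
  assumes "u \<in> S0 r"
  shows "kappa N u = kappa (N + k) (u * (\<Prod>i<k. beta (N + i)))"
  unfolding kappa_def
  by (subst iota_eq[OF Wm.ev_V Wm.ev_V]) (rule exI[of _ "N + k"], simp add: fold_phi_ev[OF assms])

lemma kappa_eq_0_iff:
  assumes "u \<in> S0 r"
  shows "kappa N u = 0 \<longleftrightarrow> (\<exists>k. u * (\<Prod>i<k. beta (N + i)) \<in> Gsub r ((N + k) * r + n))"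
proof
  assume "kappa N u = 0"
  then have "\<iota> N (Wm.ev N u) = \<iota> N (Wm.ev N 0)" by (simp add: kappa_def iota_zero Wm.ev_zero)
  then obtain K where K: "N \<le> K" "fold \<phi> [N..<K] (Wm.ev N u) = fold \<phi> [N..<K] (Wm.ev N 0)"
    using iota_eq[OF Wm.ev_V Wm.ev_V, of N u N 0] by auto
  obtain k where k: "K = N + k" using K(1) le_Suc_ex by blast
  have "Wm.ev (N + k) (u * (\<Prod>i<k. beta (N + i))) = 0"
    using K(2) unfolding k fold_phi_ev[OF assms] fold_phi_ev[OF S0_zero] by (simp add: Wm.ev_zero)
  then show "\<exists>k. u * (\<Prod>i<k. beta (N + i)) \<in> Gsub r ((N + k) * r + n)"
    using Wm.ev_eq_0_iff[OF S0_mult[OF assms betas_S0]] by blast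
next
  assume "\<exists>k. u * (\<Prod>i<k. beta (N + i)) \<in> Gsub r ((N + k) * r + n)"
  then show "kappa N u = 0" using kappa_push[OF assms] kappa_Gsub by metis
qed

lemma kappaE:
  assumes "x \<in> L"
  obtains N u where "u \<in> S0 r" "x = kappa N u"
proof -
  obtain N v where v: "v \<in> W N" "x = \<iota> N v" using assms L_eq by auto
  then obtain u where "u \<in> S0 r" "v = Wm.ev N u" using Wm.V_eq[of N] by auto
  then show thesis using that[of u N] v by (simp add: kappa_def)
qed

lemma kappaE2:
  assumes "x \<in> L" "y \<in> L"
  obtains N u v where "1 \<le> N" "u \<in> S0 r" "v \<in> S0 r" "x = kappa N u" "y = kappa N v"
proof -
  obtain N u M v where u: "u \<in> S0 r" "x = kappa N u" and v: "v \<in> S0 r" "y = kappa M v"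
    using kappaE assms by metis
  let ?u = "u * (\<Prod>i<Suc M. beta (N + i))" and ?v = "v * (\<Prod>i<Suc N. beta (M + i))"
  have "x = kappa (N + Suc M) ?u" using kappa_push[OF u(1), of N "Suc M"] u(2) by simp
  moreover have "y = kappa (M + Suc N) ?v" using kappa_push[OF v(1), of M "Suc N"] v(2) by simp
  then have "y = kappa (N + Suc M) ?v" by (simp add: add.commute)
  ultimately show thesis using that[of "N + Suc M" ?u ?v] S0_mult[OF u(1) betas_S0[where k = "Suc M"]] S0_mult[OF v(1) betas_S0[where k = "Suc N"]] by simp
qed

lemma kappa_tau_push:
  assumes "u \<in> S0 r"
  shows "kappa (Suc N) ((tau ^^ r) u) = kappa (Suc (N + k)) ((tau ^^ r) (u * (\<Prod>i<k. beta (N + i))))"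
  using kappa_push[OF tau_pow_S0[OF assms], of "Suc N" r k]
  by (simp add: tau_pow_mult tau_pow_betas)

lemma kappa_tau_zero:
  assumes u: "u \<in> S0 r" and "kappa N u = 0"
  shows "kappa (Suc N) ((tau ^^ r) u) = 0"
proof -
  obtain k where "u * (\<Prod>i<k. beta (N + i)) \<in> Gsub r ((N + k) * r + n)"
    using assms kappa_eq_0_iff by blast
  from tau_pow_Gsub[OF r2 this, of r]
  moreover have "(N + k) * r + n + r = (Suc N + k) * r + n" by simp
  ultimately have "(tau ^^ r) u * (\<Prod>i<k. beta (Suc N + i)) \<in> Gsub r ((Suc N + k) * r + n)"
    by (simp only: tau_pow_mult tau_pow_betas)
  then show ?thesis using kappa_eq_0_iff[OF tau_pow_S0[OF u]] by blast
qed

text \<open>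
  If $\tau^r$ maps an element into \<open>Gsub\<close>, then its product with \<open>r\<close> consecutive factors \<open>beta\<close> lies in \<open>Gsub\<close>, by \<open>tv_pow_tau_pow\<close>.
\<close>

lemma kappa_tau_inj:
  assumes u: "u \<in> S0 r" and 0: "kappa (Suc N) ((tau ^^ r) u) = 0"
  shows "kappa N u = 0"
proof -
  obtain k where k: "(tau ^^ r) u * (\<Prod>i<k. beta (Suc N + i)) \<in> Gsub r ((Suc N + k) * r + n)"
    using kappa_eq_0_iff[OF tau_pow_S0[OF u]] 0 by blast
  let ?U = "u * (\<Prod>i<k. beta (N + i))" and ?M = "(Suc N + k) * r + n"
  have U: "?U \<in> S0 r" by (intro S0_mult u betas_S0)
  have "(tau ^^ r) ?U \<in> Gsub r ?M" using k by (simp only: tau_pow_mult tau_pow_betas)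
  then have B: "tv_pow r r ?M ((tau ^^ r) ?U) \<in> Gsub r (?M + r * (r - 1))" by (rule tv_pow_Gsub[OF r2])
  have "r \<le> ?M" by simp
  then obtain c where c: "c \<noteq> 0" "Gproj r (?M + r * (r - 1)) (tv_pow r r ?M ((tau ^^ r) ?U))
     = scal c (Gproj r (?M + r * (r - 1)) (?U * (\<Prod>i<r. delta r (int ?M + int r - int r + int (i * r)))))"
    using tv_pow_tau_pow[OF r2] U by blast
  have e: "(\<Prod>i<r. delta r (int ?M + int r - int r + int (i * r))) = (\<Prod>i<r. beta (N + k + i))"
    by (intro prod.cong refl) (simp add: beta_def algebra_simps)
  have m: "?M + r * (r - 1) = (N + k + r) * r + n"
    using r2 by (cases r) (auto simp: algebra_simps)
  have "scal c (Gproj r ((N + k + r) * r + n) (?U * (\<Prod>i<r. beta (N + k + i)))) = 0"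
    using c(2) B unfolding e m by (simp only: Gproj_eq_0[OF r2, symmetric])
  then have "scal (inverse c) (scal c (Gproj r ((N + k + r) * r + n) (?U * (\<Prod>i<r. beta (N + k + i))))) = scal (inverse c) 0"
    by (rule arg_cong)
  then have "Gproj r ((N + k + r) * r + n) (?U * (\<Prod>i<r. beta (N + k + i))) = 0"
    using c(1) by (simp add: scal_scal)
  then have "kappa (N + k) ?U = 0"
    using kappa_push[OF U, of "N + k" r] kappa_Gsub Gproj_eq_0[OF r2] by simp
  then show ?thesis using kappa_push[OF u, of N k] by simp
qed

text \<open>
  By \<open>Theta_formula\<close> the image of \<open>u\<close> under \<open>r\<close> transition maps is in the image of $\tau^r$. The formula requires \<open>r \<le> m\<close>, hence \<open>N \<ge> 1\<close>.
\<close>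

lemma kappa_tau_surj:
  assumes "x \<in> L"
  shows "\<exists>N u. u \<in> S0 r \<and> x = kappa (Suc N) ((tau ^^ r) u)"
proof -
  obtain N u where u: "1 \<le> N" "u \<in> S0 r" "x = kappa N u" using kappaE2[OF assms assms] by metis
  let ?m = "N * r + n"
  have "r \<le> ?m" using u(1) by (cases N) auto
  then obtain c where c: "c \<noteq> 0" "Theta r ?m u
     = scal c (Gproj r (?m + r * r) (u * (\<Prod>i<r. delta r (int ?m + int r + int (i * r)))))"
    using Theta_formula[OF r2] u(2) by blast
  have e: "(\<Prod>i<r. delta r (int ?m + int r + int (i * r))) = (\<Prod>i<r. beta (N + i))"
    by (intro prod.cong refl) (simp add: beta_def algebra_simps)
  have m: "?m + r * r = (N + r) * r + n" by (simp add: algebra_simps)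
  note g = clin_Gproj[OF r2]
  have "scal (inverse c) (Theta r ?m u) = Gproj r ((N + r) * r + n) (u * (\<Prod>i<r. beta (N + i)))"
    using c unfolding e m by (simp add: scal_scal)
  then have "Gproj r ((N + r) * r + n) (u * (\<Prod>i<r. beta (N + i)))
      = Gproj r ((N + r) * r + n) ((tau ^^ r) (scal (inverse c) (tv_pow r r ?m u)))"
    unfolding Theta_def m by (simp add: clin_scal[OF clin_tau_pow] clin_scal[OF g])
  from kappa_cong[OF this] have "x = kappa (N + r) ((tau ^^ r) (scal (inverse c) (tv_pow r r ?m u)))"
    using kappa_push[OF u(2), of N r] u(3) by simp
  moreover obtain K where "N + r = Suc K" using r2 by (cases "N + r") auto
  ultimately show ?thesis using S0.scal[OF tv_pow_S0[OF r2 u(2)]] by metis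
qed

text \<open>
  The map induced by $\tau^r$; that it is well defined is \<open>T_kappa\<close>.
\<close>

definition T :: "'l \<Rightarrow> 'l" where
  "T x = (SOME y. \<exists>N. \<exists>u\<in>S0 r. x = kappa N u \<and> y = kappa (Suc N) ((tau ^^ r) u))"

lemma T_kappa:
  assumes u: "u \<in> S0 r"
  shows "T (kappa N u) = kappa (Suc N) ((tau ^^ r) u)"
proof -
  have "\<exists>M. \<exists>v\<in>S0 r. kappa N u = kappa M v \<and> T (kappa N u) = kappa (Suc M) ((tau ^^ r) v)"
    unfolding T_def by (rule someI_ex) (use u in blast)
  then obtain M v where v: "v \<in> S0 r" "kappa N u = kappa M v" "T (kappa N u) = kappa (Suc M) ((tau ^^ r) v)"
    by blast
  let ?u = "u * (\<Prod>i<M. beta (N + i))" and ?v = "v * (\<Prod>i<N. beta (M + i))"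
  have S: "?u - ?v \<in> S0 r" by (intro S0_diff S0_mult u v betas_S0)
  have "kappa (N + M) (?u - ?v) = 0"
    using kappa_push[OF u, of N M] kappa_push[OF v(1), of M N] v(2) by (simp add: kappa_diff add.commute)
  from kappa_tau_zero[OF S this] show ?thesis
    using kappa_tau_push[OF u, of N M] kappa_tau_push[OF v(1), of M N] v(3)
    by (simp add: clin_diff[OF clin_tau_pow] kappa_diff add.commute)
qed

lemma T_V: "x \<in> L \<Longrightarrow> T x \<in> L"
  using T_kappa kappaE kappa_V by metis

lemma T_add: "x \<in> L \<Longrightarrow> y \<in> L \<Longrightarrow> T (x + y) = T x + T y"
  by (erule (1) kappaE2) (simp add: T_kappa S0.add kappa_add clin_add[OF clin_tau_pow] flip: kappa_add)

lemma T_scale: "x \<in> L \<Longrightarrow> T (scL c x) = scL c (T x)"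
  by (erule kappaE) (simp add: T_kappa S0.scal kappa_scal clin_scal[OF clin_tau_pow] flip: kappa_scal)

lemma T_inj: "x \<in> L \<Longrightarrow> T x = 0 \<Longrightarrow> x = 0"
  by (erule kappaE) (simp add: T_kappa kappa_tau_inj)

lemma T_surj: "x \<in> L \<Longrightarrow> \<exists>y\<in>L. x = T y"
  using kappa_tau_surj T_kappa kappa_V by metis

lemma T_act:
  assumes "xconj r r X Y" "X \<in> slp r" "Y \<in> slp r" "x \<in> L"
  shows "T (actL X x) = actL Y (T x) - scL (of_nat r * Poly_Mapping.lookup (X $$ (0, 0)) 0) (T x)"
proof -
  obtain N u where u: "u \<in> S0 r" "x = kappa N u" using kappaE[OF assms(4)] .
  have e: "N * r + n + r = Suc N * r + n" by simp
  have "T (actL X x) = kappa (Suc N) ((tau ^^ r) (act_sym r (N * r + n) X u))"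
    using u assms r2 by (simp add: T_kappa act_sym_S0 slp_gl flip: kappa_act)
  also have "\<dots> = actL Y (kappa (Suc N) ((tau ^^ r) u)) - scL (of_nat r * Poly_Mapping.lookup (X $$ (0, 0)) 0) (kappa (Suc N) ((tau ^^ r) u))"
    using tau_pow_act[OF u(1) assms(1), of "N * r + n"] r2 unfolding e
    by (simp only: kappa_diff kappa_scal kappa_act[OF tau_pow_S0[OF u(1)] assms(3)])
  finally show ?thesis by (simp only: u(2) T_kappa[OF u(1)])
qed

lemma iota_pow:
  assumes "X \<in> slp r" "v \<in> W N"
  shows "(actL X ^^ k) (\<iota> N v) = \<iota> N ((act N X ^^ k) v) \<and> (act N X ^^ k) v \<in> W N"
  by (induction k) (use assms in \<open>simp_all add: iota_act Wm.act_closed\<close>)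

lemma actL_nilpotent:
  assumes j: "1 \<le> j" "j < r" and x: "x \<in> L"
  shows "\<exists>k. (actL (Emat r 0 j 1) ^^ k) x = 0" "\<exists>k. (actL (Emat r j 0 1) ^^ k) x = 0"
proof -
  have E: "Emat r 0 j 1 \<in> slp r" "Emat r j 0 1 \<in> slp r" using j by (auto intro!: Emat_slp)
  obtain N v where v: "v \<in> W N" "x = \<iota> N v" using x L_eq by auto
  show "\<exists>k. (actL (Emat r 0 j 1) ^^ k) x = 0"
    using Wm.act_row_nilpotent[OF j polys_one v(1)] iota_pow[OF E(1) v(1)] v(2) iota_zero by metis
  show "\<exists>k. (actL (Emat r j 0 1) ^^ k) x = 0"
    using Wm.act_col_nilpotent[OF j v(1)] iota_pow[OF E(2) v(1)] v(2) iota_zero by metis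
qed

lemma actL_sl2:
  assumes j: "1 \<le> j" "j < r"
  shows "sl2_integrable scL L (actL (Emat r 0 j 1)) (actL (Emat r j 0 1)) (actL (hmat r j (-1)))"
  by (intro Lm.sl2_integrableI j actL_nilpotent)

end

section \<open>Extending currents to Laurent polynomials by conjugation\<close>

definition br :: "'a::ring \<Rightarrow> 'a \<Rightarrow> 'a" where "br x y = x * y - y * x"

lemma br_simps:
  "br (x + y) z = br x z + br y z" "br x (y + z) = br x y + br x z"
  "br (x - y) z = br x z - br y z" "br x (y - z) = br x y - br x z"
  "br (- x) z = - br x z" "br x (- z) = - br x z"
  "br 0 z = 0" "br x 0 = 0"
  by (simp_all add: br_def algebra_simps)

lemma br_swap: "br x y = - br y x"
  by (simp add: br_def)

lemma br_jacobi: "br x (br y z) = br (br x y) z + br y (br x z)"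
  by (simp add: br_def algebra_simps)

lemma br_sum_left: "br (sum g A) z = (\<Sum>a\<in>A. br (g a) z)"
  by (induction A rule: infinite_finite_induct) (simp_all add: br_simps)

lemma br_sum_right: "br x (sum g A) = (\<Sum>a\<in>A. br x (g a))"
  by (induction A rule: infinite_finite_induct) (simp_all add: br_simps)

definition cj :: "'a::{ring, monoid_mult} \<Rightarrow> 'a \<Rightarrow> nat \<Rightarrow> 'a \<Rightarrow> 'a" where
  "cj U V k x = U ^ k * x * V ^ k"

lemma cj_0 [simp]: "cj U V 0 x = x"
  by (simp add: cj_def)

lemma cj_add: "cj U V k (x + y) = cj U V k x + cj U V k y"
  by (simp add: cj_def distrib_left distrib_right)

lemma cj_cj: "cj U V k (cj U V l x) = cj U V (k + l) x"
proof -
  have "V ^ l * V ^ k = V ^ (k + l)" by (simp add: power_add[symmetric] add.commute)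
  then show ?thesis by (simp add: cj_def power_add mult.assoc)
qed

lemma power_cancel:
  fixes U V :: "'a::monoid_mult"
  assumes "U * V = 1"
  shows "U ^ k * V ^ k = 1"
proof (induction k)
  case (Suc k)
  have "U ^ Suc k * V ^ Suc k = U * (U ^ k * V ^ k) * V"
    by (simp only: power_Suc[of U] power_Suc2[of V] mult.assoc)
  then show ?case by (simp only: Suc assms mult_1_right)
qed simp

lemma cj_mult:
  assumes "V * U = 1"
  shows "cj U V k (x * y) = cj U V k x * cj U V k y"
proof -
  have "cj U V k x * cj U V k y = U ^ k * x * (V ^ k * U ^ k) * y * V ^ k"
    by (simp only: cj_def mult.assoc)
  then show ?thesis by (simp only: power_cancel[OF assms] mult_1_right) (simp only: cj_def mult.assoc)
qed

lemma cj_inverse: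
  assumes "V * U = 1"
  shows "cj V U k (cj U V k x) = x"
proof -
  have "cj V U k (cj U V k x) = (V ^ k * U ^ k) * x * (V ^ k * U ^ k)" by (simp only: cj_def mult.assoc)
  then show ?thesis by (simp only: power_cancel[OF assms] mult_1_left mult_1_right)
qed

lemma cj_diff: "cj U V k (x - y) = cj U V k x - cj U V k y"
  using cj_add[of U V k "x - y" y] by simp

lemma cj_zero [simp]: "cj U V k 0 = 0"
  by (simp add: cj_def)

lemma cj_uminus: "cj U V k (- x) = - cj U V k x"
  using cj_diff[of U V k 0 x] by simp

lemma cj_br: "V * U = 1 \<Longrightarrow> cj U V k (br x y) = br (cj U V k x) (cj U V k y)"
  by (simp add: br_def cj_diff cj_mult)

section \<open>Shifting Laurent polynomials into \<open>C[x, y]\<close>\<close>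

lemma xpow_xpow: "xpow a * (xpow b * P) = xpow (a + b) * P"
  by (simp add: xpow_add flip: mult.assoc)

lemma xpow_mult_polys:
  assumes "1 \<le> r"
  shows "\<exists>k. xpow (int (r * k)) * P \<in> polys"
proof (induction P rule: poly_mapping_linear_induct)
  case (single a c)
  obtain i j where a: "a = (i, j)" by fastforce
  have "int (nat \<bar>i\<bar>) \<le> int (r * nat \<bar>i\<bar>)" using assms by (simp only: of_nat_le_iff) (cases r, auto)
  then have "0 \<le> int (r * nat \<bar>i\<bar>) + i" by linarith
  then have "xpow (int (r * nat \<bar>i\<bar>)) * Poly_Mapping.single a c \<in> polys"
    unfolding xpow_def a mult_single by (intro polys_single) simp
  then show ?case by (rule exI)
next
  case (add P Q)
  then obtain k l where kl: "xpow (int (r * k)) * P \<in> polys" "xpow (int (r * l)) * Q \<in> polys" by blast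
  have "xpow (int (r * l)) * (xpow (int (r * k)) * P) + xpow (int (r * k)) * (xpow (int (r * l)) * Q) \<in> polys"
    by (intro polys_add polys_mult[OF polys_xpow] kl of_nat_0_le_iff)
  then have "xpow (int (r * (k + l))) * (P + Q) \<in> polys"
    by (simp add: distrib_left xpow_add algebra_simps flip: mult.assoc)
  then show ?case by (rule exI)
qed

lemma xpow_mult_polys_mono:
  assumes "xpow a * P \<in> polys" "a \<le> b"
  shows "xpow b * P \<in> polys"
proof -
  have "xpow (b - a) * (xpow a * P) \<in> polys" using assms by (simp add: polys_mult[OF polys_xpow assms(1)])
  then show ?thesis by (simp add: xpow_add flip: mult.assoc)
qed

text \<open>
  The monomials by which conjugation with powers of \<open>T\<close> shifts.
\<close>

definition sh :: "nat \<Rightarrow> nat \<Rightarrow> laurent" where "sh r k = xpow (int (r * k))"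

lemma sh_mult: "sh r k * sh r l = sh r (k + l)"
  by (simp add: sh_def xpow_add distrib_left)

lemma sh_add: "sh r k * (sh r l * P) = sh r (k + l) * P"
  by (simp add: sh_mult flip: mult.assoc)

lemma sh_0 [simp]: "sh r 0 = 1" by (simp add: sh_def)

lemma sh_Suc: "sh r (Suc k) * P = xpow (int r) * (sh r k * P)"
  by (simp add: sh_def xpow_xpow)

lemma sh_polys: "sh r k \<in> polys"
  unfolding sh_def by (rule polys_xpow) (rule of_nat_0_le_iff)

lemma sh_polys_le: "sh r k * P \<in> polys \<Longrightarrow> k \<le> l \<Longrightarrow> sh r l * P \<in> polys"
  unfolding sh_def by (erule xpow_mult_polys_mono) (simp only: of_nat_le_iff mult_le_mono2)

lemma ex_sh_polys:
  assumes "1 \<le> r"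
  shows "\<exists>k. sh r k * P \<in> polys"
  using xpow_mult_polys[OF assms] by (simp only: sh_def)

text \<open>
  $U^k g(x^{rk} P) V^k$ for the least admissible \<open>k\<close>; under the assumptions of \<open>lau_extension\<close> any admissible \<open>k\<close> gives the same value (\<open>lau_eq\<close>).
\<close>

definition lau :: "nat \<Rightarrow> 'a::{ring, monoid_mult} \<Rightarrow> 'a \<Rightarrow> (laurent \<Rightarrow> 'a) \<Rightarrow> laurent \<Rightarrow> 'a" where
  "lau r U V g P = (let k = LEAST k. sh r k * P \<in> polys in cj U V k (g (sh r k * P)))"

locale lau_extension =
  fixes r :: nat and U V :: "'a::{ring, monoid_mult}" and g :: "laurent \<Rightarrow> 'a"
  assumes r: "1 \<le> r" and UV: "U * V = 1" and VU: "V * U = 1"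
    and g_add: "P \<in> polys \<Longrightarrow> Q \<in> polys \<Longrightarrow> g (P + Q) = g P + g Q"
    and g_shift: "P \<in> polys \<Longrightarrow> U * g (xpow (int r) * P) = g P * U"
begin

lemma cj_g: "P \<in> polys \<Longrightarrow> cj U V k (g (sh r k * P)) = g P"
proof (induction k)
  case (Suc k)
  have Q: "sh r k * P \<in> polys" using Suc.prems by (intro polys_mult sh_polys)
  have x: "sh r (Suc k) * P = xpow (int r) * (sh r k * P)"
    by (simp only: sh_Suc)
  have "cj U V (Suc k) (g (sh r (Suc k) * P)) = cj U V k (U * g (xpow (int r) * (sh r k * P)) * V)"
    unfolding x using cj_cj[of U V k 1 "g (xpow (int r) * (sh r k * P))"]
    by (simp only: cj_def[of U V 1] power_one_right) simp
  also have "\<dots> = cj U V k (g (sh r k * P))"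
    unfolding g_shift[OF Q] by (simp add: mult.assoc UV)
  finally show ?case using Suc by simp
qed simp

lemma lau_eq:
  assumes k: "sh r k * P \<in> polys"
  shows "lau r U V g P = cj U V k (g (sh r k * P))"
proof -
  define l where "l = (LEAST k. sh r k * P \<in> polys)"
  have l: "sh r l * P \<in> polys" unfolding l_def using k by (rule LeastI)
  have lk: "l \<le> k" unfolding l_def using k by (rule Least_le)
  have x: "sh r k * P = sh r (k - l) * (sh r l * P)"
    using lk by (simp add: sh_add)
  have "cj U V k (g (sh r k * P)) = cj U V l (cj U V (k - l) (g (sh r (k - l) * (sh r l * P))))"
    unfolding x cj_cj using lk by simp
  also have "\<dots> = cj U V l (g (sh r l * P))" by (simp only: cj_g[OF l])
  finally show ?thesis by (simp add: lau_def l_def Let_def)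
qed

lemma lau_polys: "P \<in> polys \<Longrightarrow> lau r U V g P = g P"
  using lau_eq[of 0 P] by simp

lemma lau_add: "lau r U V g (P + Q) = lau r U V g P + lau r U V g Q"
proof -
  obtain k l where kl: "sh r k * P \<in> polys" "sh r l * Q \<in> polys"
    using ex_sh_polys[OF r] by meson
  let ?m = "max k l"
  have P: "sh r ?m * P \<in> polys" and Q: "sh r ?m * Q \<in> polys"
    by (rule sh_polys_le[OF kl(1)] sh_polys_le[OF kl(2)], simp)+
  then show ?thesis
    using lau_eq[OF P] lau_eq[OF Q] lau_eq[of ?m "P + Q"] by (simp add: distrib_left polys_add g_add cj_add)
qed

lemma lau_shift: "cj U V m (lau r U V g (sh r m * P)) = lau r U V g P"
proof -
  obtain k where k: "sh r k * P \<in> polys" using ex_sh_polys[OF r] by blast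
  have x: "sh r k * (sh r m * P) = sh r (m + k) * P"
    by (simp only: sh_add add.commute)
  have 1: "sh r (m + k) * P \<in> polys" by (rule sh_polys_le[OF k]) simp
  then have "sh r k * (sh r m * P) \<in> polys" unfolding x .
  from lau_eq[OF this] show ?thesis unfolding x by (simp add: cj_cj lau_eq[OF 1])
qed

lemma lau_unshift: "cj V U m (lau r U V g P) = lau r U V g (sh r m * P)"
  using cj_inverse[OF VU, of m "lau r U V g (sh r m * P)"] by (simp only: lau_shift)

end

abbreviation dlt :: "nat \<Rightarrow> nat \<Rightarrow> 'a::zero \<Rightarrow> 'a" where "dlt i j x \<equiv> (if i = j then x else 0)"

section \<open>Currents in a ring of operators\<close>

text \<open>
  The situation on the limit in terms of operators: \<open>e i P\<close> and \<open>f i P\<close> are the generators of $sl_r[x,y]$, \<open>S\<close> the scalars,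
  \<open>G\<close> the set of operators to which rigidity applies. For \<open>T_h\<close> recall that \<open>T\<close> commutes with the coroots only up to scalars. The assumptions
  are symmetric under exchange of \<open>e\<close>, \<open>f\<close> together with exchange of \<open>T\<close> and its inverse (\<open>mirror\<close>), which
  halves the number of proofs.
\<close>

locale sl_currents =
  fixes r :: nat and S :: "complex \<Rightarrow> 'a::{ring, monoid_mult}" and G :: "'a set" and T Ti :: 'a
    and e f :: "nat \<Rightarrow> laurent \<Rightarrow> 'a"
  assumes r2: "2 \<le> r"
    and S_add: "S (a + b) = S a + S b" and S_mult: "S (a * b) = S a * S b" and S_one: "S 1 = 1"
    and G_diff: "x \<in> G \<Longrightarrow> y \<in> G \<Longrightarrow> x - y \<in> G" and G_mult: "x \<in> G \<Longrightarrow> y \<in> G \<Longrightarrow> x * y \<in> G"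
    and G_S: "x \<in> G \<Longrightarrow> S a * x \<in> G" and S_comm: "x \<in> G \<Longrightarrow> S a * x = x * S a"
    and G_conj: "x \<in> G \<Longrightarrow> T * x * Ti \<in> G" "x \<in> G \<Longrightarrow> Ti * x * T \<in> G"
    and T_Ti: "T * Ti = 1" "Ti * T = 1" and S_T: "S a * T = T * S a" "S a * Ti = Ti * S a"
    and e_G: "P \<in> polys \<Longrightarrow> i \<in> {1..<r} \<Longrightarrow> e i P \<in> G" and f_G: "P \<in> polys \<Longrightarrow> i \<in> {1..<r} \<Longrightarrow> f i P \<in> G"
    and e_add: "P \<in> polys \<Longrightarrow> Q \<in> polys \<Longrightarrow> i \<in> {1..<r} \<Longrightarrow> e i (P + Q) = e i P + e i Q"
    and f_add: "P \<in> polys \<Longrightarrow> Q \<in> polys \<Longrightarrow> i \<in> {1..<r} \<Longrightarrow> f i (P + Q) = f i P + f i Q"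
    and e_scal: "P \<in> polys \<Longrightarrow> i \<in> {1..<r} \<Longrightarrow> e i (scal a P) = S a * e i P"
    and f_scal: "P \<in> polys \<Longrightarrow> i \<in> {1..<r} \<Longrightarrow> f i (scal a P) = S a * f i P"
    and ee: "P \<in> polys \<Longrightarrow> Q \<in> polys \<Longrightarrow> i \<in> {1..<r} \<Longrightarrow> j \<in> {1..<r} \<Longrightarrow> br (e i P) (e j Q) = 0"
    and ff: "P \<in> polys \<Longrightarrow> Q \<in> polys \<Longrightarrow> i \<in> {1..<r} \<Longrightarrow> j \<in> {1..<r} \<Longrightarrow> br (f i P) (f j Q) = 0"
    and efe: "P \<in> polys \<Longrightarrow> Q \<in> polys \<Longrightarrow> R \<in> polys \<Longrightarrow> i \<in> {1..<r} \<Longrightarrow> j \<in> {1..<r} \<Longrightarrow> k \<in> {1..<r} \<Longrightarrow>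
      br (br (e i P) (f j Q)) (e k R) = dlt i j (e k (P * Q * R)) + dlt j k (e i (P * Q * R))"
    and fef: "P \<in> polys \<Longrightarrow> Q \<in> polys \<Longrightarrow> R \<in> polys \<Longrightarrow> i \<in> {1..<r} \<Longrightarrow> j \<in> {1..<r} \<Longrightarrow> k \<in> {1..<r} \<Longrightarrow>
      br (br (f i P) (e j Q)) (f k R) = dlt i j (f k (P * Q * R)) + dlt j k (f i (P * Q * R))"
    and ef_prod: "P \<in> polys \<Longrightarrow> Q \<in> polys \<Longrightarrow> P' \<in> polys \<Longrightarrow> Q' \<in> polys \<Longrightarrow> P * Q = P' * Q' \<Longrightarrow>
      i \<in> {1..<r} \<Longrightarrow> j \<in> {1..<r} \<Longrightarrow> br (e i P) (f j Q) = br (e i P') (f j Q')"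
    and T_e: "P \<in> polys \<Longrightarrow> i \<in> {1..<r} \<Longrightarrow> T * e i (xpow (int r) * P) = e i P * T"
    and T_f: "P \<in> polys \<Longrightarrow> i \<in> {1..<r} \<Longrightarrow> Ti * f i (xpow (int r) * P) = f i P * Ti"
    and T_h: "i \<in> {1..<r} \<Longrightarrow> \<exists>z. (\<forall>x\<in>G. z * x = x * z) \<and> T * br (e i 1) (f i 1) * Ti = br (e i 1) (f i 1) + z"
    and rigid_f: "i \<in> {1..<r} \<Longrightarrow> t \<in> G \<Longrightarrow> br (f i 1) t = 0 \<Longrightarrow> 0 < n \<Longrightarrow>
      br (br (e i 1) (f i 1)) t = S (of_nat n) * t \<Longrightarrow> t = 0"
    and rigid_e: "i \<in> {1..<r} \<Longrightarrow> t \<in> G \<Longrightarrow> br (e i 1) t = 0 \<Longrightarrow> 0 < n \<Longrightarrow>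
      br (br (f i 1) (e i 1)) t = S (of_nat n) * t \<Longrightarrow> t = 0"
begin

definition eL :: "nat \<Rightarrow> laurent \<Rightarrow> 'a" where "eL i = lau r T Ti (e i)"
definition fL :: "nat \<Rightarrow> laurent \<Rightarrow> 'a" where "fL i = lau r Ti T (f i)"

lemma lau_e: "i \<in> {1..<r} \<Longrightarrow> lau_extension r T Ti (e i)"
  by unfold_locales (use r2 T_Ti e_add T_e in auto)

lemma lau_f: "i \<in> {1..<r} \<Longrightarrow> lau_extension r Ti T (f i)"
  by unfold_locales (use r2 T_Ti f_add T_f in auto)

lemma central_cj:
  assumes z: "\<And>x. x \<in> G \<Longrightarrow> z * x = x * z" and x: "x \<in> G"
  shows "(T * z * Ti) * x = x * (T * z * Ti)" "(Ti * z * T) * x = x * (Ti * z * T)"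
proof -
  have "(T * z * Ti) * x = T * (z * (Ti * x * T)) * Ti"
    by (simp only: mult.assoc T_Ti(1) mult_1_right)
  also have "\<dots> = (T * Ti) * x * (T * z * Ti)"
    unfolding z[OF G_conj(2)[OF x]] by (simp only: mult.assoc)
  finally show "(T * z * Ti) * x = x * (T * z * Ti)" by (simp add: T_Ti)
  have "(Ti * z * T) * x = Ti * (z * (T * x * Ti)) * T"
    by (simp only: mult.assoc T_Ti(2) mult_1_right)
  also have "\<dots> = (Ti * T) * x * (Ti * z * T)"
    unfolding z[OF G_conj(1)[OF x]] by (simp only: mult.assoc)
  finally show "(Ti * z * T) * x = x * (Ti * z * T)" by (simp add: T_Ti)
qed

lemma mirror: "sl_currents r S G Ti T f e"
proof unfold_locales
  fix i assume i: "i \<in> {1..<r}"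
  obtain z where z: "\<forall>x\<in>G. z * x = x * z" "T * br (e i 1) (f i 1) * Ti = br (e i 1) (f i 1) + z"
    using T_h[OF i] by blast
  let ?h = "br (e i 1) (f i 1)"
  have "Ti * ?h * T = Ti * (T * ?h * Ti - z) * T" using z(2) by simp
  also have "\<dots> = (Ti * T) * ?h * (Ti * T) - Ti * z * T"
    by (simp only: right_diff_distrib left_diff_distrib mult.assoc)
  finally have "Ti * br (f i 1) (e i 1) * T = br (f i 1) (e i 1) + Ti * z * T"
    unfolding br_swap[of "f i 1"] by (simp add: T_Ti)
  then show "\<exists>z. (\<forall>x\<in>G. z * x = x * z) \<and> Ti * br (f i 1) (e i 1) * T = br (f i 1) (e i 1) + z"
    using central_cj(2)[of z] z(1) by blast
next
  fix P Q P' Q' i j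
  assume *: "P \<in> polys" "Q \<in> polys" "P' \<in> polys" "Q' \<in> polys" "P * Q = P' * Q'" "i \<in> {1..<r}" "j \<in> {1..<r}"
  then have "br (e j Q) (f i P) = br (e j Q') (f i P')" by (intro ef_prod) (simp_all add: mult.commute)
  then show "br (f i P) (e j Q) = br (f i P') (e j Q')" by (simp add: br_swap[of "f i _"])
qed (fact r2 S_add S_mult S_one G_diff G_mult G_S S_comm G_conj T_Ti S_T e_G f_G e_add f_add e_scal f_scal ee ff efe fef
  T_e T_f rigid_f rigid_e)+

lemma G_cj: "x \<in> G \<Longrightarrow> cj T Ti k x \<in> G" "x \<in> G \<Longrightarrow> cj Ti T k x \<in> G"
proof -
  have 1: "cj U V (Suc k) x = cj U V k (U * x * V)" for U V :: 'a and k x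
    by (simp only: cj_def power_Suc2[of U] power_Suc[of V] mult.assoc)
  show "x \<in> G \<Longrightarrow> cj T Ti k x \<in> G" "x \<in> G \<Longrightarrow> cj Ti T k x \<in> G"
    by (induction k arbitrary: x) (simp_all add: 1 G_conj)
qed

lemma eL_polys: "P \<in> polys \<Longrightarrow> i \<in> {1..<r} \<Longrightarrow> eL i P = e i P"
  by (simp add: eL_def lau_extension.lau_polys[OF lau_e])

lemma fL_polys: "P \<in> polys \<Longrightarrow> i \<in> {1..<r} \<Longrightarrow> fL i P = f i P"
  by (simp add: fL_def lau_extension.lau_polys[OF lau_f])

lemma eL_add: "i \<in> {1..<r} \<Longrightarrow> eL i (P + Q) = eL i P + eL i Q"
  by (simp add: eL_def lau_extension.lau_add[OF lau_e])

lemma eL_cj: "i \<in> {1..<r} \<Longrightarrow> cj T Ti m (eL i (sh r m * P)) = eL i P"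
  "i \<in> {1..<r} \<Longrightarrow> cj Ti T m (eL i P) = eL i (sh r m * P)"
  by (simp_all only: eL_def lau_extension.lau_shift[OF lau_e] lau_extension.lau_unshift[OF lau_e])

lemma fL_cj: "i \<in> {1..<r} \<Longrightarrow> cj Ti T m (fL i (sh r m * P)) = fL i P"
  "i \<in> {1..<r} \<Longrightarrow> cj T Ti m (fL i P) = fL i (sh r m * P)"
  by (simp_all only: fL_def lau_extension.lau_shift[OF lau_f] lau_extension.lau_unshift[OF lau_f])

lemmas cjb = cj_br[OF T_Ti(1)] cj_br[OF T_Ti(2)]

lemma polys_bound1: obtains m where "sh r m * P \<in> polys"
proof -
  have "1 \<le> r" using r2 by simp
  from ex_sh_polys[OF this, of P] that show thesis by blast
qed

lemma polys_bound2: obtains m where "sh r m * P \<in> polys" "sh r m * Q \<in> polys"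
proof -
  obtain k where k: "sh r k * P \<in> polys" by (rule polys_bound1)
  obtain l where l: "sh r l * Q \<in> polys" by (rule polys_bound1)
  have "sh r (max k l) * P \<in> polys" by (rule sh_polys_le[OF k max.cobounded1])
  moreover have "sh r (max k l) * Q \<in> polys" by (rule sh_polys_le[OF l max.cobounded2])
  ultimately show thesis by (rule that)
qed

lemma eL_G: "i \<in> {1..<r} \<Longrightarrow> eL i P \<in> G"
proof -
  assume i: "i \<in> {1..<r}"
  obtain m where "sh r m * P \<in> polys" by (rule polys_bound1)
  then show ?thesis using eL_cj(1)[OF i, of m P] G_cj(1)[OF e_G[OF _ i]] eL_polys[OF _ i] by metis
qed

lemma S_cj: "cj T Ti m (S a * x) = S a * cj T Ti m x"
proof -
  have "T ^ m * S a = S a * T ^ m"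
    by (induction m) (simp_all add: mult.assoc[symmetric] S_T, simp add: mult.assoc)
  then show ?thesis by (simp add: cj_def mult.assoc[symmetric])
qed

lemma eL_scal:
  assumes i: "i \<in> {1..<r}" shows "eL i (scal a P) = S a * eL i P"
proof -
  obtain m where m: "sh r m * P \<in> polys" by (rule polys_bound1)
  have "eL i (scal a P) = cj T Ti m (e i (scal a (sh r m * P)))"
    using eL_cj(1)[OF i, of m "scal a P"] eL_polys[OF _ i, of "scal a (sh r m * P)"] m
    by (simp add: scal_mult_right polys_scal)
  also have "\<dots> = S a * cj T Ti m (e i (sh r m * P))" by (simp only: e_scal[OF m i] S_cj)
  finally show ?thesis using eL_cj(1)[OF i, of m P] eL_polys[OF m i] by simp
qed

lemma eL_eL: assumes "i \<in> {1..<r}" "j \<in> {1..<r}" shows "br (eL i P) (eL j Q) = 0"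
proof -
  obtain m where m: "sh r m * P \<in> polys" "sh r m * Q \<in> polys" by (rule polys_bound2)
  have "br (eL i P) (eL j Q) = br (cj T Ti m (eL i (sh r m * P))) (cj T Ti m (eL j (sh r m * Q)))"
    by (simp only: eL_cj assms)
  then show ?thesis by (simp only: cjb[symmetric] eL_polys m assms ee cj_zero)
qed

text \<open>
  The element that plays the role of $E_{ij} \otimes P$ for \<open>i \<noteq> j\<close> and of $(E_{ii} - E_{00}) \otimes P$ for \<open>i = j\<close>.
\<close>

definition DL :: "nat \<Rightarrow> nat \<Rightarrow> laurent \<Rightarrow> 'a" where
  "DL i j P = br (fL i P) (eL j 1)"

lemma fe_prod:
  assumes "P \<in> polys" "Q \<in> polys" "P' \<in> polys" "Q' \<in> polys" "P * Q = P' * Q'" "i \<in> {1..<r}" "j \<in> {1..<r}"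
  shows "br (f i P) (e j Q) = br (f i P') (e j Q')"
  using assms sl_currents.ef_prod[OF mirror] by blast

text \<open>
  When one argument is divisible by a high power of \<open>x\<close>, conjugation by a power of \<open>T\<close> makes both arguments polynomial. Then the
  bracket depends on their product only, and powers of \<open>x\<close> may be moved to the other argument so as to undo the conjugation.
\<close>

lemma high_pair:
  assumes "i \<in> {1..<r}" "j \<in> {1..<r}"
  shows "\<forall>\<^sub>F K in sequentially. br (fL i (sh r K * P)) (eL j Q) = DL i j (sh r K * (P * Q))"
proof -
  obtain m where m: "sh r m * P \<in> polys" "sh r m * Q \<in> polys" by (rule polys_bound2)
  have "br (fL i (sh r K * P)) (eL j Q) = DL i j (sh r K * (P * Q))" if mK: "m + (m + m) \<le> K" for K
  proof -
    define k where "k = K - (m + (m + m))"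
    have k: "K = m + (m + (k + m))" using mK by (simp add: k_def)
    let ?D = "sh r k * (sh r m * P)" and ?Q = "sh r m * Q"
    have D: "?D \<in> polys" by (intro polys_mult[OF sh_polys] m)
    have p: "sh r m * ?D \<in> polys" "?D * ?Q \<in> polys" "sh r m * (?D * ?Q) \<in> polys"
      by (intro polys_mult[OF sh_polys] polys_mult[OF D] D m)+
    have K: "sh r K * P = sh r m * (sh r m * ?D)" "sh r K * (P * Q) = sh r m * (?D * ?Q)"
      by (simp_all only: k sh_mult[symmetric] mult_ac)
    have "br (fL i (sh r K * P)) (eL j Q) = br (cj T Ti m (fL i (sh r m * ?D))) (cj T Ti m (eL j ?Q))"
      unfolding K(1) by (simp only: fL_cj eL_cj assms)
    also have "\<dots> = cj T Ti m (br (f i (sh r m * ?D)) (e j ?Q))"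
      by (simp only: cjb fL_polys eL_polys assms p m)
    also have "br (f i (sh r m * ?D)) (e j ?Q) = br (f i (?D * ?Q)) (e j (sh r m * 1))"
      by (intro fe_prod p m assms) (simp_all add: sh_polys mult_ac)
    also have "cj T Ti m \<dots> = br (cj T Ti m (fL i (?D * ?Q))) (cj T Ti m (eL j (sh r m * 1)))"
      by (simp only: mult_1_right sh_polys cjb fL_polys eL_polys assms p)
    also have "\<dots> = DL i j (sh r K * (P * Q))"
      unfolding K(2) by (simp only: fL_cj eL_cj assms DL_def)
    finally show ?thesis .
  qed
  then show ?thesis unfolding eventually_sequentially by blast
qed

lemma high_pair':
  assumes "i \<in> {1..<r}" "j \<in> {1..<r}"
  shows "\<forall>\<^sub>F K in sequentially. br (fL i P) (eL j (sh r K * Q)) = DL i j (sh r K * (P * Q))"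
proof -
  interpret m: sl_currents r S G Ti T f e by (rule mirror)
  obtain m where m: "sh r m * (P * Q) \<in> polys" by (rule polys_bound1)
  have "\<forall>\<^sub>F K in sequentially. br (eL j (sh r K * Q)) (fL i P) = br (eL j (sh r K * (Q * P))) (fL i 1)"
    using m.high_pair[OF assms(2,1), of Q P] by (simp only: m.DL_def m.eL_def m.fL_def eL_def fL_def)
  moreover have "\<forall>\<^sub>F K in sequentially. m \<le> K" by (rule eventually_ge_at_top)
  ultimately show ?thesis
  proof eventually_elim
    case (elim K)
    have p: "sh r K * (P * Q) \<in> polys" using elim(2) by (rule sh_polys_le[OF m])
    then have "br (f i 1) (e j (sh r K * (P * Q))) = br (f i (sh r K * (P * Q))) (e j 1)"
      using assms by (intro fe_prod) auto
    then show ?case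
      using elim(1) p assms polys_one
      by (simp only: DL_def br_swap[of "eL j _"] br_swap[of "e j _"] neg_equal_iff_equal mult.commute[of Q P] fL_polys eL_polys)
  qed
qed

lemma high_fixed:
  assumes "i \<in> {1..<r}" "j \<in> {1..<r}"
  shows "\<forall>\<^sub>F K in sequentially. sh r K * P \<in> polys \<and> cj Ti T m (DL i j (sh r K * P)) = DL i j (sh r K * P)
    \<and> cj T Ti m (DL i j (sh r K * P)) = DL i j (sh r K * P)"
proof -
  obtain l where l: "sh r l * P \<in> polys" by (rule polys_bound1)
  have "sh r K * P \<in> polys \<and> cj Ti T m (DL i j (sh r K * P)) = DL i j (sh r K * P)
    \<and> cj T Ti m (DL i j (sh r K * P)) = DL i j (sh r K * P)" if mK: "m + l \<le> K" for K
  proof -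
    define k where "k = K - (m + l)"
    have k: "K = m + (k + l)" using mK by (simp add: k_def)
    let ?D = "sh r k * (sh r l * P)"
    have D: "?D \<in> polys" by (intro polys_mult[OF sh_polys] l)
    have D': "sh r m * ?D \<in> polys" by (intro polys_mult[OF sh_polys] D)
    have K: "sh r K * P = sh r m * ?D" by (simp only: k sh_add)
    have "cj Ti T m (DL i j (sh r K * P)) = br (fL i ?D) (eL j (sh r m * 1))"
      unfolding DL_def K by (simp only: cjb fL_cj eL_cj assms)
    also have "\<dots> = br (f i ?D) (e j (sh r m * 1))"
      by (simp only: mult_1_right sh_polys fL_polys eL_polys assms D)
    also have "\<dots> = br (f i (sh r m * ?D)) (e j 1)"
      using sh_polys D D' assms by (intro fe_prod) (simp_all add: mult_ac)
    finally have 1: "cj Ti T m (DL i j (sh r K * P)) = DL i j (sh r K * P)"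
      unfolding DL_def K using D' by (simp only: fL_polys eL_polys assms polys_one)
    have "cj T Ti m (DL i j (sh r K * P)) = cj T Ti m (cj Ti T m (DL i j (sh r K * P)))"
      by (simp only: 1)
    then show ?thesis using 1 D' K by (simp only: cj_inverse[OF T_Ti(1)])
  qed
  then show ?thesis unfolding eventually_sequentially by blast
qed

text \<open>
  As \<open>DL\<close> of a highly divisible argument is invariant under conjugation, the other argument may be assumed to be polynomial.
\<close>

lemma high_act_f:
  assumes "i \<in> {1..<r}" "j \<in> {1..<r}" "k \<in> {1..<r}"
  shows "\<forall>\<^sub>F K in sequentially. br (DL i j (sh r K * P)) (fL k Q)
    = dlt i j (fL k (sh r K * (P * Q))) + dlt j k (fL i (sh r K * (P * Q)))"
proof -
  obtain m where m: "sh r m * Q \<in> polys" by (rule polys_bound1)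
  show ?thesis
    using high_fixed[OF assms(1,2), where P = P and m = m]
  proof eventually_elim
    case (elim K)
    let ?R = "sh r K * P"
    have "br (DL i j ?R) (fL k Q) = br (cj Ti T m (DL i j ?R)) (cj Ti T m (fL k (sh r m * Q)))"
      using elim by (simp only: fL_cj assms)
    also have "\<dots> = cj Ti T m (br (br (f i ?R) (e j 1)) (f k (sh r m * Q)))"
      unfolding DL_def using elim by (simp only: cjb fL_polys eL_polys assms m polys_one)
    also have "br (br (f i ?R) (e j 1)) (f k (sh r m * Q))
      = dlt i j (f k (?R * 1 * (sh r m * Q))) + dlt j k (f i (?R * 1 * (sh r m * Q)))"
      using elim by (simp only: fef assms m polys_one)
    also have "?R * 1 * (sh r m * Q) = sh r m * (sh r K * (P * Q))" by (simp only: mult_ac mult_1_left)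
    finally have 1: "br (DL i j ?R) (fL k Q) = dlt i j (cj Ti T m (f k (sh r m * (sh r K * (P * Q)))))
        + dlt j k (cj Ti T m (f i (sh r m * (sh r K * (P * Q)))))"
      by (simp add: cj_add)
    have "sh r K * P * (sh r m * Q) \<in> polys" by (rule polys_mult) (use elim m in auto)
    then have "sh r m * (sh r K * (P * Q)) \<in> polys" by (simp only: mult_ac)
    then have "f l (sh r m * (sh r K * (P * Q))) = fL l (sh r m * (sh r K * (P * Q)))" if "l \<in> {1..<r}" for l
      using that by (simp only: fL_polys)
    then show ?case unfolding 1 by (simp only: fL_cj assms)
  qed
qed

lemma high_act_e:
  assumes "i \<in> {1..<r}" "j \<in> {1..<r}" "k \<in> {1..<r}"
  shows "\<forall>\<^sub>F K in sequentially. br (DL i j (sh r K * P)) (eL k Q)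
    = - (dlt i j (eL k (sh r K * (P * Q))) + dlt i k (eL j (sh r K * (P * Q))))"
proof -
  obtain m where m: "sh r m * Q \<in> polys" by (rule polys_bound1)
  show ?thesis
    using high_fixed[OF assms(1,2), where P = P and m = m]
  proof eventually_elim
    case (elim K)
    let ?R = "sh r K * P"
    have "br (DL i j ?R) (eL k Q) = br (cj T Ti m (DL i j ?R)) (cj T Ti m (eL k (sh r m * Q)))"
      using elim by (simp only: eL_cj assms)
    also have "\<dots> = cj T Ti m (- br (br (e j 1) (f i ?R)) (e k (sh r m * Q)))"
      unfolding DL_def br_swap[of "fL i _"] br_simps(5)
      using elim by (simp only: cjb fL_polys eL_polys assms m polys_one br_simps(5) cj_uminus)
    also have "br (br (e j 1) (f i ?R)) (e k (sh r m * Q))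
      = dlt j i (e k (1 * ?R * (sh r m * Q))) + dlt i k (e j (1 * ?R * (sh r m * Q)))"
      using elim by (simp only: efe assms m polys_one)
    also have "1 * ?R * (sh r m * Q) = sh r m * (sh r K * (P * Q))" by (simp only: mult_ac mult_1_left)
    finally have 1: "br (DL i j ?R) (eL k Q) = - (dlt i j (cj T Ti m (e k (sh r m * (sh r K * (P * Q)))))
        + dlt i k (cj T Ti m (e j (sh r m * (sh r K * (P * Q))))))"
      by (simp add: cj_add cj_uminus cj_diff)
    have "sh r K * P * (sh r m * Q) \<in> polys" by (rule polys_mult) (use elim m in auto)
    then have "sh r m * (sh r K * (P * Q)) \<in> polys" by (simp only: mult_ac)
    then have "e l (sh r m * (sh r K * (P * Q))) = eL l (sh r m * (sh r K * (P * Q)))" if "l \<in> {1..<r}" for l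
      using that by (simp only: eL_polys)
    then show ?case unfolding 1 by (simp only: eL_cj assms)
  qed
qed

end

context sl_currents
begin

section \<open>The triple relation for Laurent polynomials\<close>

lemma fL_fL: "i \<in> {1..<r} \<Longrightarrow> j \<in> {1..<r} \<Longrightarrow> br (fL i P) (fL j Q) = 0"
  using sl_currents.eL_eL[OF mirror] by (simp only: sl_currents.eL_def[OF mirror] fL_def)

lemma fL_G: "i \<in> {1..<r} \<Longrightarrow> fL i P \<in> G"
  using sl_currents.eL_G[OF mirror] by (simp only: sl_currents.eL_def[OF mirror] fL_def)

lemma fL_add: "i \<in> {1..<r} \<Longrightarrow> fL i (P + Q) = fL i P + fL i Q"
  using sl_currents.eL_add[OF mirror] by (simp only: sl_currents.eL_def[OF mirror] fL_def)

lemma fL_scal: "i \<in> {1..<r} \<Longrightarrow> fL i (scal a P) = S a * fL i P"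
  using sl_currents.eL_scal[OF mirror] by (simp only: sl_currents.eL_def[OF mirror] fL_def)

abbreviation hL :: "nat \<Rightarrow> 'a" where "hL i \<equiv> br (e i 1) (f i 1)"

lemma hL_cj:
  assumes i: "i \<in> {1..<r}"
  shows "\<exists>z. (\<forall>x\<in>G. z * x = x * z) \<and> cj T Ti m (hL i) = hL i + z"
proof (induction m)
  case 0
  show ?case by (rule exI[of _ 0]) simp
next
  case (Suc m)
  then obtain z where z: "\<forall>x\<in>G. z * x = x * z" "cj T Ti m (hL i) = hL i + z" by blast
  obtain y where y: "\<forall>x\<in>G. y * x = x * y" "T * hL i * Ti = hL i + y" using T_h[OF i] by blast
  have "cj T Ti (Suc m) (hL i) = T * cj T Ti m (hL i) * Ti"
    using cj_cj[of T Ti 1 m "hL i"] by (simp add: cj_def[of T Ti "Suc 0"])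
  also have "\<dots> = hL i + (y + T * z * Ti)"
    unfolding z(2) by (simp add: distrib_left distrib_right y(2))
  finally have "cj T Ti (Suc m) (hL i) = hL i + (y + T * z * Ti)" .
  moreover have "(y + T * z * Ti) * x = x * (y + T * z * Ti)" if "x \<in> G" for x
    using central_cj(1)[OF _ that, of z] z(1) y(1) that by (simp add: distrib_left distrib_right)
  ultimately show ?case by blast
qed

lemma br_hL_cj:
  assumes "i \<in> {1..<r}" "x \<in> G"
  shows "br (hL i) (cj T Ti m x) = cj T Ti m (br (hL i) x)"
proof -
  obtain z where z: "\<forall>x\<in>G. z * x = x * z" "cj T Ti m (hL i) = hL i + z" using hL_cj[OF assms(1)] by blast
  have "br z (cj T Ti m x) = 0" using z(1) G_cj(1)[OF assms(2)] by (simp add: br_def)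
  then show ?thesis using cj_br[OF T_Ti(2), of m "hL i" x] by (simp add: z(2) br_simps)
qed

lemma hL_eL:
  assumes i: "i \<in> {1..<r}" and k: "k \<in> {1..<r}"
  shows "br (hL i) (eL k P) = eL k P + dlt i k (eL k P)"
proof -
  obtain m where m: "sh r m * P \<in> polys" by (rule polys_bound1)
  have "br (hL i) (cj T Ti m (e k (sh r m * P))) = cj T Ti m (e k (sh r m * P)) + dlt i k (cj T Ti m (e k (sh r m * P)))"
    unfolding br_hL_cj[OF i e_G[OF m k]] using efe[OF polys_one polys_one m i i k] by (simp add: cj_add)
  then show ?thesis using eL_cj(1)[OF k, of m P] eL_polys[OF m k] by simp
qed

lemma hL_fL:
  assumes i: "i \<in> {1..<r}" and k: "k \<in> {1..<r}"
  shows "br (hL i) (fL k P) = - (fL k P + dlt i k (fL k P))"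
proof -
  have "br (br (f i 1) (e i 1)) (fL k P) = fL k P + dlt i k (fL k P)"
    using sl_currents.hL_eL[OF mirror i k, of P] by (simp only: sl_currents.eL_def[OF mirror] fL_def)
  then show ?thesis unfolding br_swap[of "f i 1"] br_simps(5) by (metis minus_minus)
qed

lemma G_zero: "0 \<in> G"
proof -
  have "e 1 1 \<in> G" using r2 by (intro e_G) auto
  from G_diff[OF this this] show ?thesis by simp
qed

lemma G_uminus: "x \<in> G \<Longrightarrow> - x \<in> G" using G_diff[OF G_zero, of x] by simp
lemma G_add: "x \<in> G \<Longrightarrow> y \<in> G \<Longrightarrow> x + y \<in> G" using G_diff[OF _ G_uminus, of x y] by simp
lemma G_br: "x \<in> G \<Longrightarrow> y \<in> G \<Longrightarrow> br x y \<in> G" by (simp add: br_def G_diff G_mult)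

lemma S_nat: "S (of_nat n) * x = (\<Sum>i<n. x)"
proof (induction n)
  case 0
  have "S 0 = 0" using S_add[of 0 0] by simp
  then show ?case by simp
next
  case (Suc n)
  then show ?case by (simp add: S_add S_one distrib_right)
qed

text \<open>
  Conjugation by $T^K$ turns \<open>f_i(x\<^bsup>rK\<^esup>)\<close> into \<open>f_i(1)\<close> and preserves the weight, since it changes the coroot by a central element only.
\<close>

lemma rigid_high:
  assumes i: "i \<in> {1..<r}" and t: "t \<in> G" and n: "0 < n" and w: "br (hL i) t = S (of_nat n) * t"
    and K: "br (fL i (sh r K)) t = 0"
  shows "t = 0"
proof -
  have f1: "f i 1 = cj Ti T K (fL i (sh r K))"
    using fL_cj(1)[OF i, of K 1] i by (simp add: fL_polys)
  let ?t = "cj Ti T K t"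
  have G: "?t \<in> G" by (rule G_cj(2)[OF t])
  have "br (f i 1) ?t = 0" unfolding f1 cjb[symmetric] K by simp
  moreover have "br (hL i) ?t = S (of_nat n) * ?t"
  proof -
    have "cj T Ti K (br (hL i) ?t) = cj T Ti K (S (of_nat n) * ?t)"
      unfolding br_hL_cj[OF i G, symmetric] S_cj cj_inverse[OF T_Ti(1)] by (rule w)
    then have "cj Ti T K (cj T Ti K (br (hL i) ?t)) = cj Ti T K (cj T Ti K (S (of_nat n) * ?t))" by (rule arg_cong)
    then show ?thesis unfolding cj_inverse[OF T_Ti(2)] .
  qed
  ultimately have "?t = 0" using rigid_f[OF i G _ n] by blast
  then have "cj T Ti K ?t = 0" by simp
  then show ?thesis unfolding cj_inverse[OF T_Ti(1)] .
qed

text \<open>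
  The element \<open>?t\<close> is the difference of the two sides. Its weight \<open>?n\<close> for the \<open>i\<close>-th coroot is positive as \<open>e_i\<close> contributes 2,
  \<open>e_k\<close> at least 1 and \<open>f_j\<close> at least -2. The commutator with \<open>f_i(x\<^bsup>rK\<^esup>)\<close> vanishes for large \<open>K\<close>: by the Jacobi identity it
  is a combination of brackets in which one argument is highly divisible, and all of them can be expressed by \<open>DL\<close>.
\<close>

theorem efe_laurent:
  assumes i: "i \<in> {1..<r}" and j: "j \<in> {1..<r}" and k: "k \<in> {1..<r}"
  shows "br (br (eL i P) (fL j Q)) (eL k R) = dlt i j (eL k (P * Q * R)) + dlt j k (eL i (P * Q * R))"
proof -
  let ?X = "br (br (eL i P) (fL j Q)) (eL k R)"
  let ?Y = "dlt i j (eL k (P * Q * R)) + dlt j k (eL i (P * Q * R))"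
  let ?t = "?X - ?Y"
  let ?n = "(2 + (if i = k then 1 else 0)) - (if i = j then 1 else 0) :: nat"
  have G: "?t \<in> G"
    using i j k by (simp add: G_diff G_br G_add G_zero eL_G fL_G del: atLeastLessThan_iff)
  have "br (hL i) ?t = S (of_nat ?n) * ?t"
  proof -
    have X: "br (hL i) ?X = br (br (br (hL i) (eL i P)) (fL j Q)) (eL k R) + br (br (eL i P) (br (hL i) (fL j Q))) (eL k R)
      + br (br (eL i P) (fL j Q)) (br (hL i) (eL k R))"
      by (simp only: br_jacobi[of "hL i" "br (eL i P) (fL j Q)"] br_jacobi[of "hL i" "eL i P"] br_simps)
    show ?thesis
      unfolding br_simps(4) X S_nat using hL_eL[OF i i] hL_eL[OF i j] hL_eL[OF i k] hL_fL[OF i j]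
      by (auto simp: br_simps numeral_2_eq_2)
  qed
  moreover have "\<exists>K. br (fL i (sh r K)) ?t = 0"
  proof -
    let ?e = "\<lambda>P. \<forall>\<^sub>F K in sequentially. P K"
    \<comment> \<open>All brackets that occur when \<open>f_i(x\<^bsup>rK\<^esup>)\<close> is moved into \<open>?t\<close>.\<close>
    note H = high_pair[OF i i, where P = 1 and Q = P] high_pair[OF i k, where P = 1 and Q = R]
      high_pair[OF i k, where P = 1 and Q = "P * Q * R"] high_pair[OF i i, where P = 1 and Q = "P * Q * R"]
      high_act_f[OF i i j, where P = P and Q = Q] high_act_f[OF i k j, where P = R and Q = Q]
      high_act_e[OF i k i, where P = R and Q = P]
      high_pair[OF j k, where P = "P * Q" and Q = R] high_pair[OF i k, where P = "P * Q" and Q = R]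
      high_pair[OF j i, where P = "R * Q" and Q = P] high_pair[OF i i, where P = "R * Q" and Q = P]
      high_pair'[OF j i, where P = Q and Q = "R * P"] high_pair'[OF j k, where P = Q and Q = "R * P"]
    have "\<forall>\<^sub>F K in sequentially. br (fL i (sh r K)) ?t = 0"
      using H
    proof eventually_elim
      case (elim K)
      note E = elim[unfolded mult_1_left mult_1_right]
      let ?x = "fL i (sh r K)"
      have J: "br ?x ?X = br (br (br ?x (eL i P)) (fL j Q)) (eL k R)
         - (br (br (br ?x (eL k R)) (eL i P)) (fL j Q) + br (eL i P) (br (br ?x (eL k R)) (fL j Q)))"
        using fL_fL[OF i j, of "sh r K" Q]
        by (simp only: br_jacobi[of ?x "br (eL i P) (fL j Q)"] br_jacobi[of ?x "eL i P" "fL j Q"]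
            br_swap[of "br (eL i P) (fL j Q)" "br ?x (eL k R)"] br_jacobi[of "br ?x (eL k R)" "eL i P" "fL j Q"] br_simps) simp
      show ?case
        unfolding br_simps(4) J using E
        by (simp add: br_simps br_swap[of "eL _ _" "fL _ _"] mult_ac cong: if_cong) (auto simp: br_simps mult_ac)
    qed
    then show ?thesis unfolding eventually_sequentially by blast
  qed
  ultimately have "?t = 0" using rigid_high[OF i G, of ?n] by auto
  then show ?thesis by simp
qed

theorem fef_laurent:
  assumes i: "i \<in> {1..<r}" and j: "j \<in> {1..<r}" and k: "k \<in> {1..<r}"
  shows "br (br (fL i P) (eL j Q)) (fL k R) = dlt i j (fL k (P * Q * R)) + dlt j k (fL i (P * Q * R))"
  using sl_currents.efe_laurent[OF mirror assms, of P Q R]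
  by (simp only: sl_currents.eL_def[OF mirror] sl_currents.fL_def[OF mirror] eL_def fL_def)

end

context sl_currents
begin

section \<open>The central term\<close>

lemma double_cancel:
  fixes x y :: 'a
  assumes *: "x + x = y + y" shows "x = y"
proof -
  have h: "S (1/2) * (x + x) = x" for x
    using S_add[of "1/2" "1/2"] S_one by (simp add: distrib_left flip: distrib_right)
  have "S (1/2) * (x + x) = S (1/2) * (y + y)" by (simp only: *)
  then show ?thesis unfolding h .
qed

lemma DL_eL:
  assumes "i \<in> {1..<r}" "j \<in> {1..<r}" "k \<in> {1..<r}"
  shows "br (DL i j P) (eL k R) = - (dlt i j (eL k (P * R)) + dlt i k (eL j (P * R)))"
  unfolding DL_def br_swap[of "fL i P"] br_simps(5)
  by (subst efe_laurent) (use assms in auto)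

lemma DL_fL:
  assumes "i \<in> {1..<r}" "j \<in> {1..<r}" "k \<in> {1..<r}"
  shows "br (DL i j P) (fL k R) = dlt i j (fL k (P * R)) + dlt j k (fL i (P * R))"
  unfolding DL_def by (subst fef_laurent) (use assms in auto)

lemma DL_add: "i \<in> {1..<r} \<Longrightarrow> DL i j (P + Q) = DL i j P + DL i j Q"
  by (simp only: DL_def fL_add br_simps)

lemma br_S_left: "y \<in> G \<Longrightarrow> br (S a * x) y = S a * br x y"
  by (simp add: br_def right_diff_distrib mult.assoc[symmetric] S_comm)

lemma br_S_right: "x \<in> G \<Longrightarrow> br x (S a * y) = S a * br x y"
  by (simp add: br_def right_diff_distrib mult.assoc[symmetric] S_comm)

lemma DL_scal: "i \<in> {1..<r} \<Longrightarrow> j \<in> {1..<r} \<Longrightarrow> DL i j (scal a P) = S a * DL i j P"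
  by (simp only: DL_def fL_scal br_S_left eL_G)

definition central :: "'a \<Rightarrow> bool" where
  "central z \<longleftrightarrow> (\<forall>k\<in>{1..<r}. \<forall>P. br z (eL k P) = 0 \<and> br z (fL k P) = 0)"

lemma centralD: "central z \<Longrightarrow> k \<in> {1..<r} \<Longrightarrow> br z (eL k P) = 0"
  "central z \<Longrightarrow> k \<in> {1..<r} \<Longrightarrow> br z (fL k P) = 0"
  by (simp_all add: central_def)

lemma central_br: "central z \<Longrightarrow> br z x = 0 \<Longrightarrow> br z y = 0 \<Longrightarrow> br z (br x y) = 0"
  by (simp add: br_jacobi[of z] br_simps)

text \<open>
  The deviation of \<open>[f_i(P), e_j(Q)]\<close> from its value in $sl_r \otimes A$.
\<close>

definition CL :: "nat \<Rightarrow> nat \<Rightarrow> laurent \<Rightarrow> laurent \<Rightarrow> 'a" where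
  "CL i j P Q = br (fL i P) (eL j Q) - DL i j (P * Q)"

lemma fL_eL: "br (fL i P) (eL j Q) = DL i j (P * Q) + CL i j P Q"
  by (simp add: CL_def)

lemma CL_one: "CL i j P 1 = 0"
  by (simp add: CL_def DL_def)

lemma CL_central: "i \<in> {1..<r} \<Longrightarrow> j \<in> {1..<r} \<Longrightarrow> central (CL i j P Q)"
  unfolding central_def
proof (intro ballI allI conjI)
  fix k R assume *: "i \<in> {1..<r}" "j \<in> {1..<r}" "k \<in> {1..<r}"
  show "br (CL i j P Q) (eL k R) = 0"
    unfolding CL_def br_simps(3) DL_eL[OF *] br_swap[of "fL i P"] br_simps(5) efe_laurent[OF *(2,1,3)]
    by (simp add: mult_ac)
  show "br (CL i j P Q) (fL k R) = 0"
    unfolding CL_def br_simps(3) DL_fL[OF *] fef_laurent[OF *] by simp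
qed

lemma central_DL: "central z \<Longrightarrow> i \<in> {1..<r} \<Longrightarrow> j \<in> {1..<r} \<Longrightarrow> br z (DL i j P) = 0"
  unfolding DL_def by (rule central_br) (simp_all only: centralD)

lemma DL_central: "central z \<Longrightarrow> i \<in> {1..<r} \<Longrightarrow> j \<in> {1..<r} \<Longrightarrow> br (DL i j P) z = 0"
  using central_DL[of z i j P] br_swap[of "DL i j P" z] by simp

text \<open>
  For \<open>i \<noteq> j\<close> it has nonzero weight for the \<open>i\<close>-th coroot, but central elements have weight 0.
\<close>

lemma CL_off_diagonal:
  assumes i: "i \<in> {1..<r}" and j: "j \<in> {1..<r}" and ij: "i \<noteq> j"
  shows "CL i j P Q = 0"
proof -
  have *: "br (DL i i 1) (br (fL i P) (eL j Q)) = br (fL i P) (eL j Q)" for P Q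
    using DL_fL[OF i i i, of 1 P] DL_eL[OF i i j, of 1 Q] ij
    by (simp add: br_jacobi[of "DL i i 1"] br_simps)
  then have "br (DL i i 1) (CL i j P Q) = CL i j P Q"
    unfolding CL_def br_simps(4) by (simp only: * DL_def[of i j])
  then show ?thesis using DL_central[OF CL_central[OF i j] i i] by metis
qed

text \<open>
  Compute \<open>[d_i(R), [f_i(P), e_i(Q)]]\<close> by the Jacobi identity, where \<open>d_i\<close> is \<open>DL i i\<close>. The left-hand side depends on the product \<open>PQ\<close>
  only, which yields \<open>CL_leibniz\<close>, and it is antisymmetric in \<open>R\<close> and \<open>PQ\<close>, which yields \<open>CL_antisym\<close>.
\<close>

lemma DL_diag_br:
  assumes i: "i \<in> {1..<r}"
  shows "br (DL i i R) (DL i i (P * Q)) = (CL i i (R * P) Q - CL i i P (R * Q)) + (CL i i (R * P) Q - CL i i P (R * Q))"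
proof -
  have "br (DL i i R) (DL i i (P * Q)) = br (DL i i R) (br (fL i P) (eL i Q))"
    unfolding fL_eL br_simps(2) DL_central[OF CL_central[OF i i] i i] by simp
  also have "\<dots> = (br (fL i (R * P)) (eL i Q) - br (fL i P) (eL i (R * Q))) + (br (fL i (R * P)) (eL i Q) - br (fL i P) (eL i (R * Q)))"
    unfolding br_jacobi[of "DL i i R"] DL_fL[OF i i i] DL_eL[OF i i i] by (simp add: br_simps)
  finally show ?thesis by (simp add: fL_eL mult_ac)
qed

lemma DL_diag_br_CL:
  assumes i: "i \<in> {1..<r}"
  shows "br (DL i i R) (DL i i P) = - CL i i P R + - CL i i P R"
  using DL_diag_br[OF i, of R P 1] by (simp add: CL_one)

lemma CL_leibniz:
  assumes i: "i \<in> {1..<r}"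
  shows "CL i i P (R * Q) = CL i i (R * P) Q + CL i i (P * Q) R"
proof -
  have "CL i i (R * P) Q - CL i i P (R * Q) = - CL i i (P * Q) R"
    by (rule double_cancel) (simp only: DL_diag_br[OF i, symmetric] DL_diag_br_CL[OF i])
  then show ?thesis by (simp add: algebra_simps)
qed

lemma CL_antisym:
  assumes i: "i \<in> {1..<r}"
  shows "CL i i P R = - CL i i R P"
proof (rule double_cancel)
  have "- (- CL i i P R + - CL i i P R) = - CL i i R P + - CL i i R P"
    unfolding DL_diag_br_CL[OF i, symmetric] by (rule br_swap[symmetric])
  then show "CL i i P R + CL i i P R = - CL i i R P + - CL i i R P" by simp
qed

text \<open>
  Bracket the off-diagonal relation \<open>[f_i(P), e_j(Q)] = [f_i(PQ), e_j(1)]\<close> with \<open>DL j i 1\<close>.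
\<close>

lemma CL_independent:
  assumes i: "i \<in> {1..<r}" and j: "j \<in> {1..<r}"
  shows "CL j j P Q = CL i i P Q"
proof (cases "i = j")
  case False
  have *: "br (DL j i 1) (br (fL i P) (eL j Q)) = DL j j (P * Q) + CL j j P Q - (DL i i (P * Q) + CL i i P Q)" for P Q
    unfolding br_jacobi[of "DL j i 1"] DL_fL[OF j i i] DL_eL[OF j i j] using False by (simp add: br_simps fL_eL)
  have "br (fL i P) (eL j Q) = br (fL i (P * Q)) (eL j 1)"
    using CL_off_diagonal[OF i j False] by (simp add: fL_eL)
  then have "DL j j (P * Q) + CL j j P Q - (DL i i (P * Q) + CL i i P Q)
    = DL j j (P * Q * 1) + CL j j (P * Q) 1 - (DL i i (P * Q * 1) + CL i i (P * Q) 1)"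
    by (simp only: *[symmetric])
  then show ?thesis by (simp add: CL_one algebra_simps)
qed simp

definition cc :: "laurent \<Rightarrow> laurent \<Rightarrow> 'a" where "cc = CL 1 1"

lemma one_I: "(1 :: nat) \<in> {1..<r}" using r2 by simp

lemma fL_eL_cc:
  assumes "i \<in> {1..<r}" "j \<in> {1..<r}"
  shows "br (fL i P) (eL j Q) = DL i j (P * Q) + dlt i j (cc P Q)"
  using CL_off_diagonal[OF assms] CL_independent[OF one_I assms(1)] by (auto simp: fL_eL cc_def)

lemma cc_one: "cc P 1 = 0" by (simp add: cc_def CL_one)
lemma cc_antisym: "cc P Q = - cc Q P" unfolding cc_def by (rule CL_antisym[OF one_I])
lemma cc_leibniz: "cc P (R * Q) = cc (R * P) Q + cc (P * Q) R" unfolding cc_def by (rule CL_leibniz[OF one_I])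
lemma cc_central: "central (cc P Q)" unfolding cc_def by (rule CL_central[OF one_I one_I])

lemma cc_add: "cc (P + Q) R = cc P R + cc Q R" "cc R (P + Q) = cc R P + cc R Q"
  by (simp_all only: cc_def CL_def fL_add[OF one_I] eL_add[OF one_I] DL_add[OF one_I] distrib_left distrib_right br_simps)
    (simp_all add: algebra_simps)

lemma cc_scal: "cc (scal a P) Q = S a * cc P Q" "cc P (scal a Q) = S a * cc P Q"
  by (simp_all only: cc_def CL_def fL_scal[OF one_I] eL_scal[OF one_I] scal_mult_left scal_mult_right DL_scal[OF one_I one_I]
     br_S_left[OF eL_G[OF one_I]] br_S_right[OF fL_G[OF one_I]] right_diff_distrib)

lemma cc_G: "cc P Q \<in> G"
  unfolding cc_def CL_def DL_def by (intro G_diff G_br fL_G eL_G one_I)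

lemma cc_zero: "cc 0 R = 0" "cc R 0 = 0"
  using cc_add(1)[of 0 0 R] cc_add(2)[of R 0 0] by simp_all

lemma DL_DL:
  assumes i: "i \<in> {1..<r}" and j: "j \<in> {1..<r}" and k: "k \<in> {1..<r}" and l: "l \<in> {1..<r}"
  shows "br (DL i j P) (DL k l Q) = dlt j k (DL i l (P * Q)) - dlt i l (DL k j (P * Q))
    + (dlt i j (dlt k l (cc P Q)) + dlt i l (dlt j k (cc P Q)))"
proof -
  have "br (DL i j P) (DL k l Q) = br (br (DL i j P) (fL k Q)) (eL l 1) + br (fL k Q) (br (DL i j P) (eL l 1))"
    unfolding DL_def[of k l] by (rule br_jacobi)
  also have "\<dots> = dlt i j (br (fL k (P * Q)) (eL l 1)) + dlt j k (br (fL i (P * Q)) (eL l 1))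
     - (dlt i j (br (fL k Q) (eL l P)) + dlt i l (br (fL k Q) (eL j P)))"
    unfolding DL_fL[OF i j k] DL_eL[OF i j l] by (simp add: br_simps)
  also have "\<dots> = dlt j k (DL i l (P * Q)) - dlt i l (DL k j (P * Q))
    - (dlt i j (dlt k l (cc Q P)) + dlt i l (dlt k j (cc Q P)))"
    by (simp add: fL_eL_cc i j k l cc_one mult.commute[of Q P] del: atLeastLessThan_iff One_nat_def)
  finally show ?thesis by (simp add: cc_antisym[of Q P])
qed

text \<open>
  The operator for $E_{ab} \otimes P - \delta_{ab} E_{00} \otimes P$, which is the unit matrix modified to have trace 0. Thus all positions \<open>(a, b)\<close> can be
  treated alike.
\<close>

definition gg :: "nat \<Rightarrow> nat \<Rightarrow> laurent \<Rightarrow> 'a" where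
  "gg a b P = (if a = 0 then (if b = 0 then 0 else eL b P) else if b = 0 then fL a P else DL a b P)"

lemma eL_fL:
  assumes "i \<in> {1..<r}" "j \<in> {1..<r}"
  shows "br (eL i P) (fL j Q) = - DL j i (P * Q) + dlt i j (cc P Q)"
  using fL_eL_cc[OF assms(2,1), of Q P] br_swap[of "eL i P" "fL j Q"] cc_antisym[of Q P]
  by (simp add: mult.commute)

lemma eL_DL:
  assumes "i \<in> {1..<r}" "j \<in> {1..<r}" "k \<in> {1..<r}"
  shows "br (eL k R) (DL i j P) = dlt i j (eL k (R * P)) + dlt i k (eL j (R * P))"
  using DL_eL[OF assms, of P R] br_swap[of "eL k R" "DL i j P"] by (simp add: mult.commute)

lemma fL_DL:
  assumes "i \<in> {1..<r}" "j \<in> {1..<r}" "k \<in> {1..<r}"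
  shows "br (fL k R) (DL i j P) = - (dlt i j (fL k (R * P)) + dlt j k (fL i (R * P)))"
  using DL_fL[OF assms, of P R] br_swap[of "fL k R" "DL i j P"] by (simp add: mult.commute)

text \<open>
  The terms with \<open>a = b\<close> or \<open>c = d\<close>, which come from the modification of the units, are arranged such that each depends on
  one of the two diagonal positions only through its argument; such terms cancel in the sum over a traceless matrix.
\<close>

lemma gg_br:
  assumes "a < r" "b < r" "c < r" "d < r"
  shows "br (gg a b P) (gg c d Q) = dlt b c (gg a d (P * Q)) - dlt d a (gg c b (P * Q))
    - dlt c d (dlt b 0 (gg a 0 (P * Q)) - dlt 0 a (gg 0 b (P * Q)))
    - dlt a b (dlt 0 c (gg 0 d (P * Q)) - dlt d 0 (gg c 0 (P * Q)))
    + (dlt b c (dlt a d (cc P Q)) + dlt a b (dlt c d (cc P Q - dlt a 0 (cc P Q) - dlt c 0 (cc P Q))))"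
proof -
  have I: "x \<in> {1..<r}" if "x < r" "x \<noteq> 0" for x using that by simp
  show ?thesis
    by (cases "a = 0"; cases "b = 0"; cases "c = 0"; cases "d = 0")
      (use assms in \<open>simp_all add: gg_def br_simps eL_eL fL_fL fL_eL_cc eL_fL DL_eL DL_fL eL_DL fL_DL DL_DL I del: atLeastLessThan_iff One_nat_def cong: if_cong\<close>)
qed

end

section \<open>The action of sl_r(A) and its cocycle\<close>

lemma sum_dlt: "j < n \<Longrightarrow> (\<Sum>i<n. dlt i j (g i)) = g j" "j < n \<Longrightarrow> (\<Sum>i<n. dlt j i (g i)) = (g j :: 'a::comm_monoid_add)"
  for n :: nat
  by simp_all

lemma sum_if_const: "(\<Sum>i\<in>A. if P then g i else 0) = (if P then \<Sum>i\<in>A. g i else 0)"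
  by simp

lemma additive_sum:
  fixes h :: "'b::ab_group_add \<Rightarrow> 'a::ab_group_add"
  assumes "\<And>u v. h (u + v) = h u + h v"
  shows "h (sum g A) = (\<Sum>a\<in>A. h (g a))"
proof -
  have "h 0 = 0" using assms[of 0 0] by simp
  then show ?thesis by (induction A rule: infinite_finite_induct) (simp_all add: assms)
qed

lemma traceless_sum:
  fixes h :: "laurent \<Rightarrow> 'a::ab_group_add"
  assumes "\<And>u v. h (u + v) = h u + h v" and Y: "Y \<in> sl_over r UNIV"
  shows "(\<Sum>c<r. \<Sum>d<r. dlt c d (h (Y $$ (c, d)))) = 0"
proof -
  have "(\<Sum>c<r. \<Sum>d<r. dlt c d (h (Y $$ (c, d)))) = (\<Sum>c<r. h (Y $$ (c, c)))"
    by (intro sum.cong refl sum_dlt(2)) simp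
  also have "\<dots> = h (\<Sum>c<r. Y $$ (c, c))" by (rule additive_sum[symmetric, OF assms(1)])
  also have "\<dots> = 0" using Y assms(1)[of 0 0] by (auto simp: sl_over_def mat_trace_def)
  finally show ?thesis .
qed

context sl_currents
begin

lemma gg_add:
  assumes "a < r" "b < r" shows "gg a b (P + Q) = gg a b P + gg a b Q"
  using assms by (simp add: gg_def eL_add fL_add DL_add)

lemma gg_scal:
  assumes "a < r" "b < r" shows "gg a b (scal u P) = S u * gg a b P"
  using assms by (simp add: gg_def eL_scal fL_scal DL_scal)

lemma gg_sum: "a < r \<Longrightarrow> b < r \<Longrightarrow> gg a b (sum g A) = (\<Sum>k\<in>A. gg a b (g k))"
  by (rule additive_sum[of "gg a b"]) (rule gg_add)

lemma gg_diff: "a < r \<Longrightarrow> b < r \<Longrightarrow> gg a b (P - Q) = gg a b P - gg a b Q"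
  using gg_add[of a b "P - Q" Q] by simp

definition rho :: "laurent mat \<Rightarrow> 'a" where
  "rho X = (\<Sum>a<r. \<Sum>b<r. gg a b (X $$ (a, b)))"

text \<open>
  Expand by \<open>gg_br\<close>: the first two sums are the matrix products, the fifth is the cocycle, and the others vanish because \<open>X\<close> and \<open>Y\<close> have trace 0.
\<close>

lemma rho_br:
  assumes X: "X \<in> sl_over r UNIV" and Y: "Y \<in> sl_over r UNIV"
  shows "br (rho X) (rho Y) = rho (mat_bracket X Y) + (\<Sum>a<r. \<Sum>b<r. cc (X $$ (a, b)) (Y $$ (b, a)))"
proof -
  let ?x = "\<lambda>a b. X $$ (a, b)" and ?y = "\<lambda>c d. Y $$ (c, d)"
  let ?S = "\<lambda>F :: nat \<Rightarrow> nat \<Rightarrow> nat \<Rightarrow> nat \<Rightarrow> 'a. \<Sum>a<r. \<Sum>b<r. \<Sum>c<r. \<Sum>d<r. F a b c d"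
  let ?T = "\<lambda>a b c d. cc (?x a b) (?y c d)"
  have XY: "X \<in> carrier_mat r r" "Y \<in> carrier_mat r r" using X Y by (auto simp: sl_over_def)
  have dr: "dlt i j (u + v) = dlt i j u + dlt i j v" "dlt i j (u - v) = dlt i j u - dlt i j v" for i j and u v :: 'a
    by simp_all
  have r0: "0 < r" using r2 by simp
  have "br (rho X) (rho Y) = ?S (\<lambda>a b c d. br (gg a b (?x a b)) (gg c d (?y c d)))"
    unfolding rho_def[of X] br_sum_left by (simp only: rho_def br_sum_right)
  also have "\<dots> = ?S (\<lambda>a b c d. dlt b c (gg a d (?x a b * ?y c d)) - dlt d a (gg c b (?x a b * ?y c d))
    - dlt c d (dlt b 0 (gg a 0 (?x a b * ?y c d)) - dlt 0 a (gg 0 b (?x a b * ?y c d)))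
    - dlt a b (dlt 0 c (gg 0 d (?x a b * ?y c d)) - dlt d 0 (gg c 0 (?x a b * ?y c d)))
    + (dlt b c (dlt a d (?T a b c d)) + dlt a b (dlt c d (?T a b c d - dlt a 0 (?T a b c d) - dlt c 0 (?T a b c d)))))"
    by (intro sum.cong refl gg_br) auto
  also have "\<dots> = ?S (\<lambda>a b c d. dlt b c (gg a d (?x a b * ?y c d))) - ?S (\<lambda>a b c d. dlt d a (gg c b (?x a b * ?y c d)))
    - ?S (\<lambda>a b c d. dlt c d (dlt b 0 (gg a 0 (?x a b * ?y c d)) - dlt 0 a (gg 0 b (?x a b * ?y c d))))
    - ?S (\<lambda>a b c d. dlt a b (dlt 0 c (gg 0 d (?x a b * ?y c d)) - dlt d 0 (gg c 0 (?x a b * ?y c d))))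
    + (?S (\<lambda>a b c d. dlt b c (dlt a d (?T a b c d)))
      + (?S (\<lambda>a b c d. dlt a b (dlt c d (?T a b c d - dlt a 0 (?T a b c d)))) - ?S (\<lambda>a b c d. dlt a b (dlt c d (dlt c 0 (?T a b c d))))))"
    (is "_ = ?s1 - ?s2 - ?s3 - ?s4 + (?s5 + (?s6 - ?s7))")
    by (simp only: sum.distrib sum_subtractf dr)
  also have "?s1 = (\<Sum>a<r. \<Sum>d<r. gg a d (\<Sum>b<r. ?x a b * ?y b d))"
  proof -
    have "?s1 = (\<Sum>a<r. \<Sum>b<r. \<Sum>d<r. gg a d (?x a b * ?y b d))"
      by (rule sum.cong[OF refl], rule sum.cong[OF refl]) (simp add: sum_if_const)
    also have "\<dots> = (\<Sum>a<r. \<Sum>d<r. \<Sum>b<r. gg a d (?x a b * ?y b d))"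
      by (intro sum.cong refl sum.swap)
    also have "\<dots> = (\<Sum>a<r. \<Sum>d<r. gg a d (\<Sum>b<r. ?x a b * ?y b d))"
      by (intro sum.cong refl gg_sum[symmetric]) auto
    finally show ?thesis .
  qed
  also have "?s2 = (\<Sum>c<r. \<Sum>b<r. gg c b (\<Sum>a<r. ?y c a * ?x a b))"
  proof -
    have "?s2 = (\<Sum>a<r. \<Sum>b<r. \<Sum>c<r. gg c b (?y c a * ?x a b))"
      by (rule sum.cong[OF refl], rule sum.cong[OF refl]) (simp add: mult.commute)
    also have "\<dots> = (\<Sum>b<r. \<Sum>a<r. \<Sum>c<r. gg c b (?y c a * ?x a b))" by (rule sum.swap)
    also have "\<dots> = (\<Sum>b<r. \<Sum>c<r. \<Sum>a<r. gg c b (?y c a * ?x a b))" by (intro sum.cong refl sum.swap)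
    also have "\<dots> = (\<Sum>c<r. \<Sum>b<r. \<Sum>a<r. gg c b (?y c a * ?x a b))" by (rule sum.swap)
    also have "\<dots> = (\<Sum>c<r. \<Sum>b<r. gg c b (\<Sum>a<r. ?y c a * ?x a b))"
      by (intro sum.cong refl gg_sum[symmetric]) auto
    finally show ?thesis .
  qed
  also have "?s3 = 0"
    by (intro sum.neutral ballI traceless_sum[OF _ Y]) (use r0 in \<open>simp add: distrib_left gg_add\<close>)
  also have "?s4 = 0"
  proof -
    have "?s4 = (\<Sum>a<r. \<Sum>b<r. dlt a b (\<Sum>c<r. \<Sum>d<r. dlt 0 c (gg 0 d (?x a b * ?y c d)) - dlt d 0 (gg c 0 (?x a b * ?y c d))))"
      by (simp only: sum_if_const)
    also have "\<dots> = 0"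
    proof (rule traceless_sum[OF _ X, of "\<lambda>u. \<Sum>c<r. \<Sum>d<r. dlt 0 c (gg 0 d (u * ?y c d)) - dlt d 0 (gg c 0 (u * ?y c d))"])
      fix u v
      show "(\<Sum>c<r. \<Sum>d<r. dlt 0 c (gg 0 d ((u + v) * ?y c d)) - dlt d 0 (gg c 0 ((u + v) * ?y c d)))
        = (\<Sum>c<r. \<Sum>d<r. dlt 0 c (gg 0 d (u * ?y c d)) - dlt d 0 (gg c 0 (u * ?y c d)))
        + (\<Sum>c<r. \<Sum>d<r. dlt 0 c (gg 0 d (v * ?y c d)) - dlt d 0 (gg c 0 (v * ?y c d)))"
        unfolding sum.distrib[symmetric] using r0 by (intro sum.cong refl) (simp add: distrib_right gg_add)
    qed
    finally show ?thesis .
  qed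
  also have "?s5 = (\<Sum>a<r. \<Sum>b<r. cc (?x a b) (?y b a))"
    by (rule sum.cong[OF refl], rule sum.cong[OF refl]) (simp add: sum_if_const)
  also have "?s6 = 0"
  proof -
    have "?s6 = ?S (\<lambda>a b c d. dlt c d (dlt a b (?T a b c d - dlt a 0 (?T a b c d))))"
      by (intro sum.cong refl) simp
    also have "\<dots> = 0"
      by (intro sum.neutral ballI traceless_sum[OF _ Y]) (simp add: cc_add)
    finally show ?thesis .
  qed
  also have "?s7 = 0"
  proof -
    have "?s7 = (\<Sum>a<r. \<Sum>b<r. dlt a b (\<Sum>c<r. \<Sum>d<r. dlt c d (dlt c 0 (?T a b c d))))"
      by (simp only: sum_if_const)
    also have "\<dots> = 0"
    proof (rule traceless_sum[OF _ X, of "\<lambda>u. \<Sum>c<r. \<Sum>d<r. dlt c d (dlt c 0 (cc u (?y c d)))"])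
      fix u v
      show "(\<Sum>c<r. \<Sum>d<r. dlt c d (dlt c 0 (cc (u + v) (?y c d))))
        = (\<Sum>c<r. \<Sum>d<r. dlt c d (dlt c 0 (cc u (?y c d)))) + (\<Sum>c<r. \<Sum>d<r. dlt c d (dlt c 0 (cc v (?y c d))))"
        unfolding sum.distrib[symmetric] by (intro sum.cong refl) (simp add: cc_add)
    qed
    finally show ?thesis .
  qed
  also have "(\<Sum>a<r. \<Sum>d<r. gg a d (\<Sum>b<r. ?x a b * ?y b d)) - (\<Sum>c<r. \<Sum>b<r. gg c b (\<Sum>a<r. ?y c a * ?x a b)) = rho (mat_bracket X Y)"
    unfolding rho_def sum_subtractf[symmetric]
    by (intro sum.cong refl) (simp add: mat_bracket_index[OF XY] gg_diff)
  finally show ?thesis by simp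
qed

end

lemma ddx_single: "ddx (Poly_Mapping.single (i, j) a) = Poly_Mapping.single (i - 1, j) (of_int i * a)"
  by (rule poly_mapping_eqI) (auto simp: ddx.rep_eq lookup_single when_def)

lemma ddy_single: "ddy (Poly_Mapping.single (i, j) a) = Poly_Mapping.single (i, j - 1) (of_nat j * a)"
  by (rule poly_mapping_eqI) (auto simp: ddy.rep_eq lookup_single when_def split: prod.splits)

lemma ddx_mult: "ddx (P * Q) = ddx P * Q + P * ddx Q"
proof (induction P rule: poly_mapping_linear_induct)
  case (single p a)
  obtain i j where p: "p = (i, j)" by fastforce
  show ?case
  proof (induction Q rule: poly_mapping_linear_induct)
    case (single q b)
    obtain k l where q: "q = (k, l)" by fastforce
    show ?case
      by (simp add: p q mult_single ddx_single algebra_simps flip: single_add)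
  next
    case (add P' Q')
    then show ?case by (simp add: distrib_left ddx_add)
  qed
next
  case (add P' Q')
  then show ?case by (simp add: distrib_right ddx_add)
qed

lemma ddy_mult: "ddy (P * Q) = ddy P * Q + P * ddy Q"
proof (induction P rule: poly_mapping_linear_induct)
  case (single p a)
  obtain i j where p: "p = (i, j)" by fastforce
  show ?case
  proof (induction Q rule: poly_mapping_linear_induct)
    case (single q b)
    obtain k l where q: "q = (k, l)" by fastforce
    show ?case
      by (cases j; cases l) (simp_all add: p q mult_single ddy_single algebra_simps flip: single_add)
  next
    case (add P' Q')
    then show ?case by (simp add: distrib_left ddy_add)
  qed
next
  case (add P' Q')
  then show ?case by (simp add: distrib_right ddy_add)
qed

definition ymon :: laurent where "ymon = Poly_Mapping.single (0, 1) 1"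

lemma if_conj_nested: "(if P \<and> Q then x else y) = (if P then if Q then x else y else y)"
  by simp

lemma ymon_power: "ymon ^ j = Poly_Mapping.single (0, j) 1"
  by (induction j) (simp_all add: mult_single ymon_def flip: zero_prod_def)

lemma single_eq_monomial: "Poly_Mapping.single (i, j) a = scal a (xpow i * ymon ^ j)"
  by (simp add: ymon_power xpow_def mult_single scal_single)

text \<open>
  The Killing form is \<open>2r\<close> times the trace form on traceless matrices; the second term vanishes there.
\<close>

lemma killing_elem:
  assumes ijkl: "i < r" "j < r" "k < r" "l < r"
  shows "killing r (elem_mat r i j) (elem_mat r k l)
    = (if j = k \<and> i = l then 2 * of_nat r else 0) - (if i = j \<and> k = l then 2 else 0)"
proof -
  let ?E = "elem_mat r"
  have c: "?E a b \<in> carrier_mat r r" for a b by (simp add: elem_mat_def)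
  have E: "?E a b $$ (p, q) = (if p = a \<and> q = b then 1 else 0)" if "p < r" "q < r" for a b p q
    using that by (auto simp: elem_mat_def)
  have br: "mat_bracket (?E a b) M $$ (p, q) = dlt p a (M $$ (b, q)) - dlt q b (M $$ (p, a))"
    if "M \<in> carrier_mat r r" "a < r" "b < r" "p < r" "q < r" for a b p q M
  proof -
    have "(\<Sum>s<r. ?E a b $$ (p, s) * M $$ (s, q)) = (\<Sum>s<r. dlt s b (dlt p a (M $$ (s, q))))"
      using that by (intro sum.cong refl) (auto simp: E)
    moreover have "(\<Sum>s<r. M $$ (p, s) * ?E a b $$ (s, q)) = (\<Sum>s<r. dlt s a (dlt q b (M $$ (p, s))))"
      using that by (intro sum.cong refl) (auto simp: E)
    ultimately show ?thesis using that by (simp add: mat_bracket_index[OF c that(1)])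
  qed
  have "killing r (?E i j) (?E k l) = (\<Sum>p<r. \<Sum>q<r. dlt p i (dlt j k (dlt l p 1) - dlt l q (dlt j p (dlt q k 1)))
      - dlt q j (dlt p k (dlt l p (dlt i q 1)) - dlt l i (dlt q k 1)))"
    unfolding killing_def
  proof (rule sum.cong[OF refl], rule sum.cong[OF refl])
    fix p q assume pq: "p \<in> {..<r}" "q \<in> {..<r}"
    show "mat_bracket (?E i j) (mat_bracket (?E k l) (?E p q)) $$ (p, q)
      = dlt p i (dlt j k (dlt l p 1) - dlt l q (dlt j p (dlt q k 1))) - dlt q j (dlt p k (dlt l p (dlt i q 1)) - dlt l i (dlt q k 1))"
      using pq ijkl by (simp add: br c E cong: if_cong)
  qed
  also have "\<dots> = (\<Sum>p<r. \<Sum>q<r. dlt p i (dlt j k (dlt l i 1)) - dlt p i (dlt q l (dlt j i (dlt l k 1)))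
      - dlt q j (dlt p k (dlt l k (dlt i j 1))) + dlt q j (dlt l i (dlt j k (1 :: complex))))"
  proof (rule sum.cong[OF refl], rule sum.cong[OF refl])
    fix p q
    have 1: "dlt p i (dlt j k (dlt l p 1)) = dlt p i (dlt j k (dlt l i (1 :: complex)))" by simp
    have 2: "dlt p i (dlt l q (dlt j p (dlt q k 1))) = dlt p i (dlt q l (dlt j i (dlt l k (1 :: complex))))" by simp
    have 3: "dlt q j (dlt p k (dlt l p (dlt i q 1))) = dlt q j (dlt p k (dlt l k (dlt i j (1 :: complex))))" by simp
    have d: "dlt u v (y - z) = dlt u v y - dlt u v z" for u v and y z :: complex by simp
    show "dlt p i (dlt j k (dlt l p 1) - dlt l q (dlt j p (dlt q k 1))) - dlt q j (dlt p k (dlt l p (dlt i q 1)) - dlt l i (dlt q k 1))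
      = dlt p i (dlt j k (dlt l i 1)) - dlt p i (dlt q l (dlt j i (dlt l k 1)))
        - dlt q j (dlt p k (dlt l k (dlt i j 1))) + dlt q j (dlt l i (dlt j k (1 :: complex)))"
      unfolding d 1 2 3 by simp
  qed
  also have "\<dots> = (\<Sum>p<r. \<Sum>q<r. dlt p i (dlt j k (dlt l i 1))) - (\<Sum>p<r. \<Sum>q<r. dlt p i (dlt q l (dlt j i (dlt l k 1))))
      - (\<Sum>p<r. \<Sum>q<r. dlt q j (dlt p k (dlt l k (dlt i j 1)))) + (\<Sum>p<r. \<Sum>q<r. dlt q j (dlt l i (dlt j k 1)))"
    by (simp only: sum.distrib sum_subtractf)
  also have "\<dots> = (if j = k \<and> i = l then 2 * of_nat r else 0) - (if i = j \<and> k = l then 2 else 0)"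
  proof -
    have 1: "(\<Sum>p<r. \<Sum>q<r. dlt p i C) = of_nat r * C" for C :: complex
      unfolding sum_if_const using ijkl by (simp del: sum_constant) simp
    have 2: "(\<Sum>p<r. \<Sum>q<r. dlt p i (dlt q l C)) = C" for C :: complex
      using ijkl by (simp add: sum_if_const)
    have 3: "(\<Sum>p<r. \<Sum>q<r. dlt q j (dlt p k C)) = C" for C :: complex
      using ijkl by simp
    have 4: "(\<Sum>p<r. \<Sum>q<r. dlt q j C) = of_nat r * C" for C :: complex
      using ijkl by simp
    show ?thesis unfolding 1 2 3 4 by (cases "i = j"; cases "j = k"; cases "l = i") simp_all
  qed
  finally show ?thesis .
qed

context sl_currents
begin

text \<open>
  \<open>Q \<mapsto> (P \<mapsto> c(P, Q))\<close> is a derivation, hence determined by its values at the coordinates. The set of \<open>Q\<close> for which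
  the formula holds is closed under sums and products; it contains the inverse of \<open>x\<close> because \<open>c(P, 1) = 0\<close>.
\<close>

lemma cc_derivation: "cc P Q = cc (P * ddx Q) (xpow 1) + cc (P * ddy Q) ymon"
proof -
  define K where "K Q \<longleftrightarrow> (\<forall>P. cc P Q = cc (P * ddx Q) (xpow 1) + cc (P * ddy Q) ymon)" for Q
  have Kadd: "K (Q + R)" if "K Q" "K R" for Q R
    using that by (simp add: K_def ddx_add ddy_add distrib_left cc_add algebra_simps)
  have Kscal: "K (scal a Q)" if "K Q" for a Q
    using that by (simp add: K_def ddx_const_mult ddy_const_mult scal_mult_right cc_scal distrib_left const_mult_eq_scal[symmetric])
      (simp add: const_mult_eq_scal scal_mult_right cc_scal distrib_left)
  have Kmult: "K (Q * R)" if Q: "K Q" and R: "K R" for Q R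
    unfolding K_def
  proof
    fix P
    have "cc P (Q * R) = cc (Q * P) R + cc (P * R) Q" by (rule cc_leibniz)
    also have "\<dots> = cc (Q * P * ddx R) (xpow 1) + cc (Q * P * ddy R) ymon + (cc (P * R * ddx Q) (xpow 1) + cc (P * R * ddy Q) ymon)"
      using Q R unfolding K_def by metis
    also have "\<dots> = cc (P * ddx (Q * R)) (xpow 1) + cc (P * ddy (Q * R)) ymon"
      by (simp add: ddx_mult ddy_mult distrib_left cc_add mult_ac add_ac)
    finally show "cc P (Q * R) = cc (P * ddx (Q * R)) (xpow 1) + cc (P * ddy (Q * R)) ymon" .
  qed
  have K1: "K 1"
    using ddx_single[of 0 0 1] ddy_single[of 0 0 1] by (simp add: K_def cc_one cc_zero flip: zero_prod_def)
  have Kx: "K (xpow 1)"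
    using ddx_single[of 1 0 1] ddy_single[of 1 0 1] by (simp add: K_def cc_zero xpow_def flip: zero_prod_def)
  have Ky: "K ymon"
    using ddx_single[of 0 1 1] ddy_single[of 0 1 1] by (simp add: K_def cc_zero ymon_def flip: zero_prod_def)
  have Kxi: "K (xpow (- 1))"
    unfolding K_def
  proof
    fix P
    have "0 = cc (xpow (-1) * P) (xpow 1 * xpow (-1))" by (simp add: xpow_add cc_one)
    also have "\<dots> = cc P (xpow (-1)) + cc (P * xpow (-2)) (xpow 1)"
      unfolding cc_leibniz by (simp add: xpow_xpow mult_ac) (simp add: xpow_xpow mult.commute[of P] mult.assoc xpow_add)
    finally have 1: "cc P (xpow (-1)) = - cc (P * xpow (-2)) (xpow 1)" by (simp add: eq_neg_iff_add_eq_0)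
    have "ddx (xpow (-1)) = - xpow (-2)"
      using ddx_single[of "-1" 0 1] by (simp add: xpow_def single_uminus)
    moreover have "ddy (xpow (-1)) = 0" using ddy_single[of "-1" 0 1] by (simp add: xpow_def)
    moreover have "cc (- (P * xpow (-2))) (xpow 1) = - cc (P * xpow (-2)) (xpow 1)"
      using cc_add(1)[of "P * xpow (-2)" "- (P * xpow (-2))" "xpow 1"] by (simp add: cc_zero eq_neg_iff_add_eq_0 add.commute)
    ultimately show "cc P (xpow (-1)) = cc (P * ddx (xpow (-1))) (xpow 1) + cc (P * ddy (xpow (-1))) ymon"
      using 1 by (simp add: cc_zero)
  qed
  have Kxn: "K (xpow (int k))" "K (xpow (- int k))" for k
  proof (induction k)
    case (Suc k)
    {
      case 1
      then show ?case using Kmult[OF Kx Suc(1)] by (simp add: xpow_add)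
    next
      case 2
      then show ?case using Kmult[OF Kxi Suc(2)] by (simp add: xpow_add)
    }
  qed (simp_all add: K1)
  have Kxk: "K (xpow i)" for i
    using Kxn[of "nat \<bar>i\<bar>"] by (cases "0 \<le> i") simp_all
  have Kyj: "K (ymon ^ j)" for j
    by (induction j) (simp_all only: power_0 K1 power_Suc Kmult[OF Ky])
  have "K Q"
  proof (induction Q rule: poly_mapping_linear_induct)
    case (single p a)
    obtain i j where "p = (i, j)" by fastforce
    then show ?case using Kscal[OF Kmult[OF Kxk Kyj], of a i j] by (simp only: single_eq_monomial)
  qed (rule Kadd)
  then show ?thesis by (simp add: K_def)
qed

text \<open>
  The operator of the central element \<open>P dQ\<close> is \<open>c(Q, P) / (2r)\<close>. The formula uses that \<open>c\<close> is determined by its values at the coordinates,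
  and the factor accounts for the Killing form.
\<close>

definition Zf :: "form \<Rightarrow> 'a" where
  "Zf w = S (1 / (2 * of_nat r)) * (cc (xpow 1) (fst w) + cc ymon (snd w))"

lemma Zf_add: "Zf (u + v) = Zf u + Zf v"
  by (simp add: Zf_def cc_add distrib_left add_ac)

lemma S_S: "S a * (S b * x) = S (a * b) * x"
  by (simp add: S_mult mult.assoc)

lemma Zf_scale: "Zf (form_mult (const a) w) = S a * Zf w"
  by (simp add: Zf_def form_mult_def const_mult_eq_scal cc_scal distrib_left S_S mult.commute)

lemma Zf_mult_d: "Zf (form_mult (const a * Q) (form_d P)) = S (a / (2 * of_nat r)) * cc P Q"
proof -
  have "cc (xpow 1) (const a * Q * ddx P) + cc ymon (const a * Q * ddy P)
    = S a * (cc (xpow 1) (Q * ddx P) + cc ymon (Q * ddy P))"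
    by (simp add: const_mult_eq_scal scal_mult_left cc_scal distrib_left)
  also have "cc (xpow 1) (Q * ddx P) + cc ymon (Q * ddy P) = - cc Q P"
    unfolding cc_derivation[of Q P] by (simp add: cc_antisym[of "xpow 1"] cc_antisym[of ymon])
  also have "- cc Q P = cc P Q" by (rule cc_antisym[symmetric])
  finally show ?thesis by (simp add: Zf_def form_mult_def form_d_def S_S)
qed

lemma Zf_d: "Zf (form_d P) = 0"
  using Zf_mult_d[of 1 1 P] by (simp add: form_mult_def const_one cc_one)

definition ZZ :: "forms_mod_exact \<Rightarrow> 'a" where "ZZ \<alpha> = Zf (rep_form \<alpha>)"

lemma ZZ_proj: "ZZ (form_proj w) = Zf w"
proof -
  have "form_proj (rep_form (form_proj w)) = form_proj w"
    using Quotient_forms_mod_exact by (rule Quotient_abs_rep)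
  then obtain P where "rep_form (form_proj w) - w = form_d P"
    using forms_mod_exact.abs_eq_iff by auto
  then have "rep_form (form_proj w) = form_d P + w" by (simp add: algebra_simps)
  then show ?thesis by (simp add: ZZ_def Zf_add Zf_d)
qed

lemma form_projE: obtains w where "\<alpha> = form_proj w"
  using Quotient_abs_rep[OF Quotient_forms_mod_exact, of \<alpha>] by metis

lemma ZZ_add: "ZZ (fme_add \<alpha> \<beta>) = ZZ \<alpha> + ZZ \<beta>"
  by (rule form_projE[of \<alpha>], rule form_projE[of \<beta>]) (simp add: fme_add.abs_eq ZZ_proj Zf_add)

lemma ZZ_scale: "ZZ (fme_scale a \<alpha>) = S a * ZZ \<alpha>"
  by (rule form_projE[of \<alpha>]) (simp add: fme_scale.abs_eq ZZ_proj Zf_scale)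

lemma ZZ_zero: "ZZ (form_proj 0) = 0"
  by (simp add: ZZ_proj Zf_def cc_zero)

lemma ZZ_G: "ZZ \<alpha> \<in> G"
  by (simp add: ZZ_def Zf_def G_S G_add cc_G)

lemma ZZ_central: "central (ZZ \<alpha>)"
proof -
  have "central (x + y)" if "central x" "central y" for x y
    using that by (simp add: central_def br_simps)
  moreover have "central (S a * x)" if "central x" for a x
    using that by (simp add: central_def br_S_left eL_G fL_G)
  ultimately show ?thesis by (simp add: ZZ_def Zf_def cc_central)
qed

lemma ZZ_cocycle:
  assumes X: "X \<in> sl_over r UNIV" and Y: "Y \<in> sl_over r UNIV"
  shows "ZZ (cocycle r X Y) = (\<Sum>a<r. \<Sum>b<r. cc (X $$ (a, b)) (Y $$ (b, a)))"
proof -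
  let ?x = "\<lambda>a b. X $$ (a, b)" and ?y = "\<lambda>c d. Y $$ (c, d)"
  have r0: "(of_nat r :: complex) \<noteq> 0" using r2 by simp
  have Zsum: "Zf (sum g A) = (\<Sum>a\<in>A. Zf (g a))" for g :: "nat \<Rightarrow> form" and A
    by (rule additive_sum[of Zf]) (rule Zf_add)
  have S0: "S 0 = 0" using S_add[of 0 0] by simp
  have "ZZ (cocycle r X Y) = (\<Sum>a<r. \<Sum>b<r. \<Sum>c<r. \<Sum>d<r.
      S (killing r (elem_mat r a b) (elem_mat r c d) / (2 * of_nat r)) * cc (?x a b) (?y c d))"
    unfolding cocycle_def ZZ_proj Zsum Zf_mult_d by (rule refl)
  also have "\<dots> = (\<Sum>a<r. \<Sum>b<r. \<Sum>c<r. \<Sum>d<r.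
      dlt b c (dlt d a (cc (?x a b) (?y c d))) - dlt a b (dlt c d (S (1 / of_nat r) * cc (?x a b) (?y c d))))"
  proof (rule sum.cong[OF refl], rule sum.cong[OF refl], rule sum.cong[OF refl], rule sum.cong[OF refl])
    fix a b c d assume "a \<in> {..<r}" "b \<in> {..<r}" "c \<in> {..<r}" "d \<in> {..<r}"
    then have kk: "killing r (elem_mat r a b) (elem_mat r c d)
      = (if b = c \<and> a = d then 2 * of_nat r else 0) - (if a = b \<and> c = d then 2 else 0)"
      by (intro killing_elem) auto
    have k: "killing r (elem_mat r a b) (elem_mat r c d) / (2 * of_nat r)
      = (if b = c \<and> a = d then 1 else 0) - (if a = b \<and> c = d then 1 / of_nat r else 0)"
    proof -
      have "(if P then u else 0) / v = (if P then u / v else 0)" for P and u v :: complex by simp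
      moreover have "2 * of_nat r / (2 * of_nat r) = (1 :: complex)" "2 / (2 * of_nat r) = (1 / of_nat r :: complex)"
        using r0 by simp_all
      ultimately show ?thesis unfolding kk diff_divide_distrib by (simp only:)
    qed
    have Sd: "S (u - v) = S u - S v" for u v using S_add[of "u - v" v] by simp
    have Si: "S (if P then u else 0) = (if P then S u else 0)" for P u by (simp add: S0)
    have mi: "(if P then u else 0) * v = (if P then u * v else 0)" for P and u v :: 'a by simp
    show "S (killing r (elem_mat r a b) (elem_mat r c d) / (2 * of_nat r)) * cc (?x a b) (?y c d)
      = dlt b c (dlt d a (cc (?x a b) (?y c d))) - dlt a b (dlt c d (S (1 / of_nat r) * cc (?x a b) (?y c d)))"
      unfolding k Sd Si left_diff_distrib mi S_one mult_1_left unfolding if_conj_nested eq_commute[of d a] by (rule refl)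
  qed
  also have "\<dots> = (\<Sum>a<r. \<Sum>b<r. \<Sum>c<r. \<Sum>d<r. dlt b c (dlt d a (cc (?x a b) (?y c d))))
     - (\<Sum>a<r. \<Sum>b<r. \<Sum>c<r. \<Sum>d<r. dlt c d (dlt a b (S (1 / of_nat r) * cc (?x a b) (?y c d))))"
    unfolding sum_subtractf[symmetric] by (intro sum.cong refl) simp
  also have "(\<Sum>a<r. \<Sum>b<r. \<Sum>c<r. \<Sum>d<r. dlt c d (dlt a b (S (1 / of_nat r) * cc (?x a b) (?y c d)))) = 0"
    by (intro sum.neutral ballI traceless_sum[OF _ Y]) (simp add: cc_add distrib_left)
  also have "(\<Sum>a<r. \<Sum>b<r. \<Sum>c<r. \<Sum>d<r. dlt b c (dlt d a (cc (?x a b) (?y c d))))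
     = (\<Sum>a<r. \<Sum>b<r. cc (?x a b) (?y b a))"
    by (rule sum.cong[OF refl], rule sum.cong[OF refl]) (simp add: sum_if_const)
  finally show ?thesis by simp
qed

lemma central_rho: "central z \<Longrightarrow> br z (rho X) = 0"
  unfolding rho_def br_sum_right
  by (intro sum.neutral ballI) (simp add: gg_def centralD central_DL br_simps)

lemma central_central: "central z \<Longrightarrow> br z (cc P Q) = 0"
  unfolding cc_def CL_def br_simps(4)
  by (simp only: central_DL one_I central_br[OF _ centralD(2) centralD(1)]) simp

theorem rho_ZZ_br:
  assumes "X \<in> sl_over r UNIV" "Y \<in> sl_over r UNIV"
  shows "br (rho X + ZZ \<alpha>) (rho Y + ZZ \<beta>) = rho (mat_bracket X Y) + ZZ (cocycle r X Y)"
proof -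
  have "br (ZZ \<alpha>) (ZZ \<beta>) = 0"
    unfolding ZZ_def[of \<beta>] Zf_def
    by (simp add: br_S_right[OF ZZ_G] br_simps central_central[OF ZZ_central])
  moreover have "br (rho X) (ZZ \<beta>) = 0"
    using central_rho[OF ZZ_central] br_swap[of "rho X"] by simp
  ultimately show ?thesis
    using central_rho[OF ZZ_central] rho_br[OF assms] ZZ_cocycle[OF assms] by (simp add: br_simps)
qed

end

section \<open>The operators on the limit\<close>

text \<open>
  A ring of operators. As \<open>L\<close> is a subset of its ambient group, operators on \<open>L\<close> are extended to the whole group by means of a projection onto \<open>L\<close>.
\<close>

typedef (overloaded) 'a endo = "{h :: 'a::ab_group_add \<Rightarrow> 'a. \<forall>u v. h (u + v) = h u + h v}"
  morphisms app Endo
  by (rule exI[of _ "\<lambda>v. v"]) simp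

setup_lifting type_definition_endo

instantiation endo :: (ab_group_add) "{ring, monoid_mult}"
begin

lift_definition zero_endo :: "'a endo" is "\<lambda>v. 0" by simp
lift_definition one_endo :: "'a endo" is "\<lambda>v. v" by simp
lift_definition plus_endo :: "'a endo \<Rightarrow> 'a endo \<Rightarrow> 'a endo" is "\<lambda>s t v. s v + t v"
  by (simp add: algebra_simps)
lift_definition minus_endo :: "'a endo \<Rightarrow> 'a endo \<Rightarrow> 'a endo" is "\<lambda>s t v. s v - t v"
  by (simp add: algebra_simps)
lift_definition uminus_endo :: "'a endo \<Rightarrow> 'a endo" is "\<lambda>t v. - t v"
  by simp
lift_definition times_endo :: "'a endo \<Rightarrow> 'a endo \<Rightarrow> 'a endo" is "\<lambda>s t v. s (t v)"
  by simp

instance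
  by standard (transfer; simp add: algebra_simps fun_eq_iff)+

end

lemma app_simps [simp]:
  "app 0 v = 0" "app 1 v = v" "app (s + t) v = app s v + app t v" "app (s - t) v = app s v - app t v"
  "app (- t) v = - app t v" "app (s * t) v = app s (app t v)"
  by (simp_all add: zero_endo.rep_eq one_endo.rep_eq plus_endo.rep_eq minus_endo.rep_eq uminus_endo.rep_eq times_endo.rep_eq)

lemma app_br: "app (br s t) v = app s (app t v) - app t (app s v)"
  by (simp add: br_def)

lemma app_add: "app t (u + v) = app t u + app t v"
  using app[of t] by simp

lemma app_Endo: "(\<And>u v. h (u + v) = h u + h v) \<Longrightarrow> app (Endo h) = h"
  by (rule Endo_inverse) simp

lemma app_diff: "app t (u - v) = app t u - app t v"
  using app_add[of t "u - v" v] by simp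

lemma app_zero: "app t 0 = 0"
  using app_diff[of t 0 0] by simp

lemma endo_eqI: "(\<And>v. app s v = app t v) \<Longrightarrow> s = t"
  by (simp add: app_inject[symmetric] fun_eq_iff)

context weyl_limit
begin

definition pr :: "'l \<Rightarrow> 'l" where
  "pr = (SOME p. (\<forall>u v. p (u + v) = p u + p v) \<and> (\<forall>c u. p (scL c u) = scL c (p u)) \<and> (\<forall>u. p u \<in> L) \<and> (\<forall>u\<in>L. p u = u))"

lemma pr: "pr (u + v) = pr u + pr v" "pr (scL c u) = scL c (pr u)" "pr u \<in> L" "u \<in> L \<Longrightarrow> pr u = u"
proof -
  obtain q where q: "\<forall>u v. q (u + v) = q u + q v" "\<forall>c u. q (scL c u) = scL c (q u)" "\<forall>u. u - q u \<in> L" "\<forall>u. q u = 0 \<longleftrightarrow> u \<in> L"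
    using Lm.exists_projection_with_kernel[OF Lm.sub] by blast
  have "\<exists>p. (\<forall>u v. p (u + v) = p u + p v) \<and> (\<forall>c u. p (scL c u) = scL c (p u)) \<and> (\<forall>u. p u \<in> L) \<and> (\<forall>u\<in>L. p u = u)"
    by (rule exI[of _ "\<lambda>u. u - q u"]) (use q in \<open>auto simp: Lm.scale_right_diff_distrib\<close>)
  from someI_ex[OF this] show "pr (u + v) = pr u + pr v" "pr (scL c u) = scL c (pr u)" "pr u \<in> L" "u \<in> L \<Longrightarrow> pr u = u"
    unfolding pr_def by blast+
qed

lemma pr_diff: "pr (u - v) = pr u - pr v"
  using pr(1)[of "u - v" v] by simp

lemma pr_pr: "pr (pr u) = pr u" by (simp add: pr)

definition Pi :: "'l endo" where "Pi = Endo pr"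
definition Sc :: "complex \<Rightarrow> 'l endo" where "Sc c = Endo (scL c)"
definition Ac :: "laurent mat \<Rightarrow> 'l endo" where "Ac X = Endo (\<lambda>v. actL X (pr v))"

definition Tinv :: "'l \<Rightarrow> 'l" where "Tinv = inv_into L T"

lemma T_image: "T ` L = L"
  using T_V T_surj by auto

lemma T_diff: "x \<in> L \<Longrightarrow> y \<in> L \<Longrightarrow> T (x - y) = T x - T y"
  using T_add[of "x - y" y] Lm.V_diff[of x y] by simp

lemma T_inj_on: "inj_on T L"
proof (rule inj_onI)
  fix x y assume "x \<in> L" "y \<in> L" "T x = T y"
  then show "x = y" using T_inj[of "x - y"] by (simp add: T_diff Lm.V_diff)
qed

lemma Tinv: "x \<in> L \<Longrightarrow> Tinv x \<in> L" "x \<in> L \<Longrightarrow> T (Tinv x) = x" "x \<in> L \<Longrightarrow> Tinv (T x) = x"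
proof -
  show "x \<in> L \<Longrightarrow> Tinv x \<in> L" using inv_into_into[of x T L] by (simp add: Tinv_def T_image)
  show "x \<in> L \<Longrightarrow> T (Tinv x) = x" using f_inv_into_f[of x T L] by (simp add: Tinv_def T_image)
  show "x \<in> L \<Longrightarrow> Tinv (T x) = x" using inv_into_f_f[OF T_inj_on] by (simp add: Tinv_def)
qed

lemma Tinv_eqI: "y \<in> L \<Longrightarrow> T y = x \<Longrightarrow> Tinv x = y"
  using Tinv(3) by blast

lemma Tinv_add: "x \<in> L \<Longrightarrow> y \<in> L \<Longrightarrow> Tinv (x + y) = Tinv x + Tinv y"
  by (rule Tinv_eqI) (simp_all add: Lm.V_add Tinv T_add)

lemma Tinv_scale: "x \<in> L \<Longrightarrow> Tinv (scL c x) = scL c (Tinv x)"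
  by (rule Tinv_eqI) (simp_all add: Lm.V_scale Tinv T_scale)

text \<open>
  \<open>T\<close> on \<open>L\<close> and the identity on the kernel of the projection, so that it becomes invertible in the ring.
\<close>

definition Th :: "'l endo" where "Th = Endo (\<lambda>v. T (pr v) + (v - pr v))"
definition Thi :: "'l endo" where "Thi = Endo (\<lambda>v. Tinv (pr v) + (v - pr v))"

lemma app_defs:
  "app Pi v = pr v" "app (Sc c) v = scL c v" "X \<in> slp r \<Longrightarrow> app (Ac X) v = actL X (pr v)"
  "app Th v = T (pr v) + (v - pr v)" "app Thi v = Tinv (pr v) + (v - pr v)"
  unfolding Pi_def Sc_def Ac_def Th_def Thi_def
  by (subst app_Endo; simp add: pr Lm.scale_right_distrib Lm.act_add T_add Tinv_add algebra_simps)+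

text \<open>
  The linear operators that vanish on the kernel of the projection and map into \<open>L\<close>.
\<close>

definition GG :: "'l endo set" where
  "GG = {t. (\<forall>v. app t v \<in> L) \<and> (\<forall>v. app t (pr v) = app t v) \<and> (\<forall>c v. app t (scL c v) = scL c (app t v))}"

lemma GG: "t \<in> GG \<Longrightarrow> app t v \<in> L" "t \<in> GG \<Longrightarrow> app t (pr v) = app t v" "t \<in> GG \<Longrightarrow> app t (scL c v) = scL c (app t v)"
  by (auto simp: GG_def)

lemma Ac_GG: "X \<in> slp r \<Longrightarrow> Ac X \<in> GG"
  by (simp add: GG_def app_defs pr_pr pr Lm.act_closed Lm.act_scale)

lemma Ac_add: "X \<in> slp r \<Longrightarrow> Y \<in> slp r \<Longrightarrow> Ac (X + Y) = Ac X + Ac Y"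
  by (rule endo_eqI) (simp add: app_defs slp_add Lm.act_ladd pr)

lemma Ac_br: "X \<in> slp r \<Longrightarrow> Y \<in> slp r \<Longrightarrow> br (Ac X) (Ac Y) = Ac (mat_bracket X Y)"
  by (rule endo_eqI) (simp add: br_def app_defs slp_bracket Lm.act_bracket pr Lm.act_closed)

definition ec :: "nat \<Rightarrow> laurent \<Rightarrow> 'l endo" where "ec i P = Ac (Emat r 0 i P)"
definition fc :: "nat \<Rightarrow> laurent \<Rightarrow> 'l endo" where "fc i P = Ac (Emat r i 0 P)"

lemma Ac_Emat_add: "P \<in> polys \<Longrightarrow> Q \<in> polys \<Longrightarrow> i \<noteq> j \<Longrightarrow> Ac (Emat r i j (P + Q)) = Ac (Emat r i j P) + Ac (Emat r i j Q)"
  by (rule endo_eqI) (simp add: app_defs Emat_slp polys_add Lm.act_Emat_add pr)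

lemma Ac_Emat_scal: "P \<in> polys \<Longrightarrow> i \<noteq> j \<Longrightarrow> Ac (Emat r i j (scal c P)) = Sc c * Ac (Emat r i j P)"
  by (rule endo_eqI) (simp add: app_defs Emat_slp polys_scal Lm.act_Emat_scal pr)

lemma Ac_Emat_zero: "i \<noteq> j \<Longrightarrow> Ac (Emat r i j 0) = 0"
  by (rule endo_eqI) (simp add: app_defs Emat_slp Lm.act_Emat_zero pr)

lemma Ac_Emat_dlt: "i \<noteq> j \<Longrightarrow> Ac (Emat r i j (dlt k l P)) = dlt k l (Ac (Emat r i j P))"
  by (simp add: Ac_Emat_zero)

lemma Th_Thi: "Th * Thi = 1" "Thi * Th = 1"
  by (rule endo_eqI, simp add: app_defs pr pr_diff Tinv T_V algebra_simps)+

lemma Sc_GG: "x \<in> GG \<Longrightarrow> Sc a * x \<in> GG" "x \<in> GG \<Longrightarrow> Sc a * x = x * Sc a"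
  by (simp add: GG_def app_defs Lm.V_scale mult.commute) (rule endo_eqI, simp add: app_defs GG)

lemma Sc_T: "Sc a * Th = Th * Sc a" "Sc a * Thi = Thi * Sc a"
  by (rule endo_eqI, simp add: app_defs pr T_scale Tinv_scale Lm.scale_right_distrib Lm.scale_right_diff_distrib)+

lemma GG_conj: "x \<in> GG \<Longrightarrow> Th * x * Thi \<in> GG" "x \<in> GG \<Longrightarrow> Thi * x * Th \<in> GG"
proof -
  assume x: "x \<in> GG"
  have k: "app x (v - pr v) = 0" for v
    by (simp add: app_diff GG(2)[OF x])
  have y: "app Th y = T y" "app Thi y = Tinv y" if "y \<in> L" for y
    using that by (simp_all add: app_defs pr)
  have "app x (app Thi v) = app x (Tinv (pr v))" "app x (app Th v) = app x (T (pr v))" for v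
    by (simp_all only: app_defs app_add k add_0_right)
  then have 1: "app (Th * x * Thi) v = T (app x (Tinv (pr v)))"
    and 2: "app (Thi * x * Th) v = Tinv (app x (T (pr v)))" for v
    by (simp_all only: app_simps y GG(1)[OF x])
  show "Th * x * Thi \<in> GG" "Thi * x * Th \<in> GG"
    unfolding GG_def mem_Collect_eq 1 2
    using GG(1)[OF x] by (simp_all add: T_V Tinv pr_pr pr GG(3)[OF x] T_scale Tinv_scale)
qed

lemma Pi_GG: "x \<in> GG \<Longrightarrow> Pi * x = x" "x \<in> GG \<Longrightarrow> x * Pi = x"
  by (rule endo_eqI, simp add: app_defs GG pr)+

text \<open>
  The scalar of \<open>T_act\<close> acts on \<open>L\<close> only, whence the projection in the last term.
\<close>

lemma Th_Ac:
  assumes "xconj r r X Y" "X \<in> slp r" "Y \<in> slp r"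
  shows "Th * Ac X = Ac Y * Th - Sc (of_nat r * Poly_Mapping.lookup (X $$ (0, 0)) 0) * (Th * Pi)"
proof (rule endo_eqI)
  fix v
  have "actL X (pr v) \<in> L" using assms by (intro Lm.act_closed pr)
  then show "app (Th * Ac X) v = app (Ac Y * Th - Sc (of_nat r * Poly_Mapping.lookup (X $$ (0, 0)) 0) * (Th * Pi)) v"
    using T_act[OF assms pr(3)[of v]] assms by (simp add: app_defs pr pr_diff pr_pr T_V)
qed

lemma Th_shift:
  assumes "P \<in> polys" "i \<in> {1..<r}"
  shows "Th * ec i (xpow (int r) * P) = ec i P * Th" "Th * fc i P = fc i (xpow (int r) * P) * Th"
proof -
  have Q: "xpow (int r) * P \<in> polys" using assms by (intro polys_mult polys_xpow) auto
  have E: "Emat r 0 i P \<in> slp r" "Emat r i 0 P \<in> slp r" "Emat r 0 i (xpow (int r) * P) \<in> slp r" "Emat r i 0 (xpow (int r) * P) \<in> slp r"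
    using assms Q by (auto intro!: Emat_slp)
  have Z: "Sc 0 = 0" by (rule endo_eqI) (simp add: app_defs)
  have "xconj r r (Emat r 0 i (xpow (int r) * P)) (Emat r 0 i P)" "xconj r r (Emat r i 0 P) (Emat r i 0 (xpow (int r) * P))"
    using E[THEN slp_gl] assms by (auto simp: xconj_def)
  from Th_Ac[OF this(1) E(3,1)] Th_Ac[OF this(2) E(2,4)]
  show "Th * ec i (xpow (int r) * P) = ec i P * Th" "Th * fc i P = fc i (xpow (int r) * P) * Th"
    using assms by (simp_all add: ec_def fc_def Z)
qed

lemma ef_hmat: "i \<in> {1..<r} \<Longrightarrow> br (ec i 1) (fc i 1) = Ac (hmat r i (- 1))"
  using Ac_br[of "Emat r 0 i 1" "Emat r i 0 1"] bracket_E0i_Ei0[of i r 1 1]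
  by (simp add: ec_def fc_def Emat_slp)

lemma hmat_xconj: "P \<in> polys \<Longrightarrow> i \<in> {1..<r} \<Longrightarrow> xconj r r (hmat r i P) (hmat r i P)"
  using slp_gl[OF hmat_slp[of P r i]] by (auto simp: xconj_def)

lemma Th_ef:
  assumes i: "i \<in> {1..<r}"
  shows "\<exists>z. (\<forall>x\<in>GG. z * x = x * z) \<and> Th * br (ec i 1) (fc i 1) * Thi = br (ec i 1) (fc i 1) + z"
proof (rule exI[of _ "- (Sc (of_nat r) * Pi)"], intro conjI ballI)
  fix x assume x: "x \<in> GG"
  have "Sc (of_nat r) * Pi * x = x * (Sc (of_nat r) * Pi)"
    by (simp only: mult.assoc Pi_GG[OF x]) (simp only: mult.assoc[symmetric] Sc_GG(2)[OF x, symmetric], simp only: mult.assoc Pi_GG[OF x])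
  then show "- (Sc (of_nat r) * Pi) * x = x * - (Sc (of_nat r) * Pi)" by simp
next
  let ?h = "Ac (hmat r i (- 1))"
  have p: "(- 1 :: laurent) \<in> polys" by (simp add: polys_uminus)
  have H: "hmat r i (- 1) \<in> slp r" using i r2 by (intro hmat_slp p) auto
  have "lookup (hmat r i (- 1) $$ (0, 0)) 0 = 1" if "lookup = Poly_Mapping.lookup" for lookup
    using i r2 by (simp add: that lookup_one)
  then have "Th * ?h = ?h * Th - Sc (of_nat r) * (Th * Pi)"
    using Th_Ac[OF hmat_xconj[OF p i] H H] by simp
  moreover have "Th * Pi = Pi * Th" by (rule endo_eqI) (simp add: app_defs pr pr_diff pr_pr T_V)
  ultimately have "Th * ?h * Thi = ?h * (Th * Thi) - Sc (of_nat r) * Pi * (Th * Thi)"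
    by (simp only: left_diff_distrib mult.assoc)
  then show "Th * br (ec i 1) (fc i 1) * Thi = br (ec i 1) (fc i 1) + - (Sc (of_nat r) * Pi)"
    by (simp add: ef_hmat[OF i] Th_Thi)
qed

lemma GG_lin: "t \<in> GG \<Longrightarrow> lin_on scL L scL L (app t)"
  by (simp add: lin_on_def GG app_add)

lemma rigid_f:
  assumes i: "i \<in> {1..<r}" and t: "t \<in> GG" and c: "br (fc i 1) t = 0" and n: "0 < a"
    and w: "br (br (ec i 1) (fc i 1)) t = Sc (of_nat a) * t"
  shows "t = 0"
proof -
  have j: "1 \<le> i" "i < r" using i by auto
  have E: "Emat r i 0 1 \<in> slp r" "hmat r i (- 1) \<in> slp r" using j by (auto intro!: Emat_slp hmat_slp polys_uminus)
  note I = Lm.sl2_integrable_swap[OF j actL_nilpotent[OF j]]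
  have "app t v = 0" if v: "v \<in> L" for v
  proof -
    have "if a = 0 then actL (Emat r 0 i 1) (app t v) = app t (actL (Emat r 0 i 1) v) else app t v = 0"
    proof (rule sl2_rigidity[OF I I GG_lin[OF t] _ _ v])
      fix v assume v: "v \<in> L"
      have "app (br (fc i 1) t) v = 0" by (simp add: c)
      then show "actL (Emat r i 0 1) (app t v) = app t (actL (Emat r i 0 1) v)"
        by (simp add: br_def fc_def app_defs E pr v GG[OF t])
      have "app (br (Ac (hmat r i (- 1))) t) v = scL (of_nat a) (app t v)"
        using w by (simp add: ef_hmat[OF i] app_defs)
      then have "actL (hmat r i (- 1)) (app t v) - app t (actL (hmat r i (- 1)) v) = scL (of_nat a) (app t v)"
        by (simp add: br_def app_defs E pr v GG[OF t])
      moreover have "app t (- x) = - app t x" for x using app_diff[of t 0 x] by (simp add: app_zero)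
      ultimately show "actL (hmat r i 1) (app t v) = app t (actL (hmat r i 1) v) - scL (of_nat a) (app t v)"
        by (simp add: Lm.act_hmat_uminus j v GG[OF t] algebra_simps)
    qed
    then show ?thesis using n by simp
  qed
  then have "app t v = 0" for v using GG(2)[OF t, of v] pr(3) by metis
  then show ?thesis by (intro endo_eqI) simp
qed

lemma rigid_e:
  assumes i: "i \<in> {1..<r}" and t: "t \<in> GG" and c: "br (ec i 1) t = 0" and n: "0 < a"
    and w: "br (br (fc i 1) (ec i 1)) t = Sc (of_nat a) * t"
  shows "t = 0"
proof -
  have j: "1 \<le> i" "i < r" using i by auto
  have E: "Emat r 0 i 1 \<in> slp r" "hmat r i (- 1) \<in> slp r" using j by (auto intro!: Emat_slp hmat_slp polys_uminus)
  have "app t v = 0" if v: "v \<in> L" for v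
  proof -
    have "if a = 0 then actL (Emat r i 0 1) (app t v) = app t (actL (Emat r i 0 1) v) else app t v = 0"
    proof (rule sl2_rigidity[OF actL_sl2[OF j] actL_sl2[OF j] GG_lin[OF t] _ _ v])
      fix v assume v: "v \<in> L"
      have "app (br (ec i 1) t) v = 0" by (simp add: c)
      then show "actL (Emat r 0 i 1) (app t v) = app t (actL (Emat r 0 i 1) v)"
        by (simp add: br_def ec_def app_defs E pr v GG[OF t])
      have "br (Ac (hmat r i (- 1))) t = - (Sc (of_nat a) * t)"
        using w by (simp add: br_swap[of "fc i 1"] br_simps ef_hmat[OF i] flip: minus_equation_iff)
      then have "app (br (Ac (hmat r i (- 1))) t) v = - scL (of_nat a) (app t v)"
        by (simp add: app_defs)
      then show "actL (hmat r i (- 1)) (app t v) = app t (actL (hmat r i (- 1)) v) - scL (of_nat a) (app t v)"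
        by (simp add: br_def app_defs E pr v GG[OF t] algebra_simps)
    qed
    then show ?thesis using n by simp
  qed
  then have "app t v = 0" for v using GG(2)[OF t, of v] pr(3) by metis
  then show ?thesis by (intro endo_eqI) simp
qed

end

section \<open>The action of the universal central extension\<close>

lemma bracket_efe:
  assumes "1 \<le> i" "i < r" "1 \<le> j" "j < r" "1 \<le> k" "k < r"
  shows "mat_bracket (mat_bracket (Emat r 0 i P) (Emat r j 0 Q)) (Emat r 0 k R)
    = Emat r 0 k (dlt i j (P * Q * R)) + Emat r 0 i (dlt j k (P * Q * R))"
  by (rule mat_bracket_EmatI) (use assms in \<open>auto simp: mat_bracket_Emat_index mult_ac\<close>)

lemma bracket_fef:
  assumes "1 \<le> i" "i < r" "1 \<le> j" "j < r" "1 \<le> k" "k < r"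
  shows "mat_bracket (mat_bracket (Emat r i 0 P) (Emat r 0 j Q)) (Emat r k 0 R)
    = Emat r k 0 (dlt i j (P * Q * R)) + Emat r i 0 (dlt j k (P * Q * R))"
  by (rule mat_bracket_EmatI) (use assms in \<open>auto simp: mat_bracket_Emat_index mult_ac\<close>)

lemma bracket_ef_cong:
  assumes "1 \<le> i" "i < r" "1 \<le> j" "j < r" "P * Q = P' * Q'"
  shows "mat_bracket (Emat r 0 i P) (Emat r j 0 Q) = mat_bracket (Emat r 0 i P') (Emat r j 0 Q')"
  by (rule mat_bracket_EmatI) (use assms in \<open>auto simp: mat_bracket_Emat_index mult_ac\<close>)

lemma bracket_rows:
  assumes "1 \<le> i" "i < r" "1 \<le> j" "j < r"
  shows "mat_bracket (Emat r 0 i P) (Emat r 0 j Q) = Emat r 0 1 0" "mat_bracket (Emat r i 0 P) (Emat r j 0 Q) = Emat r 0 1 0"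
  by (rule mat_bracket_EmatI; use assms in auto)+

lemma bracket_fe:
  assumes "1 \<le> i" "i < r" "1 \<le> j" "j < r"
  shows "mat_bracket (Emat r i 0 P) (Emat r 0 j 1) = (if i = j then hmat r i P else Emat r i j P)"
  by (rule mat_bracket_EmatI) (use assms in auto)

context weyl_limit
begin

lemma currents: "sl_currents r Sc GG Th Thi ec fc"
proof unfold_locales
  show "2 \<le> r" by (rule r2)
  show "Sc (a + b) = Sc a + Sc b" "Sc (a * b) = Sc a * Sc b" "Sc 1 = 1" for a b
    by (rule endo_eqI, simp add: app_defs Lm.scale_left_distrib)+
  show "x - y \<in> GG" "x * y \<in> GG" if "x \<in> GG" "y \<in> GG" for x y
    using that by (simp_all add: GG_def Lm.V_diff Lm.scale_right_diff_distrib)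
  show "x \<in> GG \<Longrightarrow> Sc a * x \<in> GG" "x \<in> GG \<Longrightarrow> Sc a * x = x * Sc a" for x a by (fact Sc_GG)+
  show "x \<in> GG \<Longrightarrow> Th * x * Thi \<in> GG" "x \<in> GG \<Longrightarrow> Thi * x * Th \<in> GG" for x by (fact GG_conj)+
  show "Th * Thi = 1" "Thi * Th = 1" by (fact Th_Thi)+
  show "Sc a * Th = Th * Sc a" "Sc a * Thi = Thi * Sc a" for a by (fact Sc_T)+
  fix i assume i: "i \<in> {1..<r}"
  then have i': "1 \<le> i" "i < r" by auto
  show "\<exists>z. (\<forall>x\<in>GG. z * x = x * z) \<and> Th * br (ec i 1) (fc i 1) * Thi = br (ec i 1) (fc i 1) + z" by (rule Th_ef[OF i])
  show "t \<in> GG \<Longrightarrow> br (fc i 1) t = 0 \<Longrightarrow> 0 < n \<Longrightarrow> br (br (ec i 1) (fc i 1)) t = Sc (of_nat n) * t \<Longrightarrow> t = 0"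
    "t \<in> GG \<Longrightarrow> br (ec i 1) t = 0 \<Longrightarrow> 0 < n \<Longrightarrow> br (br (fc i 1) (ec i 1)) t = Sc (of_nat n) * t \<Longrightarrow> t = 0" for t n
    by (fact rigid_f[OF i] rigid_e[OF i])+
  fix P :: laurent assume P: "P \<in> polys"
  have E: "Emat r 0 k Q \<in> slp r" "Emat r k 0 Q \<in> slp r" if "k \<in> {1..<r}" "Q \<in> polys" for k Q
    using that by (auto intro!: Emat_slp)
  show "ec i P \<in> GG" "fc i P \<in> GG" using E[OF i P] by (simp_all add: ec_def fc_def Ac_GG)
  show "ec i (scal a P) = Sc a * ec i P" "fc i (scal a P) = Sc a * fc i P" for a
    using i by (simp_all add: ec_def fc_def Ac_Emat_scal P)
  show "Th * ec i (xpow (int r) * P) = ec i P * Th" by (rule Th_shift[OF P i])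
  have "Thi * fc i (xpow (int r) * P) = Thi * (fc i (xpow (int r) * P) * Th) * Thi"
    by (simp only: mult.assoc Th_Thi mult_1_right)
  also have "\<dots> = (Thi * Th) * fc i P * Thi" by (simp only: Th_shift(2)[OF P i, symmetric] mult.assoc)
  finally show "Thi * fc i (xpow (int r) * P) = fc i P * Thi" by (simp add: Th_Thi)
  fix Q :: laurent assume Q: "Q \<in> polys"
  show "ec i (P + Q) = ec i P + ec i Q" "fc i (P + Q) = fc i P + fc i Q"
    using i by (simp_all add: ec_def fc_def Ac_Emat_add P Q)
  fix j assume j: "j \<in> {1..<r}"
  then have j': "1 \<le> j" "j < r" by auto
  show "br (ec i P) (ec j Q) = 0" "br (fc i P) (fc j Q) = 0"
    using Ac_Emat_zero[of 0 1] by (simp_all add: ec_def fc_def Ac_br E i j P Q bracket_rows[OF i' j'] del: atLeastLessThan_iff One_nat_def)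
  show "br (ec i P) (fc j Q) = br (ec i P') (fc j Q')" if "P' \<in> polys" "Q' \<in> polys" "P * Q = P' * Q'" for P' Q'
    unfolding ec_def fc_def
    by (simp only: Ac_br E i j P Q that bracket_ef_cong[OF i' j' that(3)])
  fix R :: laurent and k assume R: "R \<in> polys" and k: "k \<in> {1..<r}"
  then have k': "1 \<le> k" "k < r" by auto
  have D: "dlt l l' (P * Q * R) \<in> polys" for l l' using P Q R by (simp add: polys_mult)
  show "br (br (ec i P) (fc j Q)) (ec k R) = dlt i j (ec k (P * Q * R)) + dlt j k (ec i (P * Q * R))"
    using i' k' unfolding ec_def fc_def
    by (simp only: Ac_br E i j k P Q R slp_bracket bracket_efe[OF i' j' k'] Ac_add D) (simp add: Ac_Emat_dlt)
  show "br (br (fc i P) (ec j Q)) (fc k R) = dlt i j (fc k (P * Q * R)) + dlt j k (fc i (P * Q * R))"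
    using i' k' unfolding ec_def fc_def
    by (simp only: Ac_br E i j k P Q R slp_bracket bracket_fef[OF i' j' k'] Ac_add D) (simp add: Ac_Emat_dlt)
qed

sublocale cur: sl_currents r Sc GG Th Thi ec fc by (rule currents)

lemma gg_polys:
  assumes "a < r" "b < r" "P \<in> polys"
  shows "cur.gg a b P = (if a = b then if a = 0 then 0 else Ac (hmat r a P) else Ac (Emat r a b P))"
proof -
  have E: "Emat r 0 k Q \<in> slp r" "Emat r k 0 Q \<in> slp r" if "k \<in> {1..<r}" "Q \<in> polys" for k Q
    using that by (auto intro!: Emat_slp)
  have "cur.DL a b P = Ac (if a = b then hmat r a P else Emat r a b P)" if "a \<noteq> 0" "b \<noteq> 0"
  proof -
    have I: "a \<in> {1..<r}" "b \<in> {1..<r}" using that assms by auto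
    then have I': "1 \<le> a" "a < r" "1 \<le> b" "b < r" by auto
    have "cur.DL a b P = br (fc a P) (ec b 1)"
      using I assms by (simp only: cur.DL_def cur.fL_polys cur.eL_polys polys_one)
    then show ?thesis
      using I assms by (simp only: ec_def fc_def Ac_br E polys_one bracket_fe[OF I'])
  qed
  then show ?thesis
    using assms by (auto simp: cur.gg_def cur.eL_polys cur.fL_polys ec_def fc_def)
qed

lemma rho_polys:
  assumes X: "X \<in> slp r"
  shows "cur.rho X = Ac X"
proof -
  let ?g = "\<lambda>(a, b). cur.gg a b (X $$ (a, b))" and ?D = "(\<lambda>a. (a, a)) ` {..<r}" and ?O = "{(i, j). i < r \<and> j < r \<and> i \<noteq> j}"
  have Xe: "X $$ (a, b) \<in> polys" if "a < r" "b < r" for a b using X that by (simp add: sl_over_def)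
  have r0: "0 < r" using r2 by simp
  have fin: "finite ?O" by (rule finite_subset[of _ "{..<r} \<times> {..<r}"]) auto
  have "cur.rho X = sum ?g ({..<r} \<times> {..<r})"
    by (simp only: cur.rho_def sum.cartesian_product)
  also have "{..<r} \<times> {..<r} = ?O \<union> ?D" by auto
  also have "sum ?g \<dots> = sum ?g ?O + sum ?g ?D"
    using fin by (intro sum.union_disjoint) auto
  also have "sum ?g ?O = (\<Sum>(i, j)\<in>?O. Ac (Emat r i j (X $$ (i, j))))"
    by (intro sum.cong refl) (auto simp: gg_polys Xe)
  also have "sum ?g ?D = (\<Sum>a<r. cur.gg a a (X $$ (a, a)))"
    by (subst sum.reindex) (auto simp: inj_on_def)
  also have "\<dots> = (\<Sum>a\<in>{1..<r}. Ac (hmat r a (X $$ (a, a))))"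
  proof -
    have "(\<Sum>a\<in>{1..<r}. cur.gg a a (X $$ (a, a))) = (\<Sum>a\<in>{1..<r}. Ac (hmat r a (X $$ (a, a))))"
      by (intro sum.cong refl) (auto simp: gg_polys Xe)
    then show ?thesis
      by (subst sum_first[OF r0]) (simp add: cur.gg_def)
  qed
  also have "(\<Sum>(i, j)\<in>?O. Ac (Emat r i j (X $$ (i, j)))) + (\<Sum>a\<in>{1..<r}. Ac (hmat r a (X $$ (a, a)))) = Ac X"
    by (rule slp_additive_decomp[OF r0 Ac_add X, symmetric])
  finally show ?thesis .
qed

lemma rho_add:
  assumes "X \<in> sl_over r UNIV" "Y \<in> sl_over r UNIV" shows "cur.rho (X + Y) = cur.rho X + cur.rho Y"
  unfolding cur.rho_def sum.distrib[symmetric]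
  by (intro sum.cong refl) (use assms in \<open>auto simp: sl_over_def cur.gg_add\<close>)

lemma rho_smult:
  assumes "X \<in> sl_over r UNIV" shows "cur.rho (const c \<cdot>\<^sub>m X) = Sc c * cur.rho X"
  unfolding cur.rho_def sum_distrib_left
  by (intro sum.cong refl) (use assms in \<open>auto simp: sl_over_def cur.gg_scal const_mult_eq_scal\<close>)

lemma rho_GG: "cur.rho X \<in> GG"
proof -
  have s: "sum g A \<in> GG" if "\<And>a. a \<in> A \<Longrightarrow> g a \<in> GG" for g and A :: "nat set"
    using that by (induction A rule: infinite_finite_induct) (simp_all add: cur.G_zero cur.G_add)
  have "cur.gg a b P \<in> GG" if "a < r" "b < r" for a b P
  proof -
    have I: "x \<in> {1..<r}" if "x < r" "x \<noteq> 0" for x using that by simp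
    show ?thesis
      unfolding cur.gg_def cur.DL_def using that
      by (simp add: cur.G_zero cur.eL_G cur.fL_G cur.G_br I cur.one_I del: atLeastLessThan_iff One_nat_def)
  qed
  then show ?thesis unfolding cur.rho_def by (intro s) auto
qed

text \<open>
  The pair \<open>(X, \<alpha>)\<close> acts by \<open>rho X + ZZ \<alpha>\<close>. On polynomial matrices this is the given action, since \<open>e_i\<close>, \<open>f_i\<close> and hence
  \<open>DL i j\<close> are extensions of the polynomial currents.
\<close>

theorem limit_extension:
  "\<exists>actL'. is_lie_module (univ_central_ext r) scL L actL' \<and>
     (\<forall>X\<in>lcarrier (sl_poly r). \<forall>v\<in>L. actL' (X, form_proj 0) v = actL X v)"
proof (intro exI conjI ballI)
  let ?a = "\<lambda>(X, \<alpha>). app (cur.rho X + cur.ZZ \<alpha>)"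
  have G: "cur.rho X + cur.ZZ \<alpha> \<in> GG" for X \<alpha> by (intro cur.G_add rho_GG cur.ZZ_G)
  have br: "app (cur.rho (mat_bracket X Y) + cur.ZZ (cocycle r X Y)) v
    = app (cur.rho X + cur.ZZ \<alpha>) (app (cur.rho Y + cur.ZZ \<beta>) v) - app (cur.rho Y + cur.ZZ \<beta>) (app (cur.rho X + cur.ZZ \<alpha>) v)"
    if "X \<in> sl_over r UNIV" "Y \<in> sl_over r UNIV" for X Y \<alpha> \<beta> v
    unfolding cur.rho_ZZ_br[OF that, of \<alpha> \<beta>, symmetric] by (rule app_br)
  show "is_lie_module (univ_central_ext r) scL L ?a"
    unfolding is_lie_module_def univ_central_ext_def
  proof (simp only: lie_alg.simps, intro conjI ballI allI)
    show "vector_space scL" "module.subspace scL L" by (fact Lm.vs Lm.sub)+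
  next
    fix p v assume "v \<in> L"
    show "?a p v \<in> L" using GG(1)[OF G] by (cases p) simp
  next
    fix p u v
    show "?a p (u + v) = ?a p u + ?a p v" by (cases p) (simp only: prod.case app_add)
  next
    fix p c v
    show "?a p (scL c v) = scL c (?a p v)" using GG(3)[OF G] by (cases p) (simp only: prod.case)
  next
    fix p q v assume "p \<in> sl_over r UNIV \<times> (UNIV :: forms_mod_exact set)" "q \<in> sl_over r UNIV \<times> (UNIV :: forms_mod_exact set)"
    then show "?a ((case p of (X, \<alpha>) \<Rightarrow> \<lambda>(Y, \<beta>). (X + Y, fme_add \<alpha> \<beta>)) q) v = ?a p v + ?a q v"
      by (cases p; cases q) (simp add: rho_add cur.ZZ_add algebra_simps)
  next
    fix p c v assume "p \<in> sl_over r UNIV \<times> (UNIV :: forms_mod_exact set)"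
    then show "?a (case p of (X, \<alpha>) \<Rightarrow> (const c \<cdot>\<^sub>m X, fme_scale c \<alpha>)) v = scL c (?a p v)"
      by (cases p) (simp add: rho_smult cur.ZZ_scale app_defs Lm.scale_right_distrib)
  next
    fix p q v assume "p \<in> sl_over r UNIV \<times> (UNIV :: forms_mod_exact set)" "q \<in> sl_over r UNIV \<times> (UNIV :: forms_mod_exact set)"
    then show "?a ((case p of (X, \<alpha>) \<Rightarrow> \<lambda>(Y, \<beta>). (mat_bracket X Y, cocycle r X Y)) q) v = ?a p (?a q v) - ?a q (?a p v)"
      using br by (cases p; cases q) (simp only: prod.case mem_Times_iff fst_conv snd_conv)
  qed
next
  fix X v assume X: "X \<in> lcarrier (sl_poly r)" and v: "v \<in> L"
  then have "X \<in> slp r" by (simp add: sl_poly_def)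
  then show "(case (X, form_proj 0) of (X, \<alpha>) \<Rightarrow> app (cur.rho X + cur.ZZ \<alpha>)) v = actL X v"
    using v by (simp add: rho_polys cur.ZZ_zero app_defs pr)
qed

end

theorem corollary8:
  fixes r n :: nat
    and scW :: "complex \<Rightarrow> 'w::ab_group_add \<Rightarrow> 'w"
    and W :: "nat \<Rightarrow> 'w set"
    and act :: "nat \<Rightarrow> laurent mat \<Rightarrow> 'w \<Rightarrow> 'w"
    and w :: "nat \<Rightarrow> 'w"
    and \<phi> :: "nat \<Rightarrow> 'w \<Rightarrow> 'w"
    and scL :: "complex \<Rightarrow> 'l::ab_group_add \<Rightarrow> 'l"
    and L :: "'l set"
    and actL :: "laurent mat \<Rightarrow> 'l \<Rightarrow> 'l"
    and \<iota> :: "nat \<Rightarrow> 'w \<Rightarrow> 'l"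
  assumes "r \<ge> 2"
    and weyl: "\<And>N. is_weyl_module r (N * r + n) scW (W N) (act N) (w N)"
    and hom: "\<And>N. is_module_hom (sl_poly r) scW (W N) (act N) scW (W (Suc N)) (act (Suc N)) (\<phi> N)"
    and gen: "\<And>N. \<phi> N (w N) = lowered_vector r (N * r + n) (act (Suc N)) (w (Suc N))"
    and lim: "is_direct_limit (sl_poly r) scW W act \<phi> scL L actL \<iota>"
  shows "\<exists>actL'. is_lie_module (univ_central_ext r) scL L actL' \<and>
           (\<forall>X\<in>lcarrier (sl_poly r). \<forall>v\<in>L. actL' (X, form_proj 0) v = actL X v)"
proof -
  interpret weyl_limit r n scW W act w \<phi> scL L actL \<iota>
    by unfold_locales (use assms in blast)+
  show ?thesis by (rule limit_extension)
qed

end
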